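(* Let $\mathcal V_{\mathbb Z}(n)$ be the $\mathbb Z$-submodule of $\widehat{\mathcal K}_{\mathbb Q}(n)$ spanned by all $A\{\lambda\}$ with $A\in\Theta^\pm_\triangle(n)$, $\lambda\in\mathbb N^n_\triangle$. Then: (1) $\mathcal V_{\mathbb Z}(n)$ is a $\mathbb Z$-subalgebra of $\widehat{\mathcal K}_{\mathbb Q}(n)$. (2) The elements $\big(\sum_{1\le i\le n}\alpha_iE^\triangle_{i,i+1}\big)\{\mathbf 0\}$, $\big(\sum_{1\le i\le n}\alpha_iE^\triangle_{i+1,i}\big)\{\mathbf 0\}$ and $0\{\lambda_i\boldsymbol e^\triangle_i\}$ (for all $\alpha\in\mathbb N^n_\triangle$, $\lambda_i\in\mathbb N$, $1\le i\le n$) generate $\mathcal V_{\mathbb Z}(n)$ as a $\mathbb Z$-algebra.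
   Context: Matrices. Let $n\ge2$ be an integer, $\mathbb N=\{0,1,2,\dots\}$. $M_{\triangle,n}(\mathbb Z)$ is the set of integer matrices $A=(a_{i,j})_{i,j\in\mathbb Z}$ with $a_{i,j}=a_{i+n,j+n}$ and with finitely many nonzero entries in every row and column. $\widetilde\Theta_\triangle(n)=\{A\in M_{\triangle,n}(\mathbb Z): a_{i,j}\ge0\ \forall i\ne j\}$; $\Theta_\triangle(n)$ is the subset of matrices with all entries in $\mathbb N$; $\Theta^\pm_\triangle(n)=\{A\in\Theta_\triangle(n):a_{i,i}=0\ \forall i\}$. $E^\triangle_{i,j}$ is the matrix with entry $1$ at positions $(i+sn,j+sn)$, $s\in\mathbb Z$, and $0$ elsewhere. $\mathbb Z^n_\triangle$ is the set of $n$-periodic integer sequences $(\lambda_i)_{i\in\mathbb Z}$ (identified with $\mathbb Z^n$), $\mathbb N^n_\triangle$ its subset of nonnegative sequences; $\boldsymbol e^\triangle_i$ corresponds to the $i$-th standard basis vector, $\mathbf 0$ to zero. $\sigma(\lambda)=\sum_{i=1}^n\lambda_i$, $\sigma(A)=\sum_{1\le i\le n,\,j\in\mathbb Z}a_{i,j}$, $\Lambda_\triangle(n,r)=\{\lambda\in\mathbb N^n_\triangle:\sigma(\lambda)=r\}$, $\Theta_\triangle(n,r)=\{A\in\Theta_\triangle(n):\sigma(A)=r\}$. $\mathrm{ro}(A)=(\sum_ja_{i,j})_i$, $\mathrm{co}(A)=(\sum_ia_{i,j})_j$; $\mathrm{diag}(\lambda)$ is the diagonal matrix with diagonal $\lambda$;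 ${}_aA=A+aI$. Affine Schur algebras. Let $r\ge0$. $\mathfrak S_{\triangle,r}$ is the group of permutations $w$ of $\mathbb Z$ with $w(i+r)=w(i)+r$ for all $i$ (the trivial group if $r=0$). $W$ is the subgroup of those $w$ with $\sum_{i=1}^rw(i)=\sum_{i=1}^ri$; it is the affine Weyl group of type $A$ with simple reflections $s_i$ ($1\le i\le r$), $s_i(j)=j+1$ if $j\equiv i$, $j-1$ if $j\equiv i+1$, and $j$ otherwise (mod $r$) ($W$ is trivial if $r\le1$). Let $\rho(j)=j+1$; then $\mathfrak S_{\triangle,r}=\langle\rho\rangle\ltimes W$ and the length function $\ell$ of $W$ is extended by $\ell(\rho^mw)=\ell(w)$. $s_1,\dots,s_{r-1}$ generate the symmetric group $\mathfrak S_r$. Let $\mathcal Z=\mathbb Z[v,v^{-1}]$. The extended affine Hecke algebra $\mathcal H_\triangle(r)$ is the $\mathcal Z$-algebra with basis $\{T_w\}_{w\in\mathfrak S_{\triangle,r}}$ and relations $T_{s_i}^2=(v^2-1)T_{s_i}+v^2$, and $T_wT_{w'}=T_{ww'}$ if $\ell(ww')=\ell(w)+\ell(w')$. For $\lambda\in\Lambda_\triangle(n,r)$ let $\mathfrak S_\lambda\subseteq\mathfrak S_r$ be the standard Young subgroup of $(\lambda_1,\dots,\lambda_n)$, $x_\lambda=\sum_{w\in\mathfrak S_\lambda}T_w$, and $\mathcal S_\triangle(n,r)=\mathrm{End}_{\mathcal H_\triangle(r)}\big(\bigoplus_{\lambda\in\Lambda_\triangle(n,r)}x_\lambda\mathcal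 H_\triangle(r)\big)$. Let $\mathscr D_\lambda=\{d:\ell(wd)=\ell(w)+\ell(d)\ \forall w\in\mathfrak S_\lambda\}$ and $\mathscr D_{\lambda,\mu}=\mathscr D_\lambda\cap\mathscr D_\mu^{-1}$. For $d\in\mathscr D_{\lambda,\mu}$ define $\phi^d_{\lambda,\mu}(x_\nu h)=\delta_{\mu\nu}\sum_{w\in\mathfrak S_\lambda d\mathfrak S_\mu}T_wh$; these form a $\mathcal Z$-basis of $\mathcal S_\triangle(n,r)$. Put $R^\lambda_{i+kn}=\{\lambda_{k,i-1}+1,\dots,\lambda_{k,i-1}+\lambda_i\}$, $\lambda_{k,i-1}=kr+\sum_{1\le t\le i-1}\lambda_t$ ($1\le i\le n$, $k\in\mathbb Z$). The map $(\lambda,d,\mu)\mapsto A=(|R^\lambda_k\cap dR^\mu_l|)_{k,l}$ is a bijection from triples with $\lambda,\mu\in\Lambda_\triangle(n,r)$, $d\in\mathscr D_{\lambda,\mu}$ onto $\Theta_\triangle(n,r)$; write $e_A=\phi^d_{\lambda,\mu}$ and $[A]=v^{-d_A}e_A$ with $d_A=\sum_{1\le i\le n,\ i\ge k,\ j<l}a_{i,j}a_{k,l}$. $\mathcal S_\triangle(n,r)_{\mathbb Z}$ is the specialization at $v=1$ over $\mathbb Z$, with basis $[A]_1=[A]\otimes1$, $A\in\Theta_\triangle(n,r)$. If $\sigma(A)=r$ and some $a_{i,i}<0$, put $[A]_1=0$ there. The algebra $\mathcal K_{\mathbb Z}(n)$. $\mathcal Z_1\subset\mathbb Q[x]$ is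 the subring generated by $1$ and all $\binom{a+x}{t}$ ($a\in\mathbb Z,t\in\mathbb N$). For $A,B\in\widetilde\Theta_\triangle(n)$ with $\mathrm{co}(B)=\mathrm{ro}(A)$ there are unique $X_i\in\widetilde\Theta_\triangle(n)$ and $P_i\in\mathcal Z_1$ with $[{}_aB]_1[{}_aA]_1=\sum_iP_i(a)[{}_aX_i]_1$ in $\mathcal S_\triangle(n,an+\sigma(A))_{\mathbb Z}$ for all large $a$. Let $\widetilde{\mathcal K}(n)$ be the free $\mathcal Z_1$-module on $\widetilde\Theta_\triangle(n)$ with the associative product $B\cdot A=\sum_iP_i(x)X_i$ if $\mathrm{co}(B)=\mathrm{ro}(A)$ and $B\cdot A=0$ otherwise. $\mathcal K_{\mathbb Z}(n)=\widetilde{\mathcal K}(n)\otimes_{\mathcal Z_1}\mathbb Z$ via $x\mapsto0$, with $\mathbb Z$-basis $[A]_1:=A\otimes1$. $\widehat{\mathcal K}_{\mathbb Q}(n)$ is the algebra of formal, possibly infinite, sums $\sum_{A\in\widetilde\Theta_\triangle(n)}\beta_A[A]_1$ ($\beta_A\in\mathbb Q$) such that for each $\mathbf x\in\mathbb Z^n$ the sets $\{A:\beta_A\ne0,\mathrm{ro}(A)=\mathbf x\}$ and $\{A:\beta_A\neq0,\mathrm{co}(A)=\mathbf x\}$ are finite, with product extending that of $\mathcal K_{\mathbb Z}(n)$; its unit is $\sum_{\lambda\in\mathbb Z^n_\triangle}[\mathrm{diag}(\lambda)]_1$. Special elements. $\binom mt=m(m-1)\cdots(m-t+1)/t!$ for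 $m\in\mathbb Z$, $t\in\mathbb N$, and $\binom\mu\lambda=\prod_{i=1}^n\binom{\mu_i}{\lambda_i}$. For $A\in\Theta^\pm_\triangle(n)$, $\lambda\in\mathbb N^n_\triangle$: $A\{\lambda\}=\sum_{\mu\in\mathbb Z^n_\triangle}\binom\mu\lambda[A+\mathrm{diag}(\mu)]_1\in\widehat{\mathcal K}_{\mathbb Q}(n)$. *)

theory Defs
  imports
    "HOL-Algebra.Generated_Rings"
    "HOL-Library.FuncSet"
    "HOL-Library.Function_Algebras"
    "HOL-Library.Poly_Mapping"
    "HOL-Computational_Algebra.Polynomial"
begin

text \<open>Throughout, sums and zero elements of functions are pointwise (Function_Algebras).\<close>

section \<open>Periodic sequences and matrices\<close>

type_synonym seq = "int \<Rightarrow> int"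
type_synonym mat = "int \<Rightarrow> int \<Rightarrow> int"

definition Zseq :: "nat \<Rightarrow> seq set" where
  "Zseq n = {l. \<forall>i. l (i + int n) = l i}"

definition Nseq :: "nat \<Rightarrow> seq set" where
  "Nseq n = {l \<in> Zseq n. \<forall>i. l i \<ge> 0}"

definition unit_seq :: "nat \<Rightarrow> int \<Rightarrow> seq" where
  "unit_seq n i = (\<lambda>j. if \<exists>s. j = i + s * int n then 1 else 0)"

definition sigma_seq :: "nat \<Rightarrow> seq \<Rightarrow> int" where
  "sigma_seq n l = (\<Sum>i=1..int n. l i)"

definition Lambda :: "nat \<Rightarrow> nat \<Rightarrow> seq set" where
  "Lambda n r = {l \<in> Nseq n. sigma_seq n l = int r}"

definition per_mats :: "nat \<Rightarrow> mat set" where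
  "per_mats n = {A. (\<forall>i j. A i j = A (i + int n) (j + int n)) \<and>
     (\<forall>i. finite {j. A i j \<noteq> 0}) \<and> (\<forall>j. finite {i. A i j \<noteq> 0})}"

definition Theta_tilde :: "nat \<Rightarrow> mat set" where
  "Theta_tilde n = {A \<in> per_mats n. \<forall>i j. i \<noteq> j \<longrightarrow> A i j \<ge> 0}"

definition Theta :: "nat \<Rightarrow> mat set" where
  "Theta n = {A \<in> per_mats n. \<forall>i j. A i j \<ge> 0}"

definition Theta_pm :: "nat \<Rightarrow> mat set" where
  "Theta_pm n = {A \<in> Theta n. \<forall>i. A i i = 0}"

definition unit_mat :: "nat \<Rightarrow> int \<Rightarrow> int \<Rightarrow> mat" where
  "unit_mat n i j = (\<lambda>k l. if \<exists>s. k = i + s * int n \<and> l = j + s * int n then 1 else 0)"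

definition ro :: "mat \<Rightarrow> seq" where
  "ro A = (\<lambda>i. \<Sum>j | A i j \<noteq> 0. A i j)"

definition co :: "mat \<Rightarrow> seq" where
  "co A = (\<lambda>j. \<Sum>i | A i j \<noteq> 0. A i j)"

definition sigma_mat :: "nat \<Rightarrow> mat \<Rightarrow> int" where
  "sigma_mat n A = (\<Sum>i=1..int n. \<Sum>j | A i j \<noteq> 0. A i j)"

definition Theta_r :: "nat \<Rightarrow> nat \<Rightarrow> mat set" where
  "Theta_r n r = {A \<in> Theta n. sigma_mat n A = int r}"

definition diag :: "seq \<Rightarrow> mat" where
  "diag l = (\<lambda>i j. if i = j then l i else 0)"

definition shift :: "int \<Rightarrow> mat \<Rightarrow> mat" where
  "shift a A = A + diag (\<lambda>_. a)"

section \<open>The extended affine symmetric group\<close>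

type_synonym perm = "int \<Rightarrow> int"

definition Saff :: "nat \<Rightarrow> perm set" where
  "Saff r = (if r = 0 then {id} else {w. bij w \<and> (\<forall>i. w (i + int r) = w i + int r)})"

definition Waff :: "nat \<Rightarrow> perm set" where
  "Waff r = {w \<in> Saff r. (\<Sum>i=1..int r. w i) = (\<Sum>i=1..int r. i)}"

definition simple_refl :: "nat \<Rightarrow> int \<Rightarrow> perm" where
  "simple_refl r i = (\<lambda>j. if j mod int r = i mod int r then j + 1
                      else if j mod int r = (i + 1) mod int r then j - 1 else j)"

definition simple_refls :: "nat \<Rightarrow> perm set" where
  "simple_refls r = (if r \<ge> 2 then simple_refl r ` {1..int r} else {})"

definition lenW :: "nat \<Rightarrow> perm \<Rightarrow> nat" where
  "lenW r w = (LEAST k. \<exists>ss. set ss \<subseteq> simple_refls r \<and> length ss = k \<and> w = foldr (\<circ>) ss id)"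

definition len :: "nat \<Rightarrow> perm \<Rightarrow> nat" where
  "len r x = lenW r (THE w. w \<in> Waff r \<and> (\<exists>m. x = (\<lambda>j. j + m) \<circ> w))"

section \<open>The extended affine Hecke algebra\<close>

text \<open>The ring of Laurent polynomials in $v$ over the integers is the monoid ring of the
  additive group of integers.\<close>

type_synonym laurent = "int \<Rightarrow>\<^sub>0 int"
type_synonym hecke = "perm \<Rightarrow>\<^sub>0 laurent"

definition vpow :: "int \<Rightarrow> laurent" where
  "vpow k = Poly_Mapping.single k 1"

definition at_one :: "laurent \<Rightarrow> int" where
  "at_one p = (\<Sum>k\<in>Poly_Mapping.keys p. Poly_Mapping.lookup p k)"

definition hscale :: "laurent \<Rightarrow> hecke \<Rightarrow> hecke" where
  "hscale c h = Poly_Mapping.map (\<lambda>y. c * y) h"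

definition T :: "perm \<Rightarrow> hecke" where
  "T w = Poly_Mapping.single w 1"

definition Hecke :: "nat \<Rightarrow> hecke set" where
  "Hecke r = {h. Poly_Mapping.keys h \<subseteq> Saff r}"

text \<open>The free module on the elements $T_w$ is given from the start, so the presentation
  describes its product.  That $T_1$ is a unit is an instance of the last clause.\<close>

definition is_hecke_mult :: "nat \<Rightarrow> (hecke \<Rightarrow> hecke \<Rightarrow> hecke) \<Rightarrow> bool" where
  "is_hecke_mult r m \<longleftrightarrow>
     (\<forall>x\<in>Hecke r. \<forall>y\<in>Hecke r. m x y \<in> Hecke r) \<and>
     (\<forall>x\<in>Hecke r. \<forall>y\<in>Hecke r. \<forall>z\<in>Hecke r.
        m (x + y) z = m x z + m y z \<and> m z (x + y) = m z x + m z y \<and> m (m x y) z = m x (m y z)) \<and>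
     (\<forall>c. \<forall>x\<in>Hecke r. \<forall>y\<in>Hecke r.
        m (hscale c x) y = hscale c (m x y) \<and> m x (hscale c y) = hscale c (m x y)) \<and>
     (\<forall>s\<in>simple_refls r.
        m (T s) (T s) = hscale (vpow 2 - 1) (T s) + hscale (vpow 2) (T id)) \<and>
     (\<forall>w\<in>Saff r. \<forall>w'\<in>Saff r.
        len r (w \<circ> w') = len r w + len r w' \<longrightarrow> m (T w) (T w') = T (w \<circ> w'))"

text \<open>Any two products satisfying the presentation agree on the carrier, so the choice below
  only fixes irrelevant values outside it.\<close>

definition hmult :: "nat \<Rightarrow> hecke \<Rightarrow> hecke \<Rightarrow> hecke" where
  "hmult r = (SOME m. is_hecke_mult r m)"

section \<open>Affine quantum Schur algebras\<close>

text \<open>An index $j = i + kn$ with $1 \le i \le n$ has $k = (j-1)$ div $n$ and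
  $i = (j-1)$ mod $n + 1$, so the sum below runs over $1 \le t \le i-1$.\<close>

definition Rset :: "nat \<Rightarrow> nat \<Rightarrow> seq \<Rightarrow> int \<Rightarrow> int set" where
  "Rset n r l j =
     (let b = ((j - 1) div int n) * int r + (\<Sum>t=1..(j - 1) mod int n. l t)
      in {b + 1 .. b + l j})"

text \<open>For $1 \le i \le n$ the sets $R^\lambda_i$ are the consecutive blocks of
  $\{1,\dots,r\}$ of sizes $\lambda_1,\dots,\lambda_n$.\<close>

definition Young :: "nat \<Rightarrow> nat \<Rightarrow> seq \<Rightarrow> perm set" where
  "Young n r l = {w \<in> Saff r. \<forall>i\<in>{1..int n}. w ` Rset n r l i = Rset n r l i}"

definition Tsum :: "perm set \<Rightarrow> hecke" where
  "Tsum D = (\<Sum>w\<in>D. T w)"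

definition xelt :: "nat \<Rightarrow> nat \<Rightarrow> seq \<Rightarrow> hecke" where
  "xelt n r l = Tsum (Young n r l)"

text \<open>The direct sum of the right ideals $x_\lambda \mathcal{H}$, as families indexed by
  $\lambda$ that vanish off the finite set of compositions.\<close>

type_synonym tensor = "seq \<Rightarrow> hecke"

definition Tmod :: "nat \<Rightarrow> nat \<Rightarrow> tensor set" where
  "Tmod n r = {m. (\<forall>l. l \<notin> Lambda n r \<longrightarrow> m l = 0) \<and>
                  (\<forall>l\<in>Lambda n r. \<exists>h\<in>Hecke r. m l = hmult r (xelt n r l) h)}"

definition inj_sum :: "seq \<Rightarrow> hecke \<Rightarrow> tensor" where
  "inj_sum l x = (\<lambda>k. if k = l then x else 0)"

definition Schur :: "nat \<Rightarrow> nat \<Rightarrow> (tensor \<Rightarrow> tensor) set" where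
  "Schur n r = {f \<in> Tmod n r \<rightarrow>\<^sub>E Tmod n r.
     (\<forall>x\<in>Tmod n r. \<forall>y\<in>Tmod n r. f (x + y) = f x + f y) \<and>
     (\<forall>x\<in>Tmod n r. \<forall>h\<in>Hecke r.
        f (\<lambda>l. hmult r (x l) h) = (\<lambda>l. hmult r (f x l) h))}"

definition schur_lincomb ::
    "nat \<Rightarrow> nat \<Rightarrow> (mat \<Rightarrow>\<^sub>0 laurent) \<Rightarrow> (mat \<Rightarrow> tensor \<Rightarrow> tensor) \<Rightarrow> tensor \<Rightarrow> tensor" where
  "schur_lincomb n r g b =
     (\<lambda>x\<in>Tmod n r. \<lambda>l. \<Sum>C\<in>Poly_Mapping.keys g. hscale (Poly_Mapping.lookup g C) (b C x l))"

definition Dleft :: "nat \<Rightarrow> nat \<Rightarrow> seq \<Rightarrow> perm set" where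
  "Dleft n r l = {d \<in> Saff r. \<forall>w\<in>Young n r l. len r (w \<circ> d) = len r w + len r d}"

definition Ddouble :: "nat \<Rightarrow> nat \<Rightarrow> seq \<Rightarrow> seq \<Rightarrow> perm set" where
  "Ddouble n r l k = Dleft n r l \<inter> inv_into UNIV ` Dleft n r k"

definition dcoset :: "nat \<Rightarrow> nat \<Rightarrow> seq \<Rightarrow> perm \<Rightarrow> seq \<Rightarrow> perm set" where
  "dcoset n r l d k = {u \<circ> d \<circ> w | u w. u \<in> Young n r l \<and> w \<in> Young n r k}"

definition phi :: "nat \<Rightarrow> nat \<Rightarrow> seq \<Rightarrow> perm \<Rightarrow> seq \<Rightarrow> tensor \<Rightarrow> tensor" where
  "phi n r l d m = (THE f. f \<in> Schur n r \<and>
     (\<forall>k\<in>Lambda n r. \<forall>h\<in>Hecke r.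
        f (inj_sum k (hmult r (xelt n r k) h)) =
          (if k = m then inj_sum l (hmult r (Tsum (dcoset n r l d m)) h) else 0)))"

definition mat_of :: "nat \<Rightarrow> nat \<Rightarrow> seq \<Rightarrow> perm \<Rightarrow> seq \<Rightarrow> mat" where
  "mat_of n r l d m = (\<lambda>i j. int (card (Rset n r l i \<inter> d ` Rset n r m j)))"

definition ebasis :: "nat \<Rightarrow> nat \<Rightarrow> mat \<Rightarrow> tensor \<Rightarrow> tensor" where
  "ebasis n r A = (THE f. \<exists>l\<in>Lambda n r. \<exists>m\<in>Lambda n r. \<exists>d\<in>Ddouble n r l m.
     mat_of n r l d m = A \<and> f = phi n r l d m)"

definition dA :: "nat \<Rightarrow> mat \<Rightarrow> int" where
  "dA n A = (\<Sum>(i,j,k,l) | 1 \<le> i \<and> i \<le> int n \<and> i \<ge> k \<and> j < l \<and> A i j * A k l \<noteq> 0.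
               A i j * A k l)"

definition nbasis :: "nat \<Rightarrow> nat \<Rightarrow> mat \<Rightarrow> tensor \<Rightarrow> tensor" where
  "nbasis n r A = schur_lincomb n r (Poly_Mapping.single A (vpow (- dA n A))) (ebasis n r)"

text \<open>The coordinates of the product $[B][A]$ with respect to the basis of all $[C]$.\<close>

definition schur_struct :: "nat \<Rightarrow> nat \<Rightarrow> mat \<Rightarrow> mat \<Rightarrow> (mat \<Rightarrow>\<^sub>0 laurent)" where
  "schur_struct n r B A = (THE g. Poly_Mapping.keys g \<subseteq> Theta_r n r \<and>
     compose (Tmod n r) (nbasis n r B) (nbasis n r A) = schur_lincomb n r g (nbasis n r))"

section \<open>Specialization at $v = 1$ and stabilization\<close>

text \<open>The specialized algebra is the free abelian group on $\Theta_\triangle(n,r)$ whose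
  structure constants are those of the generic algebra evaluated at $v = 1$.\<close>

definition schurZ_mult :: "nat \<Rightarrow> nat \<Rightarrow> (mat \<Rightarrow>\<^sub>0 int) \<Rightarrow> (mat \<Rightarrow>\<^sub>0 int) \<Rightarrow> (mat \<Rightarrow>\<^sub>0 int)" where
  "schurZ_mult n r x y =
     (\<Sum>B\<in>Poly_Mapping.keys x. \<Sum>A\<in>Poly_Mapping.keys y.
        Poly_Mapping.map
          (\<lambda>c. Poly_Mapping.lookup x B * Poly_Mapping.lookup y A * at_one c)
          (schur_struct n r B A))"

definition br1 :: "nat \<Rightarrow> nat \<Rightarrow> mat \<Rightarrow> (mat \<Rightarrow>\<^sub>0 int)" where
  "br1 n r A = (if A \<in> Theta_r n r then Poly_Mapping.single A 1 else 0)"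

definition binom_poly :: "int \<Rightarrow> nat \<Rightarrow> rat poly" where
  "binom_poly a t = smult (1 / fact t) (\<Prod>i<t. [:of_int a - of_nat i, 1:])"

inductive_set Z1 :: "rat poly set" where
  one: "1 \<in> Z1"
| binom: "binom_poly a t \<in> Z1"
| uminus: "p \<in> Z1 \<Longrightarrow> - p \<in> Z1"
| add: "p \<in> Z1 \<Longrightarrow> q \<in> Z1 \<Longrightarrow> p + q \<in> Z1"
| mult: "p \<in> Z1 \<Longrightarrow> q \<in> Z1 \<Longrightarrow> p * q \<in> Z1"

text \<open>The stabilization formula.  The condition on \<open>sigma_mat\<close> makes the right-hand side
  meaningful: ${}_aX$ must index a basis element of the same Schur algebra.\<close>

definition is_stab_prod :: "nat \<Rightarrow> mat \<Rightarrow> mat \<Rightarrow> (mat \<Rightarrow>\<^sub>0 rat poly) \<Rightarrow> bool" where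
  "is_stab_prod n B A P \<longleftrightarrow>
     (\<forall>X\<in>Poly_Mapping.keys P.
        X \<in> Theta_tilde n \<and> sigma_mat n X = sigma_mat n A \<and> Poly_Mapping.lookup P X \<in> Z1) \<and>
     (\<forall>\<^sub>F a in at_top.
        let r = nat (a * int n + sigma_mat n A) in
        \<forall>C. of_int (Poly_Mapping.lookup
                      (schurZ_mult n r (br1 n r (shift a B)) (br1 n r (shift a A))) C) =
            (\<Sum>X\<in>Poly_Mapping.keys P.
               poly (Poly_Mapping.lookup P X) (of_int a) *
               of_int (Poly_Mapping.lookup (br1 n r (shift a X)) C)))"

definition Ktilde_prod :: "nat \<Rightarrow> mat \<Rightarrow> mat \<Rightarrow> (mat \<Rightarrow>\<^sub>0 rat poly)" where
  "Ktilde_prod n B A = (if co B = ro A then THE P. is_stab_prod n B A P else 0)"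

text \<open>The product $[B]_1 [A]_1$ in $\mathcal{K}_{\mathbb{Z}}(n)$, obtained by $x \mapsto 0$;
  its coefficients are integers because elements of $\mathcal{Z}_1$ are integer-valued.\<close>

definition KZ_prod :: "nat \<Rightarrow> mat \<Rightarrow> mat \<Rightarrow> (mat \<Rightarrow>\<^sub>0 rat)" where
  "KZ_prod n B A = Poly_Mapping.map (\<lambda>p. poly p 0) (Ktilde_prod n B A)"

section \<open>The completion\<close>

text \<open>A formal sum is represented by its coefficient function.\<close>

definition Khat_carrier :: "nat \<Rightarrow> (mat \<Rightarrow> rat) set" where
  "Khat_carrier n = {b. (\<forall>A. b A \<noteq> 0 \<longrightarrow> A \<in> Theta_tilde n) \<and>
     (\<forall>x\<in>Zseq n. finite {A. b A \<noteq> 0 \<and> ro A = x} \<and> finite {A. b A \<noteq> 0 \<and> co A = x})}"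

text \<open>The set of contributing pairs is finite for elements of the carrier: $[B]_1 [A]_1$
  involves only $X$ with the rows of $B$ and the columns of $A$, and needs
  $\mathrm{co}(B) = \mathrm{ro}(A)$.\<close>

definition Khat_mult :: "nat \<Rightarrow> (mat \<Rightarrow> rat) \<Rightarrow> (mat \<Rightarrow> rat) \<Rightarrow> (mat \<Rightarrow> rat)" where
  "Khat_mult n b c = (\<lambda>X.
     \<Sum>(B, A) | b B * c A * Poly_Mapping.lookup (KZ_prod n B A) X \<noteq> 0.
       b B * c A * Poly_Mapping.lookup (KZ_prod n B A) X)"

definition Khat :: "nat \<Rightarrow> (mat \<Rightarrow> rat) ring" where
  "Khat n = \<lparr> carrier = Khat_carrier n,
              monoid.mult = Khat_mult n,
              one = (\<lambda>X. if X \<in> diag ` Zseq n then 1 else 0),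
              zero = 0,
              add = (+) \<rparr>"

definition binom_seq :: "nat \<Rightarrow> seq \<Rightarrow> seq \<Rightarrow> rat" where
  "binom_seq n m l = (\<Prod>i=1..int n. (of_int (m i) :: rat) gchoose (nat (l i)))"

text \<open>The element $A\{\lambda\}$; at most one index $\mu$ contributes to each coefficient.\<close>

definition brace :: "nat \<Rightarrow> mat \<Rightarrow> seq \<Rightarrow> (mat \<Rightarrow> rat)" where
  "brace n A l = (\<lambda>X. \<Sum>m | m \<in> Zseq n \<and> X = A + diag m. binom_seq n m l)"

definition VZ :: "nat \<Rightarrow> (mat \<Rightarrow> rat) set" where
  "VZ n = Modules.module.span (\<lambda>(k::int) b. (\<lambda>X. of_int k * b X))
            {brace n A l | A l. A \<in> Theta_pm n \<and> l \<in> Nseq n}"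

definition VZ_gens :: "nat \<Rightarrow> (mat \<Rightarrow> rat) set" where
  "VZ_gens n =
     {brace n (\<lambda>k l. \<Sum>i=1..int n. \<alpha> i * unit_mat n i (i + 1) k l) 0 | \<alpha>. \<alpha> \<in> Nseq n} \<union>
     {brace n (\<lambda>k l. \<Sum>i=1..int n. \<alpha> i * unit_mat n (i + 1) i k l) 0 | \<alpha>. \<alpha> \<in> Nseq n} \<union>
     {brace n 0 (\<lambda>j. int t * unit_seq n i j) | t i. 1 \<le> i \<and> i \<le> int n}"

end

theory Submission
  imports Defs
begin

text \<open>
  Everything rests on one closed formula for the structure constants at \<open>v = 1\<close>.

  The composition of two basis elements of the affine Schur algebra is computed by multiplying
  sums of \<open>T w\<close> over double cosets of Young subgroups. At \<open>v = 1\<close> the coefficient of \<open>[C]\<close> in \<open>[B][A]\<close>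
  counts the factorizations \<open>c = b a\<close> of one fixed \<open>c\<close> in the double coset of \<open>C\<close>, with \<open>b\<close> and \<open>a\<close> in those of
  \<open>B\<close> and \<open>A\<close>, divided by the order of the Young subgroup in the middle (\<open>schur_struct_at_one\<close>). A coset of a
  Young subgroup is the same as an equivariant labelling of the integers with fibres of given sizes, so the coefficient
  is the number of middle labellings compatible with \<open>B\<close> on one side and \<open>A\<close> on the other.
  Such a labelling is sorted by its transport tensor \<open>t\<close>, where \<open>t i k j\<close> counts the points with row label \<open>i\<close>,
  middle label \<open>k \<noteq> i\<close> and column label \<open>j\<close>: multiplying by \<open>B\<close> moves \<open>t i k j\<close> units of \<open>A\<close> from
  position \<open>(k, j)\<close> to position \<open>(i, j)\<close>, and \<open>C\<close> is the result. The number of labellings with a given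
  tensor is a product of binomials in the entries of \<open>C\<close> and of multinomial constants (\<open>schur_coefficient\<close>).

  The set of tensors depends on the off-diagonal entries of \<open>B\<close> and \<open>A\<close> alone, and adding \<open>a\<close> to both
  diagonals adds \<open>a\<close> to the diagonal of \<open>C\<close>. Hence the coefficients are polynomials in \<open>a\<close>, and their
  values at \<open>0\<close> give the same formula for arbitrary integral diagonals (\<open>lookup_KZ_prod\<close>).

  In a product \<open>B{k} A{l}\<close> a tensor and the diagonal of the result determine the diagonals of both
  factors by translation. The product is therefore a finite sum, over the tensors, of sums
  \<open>\<Sum>\<mu>. P \<mu> [X + diag \<mu>]\<close> in which \<open>P\<close> is a product of one-variable polynomials taking integral values at
  integers. By Newton interpolation these are integral combinations of binomials, so the product is an
  integral combination of elements \<open>X{\<lambda>}\<close> (\<open>VZ_mult\<close>).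

  For generation, \<open>0{\<lambda>}\<close> is the product of the \<open>0{\<lambda>\<^sub>i e\<^sub>i}\<close>, and multiplying \<open>A{0}\<close> by these gives all
  \<open>A{\<lambda>}\<close> (\<open>all_weights_in\<close>). It remains to reach \<open>A{0}\<close>. For \<open>A\<close> strictly upper triangular, let \<open>S\<close> have the row sums
  of \<open>A\<close> on the first superdiagonal and let \<open>A'\<close> be \<open>A\<close> with its rows pushed one step towards the diagonal.
  Then \<open>S{0} A'{0}\<close> is \<open>A{0}\<close> plus terms \<open>X{\<lambda>}\<close> with \<open>X\<close> upper triangular, the same value of
  \<open>\<Sum> (j - i) a\<^sub>i\<^sub>j\<close> and a larger sum of entries; the latter is bounded by the former, so the recursion ends
  (\<open>triangular_in\<close>). The lower triangular case is symmetric. A general \<open>A\<close> is the sum of its upper part \<open>B\<close> and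
  its lower part \<open>C\<close>, and \<open>B{0} C{0}\<close> is \<open>A{0}\<close> plus terms with a smaller sum of entries (\<open>offdiagonal_in\<close>).
\<close>

section \<open>Affine permutations and their length\<close>

lemma periodic_shift:
  fixes f :: "int \<Rightarrow> 'a"
  assumes "\<And>x. f (x + p) = f x"
  shows "f (x + k * p) = f x"
proof (induction k rule: int_induct[where k = 0])
  case base show ?case by simp
next
  case (step1 i)
  then show ?case using assms[of "x + i * p"] by (simp add: algebra_simps)
next
  case (step2 i)
  then show ?case using assms[of "x + (i - 1) * p"] by (simp add: algebra_simps)
qed

lemma equivariant_shift:
  fixes f :: "int \<Rightarrow> int"
  assumes "\<And>x. f (x + p) = f x + q"
  shows "f (x + k * p) = f x + k * q"
proof (induction k rule: int_induct[where k = 0])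
  case base show ?case by simp
next
  case (step1 i)
  then show ?case using assms[of "x + i * p"] by (simp add: algebra_simps)
next
  case (step2 i)
  then show ?case using assms[of "x + (i - 1) * p"] by (simp add: algebra_simps)
qed

text \<open>Any \<open>r\<close> consecutive integers represent the residues, so sums of periodic functions may be taken
  over any window of that length.\<close>

lemma bij_betw_window:
  fixes r :: nat and a :: int
  assumes "r > 0"
  shows "bij_betw (\<lambda>x. (x - 1) mod int r + 1) {a + 1..a + int r} {1..int r}"
proof -
  have inj: "inj_on (\<lambda>x. (x - 1) mod int r + 1) {a + 1..a + int r}"
  proof (rule inj_onI)
    fix x y assume x: "x \<in> {a + 1..a + int r}" and y: "y \<in> {a + 1..a + int r}"
      and e: "(x - 1) mod int r + 1 = (y - 1) mod int r + 1"
    then have "int r dvd x - y" by (simp add: mod_eq_dvd_iff)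
    then obtain k where k: "x - y = int r * k" by (auto elim: dvdE)
    have "\<bar>x - y\<bar> < int r" using x y by auto
    then have "int r * \<bar>k\<bar> < int r * 1" using k by (simp add: abs_mult)
    then have "\<bar>k\<bar> < 1" using assms by (simp only: mult_less_cancel_left_pos of_nat_0_less_iff)
    then show "x = y" using k by simp
  qed
  have sub: "(\<lambda>x. (x - 1) mod int r + 1) ` {a + 1..a + int r} \<subseteq> {1..int r}"
    using assms by (auto simp: pos_mod_bound add1_zle_eq)
  have "(\<lambda>x. (x - 1) mod int r + 1) ` {a + 1..a + int r} = {1..int r}"
    by (rule card_subset_eq) (use sub in \<open>auto simp: card_image[OF inj]\<close>)
  then show ?thesis using inj by (simp add: bij_betw_def)
qed

lemma periodic_window:
  fixes f :: "int \<Rightarrow> 'a"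
  assumes "\<And>x. f (x + int r) = f x"
  shows "f ((x - 1) mod int r + 1) = f x"
proof -
  have "x = ((x - 1) mod int r + 1) + ((x - 1) div int r) * int r"
    by (simp add: algebra_simps)
  then show ?thesis using periodic_shift[of f "int r"] assms by metis
qed

lemma periodic_sum:
  fixes f :: "int \<Rightarrow> 'a::comm_monoid_add"
  assumes "r > 0" "\<And>x. f (x + int r) = f x"
  shows "(\<Sum>x\<in>{a + 1..a + int r}. f x) = (\<Sum>x=1..int r. f x)"
  using sum.reindex_bij_betw[OF bij_betw_window[OF assms(1), of a], of f]
  by (simp add: periodic_window[of f, OF assms(2)])

lemma periodic_sum_shift:
  fixes f :: "int \<Rightarrow> 'a::comm_monoid_add"
  assumes "r > 0" "\<And>x. f (x + int r) = f x"
  shows "(\<Sum>x=1..int r. f (x + a)) = (\<Sum>x=1..int r. f x)"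
proof -
  have "(\<Sum>x=1..int r. f (x + a)) = (\<Sum>x\<in>{a + 1..a + int r}. f x)"
    by (rule sum.reindex_bij_witness[of _ "\<lambda>x. x - a" "\<lambda>x. x + a"]) auto
  then show ?thesis using periodic_sum[of r f a] assms by simp
qed

abbreviation ipm :: "perm \<Rightarrow> perm" where "ipm w \<equiv> inv_into UNIV w"

abbreviation (input) rho :: "int \<Rightarrow> perm" where "rho m \<equiv> (\<lambda>j. j + m)"

lemma int_step_less:
  fixes f :: "int \<Rightarrow> int"
  assumes "\<And>i. f i < f (i + 1)" "i < j"
  shows "f i < f j"
  using assms(2)
proof (induction j rule: int_gr_induct)
  case base show ?case using assms(1)[of i] by simp
next
  case (step j) then show ?case using assms(1)[of j] by simp
qed

text \<open>Stabilization only sees large ranks, so \<open>r \<ge> 2\<close> may be assumed; then \<open>s i\<close> swaps two distinct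
  residues.\<close>

locale affine =
  fixes r :: nat
  assumes r2: "2 \<le> r"
begin

abbreviation "s \<equiv> simple_refl r"
abbreviation "G \<equiv> Saff r"

lemma r_pos: "r > 0" using r2 by simp

lemma G_iff: "w \<in> G \<longleftrightarrow> bij w \<and> (\<forall>i. w (i + int r) = w i + int r)"
  using r_pos by (simp add: Saff_def)

lemma G_bij: "w \<in> G \<Longrightarrow> bij w" by (simp add: G_iff)

lemma G_inj: "w \<in> G \<Longrightarrow> w x = w y \<longleftrightarrow> x = y"
  by (meson G_bij bij_def injD)

lemma G_shift: "w \<in> G \<Longrightarrow> w (i + k * int r) = w i + k * int r"
  by (rule equivariant_shift) (simp add: G_iff)

lemma G_id: "id \<in> G" by (simp add: G_iff)

lemma G_rho: "rho m \<in> G"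
  by (auto simp: G_iff intro!: bij_betw_byWitness[where f' = "\<lambda>j. j - m"])

lemma G_comp: "w \<in> G \<Longrightarrow> w' \<in> G \<Longrightarrow> w \<circ> w' \<in> G"
  by (simp add: G_iff bij_comp)

lemma G_ipm_left: "w \<in> G \<Longrightarrow> ipm w (w x) = x"
  using G_bij bij_is_inj inv_f_f by metis

lemma G_ipm_right: "w \<in> G \<Longrightarrow> w (ipm w x) = x"
  using G_bij bij_is_surj surj_f_inv_f by metis

lemma G_ipm: "w \<in> G \<Longrightarrow> ipm w \<in> G"
proof -
  assume w: "w \<in> G"
  have "ipm w (i + int r) = ipm w i + int r" for i
  proof -
    have "w (ipm w i + int r) = i + int r" using w G_ipm_right by (simp add: G_iff)
    then show ?thesis using G_ipm_left[OF w] by metis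
  qed
  then show ?thesis using w by (simp add: G_iff bij_imp_bij_inv)
qed

lemma ipm_unique: "w \<in> G \<Longrightarrow> (\<And>x. v (w x) = x) \<Longrightarrow> ipm w = v"
  using G_ipm_right by (metis ext)

lemma ipm_comp: "w \<in> G \<Longrightarrow> w' \<in> G \<Longrightarrow> ipm (w \<circ> w') = ipm w' \<circ> ipm w"
  by (rule ipm_unique) (auto simp: G_comp G_ipm_left)

lemma ipm_ipm: "w \<in> G \<Longrightarrow> ipm (ipm w) = w"
  by (rule ipm_unique) (auto simp: G_ipm G_ipm_right)

lemma ipm_rho: "ipm (rho m) = rho (- m)"
  by (rule ipm_unique[OF G_rho]) simp

lemma comp_ipm: "w \<in> G \<Longrightarrow> w \<circ> ipm w = id" "w \<in> G \<Longrightarrow> ipm w \<circ> w = id"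
  by (auto simp: G_ipm_left G_ipm_right)

lemma mod_neq: "0 < d \<Longrightarrow> d < int r \<Longrightarrow> (i + d) mod int r \<noteq> i mod int r"
  by (metis add_diff_cancel_left' mod_eq_dvd_iff zdvd_not_zless)

lemma mod_eqE:
  assumes "(x::int) mod int r = i mod int r" obtains k where "x = i + k * int r"
proof -
  have "int r dvd x - i" using assms by (simp add: mod_eq_dvd_iff)
  then obtain k where "x - i = int r * k" by (auto elim: dvdE)
  then have "x = i + k * int r" by (simp add: algebra_simps)
  then show ?thesis by (rule that)
qed

lemma mod_Suc_iff: "(x + 1) mod int r = (i + 1) mod int r \<longleftrightarrow> (x::int) mod int r = i mod int r"
  by (simp add: mod_eq_dvd_iff)

lemma s_at: "s i i = i + 1" by (simp add: simple_refl_def)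

lemma s_at_Suc: "s i (i + 1) = i"
  using mod_neq[of 1 i] r2 by (simp add: simple_refl_def)

lemma s_mod: "i mod int r = j mod int r \<Longrightarrow> s i = s j"
  by (auto simp: simple_refl_def fun_eq_iff mod_Suc_iff)

lemma s_s: "s i (s i x) = x"
proof -
  consider "x mod int r = i mod int r" | "x mod int r = (i + 1) mod int r"
    | "x mod int r \<noteq> i mod int r" "x mod int r \<noteq> (i + 1) mod int r" by blast
  then show ?thesis
  proof cases
    case 1
    then show ?thesis using s_at[of x] s_at_Suc[of x] s_mod[of i x] by simp
  next
    case 2
    then have "(x - 1) mod int r = i mod int r" using mod_Suc_iff[of "x - 1" i] by simp
    then show ?thesis using s_at[of "x - 1"] s_at_Suc[of "x - 1"] s_mod[of i "x - 1"] by simp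
  next
    case 3 then show ?thesis by (simp add: simple_refl_def)
  qed
qed

lemma s_comp_s: "s i \<circ> s i = id" by (simp add: fun_eq_iff s_s)

lemma G_s: "s i \<in> G"
proof -
  have "bij (s i)" by (rule bij_betw_byWitness[where f' = "s i"]) (auto simp: s_s)
  then show ?thesis by (auto simp: G_iff simple_refl_def)
qed

lemma ipm_s: "ipm (s i) = s i" by (rule ipm_unique[OF G_s]) (simp add: s_s)

lemma s_neq: "s i x = x + 1 \<or> s i x = x - 1 \<or> s i x = x"
  by (simp add: simple_refl_def)

lemma s_fix: "x mod int r \<noteq> i mod int r \<Longrightarrow> x mod int r \<noteq> (i + 1) mod int r \<Longrightarrow> s i x = x"
  by (simp add: simple_refl_def)

text \<open>A simple reflection inverts no pairs but the adjacent ones it swaps.\<close>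

lemma s_flip:
  assumes "p < q" "s i q < s i p"
  shows "p mod int r = i mod int r \<and> q = p + 1"
proof -
  have q: "q = p + 1" using assms s_neq[of i p] s_neq[of i q] by linarith
  moreover have "p mod int r = i mod int r"
    using assms unfolding q simple_refl_def by (auto split: if_splits)
  ultimately show ?thesis by simp
qed

text \<open>Where \<open>x\<close> carries an adjacent pair to an adjacent pair in order, it intertwines the two
  reflections; this is the source of all commutation rules below.\<close>

lemma s_conj:
  assumes x: "x \<in> G" and a: "x j mod int r = i mod int r" and b: "x (j + 1) = x j + 1"
  shows "s i \<circ> x = x \<circ> s j"
proof
  fix y
  consider k where "y = j + k * int r" | k where "y = (j + 1) + k * int r"
    | "y mod int r \<noteq> j mod int r" "y mod int r \<noteq> (j + 1) mod int r"
    using mod_eqE by metis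
  then show "(s i \<circ> x) y = (x \<circ> s j) y"
  proof cases
    case 1
    have "s i (x y) = x y + 1"
      using 1 a by (simp add: G_shift[OF x] simple_refl_def)
    moreover have "s j y = y + 1" using 1 by (simp add: simple_refl_def)
    moreover have "x (y + 1) = x y + 1" using b G_shift[OF x, of "j + 1" k] G_shift[OF x, of j k] 1
      by (simp add: algebra_simps)
    ultimately show ?thesis by simp
  next
    case 2
    then have y: "y = j + k * int r + 1" by simp
    have jj: "s j = s (j + k * int r)" by (rule s_mod) simp
    have sy: "s j y = j + k * int r" unfolding y jj by (rule s_at_Suc)
    have xy: "x y = x (j + k * int r) + 1"
      using b G_shift[OF x, of "j + 1" k] G_shift[OF x, of j k] unfolding 2 by (simp add: algebra_simps)
    have ii: "s i = s (x (j + k * int r))" by (rule s_mod) (simp add: G_shift[OF x] a)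
    have "s i (x y) = x (j + k * int r)" unfolding xy ii by (rule s_at_Suc)
    then show ?thesis using sy by simp
  next
    case 3
    have "x y mod int r \<noteq> i mod int r"
    proof
      assume "x y mod int r = i mod int r"
      then have "x y mod int r = x j mod int r" using a by simp
      then obtain k where "x y = x j + k * int r" by (rule mod_eqE)
      then have "x y = x (j + k * int r)" by (simp add: G_shift[OF x])
      then show False using 3 G_inj[OF x] by auto
    qed
    moreover have "x y mod int r \<noteq> (i + 1) mod int r"
    proof
      assume "x y mod int r = (i + 1) mod int r"
      then have "x y mod int r = x (j + 1) mod int r" using a b mod_Suc_iff by metis
      then obtain k where "x y = x (j + 1) + k * int r" by (rule mod_eqE)
      then have "x y = x (j + 1 + k * int r)" by (simp add: G_shift[OF x])
      then have "y = j + 1 + k * int r" using G_inj[OF x] by simp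
      then show False using 3 by simp
    qed
    ultimately show ?thesis using 3 by (simp add: s_fix)
  qed
qed

definition wprod :: "int list \<Rightarrow> perm" where
  "wprod ks = foldr (\<circ>) (map s ks) id"

lemma wprod_simps [simp]: "wprod [] = id" "wprod (k # ks) = s k \<circ> wprod ks"
  by (simp_all add: wprod_def)

lemma wprod_append: "wprod (xs @ ys) = wprod xs \<circ> wprod ys"
  by (induction xs) (auto simp: comp_assoc)

lemma G_wprod: "wprod ks \<in> G"
proof (induction ks)
  case Nil show ?case by (simp only: wprod_simps G_id)
next
  case (Cons k ks) then show ?case by (simp only: wprod_simps G_comp[OF G_s])
qed

lemma s_rho: "s i \<circ> rho m = rho m \<circ> s (i - m)"
  by (rule s_conj[OF G_rho]) (auto)

lemma wprod_rho: "wprod ks \<circ> rho m = rho m \<circ> wprod (map (\<lambda>i. i - m) ks)"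
proof (induction ks)
  case Nil show ?case by (simp add: fun_eq_iff)
next
  case (Cons k ks)
  have "wprod (k # ks) \<circ> rho m = s k \<circ> (wprod ks \<circ> rho m)" by (simp add: comp_assoc)
  also have "\<dots> = (s k \<circ> rho m) \<circ> wprod (map (\<lambda>i. i - m) ks)" by (simp only: Cons comp_assoc)
  also have "\<dots> = rho m \<circ> wprod (map (\<lambda>i. i - m) (k # ks))" by (simp only: s_rho comp_assoc wprod_simps list.map)
  finally show ?case .
qed

lemma ipm_wprod: "ipm (wprod ks) = wprod (rev ks)"
proof (induction ks)
  case Nil show ?case using ipm_unique[OF G_id, of id] by simp
next
  case (Cons k ks)
  have "ipm (wprod (k # ks)) = ipm (wprod ks) \<circ> ipm (s k)"
    using ipm_comp[OF G_s G_wprod] by simp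
  then show ?case using Cons by (simp only: ipm_s rev.simps wprod_append wprod_simps comp_id)
qed

text \<open>Deletion: the two strands that start in adjacent positions and end in the wrong order
  must cross at some letter of the word, and that letter can be dropped.\<close>

lemma wprod_exchange:
  "wprod ks (i + 1) < wprod ks i \<Longrightarrow> \<exists>ks'. Suc (length ks') = length ks \<and> wprod ks \<circ> s i = wprod ks'"
proof (induction ks)
  case Nil then show ?case by simp
next
  case (Cons k ks)
  let ?u = "wprod ks"
  show ?case
  proof (cases "?u (i + 1) < ?u i")
    case True
    then obtain ks' where "Suc (length ks') = length ks" "?u \<circ> s i = wprod ks'" using Cons by blast
    then have "Suc (length (k # ks')) = length (k # ks)" "wprod (k # ks) \<circ> s i = wprod (k # ks')"
      by (simp_all add: comp_assoc)
    then show ?thesis by blast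
  next
    case False
    then have lt: "?u i < ?u (i + 1)" using G_inj[OF G_wprod, of ks i "i + 1"] by linarith
    have "?u i mod int r = k mod int r \<and> ?u (i + 1) = ?u i + 1"
      by (rule s_flip[OF lt]) (use Cons.prems in simp)
    then have "s k \<circ> ?u = ?u \<circ> s i" by (intro s_conj[OF G_wprod]) auto
    then have "wprod (k # ks) \<circ> s i = ?u" by (simp only: wprod_simps comp_assoc s_comp_s comp_id)
    then show ?thesis by (intro exI[of _ ks]) (simp only: list.size add_Suc_right add_0_right)
  qed
qed

text \<open>Words in the simple reflections times a power of the shift, so that the component in the Weyl
  group never has to be chosen; agreement with \<open>len\<close> is \<open>len_eq\<close>.\<close>

definition elen :: "perm \<Rightarrow> nat" where
  "elen x = (LEAST k. \<exists>ks m. length ks = k \<and> x = rho m \<circ> wprod ks)"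

text \<open>A descent is undone by a simple reflection at the cost of this squared displacement; it is the
  termination measure for sorting an affine permutation.\<close>

definition msr :: "perm \<Rightarrow> nat" where
  "msr x = nat (\<Sum>i=1..int r. (x i - i)^2)"

lemma window_split:
  fixes f :: "int \<Rightarrow> 'a::comm_monoid_add"
  assumes "\<And>x. f (x + int r) = f x"
  shows "(\<Sum>x=1..int r. f x) = f i + f (i + 1) + (\<Sum>x\<in>{i+2..i+int r-1}. f x)"
proof -
  have "{i..i + int r - 1} = insert i (insert (i + 1) {i+2..i+int r-1})" using r2 by auto
  then have "(\<Sum>x\<in>{i..i + int r - 1}. f x) = f i + f (i + 1) + (\<Sum>x\<in>{i+2..i+int r-1}. f x)"
    by (simp add: add.assoc)
  moreover have "(\<Sum>x\<in>{(i-1) + 1..(i-1) + int r}. f x) = (\<Sum>x=1..int r. f x)"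
    by (rule periodic_sum[OF r_pos]) (rule assms)
  moreover have "{(i-1) + 1..(i-1) + int r} = {i..i + int r - 1}" by auto
  ultimately show ?thesis by (simp only:)
qed

lemma s_window: "x \<in> {i+2..i+int r-1} \<Longrightarrow> s i x = x"
  using mod_neq[of "x - i" i] mod_neq[of "x - (i + 1)" "i + 1"] by (intro s_fix) auto

lemma msr_less:
  assumes x: "x \<in> G" and d: "x (i + 1) < x i"
  shows "msr (x \<circ> s i) < msr x"
proof -
  have per: "\<And>w j. w \<in> G \<Longrightarrow> (w (j + int r) - (j + int r))^2 = (w j - j)^2" by (simp add: G_iff)
  have 1: "(\<Sum>j=1..int r. (x j - j)^2) = (x i - i)^2 + (x (i+1) - (i+1))^2
      + (\<Sum>j\<in>{i+2..i+int r-1}. (x j - j)^2)"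
    by (rule window_split) (rule per[OF x])
  have 2: "(\<Sum>j=1..int r. ((x \<circ> s i) j - j)^2) = (x (i+1) - i)^2 + (x i - (i+1))^2
      + (\<Sum>j\<in>{i+2..i+int r-1}. ((x \<circ> s i) j - j)^2)"
    using window_split[of "\<lambda>j. ((x \<circ> s i) j - j)^2" i, OF per[OF G_comp[OF x G_s]]]
    by (simp add: s_at s_at_Suc)
  have 3: "(\<Sum>j\<in>{i+2..i+int r-1}. ((x \<circ> s i) j - j)^2) = (\<Sum>j\<in>{i+2..i+int r-1}. (x j - j)^2)"
    by (rule sum.cong) (simp_all add: s_window)
  have "(x (i+1) - i)^2 + (x i - (i+1))^2 < (x i - i)^2 + (x (i+1) - (i+1))^2"
    using d by (simp add: power2_eq_square algebra_simps)
  moreover have "0 \<le> (\<Sum>j=1..int r. ((x \<circ> s i) j - j)^2)" by (rule sum_nonneg) simp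
  ultimately show ?thesis unfolding msr_def using 1 2 3 by linarith
qed

text \<open>Without descents the map is an increasing bijection of the integers.\<close>

lemma no_descent:
  assumes x: "x \<in> G" and d: "\<And>i. \<not> x (i + 1) < x i"
  shows "\<exists>m. x = rho m"
proof -
  have st: "x i < x (i + 1)" for i using d[of i] G_inj[OF x, of i "i + 1"] by linarith
  note mono = int_step_less[of x, OF st]
  have suc: "x (i + 1) = x i + 1" for i
  proof (rule ccontr)
    assume "x (i + 1) \<noteq> x i + 1"
    then have *: "x i + 1 < x (i + 1)" using st[of i] by simp
    obtain j where j: "x j = x i + 1" using G_ipm_right[OF x] by blast
    have "i < j"
    proof (rule ccontr)
      assume "\<not> i < j"
      then have "j = i \<or> j < i" by linarith
      then show False using j mono[of j i] by auto
    qed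
    moreover have "j < i + 1"
    proof (rule ccontr)
      assume "\<not> j < i + 1"
      then have "j = i + 1 \<or> i + 1 < j" by linarith
      then show False using j * mono[of "i + 1" j] by auto
    qed
    ultimately show False by simp
  qed
  have "x i = x 0 + i" for i
  proof (induction i rule: int_induct[where k = 0])
    case base show ?case by simp
  next
    case (step1 i) then show ?case using suc[of i] by simp
  next
    case (step2 i) then show ?case using suc[of "i - 1"] by simp
  qed
  then have "x i = x 0 + i" for i .
  then have "x = (\<lambda>j. j + x 0)" by (intro ext) (metis add.commute)
  then show ?thesis by blast
qed

lemma word_exists: "x \<in> G \<Longrightarrow> \<exists>ks m. x = rho m \<circ> wprod ks"
proof (induction "msr x" arbitrary: x rule: less_induct)
  case less
  show ?case
  proof (cases "\<exists>i. x (i + 1) < x i")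
    case True
    then obtain i where i: "x (i + 1) < x i" by blast
    then obtain ks m where "x \<circ> s i = rho m \<circ> wprod ks"
      using less(1)[OF msr_less[OF less(2) i]] less(2) G_comp G_s by blast
    then have "x \<circ> (s i \<circ> s i) = rho m \<circ> (wprod ks \<circ> wprod [i])" by (simp add: comp_assoc[symmetric])
    then have "x = rho m \<circ> wprod (ks @ [i])" unfolding s_comp_s wprod_append by simp
    then show ?thesis by blast
  next
    case False
    then obtain m where "x = rho m \<circ> wprod []" using no_descent[OF less(2)] by auto
    then show ?thesis by blast
  qed
qed

lemma elen_attain:
  assumes "x \<in> G" obtains ks m where "length ks = elen x" "x = rho m \<circ> wprod ks"
proof -
  have "\<exists>k ks m. length ks = k \<and> x = rho m \<circ> wprod ks" using word_exists[OF assms] by blast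
  from LeastI_ex[OF this] show ?thesis unfolding elen_def[symmetric] using that by blast
qed

lemma elen_le: "x = rho m \<circ> wprod ks \<Longrightarrow> elen x \<le> length ks"
  unfolding elen_def by (rule Least_le) blast

lemma elen_comp_le:
  assumes "x \<in> G" "y \<in> G" shows "elen (x \<circ> y) \<le> elen x + elen y"
proof -
  obtain ks m where 1: "length ks = elen x" "x = rho m \<circ> wprod ks" using elen_attain[OF assms(1)] .
  obtain ls l where 2: "length ls = elen y" "y = rho l \<circ> wprod ls" using elen_attain[OF assms(2)] .
  have "x \<circ> y = rho m \<circ> (wprod ks \<circ> rho l) \<circ> wprod ls" by (simp only: 1(2) 2(2) comp_assoc)
  also have "\<dots> = (rho m \<circ> rho l) \<circ> (wprod (map (\<lambda>i. i - l) ks) \<circ> wprod ls)"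
    by (simp only: wprod_rho comp_assoc)
  also have "\<dots> = rho (l + m) \<circ> wprod (map (\<lambda>i. i - l) ks @ ls)"
    by (simp add: wprod_append fun_eq_iff)
  finally have "elen (x \<circ> y) \<le> length (map (\<lambda>i. i - l) ks @ ls)" by (rule elen_le)
  then show ?thesis using 1 2 by simp
qed

lemma elen_s: "elen (s i) \<le> 1"
  using elen_le[of "s i" 0 "[i]"] by (simp add: fun_eq_iff)

lemma elen_rho: "elen (rho m) = 0"
  using elen_le[of "rho m" m "[]"] by simp

lemma elen_id: "elen id = 0"
  using elen_rho[of 0] by (simp add: id_def)

text \<open>The exchange property shortens a reduced word, and one letter changes the length by at most one.\<close>

lemma elen_down:
  assumes x: "x \<in> G" and d: "x (i + 1) < x i"
  shows "elen x = elen (x \<circ> s i) + 1"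
proof -
  obtain ks m where 1: "length ks = elen x" "x = rho m \<circ> wprod ks" using elen_attain[OF x] .
  have "wprod ks (i + 1) < wprod ks i" using d 1(2) by simp
  then obtain ks' where 2: "Suc (length ks') = length ks" "wprod ks \<circ> s i = wprod ks'"
    using wprod_exchange by blast
  have "x \<circ> s i = rho m \<circ> wprod ks'" by (simp only: 1(2) comp_assoc 2(2))
  then have "elen (x \<circ> s i) \<le> length ks'" by (rule elen_le)
  moreover have "elen x \<le> elen (x \<circ> s i) + 1"
  proof -
    have "x = (x \<circ> s i) \<circ> s i" by (simp add: comp_assoc s_comp_s)
    then show ?thesis using elen_comp_le[OF G_comp[OF x G_s] G_s, of i i] elen_s[of i] by simp
  qed
  ultimately show ?thesis using 1 2 by simp
qed

lemma elen_up:
  assumes x: "x \<in> G" and d: "x i < x (i + 1)"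
  shows "elen (x \<circ> s i) = elen x + 1"
proof -
  have "(x \<circ> s i) (i + 1) < (x \<circ> s i) i" using d by (simp add: s_at s_at_Suc)
  from elen_down[OF G_comp[OF x G_s] this] show ?thesis
    by (simp only: comp_assoc s_comp_s comp_id)
qed

lemma elen_ipm_le: "x \<in> G \<Longrightarrow> elen (ipm x) \<le> elen x"
proof -
  assume x: "x \<in> G"
  obtain ks m where 1: "length ks = elen x" "x = rho m \<circ> wprod ks" using elen_attain[OF x] .
  have "ipm x = wprod (rev ks) \<circ> rho (- m)"
    unfolding 1(2) by (simp only: ipm_comp[OF G_rho G_wprod] ipm_wprod ipm_rho)
  also have "\<dots> = rho (-m) \<circ> wprod (map (\<lambda>i. i - (-m)) (rev ks))" by (rule wprod_rho)
  finally have "elen (ipm x) \<le> length (map (\<lambda>i. i - (-m)) (rev ks))" by (rule elen_le)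
  then show ?thesis using 1 by simp
qed

lemma elen_ipm: "x \<in> G \<Longrightarrow> elen (ipm x) = elen x"
  using elen_ipm_le[of x] elen_ipm_le[of "ipm x"] by (simp add: G_ipm ipm_ipm)

lemma ipm_comp_s: "x \<in> G \<Longrightarrow> ipm (s i \<circ> x) = ipm x \<circ> s i"
  by (simp only: ipm_comp[OF G_s] ipm_s)

lemma elen_down_left:
  assumes x: "x \<in> G" and d: "ipm x (i + 1) < ipm x i"
  shows "elen x = elen (s i \<circ> x) + 1"
  using elen_down[OF G_ipm[OF x] d] elen_ipm[OF x] elen_ipm[OF G_comp[OF G_s x], of i]
  by (simp only: ipm_comp_s[OF x])

lemma elen_up_left:
  assumes x: "x \<in> G" and d: "ipm x i < ipm x (i + 1)"
  shows "elen (s i \<circ> x) = elen x + 1"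
  using elen_up[OF G_ipm[OF x] d] elen_ipm[OF x] elen_ipm[OF G_comp[OF G_s x], of i]
  by (simp only: ipm_comp_s[OF x])

text \<open>Every element is reached from a shift by steps that lengthen it.\<close>

lemma G_induct_right [consumes 1, case_names rho step]:
  assumes x: "x \<in> G" and base: "\<And>m. P (rho m)"
    and step: "\<And>x i. x \<in> G \<Longrightarrow> x i < x (i + 1) \<Longrightarrow> elen (x \<circ> s i) = elen x + 1 \<Longrightarrow> P x \<Longrightarrow> P (x \<circ> s i)"
  shows "P x"
  using x
proof (induction "elen x" arbitrary: x rule: less_induct)
  case less
  show ?case
  proof (cases "\<exists>i. x (i + 1) < x i")
    case True
    then obtain i where i: "x (i + 1) < x i" by blast
    let ?y = "x \<circ> s i"
    have y: "?y \<in> G" using less(2) G_comp G_s by blast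
    have l: "elen x = elen ?y + 1" by (rule elen_down[OF less(2) i])
    have P: "P ?y" using less(1)[OF _ y] l by simp
    have lt: "?y i < ?y (i + 1)" using i by (simp add: s_at s_at_Suc)
    have e: "?y \<circ> s i = x" by (simp add: comp_assoc s_comp_s)
    have "P (?y \<circ> s i)" by (rule step[OF y lt _ P]) (use l e in simp)
    then show ?thesis using e by simp
  next
    case False
    then obtain m where "x = rho m" using no_descent[OF less(2)] by auto
    then show ?thesis using base by simp
  qed
qed

lemma G_induct_left [consumes 1, case_names rho step]:
  assumes x: "x \<in> G" and base: "\<And>m. P (rho m)"
    and step: "\<And>x i. x \<in> G \<Longrightarrow> ipm x i < ipm x (i + 1) \<Longrightarrow> elen (s i \<circ> x) = elen x + 1 \<Longrightarrow> P x \<Longrightarrow> P (s i \<circ> x)"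
  shows "P x"
proof -
  have "P (ipm y)" if "y \<in> G" for y
    using that
  proof (induction rule: G_induct_right)
    case (rho m) show ?case using base[of "- m"] ipm_rho by simp
  next
    case (step y i)
    have y': "ipm y \<in> G" using step(1) by (rule G_ipm)
    have lt: "ipm (ipm y) i < ipm (ipm y) (i + 1)" using step by (simp add: ipm_ipm)
    have e: "ipm (y \<circ> s i) = s i \<circ> ipm y" by (simp only: ipm_comp[OF step(1) G_s] ipm_s)
    show ?case unfolding e
      by (rule assms(3)[OF y' lt elen_up_left[OF y' lt] step(4)])
  qed
  from this[OF G_ipm[OF x]] show ?thesis by (simp add: ipm_ipm[OF x])
qed

lemma disp_s:
  assumes x: "x \<in> G"
  shows "(\<Sum>j=1..int r. (x \<circ> s i) j) = (\<Sum>j=1..int r. x j)"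
proof -
  have per: "\<And>w j. w \<in> G \<Longrightarrow> w (j + int r) - (j + int r) = w j - j" by (simp add: G_iff)
  have 1: "(\<Sum>j=1..int r. x j - j) = (x i - i) + (x (i+1) - (i+1))
      + (\<Sum>j\<in>{i+2..i+int r-1}. x j - j)"
    by (rule window_split) (rule per[OF x])
  have 2: "(\<Sum>j=1..int r. (x \<circ> s i) j - j) = (x (i+1) - i) + (x i - (i+1))
      + (\<Sum>j\<in>{i+2..i+int r-1}. (x \<circ> s i) j - j)"
    using window_split[of "\<lambda>j. (x \<circ> s i) j - j" i, OF per[OF G_comp[OF x G_s]]]
    by (simp add: s_at s_at_Suc)
  have 3: "(\<Sum>j\<in>{i+2..i+int r-1}. (x \<circ> s i) j - j) = (\<Sum>j\<in>{i+2..i+int r-1}. x j - j)"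
    by (rule sum.cong) (simp_all add: s_window)
  show ?thesis using 1 2 3 by (simp add: sum_subtractf)
qed

lemma Waff_wprod: "wprod ks \<in> Waff r"
proof -
  have "(\<Sum>j=1..int r. wprod ks j) = (\<Sum>j=1..int r. j)"
  proof (induction ks rule: rev_induct)
    case Nil show ?case by simp
  next
    case (snoc k ks)
    then show ?case using disp_s[OF G_wprod, of ks k] by (simp add: wprod_append)
  qed
  then show ?thesis by (simp add: Waff_def G_wprod)
qed

text \<open>The sum over a window separates the shift from the component in the Weyl group.\<close>

lemma Waff_unique:
  assumes "w \<in> Waff r" "w' \<in> Waff r" "rho m \<circ> w = rho m' \<circ> w'"
  shows "m = m' \<and> w = w'"
proof -
  have e: "w j + m = w' j + m'" for j using fun_cong[OF assms(3), of j] by simp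
  have "(\<Sum>j=1..int r. w j + m) = (\<Sum>j=1..int r. w' j + m')" using e by simp
  then have "int r * m = int r * m'" using assms by (simp add: sum.distrib Waff_def)
  then have "m = m'" using r_pos by simp
  then show ?thesis using e by (simp add: fun_eq_iff)
qed

lemma simple_refls_eq: "simple_refls r = range s"
proof -
  have "s i \<in> s ` {1..int r}" for i
  proof -
    have "s i = s ((i - 1) mod int r + 1)" by (rule s_mod) (simp add: mod_add_left_eq)
    moreover have "(i - 1) mod int r + 1 \<in> {1..int r}" using r_pos by (simp add: add1_zle_eq)
    ultimately show ?thesis by blast
  qed
  then show ?thesis using r2 by (auto simp: simple_refls_def)
qed

lemma len_eq: "x \<in> G \<Longrightarrow> len r x = elen x"
proof -
  assume x: "x \<in> G"
  obtain ls m0 where x0: "x = rho m0 \<circ> wprod ls" using word_exists[OF x] by blast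
  have the: "(THE w. w \<in> Waff r \<and> (\<exists>m. x = (\<lambda>j. j + m) \<circ> w)) = wprod ls"
  proof (rule the_equality)
    show "wprod ls \<in> Waff r \<and> (\<exists>m. x = (\<lambda>j. j + m) \<circ> wprod ls)" using x0 Waff_wprod by blast
    show "w = wprod ls" if "w \<in> Waff r \<and> (\<exists>m. x = (\<lambda>j. j + m) \<circ> w)" for w
      using that Waff_unique[OF _ Waff_wprod] x0 by metis
  qed
  have "(\<exists>ss. set ss \<subseteq> simple_refls r \<and> length ss = k \<and> wprod ls = foldr (\<circ>) ss id) \<longleftrightarrow>
     (\<exists>ks m. length ks = k \<and> x = rho m \<circ> wprod ks)" (is "?L \<longleftrightarrow> ?R") for k
  proof
    assume ?L
    then obtain ss where ss: "set ss \<subseteq> range s" "length ss = k" "wprod ls = foldr (\<circ>) ss id"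
      unfolding simple_refls_eq by blast
    from ss(1) have "\<exists>ks. ss = map s ks"
      by (metis ex_map_conv imageE subsetD)
    then obtain ks where "ss = map s ks" by blast
    then have "length ks = k" "x = rho m0 \<circ> wprod ks" using ss x0 by (simp_all add: wprod_def)
    then show ?R by blast
  next
    assume ?R
    then obtain ks m where k: "length ks = k" "x = rho m \<circ> wprod ks" by blast
    then have "wprod ls = wprod ks" using Waff_unique[OF Waff_wprod Waff_wprod] x0 by metis
    then show ?L using k by (intro exI[of _ "map s ks"]) (auto simp: simple_refls_eq wprod_def)
  qed
  then show ?thesis unfolding len_def the lenW_def elen_def by simp
qed

end

section \<open>The extended affine Hecke algebra\<close>

abbreviation "lk \<equiv> Poly_Mapping.lookup"

lemma lookup_map_zero: "f 0 = 0 \<Longrightarrow> lk (Poly_Mapping.map f p) k = f (lk p k)"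
  by (simp add: Poly_Mapping.map.rep_eq when_def)

lemma lookup_hscale [simp]: "lk (hscale c h) w = c * lk h w"
  unfolding hscale_def by (rule lookup_map_zero) simp

lemma lookup_T: "lk (T w) x = (if x = w then 1 else 0)"
  by (auto simp: T_def lookup_single when_def)

lemma hscale_add: "hscale c (x + y) = hscale c x + hscale c y"
  by (rule poly_mapping_eqI) (simp add: lookup_add algebra_simps)

lemma hscale_hscale: "hscale c (hscale d x) = hscale (c * d) x"
  by (rule poly_mapping_eqI) (simp add: algebra_simps)

lemma hscale_zero [simp]: "hscale c 0 = 0"
  by (rule poly_mapping_eqI) simp

lemma hscale_zero_left [simp]: "hscale 0 h = 0"
  by (rule poly_mapping_eqI) simp

lemma hscale_one [simp]: "hscale 1 x = x"
  by (rule poly_mapping_eqI) simp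

lemma lookup_Tsum: "finite D \<Longrightarrow> lk (Tsum D) w = (if w \<in> D then 1 else 0)"
  by (simp add: Tsum_def lookup_sum lookup_T)

lemma keys_Tsum: "finite D \<Longrightarrow> Poly_Mapping.keys (Tsum D) = D"
  by (auto simp: in_keys_iff lookup_Tsum split: if_splits)

lemma hecke_expand: "(h::hecke) = (\<Sum>w\<in>Poly_Mapping.keys h. hscale (lk h w) (T w))"
proof (rule poly_mapping_eqI)
  fix x
  have "lk (\<Sum>w\<in>Poly_Mapping.keys h. hscale (lk h w) (T w)) x
      = (\<Sum>w\<in>Poly_Mapping.keys h. if x = w then lk h w else 0)"
    unfolding lookup_sum by (rule sum.cong) (auto simp: lookup_T)
  then show "lk h x = lk (\<Sum>w\<in>Poly_Mapping.keys h. hscale (lk h w) (T w)) x"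
    by (simp add: in_keys_iff)
qed

lemma Hecke_iff: "h \<in> Hecke r \<longleftrightarrow> (\<forall>w. w \<notin> Saff r \<longrightarrow> lk h w = 0)"
  by (auto simp: Hecke_def in_keys_iff)

lemma Hecke_zero [simp]: "0 \<in> Hecke r" by (simp add: Hecke_iff)
lemma Hecke_add: "x \<in> Hecke r \<Longrightarrow> y \<in> Hecke r \<Longrightarrow> x + y \<in> Hecke r"
  by (simp add: Hecke_iff lookup_add)
lemma Hecke_diff: "x \<in> Hecke r \<Longrightarrow> y \<in> Hecke r \<Longrightarrow> x - y \<in> Hecke r"
  by (simp add: Hecke_iff lookup_minus)
lemma Hecke_scale: "x \<in> Hecke r \<Longrightarrow> hscale c x \<in> Hecke r"
  by (simp add: Hecke_iff)
lemma Hecke_T: "w \<in> Saff r \<Longrightarrow> T w \<in> Hecke r"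
  by (auto simp: Hecke_iff lookup_T)
lemma Hecke_sum: "(\<And>a. a \<in> A \<Longrightarrow> f a \<in> Hecke r) \<Longrightarrow> sum f A \<in> Hecke r"
  by (induction A rule: infinite_finite_induct) (simp_all add: Hecke_add)
lemma Hecke_Tsum: "D \<subseteq> Saff r \<Longrightarrow> Tsum D \<in> Hecke r"
  unfolding Tsum_def by (intro Hecke_sum Hecke_T) auto

lemma hecke_induct [consumes 1, case_names zero add T]:
  assumes "h \<in> Hecke r" and "P 0"
    and "\<And>x y. x \<in> Hecke r \<Longrightarrow> y \<in> Hecke r \<Longrightarrow> P x \<Longrightarrow> P y \<Longrightarrow> P (x + y)"
    and "\<And>c w. w \<in> Saff r \<Longrightarrow> P (hscale c (T w))"
  shows "P h"
proof -
  have "P (\<Sum>w\<in>A. hscale (lk h w) (T w))" if "finite A" "A \<subseteq> Saff r" for A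
    using that
  proof (induction A)
    case empty show ?case using assms(2) by simp
  next
    case (insert a A)
    have "(\<Sum>w\<in>A. hscale (lk h w) (T w)) \<in> Hecke r"
      by (intro Hecke_sum Hecke_scale Hecke_T) (use insert in auto)
    then show ?case using insert assms(3,4) by (simp add: Hecke_scale Hecke_T)
  qed
  from this[of "Poly_Mapping.keys h"] assms(1) show ?thesis
    using hecke_expand[of h] by (simp add: Hecke_def)
qed

abbreviation q :: laurent where "q \<equiv> vpow 2"

context affine
begin

text \<open>Right and left multiplication by \<open>T s\<close>, written on coefficients, and multiplication by
  the length-zero element \<open>T \<rho>\<close>.\<close>

definition Rop :: "int \<Rightarrow> hecke \<Rightarrow> hecke" where
  "Rop i h = Abs_poly_mapping (\<lambda>w. if w \<in> G then
     if w i < w (i + 1) then q * lk h (w \<circ> s i) else lk h (w \<circ> s i) + (q - 1) * lk h w else 0)"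

definition Lop :: "int \<Rightarrow> hecke \<Rightarrow> hecke" where
  "Lop i h = Abs_poly_mapping (\<lambda>w. if w \<in> G then
     if ipm w i < ipm w (i + 1) then q * lk h (s i \<circ> w) else lk h (s i \<circ> w) + (q - 1) * lk h w else 0)"

definition Sop :: "int \<Rightarrow> hecke \<Rightarrow> hecke" where
  "Sop m h = Abs_poly_mapping (\<lambda>w. lk h (w \<circ> rho (- m)))"

definition SL :: "int \<Rightarrow> hecke \<Rightarrow> hecke" where
  "SL m h = Abs_poly_mapping (\<lambda>w. lk h (rho (- m) \<circ> w))"

lemma comp_s_s: "(w \<circ> s i) \<circ> s i = w" by (simp only: comp_assoc s_comp_s comp_id)
lemma s_comp_s_comp: "s i \<circ> (s i \<circ> w) = w" by (simp only: comp_assoc[symmetric] s_comp_s id_comp)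

lemma lookup_Rop: "lk (Rop i h) w = (if w \<in> G then
     if w i < w (i + 1) then q * lk h (w \<circ> s i) else lk h (w \<circ> s i) + (q - 1) * lk h w else 0)"
proof -
  have "{w. (if w \<in> G then if w i < w (i + 1) then q * lk h (w \<circ> s i)
      else lk h (w \<circ> s i) + (q - 1) * lk h w else 0) \<noteq> 0}
      \<subseteq> Poly_Mapping.keys h \<union> (\<lambda>w. w \<circ> s i) ` Poly_Mapping.keys h" (is "{w. ?f w \<noteq> 0} \<subseteq> _")
  proof
    fix w assume "w \<in> {w. ?f w \<noteq> 0}"
    then have "lk h w \<noteq> 0 \<or> lk h (w \<circ> s i) \<noteq> 0" by (auto split: if_splits)
    then show "w \<in> Poly_Mapping.keys h \<union> (\<lambda>w. w \<circ> s i) ` Poly_Mapping.keys h"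
      using comp_s_s[of w i, symmetric] by (auto simp only: in_keys_iff Un_iff image_iff)
  qed
  then have "finite {w. ?f w \<noteq> 0}" by (rule finite_subset) simp
  then show ?thesis unfolding Rop_def by (rule lookup_Abs_poly_mapping[THEN fun_cong])
qed

lemma lookup_Lop: "lk (Lop i h) w = (if w \<in> G then
     if ipm w i < ipm w (i + 1) then q * lk h (s i \<circ> w) else lk h (s i \<circ> w) + (q - 1) * lk h w else 0)"
proof -
  have "{w. (if w \<in> G then if ipm w i < ipm w (i + 1) then q * lk h (s i \<circ> w)
      else lk h (s i \<circ> w) + (q - 1) * lk h w else 0) \<noteq> 0}
      \<subseteq> Poly_Mapping.keys h \<union> (\<lambda>w. s i \<circ> w) ` Poly_Mapping.keys h" (is "{w. ?f w \<noteq> 0} \<subseteq> _")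
  proof
    fix w assume "w \<in> {w. ?f w \<noteq> 0}"
    then have "lk h w \<noteq> 0 \<or> lk h (s i \<circ> w) \<noteq> 0" by (auto split: if_splits)
    then show "w \<in> Poly_Mapping.keys h \<union> (\<lambda>w. s i \<circ> w) ` Poly_Mapping.keys h"
      using s_comp_s_comp[of i w, symmetric] by (auto simp only: in_keys_iff Un_iff image_iff)
  qed
  then have "finite {w. ?f w \<noteq> 0}" by (rule finite_subset) simp
  then show ?thesis unfolding Lop_def by (rule lookup_Abs_poly_mapping[THEN fun_cong])
qed

lemma rho_cancel: "(w \<circ> rho (- m)) \<circ> rho m = w" "rho m \<circ> (rho (- m) \<circ> w) = w"
  "(w \<circ> rho m) \<circ> rho (- m) = w" "rho (-m) \<circ> (rho m \<circ> w) = w"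
  by (auto simp: fun_eq_iff)

lemma lookup_Sop: "lk (Sop m h) w = lk h (w \<circ> rho (- m))"
proof -
  have "{w. lk h (w \<circ> rho (- m)) \<noteq> 0} \<subseteq> (\<lambda>w. w \<circ> rho m) ` Poly_Mapping.keys h"
  proof
    fix w assume "w \<in> {w. lk h (w \<circ> rho (- m)) \<noteq> 0}"
    then have "w \<circ> rho (- m) \<in> Poly_Mapping.keys h" by (simp only: in_keys_iff mem_Collect_eq not_False_eq_True)
    then show "w \<in> (\<lambda>w. w \<circ> rho m) ` Poly_Mapping.keys h"
      by (rule rev_image_eqI) (simp only: rho_cancel)
  qed
  then have "finite {w. lk h (w \<circ> rho (- m)) \<noteq> 0}" by (rule finite_subset) simp
  then show ?thesis unfolding Sop_def by (rule lookup_Abs_poly_mapping[THEN fun_cong])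
qed

lemma lookup_SL: "lk (SL m h) w = lk h (rho (- m) \<circ> w)"
proof -
  have "{w. lk h (rho (- m) \<circ> w) \<noteq> 0} \<subseteq> (\<lambda>w. rho m \<circ> w) ` Poly_Mapping.keys h"
  proof
    fix w assume "w \<in> {w. lk h (rho (- m) \<circ> w) \<noteq> 0}"
    then have "rho (- m) \<circ> w \<in> Poly_Mapping.keys h" by (simp only: in_keys_iff mem_Collect_eq not_False_eq_True)
    then show "w \<in> (\<lambda>w. rho m \<circ> w) ` Poly_Mapping.keys h"
      by (rule rev_image_eqI) (simp only: rho_cancel)
  qed
  then have "finite {w. lk h (rho (- m) \<circ> w) \<noteq> 0}" by (rule finite_subset) simp
  then show ?thesis unfolding SL_def by (rule lookup_Abs_poly_mapping[THEN fun_cong])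
qed

lemma G_comp_s_iff: "w \<circ> s i \<in> G \<longleftrightarrow> w \<in> G"
  using G_comp[OF _ G_s, of "w \<circ> s i" i] G_comp[OF _ G_s, of w i] by (auto simp only: comp_s_s)

lemma G_s_comp_iff: "s i \<circ> w \<in> G \<longleftrightarrow> w \<in> G"
  using G_comp[OF G_s, of "s i \<circ> w" i] G_comp[OF G_s, of w i] by (auto simp only: s_comp_s_comp)

lemma G_comp_rho_iff: "w \<circ> rho m \<in> G \<longleftrightarrow> w \<in> G"
  using G_comp[OF _ G_rho, of "w \<circ> rho m" "- m"] G_comp[OF _ G_rho, of w m] by (auto simp only: rho_cancel)

lemma G_rho_comp_iff: "rho m \<circ> w \<in> G \<longleftrightarrow> w \<in> G"
  using G_comp[OF G_rho, of "rho m \<circ> w" "- m"] G_comp[OF G_rho, of w m] by (auto simp only: rho_cancel)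

lemma comp_s_neq: "w \<in> G \<Longrightarrow> w \<circ> s i \<noteq> w"
proof
  assume w: "w \<in> G" and e: "w \<circ> s i = w"
  have "w (s i i) = w i" using fun_cong[OF e, of i] by simp
  then show False using G_inj[OF w] s_at by simp
qed

lemma s_comp_neq: "w \<in> G \<Longrightarrow> s i \<circ> w \<noteq> w"
proof
  assume w: "w \<in> G" and e: "s i \<circ> w = w"
  have "s i (w (ipm w i)) = w (ipm w i)" using fun_cong[OF e, of "ipm w i"] by simp
  then show False using G_ipm_right[OF w] s_at by simp
qed

lemma comp_s_eq_iff: "x \<circ> s i = w \<longleftrightarrow> x = w \<circ> s i"
  by (metis comp_s_s)

lemma s_comp_eq_iff: "s i \<circ> x = w \<longleftrightarrow> x = s i \<circ> w"
  by (metis s_comp_s_comp)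

lemma G_neq_Suc: "w \<in> G \<Longrightarrow> w (i + 1) \<noteq> w i" using G_inj[of w "i+1" i] by simp

lemma Rop_T_up:
  assumes w: "w \<in> G" and up: "w i < w (i + 1)" shows "Rop i (T w) = T (w \<circ> s i)"
proof (rule poly_mapping_eqI)
  fix x
  consider "x = w" | "x = w \<circ> s i" | "x \<noteq> w" "x \<noteq> w \<circ> s i" by blast
  then show "lk (Rop i (T w)) x = lk (T (w \<circ> s i)) x"
  proof cases
    case 1 then show ?thesis using w up comp_s_neq[OF w, of i] by (simp add: lookup_Rop lookup_T)
  next
    case 2
    have "\<not> x i < x (i + 1)" using up unfolding 2 by (simp add: s_at s_at_Suc)
    moreover have "x \<in> G" using w unfolding 2 by (simp only: G_comp_s_iff)
    ultimately show ?thesis using comp_s_neq[OF w, of i] unfolding 2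
      by (simp only: lookup_Rop lookup_T if_True if_False comp_s_s) simp
  next
    case 3
    then have "x \<circ> s i \<noteq> w" by (simp only: comp_s_eq_iff not_False_eq_True)
    with 3 show ?thesis by (simp add: lookup_Rop lookup_T)
  qed
qed

lemma Rop_T_down:
  assumes w: "w \<in> G" and dn: "\<not> w i < w (i + 1)"
  shows "Rop i (T w) = hscale (q - 1) (T w) + hscale q (T (w \<circ> s i))"
proof (rule poly_mapping_eqI)
  fix x
  consider "x = w" | "x = w \<circ> s i" | "x \<noteq> w" "x \<noteq> w \<circ> s i" by blast
  then show "lk (Rop i (T w)) x = lk (hscale (q - 1) (T w) + hscale q (T (w \<circ> s i))) x"
  proof cases
    case 1 then show ?thesis using w dn comp_s_neq[OF w, of i] comp_s_neq[OF w, of i, symmetric]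
      by (simp add: lookup_Rop lookup_T lookup_add)
  next
    case 2
    have "x i < x (i + 1)" using dn G_neq_Suc[OF w, of i] unfolding 2 by (simp add: s_at s_at_Suc)
    moreover have "x \<in> G" using w unfolding 2 by (simp only: G_comp_s_iff)
    ultimately show ?thesis using comp_s_neq[OF w, of i] unfolding 2
      by (simp only: lookup_Rop lookup_T if_True if_False comp_s_s lookup_add lookup_hscale) simp
  next
    case 3
    then have "x \<circ> s i \<noteq> w" by (simp only: comp_s_eq_iff not_False_eq_True)
    with 3 show ?thesis by (simp add: lookup_Rop lookup_T lookup_add)
  qed
qed

lemma Lop_T_up:
  assumes w: "w \<in> G" and up: "ipm w i < ipm w (i + 1)" shows "Lop i (T w) = T (s i \<circ> w)"
proof (rule poly_mapping_eqI)
  fix x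
  consider "x = w" | "x = s i \<circ> w" | "x \<noteq> w" "x \<noteq> s i \<circ> w" by blast
  then show "lk (Lop i (T w)) x = lk (T (s i \<circ> w)) x"
  proof cases
    case 1 then show ?thesis using w up s_comp_neq[OF w, of i] by (simp add: lookup_Lop lookup_T)
  next
    case 2
    have "\<not> ipm x i < ipm x (i + 1)" using up unfolding 2 ipm_comp_s[OF w] by (simp add: s_at s_at_Suc)
    moreover have "x \<in> G" using w unfolding 2 by (simp only: G_s_comp_iff)
    ultimately show ?thesis using s_comp_neq[OF w, of i] unfolding 2
      by (simp only: lookup_Lop lookup_T if_True if_False s_comp_s_comp) simp
  next
    case 3
    then have "s i \<circ> x \<noteq> w" by (simp only: s_comp_eq_iff not_False_eq_True)
    with 3 show ?thesis by (simp add: lookup_Lop lookup_T)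
  qed
qed

lemma Lop_T_down:
  assumes w: "w \<in> G" and dn: "\<not> ipm w i < ipm w (i + 1)"
  shows "Lop i (T w) = hscale (q - 1) (T w) + hscale q (T (s i \<circ> w))"
proof (rule poly_mapping_eqI)
  fix x
  consider "x = w" | "x = s i \<circ> w" | "x \<noteq> w" "x \<noteq> s i \<circ> w" by blast
  then show "lk (Lop i (T w)) x = lk (hscale (q - 1) (T w) + hscale q (T (s i \<circ> w))) x"
  proof cases
    case 1 then show ?thesis using w dn s_comp_neq[OF w, of i] s_comp_neq[OF w, of i, symmetric]
      by (simp add: lookup_Lop lookup_T lookup_add)
  next
    case 2
    have "ipm x i < ipm x (i + 1)" using dn G_neq_Suc[OF G_ipm[OF w], of i] unfolding 2 ipm_comp_s[OF w]
      by (simp add: s_at s_at_Suc)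
    moreover have "x \<in> G" using w unfolding 2 by (simp only: G_s_comp_iff)
    ultimately show ?thesis using s_comp_neq[OF w, of i] unfolding 2
      by (simp only: lookup_Lop lookup_T if_True if_False s_comp_s_comp lookup_add lookup_hscale) simp
  next
    case 3
    then have "s i \<circ> x \<noteq> w" by (simp only: s_comp_eq_iff not_False_eq_True)
    with 3 show ?thesis by (simp add: lookup_Lop lookup_T lookup_add)
  qed
qed

lemma Sop_T: "Sop m (T w) = T (w \<circ> rho m)"
proof (rule poly_mapping_eqI)
  fix x
  have "x \<circ> rho (- m) = w \<longleftrightarrow> x = w \<circ> rho m" by (metis rho_cancel)
  then show "lk (Sop m (T w)) x = lk (T (w \<circ> rho m)) x"
    by (simp only: lookup_Sop lookup_T)
qed

lemma SL_T: "SL m (T w) = T (rho m \<circ> w)"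
proof (rule poly_mapping_eqI)
  fix x
  have "rho (- m) \<circ> x = w \<longleftrightarrow> x = rho m \<circ> w" by (metis rho_cancel)
  then show "lk (SL m (T w)) x = lk (T (rho m \<circ> w)) x"
    by (simp only: lookup_SL lookup_T)
qed

text \<open>The left and the right order condition are independent unless \<open>s w = w t\<close>; this
  is the one case in which left and right multiplication meet.\<close>

lemma order_change:
  assumes w: "w \<in> G" and c: "((s i \<circ> w) j < (s i \<circ> w) (j + 1)) \<noteq> (w j < w (j + 1))"
  shows "s i \<circ> w = w \<circ> s j"
proof (cases "w j < w (j + 1)")
  case True
  then have "s i (w (j + 1)) < s i (w j)"
    using c G_neq_Suc[OF G_comp[OF G_s w], of i j] by simp
  from s_flip[OF True this] show ?thesis by (intro s_conj[OF w]) auto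
next
  case False
  then have lt: "w (j + 1) < w j" using G_neq_Suc[OF w, of j] by linarith
  have "s i (w j) < s i (w (j + 1))" using c False by simp
  from s_flip[OF lt this] have a: "w (j + 1) mod int r = i mod int r" "w j = w (j + 1) + 1" by auto
  let ?u = "w \<circ> s j"
  have u: "?u j = w (j + 1)" "?u (j + 1) = w j" by (simp_all add: s_at s_at_Suc)
  have "s i \<circ> ?u = ?u \<circ> s j"
    by (rule s_conj[OF G_comp[OF w G_s]]) (simp_all only: u a)
  then have "s i \<circ> w \<circ> s j \<circ> s j = w \<circ> s j \<circ> s j \<circ> s j" by (simp only: comp_assoc)
  then show ?thesis by (simp only: comp_s_s)
qed

lemma order_change_left:
  assumes w: "w \<in> G" and c: "(ipm (w \<circ> s j) i < ipm (w \<circ> s j) (i + 1)) \<noteq> (ipm w i < ipm w (i + 1))"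
  shows "s i \<circ> w = w \<circ> s j"
proof -
  have e: "ipm (w \<circ> s j) = s j \<circ> ipm w" by (simp only: ipm_comp[OF w G_s] ipm_s)
  have "s j \<circ> ipm w = ipm w \<circ> s i" by (rule order_change[OF G_ipm[OF w]]) (use c e in simp)
  then have "w \<circ> (s j \<circ> ipm w) \<circ> w = w \<circ> (ipm w \<circ> s i) \<circ> w" by simp
  then have "w \<circ> s j \<circ> (ipm w \<circ> w) = (w \<circ> ipm w) \<circ> s i \<circ> w" by (simp only: comp_assoc)
  then show ?thesis by (simp only: comp_ipm[OF w] comp_id id_comp)
qed

text \<open>Away from the case \<open>s w = w t\<close> the two order conditions are independent and the coefficients agree
  term by term; in that case both sides involve only two coefficients. This commutation is what makes
  the product associative.\<close>

lemma Lop_Rop: "Lop i (Rop j h) = Rop j (Lop i h)"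
proof (rule poly_mapping_eqI)
  fix w
  show "lk (Lop i (Rop j h)) w = lk (Rop j (Lop i h)) w"
  proof (cases "w \<in> G")
    case False then show ?thesis by (simp add: lookup_Lop lookup_Rop)
  next
    case w: True
    have sw: "s i \<circ> w \<in> G" and wt: "w \<circ> s j \<in> G" using w by (simp_all only: G_s_comp_iff G_comp_s_iff)
    let ?c = "\<lambda>w. ipm w i < ipm w (i + 1)" and ?d = "\<lambda>w. w j < w (j + 1)"
    have L: "lk (Lop i (Rop j h)) w = (if ?c w then q * lk (Rop j h) (s i \<circ> w)
         else lk (Rop j h) (s i \<circ> w) + (q - 1) * lk (Rop j h) w)"
      using w by (simp only: lookup_Lop if_True)
    have R: "lk (Rop j (Lop i h)) w = (if ?d w then q * lk (Lop i h) (w \<circ> s j)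
         else lk (Lop i h) (w \<circ> s j) + (q - 1) * lk (Lop i h) w)"
      using w by (simp only: lookup_Rop[of j "Lop i h"] if_True)
    have l1: "lk (Rop j h) (s i \<circ> w) = (if ?d (s i \<circ> w) then q * lk h (s i \<circ> w \<circ> s j)
         else lk h (s i \<circ> w \<circ> s j) + (q - 1) * lk h (s i \<circ> w))"
      using sw by (simp only: lookup_Rop if_True)
    have l2: "lk (Rop j h) w = (if ?d w then q * lk h (w \<circ> s j)
         else lk h (w \<circ> s j) + (q - 1) * lk h w)"
      using w by (simp only: lookup_Rop if_True)
    have r1: "lk (Lop i h) (w \<circ> s j) = (if ?c (w \<circ> s j) then q * lk h (s i \<circ> w \<circ> s j)
         else lk h (s i \<circ> w \<circ> s j) + (q - 1) * lk h (w \<circ> s j))"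
      using wt by (simp only: lookup_Lop if_True comp_assoc)
    have r2': "lk (Lop i h) w = (if ?c w then q * lk h (s i \<circ> w)
         else lk h (s i \<circ> w) + (q - 1) * lk h w)"
      using w by (simp only: lookup_Lop if_True)
    show ?thesis
    proof (cases "s i \<circ> w = w \<circ> s j")
      case False
      have d: "?d (s i \<circ> w) = ?d w" using order_change[OF w, of i j] False by blast
      have c: "?c (w \<circ> s j) = ?c w" using order_change_left[OF w, of j i] False by blast
      show ?thesis unfolding L R l1 l2 r1 r2' d c by (simp add: algebra_simps)
    next
      case True
      have d: "?d (s i \<circ> w) = (\<not> ?d w)" unfolding True using G_neq_Suc[OF w, of j]
        by (auto simp: s_at s_at_Suc)
      have c: "?c (w \<circ> s j) = (\<not> ?c w)" unfolding True[symmetric] ipm_comp_s[OF w]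
        using G_neq_Suc[OF G_ipm[OF w], of i] by (auto simp: s_at s_at_Suc)
      have w': "w = s i \<circ> w \<circ> s j" using True by (metis comp_s_s)
      have "?c w = ?d w"
      proof -
        let ?p = "w j" and ?p' = "w (j + 1)"
        have 1: "s i ?p = ?p'" using fun_cong[OF True, of j] by (simp add: s_at)
        have ne: "?p \<noteq> ?p'" using G_neq_Suc[OF w, of j] by simp
        have ij: "ipm w ?p = j" "ipm w ?p' = j + 1" using G_ipm_left[OF w] by auto
        have "?p mod int r = i mod int r \<and> ?p' = ?p + 1 \<or> ?p mod int r = (i + 1) mod int r \<and> ?p' = ?p - 1"
          using 1 ne by (auto simp: simple_refl_def split: if_splits)
        then show ?thesis
        proof
          assume a: "?p mod int r = i mod int r \<and> ?p' = ?p + 1"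
          then have "i mod int r = ?p mod int r" by simp
          then obtain k where k: "i = ?p + k * int r" by (rule mod_eqE)
          have "ipm w i = j + k * int r" unfolding k using G_shift[OF G_ipm[OF w]] ij by simp
          moreover have "ipm w (i + 1) = j + 1 + k * int r"
          proof -
            have "i + 1 = ?p' + k * int r" using k a by simp
            then show ?thesis using G_shift[OF G_ipm[OF w]] ij by simp
          qed
          ultimately show ?thesis using a by simp
        next
          assume a: "?p mod int r = (i + 1) mod int r \<and> ?p' = ?p - 1"
          then have "(i + 1) mod int r = ?p mod int r" by simp
          then obtain k where k: "i + 1 = ?p + k * int r" by (rule mod_eqE)
          have "ipm w (i + 1) = j + k * int r" unfolding k using G_shift[OF G_ipm[OF w]] ij by simp
          moreover have "ipm w i = j + 1 + k * int r"
          proof -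
            have "i = ?p' + k * int r" using k a by simp
            then show ?thesis using G_shift[OF G_ipm[OF w]] ij by simp
          qed
          ultimately show ?thesis using a by simp
        qed
      qed
      then show ?thesis unfolding L R l1 l2 r1 r2' d c w'[symmetric] unfolding True
        by (cases "?d w") (simp_all add: algebra_simps)
    qed
  qed
qed

lemma Lop_Sop: "Lop i (Sop m h) = Sop m (Lop i h)"
proof (rule poly_mapping_eqI)
  fix w
  show "lk (Lop i (Sop m h)) w = lk (Sop m (Lop i h)) w"
  proof (cases "w \<in> G")
    case True
    have "ipm (w \<circ> rho (- m)) = rho m \<circ> ipm w" by (simp only: ipm_comp[OF True G_rho] ipm_rho minus_minus)
    then have c: "ipm (w \<circ> rho (- m)) i < ipm (w \<circ> rho (- m)) (i + 1) \<longleftrightarrow> ipm w i < ipm w (i + 1)" by simp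
    show ?thesis using True by (simp only: lookup_Lop lookup_Sop G_comp_rho_iff c comp_assoc)
  next
    case False then show ?thesis by (simp only: lookup_Lop lookup_Sop G_comp_rho_iff if_False)
  qed
qed

lemma SL_Rop: "SL m (Rop j h) = Rop j (SL m h)"
proof (rule poly_mapping_eqI)
  fix w
  show "lk (SL m (Rop j h)) w = lk (Rop j (SL m h)) w"
  proof (cases "w \<in> G")
    case True
    have c: "(rho (-m) \<circ> w) j < (rho (-m) \<circ> w) (j + 1) \<longleftrightarrow> w j < w (j + 1)" by simp
    show ?thesis using True
      by (simp only: lookup_Rop lookup_SL G_rho_comp_iff c comp_assoc)
  next
    case False then show ?thesis by (simp only: lookup_Rop lookup_SL G_rho_comp_iff if_False)
  qed
qed

lemma SL_Sop: "SL m (Sop k h) = Sop k (SL m h)"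
  by (rule poly_mapping_eqI) (simp only: lookup_SL lookup_Sop comp_assoc)

text \<open>Endomorphisms that commute with right multiplication by generators. Since \<open>T id\<close> generates the
  regular module from the right, such a map is determined by its value there, and left multiplications
  realize every value; composition of these maps is then an associative product.\<close>

definition hop :: "(hecke \<Rightarrow> hecke) \<Rightarrow> bool" where
  "hop F \<longleftrightarrow> (\<forall>x\<in>Hecke r. F x \<in> Hecke r) \<and> (\<forall>x\<in>Hecke r. \<forall>y\<in>Hecke r. F (x + y) = F x + F y) \<and>
    (\<forall>c. \<forall>x\<in>Hecke r. F (hscale c x) = hscale c (F x)) \<and>
    (\<forall>i. \<forall>x\<in>Hecke r. F (Rop i x) = Rop i (F x)) \<and> (\<forall>m. \<forall>x\<in>Hecke r. F (Sop m x) = Sop m (F x))"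

lemma Rop_linear: "Rop i (x + y) = Rop i x + Rop i y" "Rop i (hscale c x) = hscale c (Rop i x)"
  by (rule poly_mapping_eqI, simp add: lookup_Rop lookup_add algebra_simps)+

lemma Lop_linear: "Lop i (x + y) = Lop i x + Lop i y" "Lop i (hscale c x) = hscale c (Lop i x)"
  by (rule poly_mapping_eqI, simp add: lookup_Lop lookup_add algebra_simps)+

lemma Sop_linear: "Sop i (x + y) = Sop i x + Sop i y" "Sop i (hscale c x) = hscale c (Sop i x)"
  by (rule poly_mapping_eqI, simp add: lookup_Sop lookup_add algebra_simps)+

lemma SL_linear: "SL i (x + y) = SL i x + SL i y" "SL i (hscale c x) = hscale c (SL i x)"
  by (rule poly_mapping_eqI, simp add: lookup_SL lookup_add algebra_simps)+

lemma Hecke_Lop: "Lop i x \<in> Hecke r" by (simp add: Hecke_iff lookup_Lop)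
lemma Hecke_SL: "x \<in> Hecke r \<Longrightarrow> SL m x \<in> Hecke r"
  unfolding Hecke_iff lookup_SL using G_rho_comp_iff[of "- m"] by blast

lemma hop_Lop: "hop (Lop i)"
  by (simp add: hop_def Hecke_Lop Lop_linear Lop_Rop Lop_Sop)

lemma hop_SL: "hop (SL m)"
  by (simp add: hop_def Hecke_SL SL_linear SL_Rop SL_Sop)

lemma hop_comp: "hop F \<Longrightarrow> hop F' \<Longrightarrow> hop (F \<circ> F')"
  by (simp add: hop_def)

lemma hop_add: "hop F \<Longrightarrow> hop F' \<Longrightarrow> hop (\<lambda>x. F x + F' x)"
  by (simp add: hop_def Hecke_add Rop_linear Sop_linear hscale_add)

lemma hop_scale: "hop F \<Longrightarrow> hop (\<lambda>x. hscale c (F x))"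
  by (simp add: hop_def Hecke_scale Rop_linear Sop_linear hscale_add hscale_hscale mult.commute)

lemma Rop_zero: "Rop i 0 = 0" "Sop i 0 = 0"
  by (rule poly_mapping_eqI, simp add: lookup_Rop lookup_Sop)+

lemma hop_zero: "hop (\<lambda>x. 0)"
  by (simp add: hop_def Rop_zero)

lemma hop_of_zero: "hop F \<Longrightarrow> F 0 = 0"
proof -
  assume F: "hop F"
  have "F (hscale 0 0) = hscale 0 (F 0)" using F Hecke_zero unfolding hop_def by blast
  then show ?thesis by simp
qed

lemma hop_unique:
  assumes F: "hop F" and F': "hop F'" and e: "F (T id) = F' (T id)" and h: "h \<in> Hecke r"
  shows "F h = F' h"
  using h
proof (induction rule: hecke_induct)
  case zero then show ?case using hop_of_zero[OF F] hop_of_zero[OF F'] by simp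
next
  case (add x y) then show ?case using F F' by (simp add: hop_def)
next
  case (T c w)
  have Tid: "T id \<in> Hecke r" by (rule Hecke_T[OF G_id])
  have "F (T w) = F' (T w)"
    using T
  proof (induction rule: G_induct_right)
    case (rho m)
    have "T (rho m) = Sop m (T id)" by (simp add: Sop_T)
    then show ?case using F F' e Tid by (simp add: hop_def)
  next
    case (step x i)
    have e: "T (x \<circ> s i) = Rop i (T x)" using Rop_T_up[OF step(1,2)] by (rule sym)
    have "F (Rop i (T x)) = Rop i (F (T x))" "F' (Rop i (T x)) = Rop i (F' (T x))"
      using F F' Hecke_T[OF step(1)] unfolding hop_def by blast+
    then show ?case unfolding e step(4) by (simp only:)
  qed
  then show ?case using F F' Hecke_T[OF T] by (simp add: hop_def)
qed

lemma hop_exists: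
  assumes "h \<in> Hecke r" shows "\<exists>F. hop F \<and> F (T id) = h"
  using assms
proof (induction rule: hecke_induct)
  case zero then show ?case using hop_zero by (intro exI[of _ "\<lambda>x. 0"]) simp
next
  case (add x y)
  obtain F where F: "hop F \<and> F (T id) = x" using add(3) ..
  obtain F' where F': "hop F' \<and> F' (T id) = y" using add(4) ..
  show ?case by (intro exI[of _ "\<lambda>x. F x + F' x"] conjI hop_add) (simp_all only: F F')
next
  case (T c w)
  have "\<exists>F. hop F \<and> F (T id) = T w"
    using T
  proof (induction rule: G_induct_left)
    case (rho m)
    have "SL m (T id) = T (rho m)" by (simp add: SL_T)
    then show "\<exists>F. hop F \<and> F (T id) = T (rho m)" using hop_SL[of m] by (intro exI[of _ "SL m"]) simp
  next
    case (step x i)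
    then obtain F where F: "hop F" "F (T id) = T x" by blast
    have "(Lop i \<circ> F) (T id) = T (s i \<circ> x)" using F Lop_T_up step by simp
    then show "\<exists>F. hop F \<and> F (T id) = T (s i \<circ> x)"
      using hop_comp[OF hop_Lop[of i] F(1)] by (intro exI[of _ "Lop i \<circ> F"] conjI)
  qed
  then obtain F where F: "hop F \<and> F (T id) = T w" ..
  show ?case by (intro exI[of _ "\<lambda>x. hscale c (F x)"] conjI hop_scale) (simp_all only: F)
qed

definition hmul :: "hecke \<Rightarrow> hecke \<Rightarrow> hecke" where
  "hmul x = (SOME F. hop F \<and> F (T id) = x)"

lemma hmul_hop: "x \<in> Hecke r \<Longrightarrow> hop (hmul x) \<and> hmul x (T id) = x"
  unfolding hmul_def by (rule someI_ex[OF hop_exists])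

lemma hmul_unique: "x \<in> Hecke r \<Longrightarrow> hop F \<Longrightarrow> F (T id) = x \<Longrightarrow> y \<in> Hecke r \<Longrightarrow> hmul x y = F y"
  using hop_unique hmul_hop by metis

text \<open>Along a reduced word for \<open>w'\<close> each partial product lengthens \<open>w\<close>, so every step is an application
  of \<open>Rop\<close> in its increasing case.\<close>

lemma hmul_T_T:
  assumes "w' \<in> G"
  shows "w \<in> G \<Longrightarrow> elen (w \<circ> w') = elen w + elen w' \<Longrightarrow> hmul (T w) (T w') = T (w \<circ> w')"
  using assms
proof (induction arbitrary: rule: G_induct_right)
  case (rho m)
  have "T (rho m) = Sop m (T id)" by (simp add: Sop_T)
  then have "hmul (T w) (T (rho m)) = Sop m (hmul (T w) (T id))"
    using hmul_hop[OF Hecke_T[OF rho(1)]] Hecke_T[OF G_id] unfolding hop_def by metis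
  then show ?case using hmul_hop[OF Hecke_T[OF rho(1)]] by (simp only: Sop_T)
next
  case (step x i)
  note w = step(5) and x = step(1)
  have wx: "w \<circ> x \<in> G" using G_comp w x by simp
  have eq: "w \<circ> (x \<circ> s i) = (w \<circ> x) \<circ> s i" by (simp only: comp_assoc)
  have l: "elen ((w \<circ> x) \<circ> s i) = elen w + elen x + 1" using step(6) unfolding eq step(3) by linarith
  have up: "(w \<circ> x) i < (w \<circ> x) (i + 1)"
  proof (rule ccontr)
    assume "\<not> ?thesis"
    then have "(w \<circ> x) (i + 1) < (w \<circ> x) i" using G_neq_Suc[OF wx, of i] by linarith
    from elen_down[OF wx this] have "elen (w \<circ> x) = elen w + elen x + 1 + 1" using l by linarith
    then show False using elen_comp_le[OF w x] by simp
  qed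
  have "elen (w \<circ> x) = elen w + elen x" using elen_up[OF wx up] l by linarith
  then have IH: "hmul (T w) (T x) = T (w \<circ> x)" by (rule step(4)[OF w])
  have "hmul (T w) (T (x \<circ> s i)) = hmul (T w) (Rop i (T x))" using Rop_T_up[OF x step(2)] by simp
  also have "\<dots> = Rop i (hmul (T w) (T x))" using hmul_hop[OF Hecke_T[OF w]] Hecke_T[OF x] by (simp add: hop_def)
  also have "\<dots> = T (w \<circ> (x \<circ> s i))" unfolding IH eq by (rule Rop_T_up[OF wx up])
  finally show ?case .
qed

lemma hmul_is_hecke_mult: "is_hecke_mult r hmul"
  unfolding is_hecke_mult_def
proof (intro conjI ballI allI impI)
  note hh = hmul_hop
  fix x y assume x: "x \<in> Hecke r" and y: "y \<in> Hecke r"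
  show "hmul x y \<in> Hecke r" using hh[OF x] y by (simp add: hop_def)
  fix z assume z: "z \<in> Hecke r"
  show "hmul (x + y) z = hmul x z + hmul y z"
    by (rule hmul_unique[OF Hecke_add[OF x y] hop_add]) (use hh x y z in auto)
  show "hmul z (x + y) = hmul z x + hmul z y" using hh[OF z] x y by (simp add: hop_def)
  have xy: "hmul x y \<in> Hecke r" using hh[OF x] y by (simp add: hop_def)
  show "hmul (hmul x y) z = hmul x (hmul y z)"
    using hmul_unique[OF xy hop_comp[OF conjunct1[OF hh[OF x]] conjunct1[OF hh[OF y]]] _ z] hh[OF y] by simp
next
  fix c x y assume x: "x \<in> Hecke r" and y: "y \<in> Hecke r"
  show "hmul (hscale c x) y = hscale c (hmul x y)"
    by (rule hmul_unique[OF Hecke_scale[OF x] hop_scale]) (use hmul_hop x y in auto)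
  show "hmul x (hscale c y) = hscale c (hmul x y)" using hmul_hop[OF x] y by (simp add: hop_def)
next
  fix t assume "t \<in> simple_refls r"
  then obtain i where t: "t = s i" by (auto simp: simple_refls_eq)
  have idi: "ipm id = id" by (rule ipm_unique[OF G_id]) simp
  have L: "Lop i (T id) = T (s i)" using Lop_T_up[OF G_id, of i] by (simp add: idi)
  have "hmul (T t) (T t) = Lop i (T (s i))" unfolding t
    by (rule hmul_unique[OF Hecke_T[OF G_s] hop_Lop L Hecke_T[OF G_s]])
  also have "\<dots> = hscale (q - 1) (T (s i)) + hscale q (T (s i \<circ> s i))"
    by (rule Lop_T_down[OF G_s]) (simp add: ipm_s s_at s_at_Suc)
  finally show "hmul (T t) (T t) = hscale (q - 1) (T t) + hscale q (T id)"
    by (simp only: s_comp_s t)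
next
  fix w w' assume w: "w \<in> G" "w' \<in> G" "len r (w \<circ> w') = len r w + len r w'"
  then show "hmul (T w) (T w') = T (w \<circ> w')"
    using hmul_T_T[OF w(2) w(1)] len_eq G_comp by simp
qed

abbreviation hm (infixl "\<star>" 70) where "hm \<equiv> hmult r"

text \<open>Some product obeys the presentation, so the chosen one does.\<close>

lemma hm_is: "is_hecke_mult r hm"
  unfolding hmult_def by (rule someI[of "is_hecke_mult r"]) (rule hmul_is_hecke_mult)

lemma hm_closed: "x \<in> Hecke r \<Longrightarrow> y \<in> Hecke r \<Longrightarrow> x \<star> y \<in> Hecke r"
  using hm_is unfolding is_hecke_mult_def by blast

lemma hm_add_left: "x \<in> Hecke r \<Longrightarrow> y \<in> Hecke r \<Longrightarrow> z \<in> Hecke r \<Longrightarrow> (x + y) \<star> z = x \<star> z + y \<star> z"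
  using hm_is unfolding is_hecke_mult_def by blast

lemma hm_add_right: "x \<in> Hecke r \<Longrightarrow> y \<in> Hecke r \<Longrightarrow> z \<in> Hecke r \<Longrightarrow> z \<star> (x + y) = z \<star> x + z \<star> y"
  using hm_is unfolding is_hecke_mult_def by blast

lemma hm_assoc: "x \<in> Hecke r \<Longrightarrow> y \<in> Hecke r \<Longrightarrow> z \<in> Hecke r \<Longrightarrow> x \<star> y \<star> z = x \<star> (y \<star> z)"
  using hm_is unfolding is_hecke_mult_def by blast

lemma hm_scale_left: "x \<in> Hecke r \<Longrightarrow> y \<in> Hecke r \<Longrightarrow> hscale c x \<star> y = hscale c (x \<star> y)"
  using hm_is unfolding is_hecke_mult_def by blast

lemma hm_scale_right: "x \<in> Hecke r \<Longrightarrow> y \<in> Hecke r \<Longrightarrow> x \<star> hscale c y = hscale c (x \<star> y)"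
  using hm_is unfolding is_hecke_mult_def by blast

lemma hm_s_s: "T (s i) \<star> T (s i) = hscale (q - 1) (T (s i)) + hscale q (T id)"
proof -
  have "s i \<in> simple_refls r" by (simp add: simple_refls_eq)
  then show ?thesis using hm_is unfolding is_hecke_mult_def by blast
qed

lemma hm_T_T: "w \<in> G \<Longrightarrow> w' \<in> G \<Longrightarrow> elen (w \<circ> w') = elen w + elen w' \<Longrightarrow> T w \<star> T w' = T (w \<circ> w')"
  using hm_is len_eq[of w] len_eq[of w'] len_eq[OF G_comp, of w w'] unfolding is_hecke_mult_def by simp

lemma hm_zero: "x \<in> Hecke r \<Longrightarrow> x \<star> 0 = 0" "x \<in> Hecke r \<Longrightarrow> 0 \<star> x = 0"
  using hm_scale_right[of x 0 0] hm_scale_left[of 0 x 0] by simp_all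

lemma hm_sum_left: "(\<And>a. a \<in> A \<Longrightarrow> f a \<in> Hecke r) \<Longrightarrow> x \<in> Hecke r \<Longrightarrow> sum f A \<star> x = (\<Sum>a\<in>A. f a \<star> x)"
  by (induction A rule: infinite_finite_induct) (simp_all add: hm_zero hm_add_left Hecke_sum)

lemma hm_sum_right: "(\<And>a. a \<in> A \<Longrightarrow> f a \<in> Hecke r) \<Longrightarrow> x \<in> Hecke r \<Longrightarrow> x \<star> sum f A = (\<Sum>a\<in>A. x \<star> f a)"
  by (induction A rule: infinite_finite_induct) (simp_all add: hm_zero hm_add_right Hecke_sum)

lemma hm_id_left: "h \<in> Hecke r \<Longrightarrow> T id \<star> h = h"
proof (induction rule: hecke_induct)
  case zero show ?case by (rule hm_zero(1)[OF Hecke_T[OF G_id]])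
next
  case (add x y) then show ?case by (simp only: hm_add_right Hecke_T[OF G_id])
next
  case (T c w)
  have "T id \<star> T w = T w" using hm_T_T[OF G_id T] by (simp only: id_comp elen_id add_0)
  then show ?case by (simp only: hm_scale_right[OF Hecke_T[OF G_id] Hecke_T[OF T]])
qed

lemma hm_id_right: "h \<in> Hecke r \<Longrightarrow> h \<star> T id = h"
proof (induction rule: hecke_induct)
  case zero show ?case by (rule hm_zero(2)[OF Hecke_T[OF G_id]])
next
  case (add x y) then show ?case by (simp only: hm_add_left Hecke_T[OF G_id])
next
  case (T c w)
  have "T w \<star> T id = T w" using hm_T_T[OF T G_id] by (simp only: comp_id elen_id add_0_right)
  then show ?case by (simp only: hm_scale_left[OF Hecke_T[OF T] Hecke_T[OF G_id]])
qed

lemma elen_s1: "elen (s i) = 1"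
  using elen_up[OF G_id, of i] by (simp add: elen_id)

lemma hm_right_s: "h \<in> Hecke r \<Longrightarrow> h \<star> T (s i) = Rop i h"
proof (induction rule: hecke_induct)
  case zero then show ?case by (simp add: hm_zero Hecke_T G_s Rop_zero)
next
  case (add x y) then show ?case by (simp add: hm_add_left Hecke_T G_s Rop_linear)
next
  case (T c w)
  have Ts: "T (s i) \<in> Hecke r" by (rule Hecke_T[OF G_s])
  have "T w \<star> T (s i) = Rop i (T w)"
  proof (cases "w i < w (i + 1)")
    case True then show ?thesis
      using hm_T_T[OF T G_s] elen_up[OF T True] by (simp add: elen_s1 Rop_T_up[OF T])
  next
    case False
    then have dn: "w (i + 1) < w i" using G_neq_Suc[OF T, of i] by simp
    let ?u = "w \<circ> s i"
    have u: "?u \<in> G" using T by (simp only: G_comp_s_iff)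
    have 1: "T ?u \<star> T (s i) = T w"
      using hm_T_T[OF u G_s] elen_down[OF T dn] by (simp only: comp_s_s elen_s1)
    have "T w \<star> T (s i) = T ?u \<star> (T (s i) \<star> T (s i))"
      unfolding 1[symmetric] by (rule hm_assoc) (use u Ts in \<open>simp_all only: Hecke_T\<close>)
    also have "\<dots> = hscale (q - 1) (T w) + hscale q (T ?u)"
      unfolding hm_s_s using Hecke_T[OF u] Ts Hecke_T[OF G_id] 1
      by (simp only: hm_add_right Hecke_scale hm_scale_right hm_id_right)
    finally show ?thesis using Rop_T_down[OF T False] by simp
  qed
  then show ?case using Hecke_T[OF T] Ts by (simp add: hm_scale_left Rop_linear)
qed

lemma hm_left_s: "h \<in> Hecke r \<Longrightarrow> T (s i) \<star> h = Lop i h"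
proof (induction rule: hecke_induct)
  case zero then show ?case using Lop_linear(2)[of i 0 0] by (simp add: hm_zero Hecke_T G_s)
next
  case (add x y) then show ?case by (simp add: hm_add_right Hecke_T G_s Lop_linear)
next
  case (T c w)
  have Ts: "T (s i) \<in> Hecke r" by (rule Hecke_T[OF G_s])
  have "T (s i) \<star> T w = Lop i (T w)"
  proof (cases "ipm w i < ipm w (i + 1)")
    case True then show ?thesis
      using hm_T_T[OF G_s T] elen_up_left[OF T True] by (simp add: elen_s1 Lop_T_up[OF T])
  next
    case False
    then have dn: "ipm w (i + 1) < ipm w i" using G_neq_Suc[OF G_ipm[OF T], of i] by simp
    let ?u = "s i \<circ> w"
    have u: "?u \<in> G" using T by (simp only: G_s_comp_iff)
    have 1: "T (s i) \<star> T ?u = T w"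
      using hm_T_T[OF G_s u] elen_down_left[OF T dn] by (simp only: s_comp_s_comp elen_s1)
    have "T (s i) \<star> T w = (T (s i) \<star> T (s i)) \<star> T ?u"
      unfolding 1[symmetric] by (rule hm_assoc[symmetric]) (use u Ts in \<open>simp_all only: Hecke_T\<close>)
    also have "\<dots> = hscale (q - 1) (T w) + hscale q (T ?u)"
      unfolding hm_s_s using Hecke_T[OF u] Ts Hecke_T[OF G_id] 1
      by (simp only: hm_add_left Hecke_scale hm_scale_left hm_id_left)
    finally show ?thesis using Lop_T_down[OF T False] by simp
  qed
  then show ?case using Hecke_T[OF T] Ts by (simp add: hm_scale_right Lop_linear)
qed

lemma hm_left_rho: "h \<in> Hecke r \<Longrightarrow> T (rho m) \<star> h = SL m h"
proof (induction rule: hecke_induct)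
  case zero then show ?case using SL_linear(2)[of m 0 0] by (simp add: hm_zero Hecke_T G_rho)
next
  case (add x y) then show ?case by (simp add: hm_add_right Hecke_T G_rho SL_linear)
next
  case (T c w)
  have "elen (rho m \<circ> w) \<le> elen w" using elen_comp_le[OF G_rho T, of m] by (simp add: elen_rho)
  moreover have "elen w \<le> elen (rho m \<circ> w)"
    using elen_comp_le[OF G_rho G_comp[OF G_rho T], of "- m" m] by (simp only: elen_rho rho_cancel add_0)
  ultimately have "elen (rho m \<circ> w) = elen (rho m) + elen w" by (simp add: elen_rho)
  from hm_T_T[OF G_rho T this] show ?case
    by (simp add: hm_scale_right Hecke_T G_rho T SL_linear SL_T)
qed

end

subsection \<open>Specialization at \<open>v = 1\<close>\<close>

lemma at_one_superset: "finite A \<Longrightarrow> Poly_Mapping.keys p \<subseteq> A \<Longrightarrow> at_one p = (\<Sum>k\<in>A. lk p k)"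
  unfolding at_one_def by (rule sum.mono_neutral_left) (auto simp: in_keys_iff)

lemma at_one_add: "at_one (p + p') = at_one p + at_one p'"
proof -
  let ?A = "Poly_Mapping.keys p \<union> Poly_Mapping.keys p'"
  have "at_one (p + p') = (\<Sum>k\<in>?A. lk (p + p') k)"
    by (rule at_one_superset) (auto dest: keys_add[THEN subsetD])
  moreover have "at_one p = (\<Sum>k\<in>?A. lk p k)" "at_one p' = (\<Sum>k\<in>?A. lk p' k)"
    by (rule at_one_superset; simp)+
  ultimately show ?thesis by (simp add: lookup_add sum.distrib)
qed

lemma at_one_zero [simp]: "at_one 0 = 0" by (simp add: at_one_def)

lemma at_one_sum: "at_one (sum f A) = (\<Sum>a\<in>A. at_one (f a))"
  by (induction A rule: infinite_finite_induct) (simp_all add: at_one_add)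

lemma at_one_single: "at_one (Poly_Mapping.single k c) = c"
  by (cases "c = 0") (simp_all add: at_one_def)

lemma laurent_expand: "(p::laurent) = (\<Sum>k\<in>Poly_Mapping.keys p. Poly_Mapping.single k (lk p k))"
proof (rule poly_mapping_eqI)
  fix x
  have "lk (\<Sum>k\<in>Poly_Mapping.keys p. Poly_Mapping.single k (lk p k)) x
      = (\<Sum>k\<in>Poly_Mapping.keys p. if x = k then lk p k else 0)"
    by (auto simp: lookup_sum lookup_single when_def intro!: sum.cong)
  then show "lk p x = lk (\<Sum>k\<in>Poly_Mapping.keys p. Poly_Mapping.single k (lk p k)) x"
    by (simp add: in_keys_iff)
qed

lemma at_one_mult: "at_one (p * p') = at_one p * at_one p'"
proof -
  have "p * p' = (\<Sum>k\<in>Poly_Mapping.keys p. \<Sum>l\<in>Poly_Mapping.keys p'. Poly_Mapping.single (k + l) (lk p k * lk p' l))"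
    by (subst laurent_expand[of p], subst laurent_expand[of p'])
      (simp add: sum_product mult_single)
  then have "at_one (p * p') = (\<Sum>k\<in>Poly_Mapping.keys p. \<Sum>l\<in>Poly_Mapping.keys p'. lk p k * lk p' l)"
    by (simp add: at_one_sum at_one_single)
  then show ?thesis by (simp add: at_one_def sum_product)
qed

lemma at_one_uminus: "at_one (- p) = - at_one p"
  by (simp add: at_one_def sum_negf)

lemma at_one_diff: "at_one (p - p') = at_one p - at_one p'"
  using at_one_add[of p "- p'"] by (simp add: at_one_uminus)

lemma at_one_vpow: "at_one (vpow k) = 1" by (simp add: vpow_def at_one_single)

lemma at_one_one: "at_one 1 = 1" using at_one_vpow[of 0] by (simp add: vpow_def)

context affine
begin

text \<open>At \<open>q = 1\<close> the deformation term of \<open>Lop\<close> vanishes and left multiplication becomes translation: the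
  specialized algebra is the group ring.\<close>

lemma at_one_T_mult:
  assumes b: "b \<in> G" and y: "y \<in> Hecke r"
  shows "c \<in> G \<Longrightarrow> at_one (lk (T b \<star> y) c) = at_one (lk y (ipm b \<circ> c))"
  using b
proof (induction arbitrary: c rule: G_induct_left)
  case (rho m) then show ?case by (simp only: hm_left_rho[OF y] lookup_SL ipm_rho)
next
  case (step x i)
  have e: "T (s i \<circ> x) = T (s i) \<star> T x"
    using hm_T_T[OF G_s step(1), of i] step(3) by (simp add: elen_s1)
  have Tx: "T x \<in> Hecke r" and xy: "T x \<star> y \<in> Hecke r" using step(1) y by (simp_all add: Hecke_T hm_closed)
  have "T (s i \<circ> x) \<star> y = Lop i (T x \<star> y)"
    unfolding e hm_assoc[OF Hecke_T[OF G_s] Tx y] by (rule hm_left_s[OF xy])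
  then have "at_one (lk (T (s i \<circ> x) \<star> y) c) = at_one (lk (T x \<star> y) (s i \<circ> c))"
    using step(5) by (simp add: lookup_Lop at_one_add at_one_mult at_one_diff at_one_vpow at_one_one)
  also have "\<dots> = at_one (lk y (ipm x \<circ> (s i \<circ> c)))"
    by (rule step(4)) (use step(5) in \<open>simp only: G_s_comp_iff\<close>)
  finally show ?case by (simp only: ipm_comp_s[OF step(1)] comp_assoc)
qed

lemma at_one_mult_hm:
  assumes x: "x \<in> Hecke r" and y: "y \<in> Hecke r" and c: "c \<in> G"
  shows "at_one (lk (x \<star> y) c) = (\<Sum>b\<in>Poly_Mapping.keys x. at_one (lk x b) * at_one (lk y (ipm b \<circ> c)))"
proof -
  have k: "b \<in> G" if "b \<in> Poly_Mapping.keys x" for b using x that by (auto simp: Hecke_def)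
  have "x \<star> y = (\<Sum>b\<in>Poly_Mapping.keys x. hscale (lk x b) (T b)) \<star> y" using hecke_expand[of x] by simp
  also have "\<dots> = (\<Sum>b\<in>Poly_Mapping.keys x. hscale (lk x b) (T b \<star> y))"
    by (subst hm_sum_left) (auto simp: y k Hecke_scale Hecke_T hm_scale_left)
  finally show ?thesis
    by (auto simp: lookup_sum at_one_sum at_one_mult at_one_T_mult k y c simp del: comp_apply intro!: sum.cong)
qed

end

section \<open>Block maps, cells and double cosets\<close>

lemma Sum_any_eq: "finite S \<Longrightarrow> (\<And>x. x \<notin> S \<Longrightarrow> f x = 0) \<Longrightarrow> Sum_any f = sum f S"
  by (rule Sum_any.expand_superset) auto

lemma ro_eq: "ro A i = Sum_any (\<lambda>j. A i j)" by (simp add: ro_def Sum_any.expand_set)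
lemma co_eq: "co A j = Sum_any (\<lambda>i. A i j)" by (simp add: co_def Sum_any.expand_set)

lemma sigma_mat_eq: "sigma_mat n A = sigma_seq n (ro A)"
  by (simp add: sigma_mat_def sigma_seq_def ro_def)

lemma card_fibre_sum:
  assumes "finite S"
  shows "Sum_any (\<lambda>j. int (card {y \<in> S. g y = j})) = int (card S)"
proof -
  have "Sum_any (\<lambda>j. int (card {y \<in> S. g y = j})) = (\<Sum>j\<in>g ` S. int (card {y \<in> S. g y = j}))"
    by (rule Sum_any_eq) (use assms in auto)
  also have "\<dots> = (\<Sum>y\<in>S. 1)"
    using sum.image_gen[OF assms, of "\<lambda>_. 1::int" g] by simp
  finally show ?thesis by simp
qed

lemma window_div_shift:
  assumes "1 \<le> n" shows "(x - k * int n - 1) div int n = (x - 1) div int n - k"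
proof -
  have e: "x - k * int n - 1 = (x - 1) + (- k) * int n" by simp
  have "((x - 1) + (- k) * int n) div int n = - k + (x - 1) div int n"
    by (rule div_mult_self1) (use assms in simp)
  then show ?thesis unfolding e by simp
qed

lemma window_div_range:
  assumes "1 \<le> n" shows "x - ((x - 1) div int n) * int n \<in> {1..int n}"
proof -
  have "x - ((x - 1) div int n) * int n = (x - 1) mod int n + 1"
    by (simp add: algebra_simps minus_div_mult_eq_mod[symmetric])
  then show ?thesis using assms by (simp add: add1_zle_eq)
qed

text \<open>Both totals count the entries modulo the diagonal shift.\<close>

lemma sigma_ro_co:
  assumes n: "1 \<le> n" and A: "A \<in> per_mats n"
  shows "sigma_seq n (ro A) = sigma_seq n (co A)"
proof -
  have per: "A (i + k * int n) (j + k * int n) = A i j" for i j k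
  proof -
    have "(\<lambda>x. A (i + x) (j + x)) (0 + k * int n) = (\<lambda>x. A (i + x) (j + x)) 0"
      by (rule periodic_shift) (use A in \<open>simp add: per_mats_def add.assoc[symmetric]\<close>)
    then show ?thesis by simp
  qed
  have fr: "finite {j. A i j \<noteq> 0}" and fc: "finite {i. A i j \<noteq> 0}" for i j
    using A by (auto simp: per_mats_def)
  note sh = window_div_shift[OF n] and rg = window_div_range[OF n]
  have z: "1 \<le> x \<and> x \<le> int n \<Longrightarrow> (x - 1) div int n = 0" for x
    by (rule div_pos_pos_trivial) auto
  have per': "A (i - k * int n) (j - k * int n) = A i j" for i j k using per[of i "- k" j] by simp
  have "sigma_seq n (ro A) = (\<Sum>(i,j)\<in>Sigma {1..int n} (\<lambda>i. {j. A i j \<noteq> 0}). A i j)"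
    unfolding sigma_seq_def ro_def by (rule sum.Sigma) (use fr in auto)
  also have "\<dots> = (\<Sum>(j,i)\<in>Sigma {1..int n} (\<lambda>j. {i. A i j \<noteq> 0}). A i j)"
  proof (rule sum.reindex_bij_witness[of _
        "\<lambda>(j,i). (i - ((i - 1) div int n) * int n, j - ((i - 1) div int n) * int n)"
        "\<lambda>(i,j). (j - ((j - 1) div int n) * int n, i - ((j - 1) div int n) * int n)"])
    fix a assume a: "a \<in> Sigma {1..int n} (\<lambda>i. {j. A i j \<noteq> 0})"
    obtain i j where ij: "a = (i, j)" by (cases a)
    let ?m = "(j - 1) div int n"
    have "(i - ?m * int n - 1) div int n = - ?m" unfolding sh using a z[of i] ij by simp
    then show "(case (case a of (i, j) \<Rightarrow> (j - (j - 1) div int n * int n, i - (j - 1) div int n * int n)) of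
         (j, i) \<Rightarrow> (i - (i - 1) div int n * int n, j - (i - 1) div int n * int n)) = a"
      unfolding ij by simp
    show "(case a of (i, j) \<Rightarrow> (j - (j - 1) div int n * int n, i - (j - 1) div int n * int n))
        \<in> Sigma {1..int n} (\<lambda>j. {i. A i j \<noteq> 0})"
      using a rg[of j] unfolding ij by (auto simp: per')
    show "(case case a of (i, j) \<Rightarrow> (j - (j - 1) div int n * int n, i - (j - 1) div int n * int n) of
          (j, i) \<Rightarrow> A i j) = (case a of (i, j) \<Rightarrow> A i j)"
      unfolding ij by (simp add: per')
  next
    fix b assume b: "b \<in> Sigma {1..int n} (\<lambda>j. {i. A i j \<noteq> 0})"
    obtain j i where ij: "b = (j, i)" by (cases b)
    let ?m = "(i - 1) div int n"
    have "(j - ?m * int n - 1) div int n = - ?m" unfolding sh using b z[of j] ij by simp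
    then show "(case (case b of (j, i) \<Rightarrow> (i - (i - 1) div int n * int n, j - (i - 1) div int n * int n)) of
         (i, j) \<Rightarrow> (j - (j - 1) div int n * int n, i - (j - 1) div int n * int n)) = b"
      unfolding ij by simp
    show "(case b of (j, i) \<Rightarrow> (i - (i - 1) div int n * int n, j - (i - 1) div int n * int n))
        \<in> Sigma {1..int n} (\<lambda>i. {j. A i j \<noteq> 0})"
      using b rg[of i] unfolding ij by (auto simp: per')
  qed
  also have "\<dots> = sigma_seq n (co A)"
    unfolding sigma_seq_def co_def by (rule sum.Sigma[symmetric]) (use fc in auto)
  finally show ?thesis .
qed

lemma split_exists:
  assumes "finite J" "finite P" "(\<Sum>j\<in>J. c j) = card P"
  shows "\<exists>k. (\<forall>z\<in>P. k z \<in> J) \<and> (\<forall>j\<in>J. card {z \<in> P. k z = j} = c j)"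
  using assms
proof (induction J arbitrary: P)
  case empty then show ?case by simp
next
  case (insert a J)
  then have "c a \<le> card P" by simp
  then obtain Q where Q: "Q \<subseteq> P" "card Q = c a" "finite Q" by (rule obtain_subset_with_card_n)
  have "card (P - Q) = card P - c a" using Q by (simp add: card_Diff_subset)
  then have "(\<Sum>j\<in>J. c j) = card (P - Q)" using insert by simp
  then obtain k where k: "\<forall>z\<in>P - Q. k z \<in> J" "\<forall>j\<in>J. card {z \<in> P - Q. k z = j} = c j"
    using insert.IH[of "P - Q"] insert.prems by blast
  let ?k = "\<lambda>z. if z \<in> Q then a else k z"
  have "card {z \<in> P. ?k z = a} = c a"
  proof -
    have "{z \<in> P. ?k z = a} = Q" using Q k(1) insert(2) by auto
    then show ?thesis using Q by simp
  qed
  moreover have "card {z \<in> P. ?k z = j} = c j" if "j \<in> J" for j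
  proof -
    have "{z \<in> P. ?k z = j} = {z \<in> P - Q. k z = j}" using that insert(2) by auto
    then show ?thesis using k(2) that by simp
  qed
  moreover have "\<forall>z\<in>P. ?k z \<in> insert a J" using k(1) by auto
  ultimately show ?case by (intro exI[of _ ?k]) auto
qed

locale affine_n = affine +
  fixes n :: nat
  assumes n1: "1 \<le> n"
begin

subsection \<open>Equivariant maps\<close>

text \<open>Labellings of the integers that descend to a map from residues modulo \<open>r\<close> to residues modulo \<open>n\<close>;
  block maps of compositions and their translates by affine permutations are of this kind.\<close>

definition eqv :: "(int \<Rightarrow> int) \<Rightarrow> bool" where
  "eqv f \<longleftrightarrow> (\<forall>z. f (z + int r) = f z + int n)"

lemma eqv_shift: "eqv f \<Longrightarrow> f (z + k * int r) = f z + k * int n"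
  by (rule equivariant_shift) (simp add: eqv_def)

lemma eqv_comp: "eqv f \<Longrightarrow> w \<in> G \<Longrightarrow> eqv (\<lambda>z. f (w z))"
  by (simp add: eqv_def G_iff)

lemma div_window: "z = ((z - 1) mod int r + 1) + ((z - 1) div int r) * int r"
  by (simp add: algebra_simps)

lemma window_mem: "(z - 1) mod int r + 1 \<in> {1..int r}"
  using r_pos by (simp add: add1_zle_eq)

lemma finite_fibre:
  assumes f: "eqv f" shows "finite {z. f z = k}"
proof -
  have "{z. f z = k} \<subseteq> (\<lambda>z0. z0 + ((k - f z0) div int n) * int r) ` {1..int r}"
  proof
    fix z assume "z \<in> {z. f z = k}"
    then have fz: "f z = k" by simp
    let ?z0 = "(z - 1) mod int r + 1" and ?m = "(z - 1) div int r"
    have z: "z = ?z0 + ?m * int r" by (rule div_window)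
    have "f z = f ?z0 + ?m * int n" using eqv_shift[OF f, of ?z0 ?m] z by metis
    then have "k - f ?z0 = ?m * int n" using fz by linarith
    then have e: "(k - f ?z0) div int n = ?m" using n1 by simp
    show "z \<in> (\<lambda>z0. z0 + ((k - f z0) div int n) * int r) ` {1..int r}"
      by (rule image_eqI[OF _ window_mem[of z]]) (simp only: e z[symmetric])
  qed
  then show ?thesis by (rule finite_subset) simp
qed

definition cell :: "(int \<Rightarrow> int) \<Rightarrow> (int \<Rightarrow> int) \<Rightarrow> int \<Rightarrow> int \<Rightarrow> nat" where
  "cell f g i j = card {z. f z = i \<and> g z = j}"

lemma cell_shift:
  assumes "eqv f" "eqv g"
  shows "cell f g (i + k * int n) (j + k * int n) = cell f g i j"
proof -
  have "bij_betw (\<lambda>z. z + k * int r) {z. f z = i \<and> g z = j} {z. f z = i + k * int n \<and> g z = j + k * int n}"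
  proof (rule bij_betw_byWitness[where f' = "\<lambda>z. z - k * int r"])
    show "(\<lambda>z. z - k * int r) ` {z. f z = i + k * int n \<and> g z = j + k * int n} \<subseteq> {z. f z = i \<and> g z = j}"
      using eqv_shift[OF assms(1), of _ "- k"] eqv_shift[OF assms(2), of _ "- k"] by auto
  qed (auto simp: eqv_shift[OF assms(1)] eqv_shift[OF assms(2)])
  from bij_betw_same_card[OF this] show ?thesis unfolding cell_def by (rule sym)
qed

lemma finite_cell: "eqv f \<Longrightarrow> finite {z. f z = i \<and> g z = j}"
  by (rule finite_subset[OF _ finite_fibre[of f i]]) auto

lemma cell_comp:
  assumes w: "w \<in> G"
  shows "cell (\<lambda>z. f (w z)) (\<lambda>z. g (w z)) i j = cell f g i j"
proof -
  have "bij_betw w {z. f (w z) = i \<and> g (w z) = j} {z. f z = i \<and> g z = j}"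
    by (rule bij_betw_byWitness[where f' = "ipm w"]) (auto simp: w G_ipm_left G_ipm_right)
  then show ?thesis unfolding cell_def by (rule bij_betw_same_card)
qed

lemma cell_row_sum: "eqv f \<Longrightarrow> Sum_any (\<lambda>j. int (cell f g i j)) = int (card {z. f z = i})"
  using card_fibre_sum[OF finite_fibre[of f i], of g] by (simp add: cell_def)

lemma cell_commute: "cell f g i j = cell g f j i"
  by (simp add: cell_def conj_commute)

lemma cell_col_sum: "eqv g \<Longrightarrow> Sum_any (\<lambda>i. int (cell f g i j)) = int (card {z. g z = j})"
  using cell_row_sum[of g f j] by (simp add: cell_commute[of f g])

lemma finite_cell_row: "eqv f \<Longrightarrow> finite {j. cell f g i j \<noteq> 0}"
proof -
  assume f: "eqv f"
  have "{j. cell f g i j \<noteq> 0} \<subseteq> g ` {z. f z = i}"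
    unfolding cell_def by (auto simp: card_eq_0_iff)
  then show ?thesis by (rule finite_subset) (simp add: finite_fibre f)
qed

lemma finite_cell_col: "eqv g \<Longrightarrow> finite {i. cell f g i j \<noteq> 0}"
  using finite_cell_row[of g f j] by (simp add: cell_commute[of f g])

lemma div_n_range: "i - ((i - 1) div int n) * int n \<in> {1..int n}"
  by (rule window_div_range[OF n1])

lemma div_n_shift: "(i + k * int n - 1) div int n = (i - 1) div int n + k"
  using window_div_shift[OF n1, of i "- k"] by simp

text \<open>Choose bijections between corresponding cells for first labels in a window and extend them
  equivariantly.\<close>

lemma equivariant_bijection:
  assumes e: "eqv f" "eqv g" "eqv f'" "eqv g'" and c: "\<And>i j. cell f g i j = cell f' g' i j"
  shows "\<exists>\<phi>\<in>G. \<forall>z. f' (\<phi> z) = f z \<and> g' (\<phi> z) = g z"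
proof -
  have "\<exists>b. bij_betw b {z. f z = i \<and> g z = j} {z. f' z = i \<and> g' z = j}" for i j
    by (rule finite_same_card_bij[OF finite_cell[OF e(1)] finite_cell[OF e(3)]])
      (rule c[unfolded cell_def])
  then have "\<forall>i j. \<exists>b. bij_betw b {z. f z = i \<and> g z = j} {z. f' z = i \<and> g' z = j}" by blast
  then obtain b where b: "\<And>i j. bij_betw (b i j) {z. f z = i \<and> g z = j} {z. f' z = i \<and> g' z = j}"
    by (auto simp only: choice_iff)
  define m where "m = (\<lambda>i. (i - 1) div int n)"
  \<comment> \<open>translate to a cell with row label in \<open>{1..n}\<close>, apply its bijection, translate back\<close>
  define \<phi> where "\<phi> = (\<lambda>z. b (f z - m (f z) * int n) (g z - m (f z) * int n) (z - m (f z) * int r) + m (f z) * int r)"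
  have ef: "f (z - k * int r) = f z - k * int n" "g (z - k * int r) = g z - k * int n"
    "f' (z - k * int r) = f' z - k * int n" "g' (z - k * int r) = g' z - k * int n" for z k
    using eqv_shift[OF e(1), of z "- k"] eqv_shift[OF e(2), of z "- k"]
      eqv_shift[OF e(3), of z "- k"] eqv_shift[OF e(4), of z "- k"] by auto
  have lab: "f' (\<phi> z) = f z \<and> g' (\<phi> z) = g z" for z
  proof -
    have "b (f z - m (f z) * int n) (g z - m (f z) * int n) (z - m (f z) * int r)
        \<in> {y. f' y = f z - m (f z) * int n \<and> g' y = g z - m (f z) * int n}"
      by (rule bij_betw_apply[OF b]) (simp add: ef)
    then show ?thesis unfolding \<phi>_def by (simp add: eqv_shift[OF e(3)] eqv_shift[OF e(4)])
  qed
  have sh: "\<phi> (z + int r) = \<phi> z + int r" for z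
  proof -
    have 1: "f (z + int r) = f z + int n" "g (z + int r) = g z + int n" using e by (auto simp: eqv_def)
    have "m (f z + int n) = m (f z) + 1" unfolding m_def using div_n_shift[of "f z" 1] by simp
    then show ?thesis unfolding \<phi>_def 1 by (simp add: algebra_simps)
  qed
  have "inj \<phi>"
  proof (rule injI)
    fix z z' assume eq: "\<phi> z = \<phi> z'"
    have l: "f z = f z'" "g z = g z'" using lab[of z] lab[of z'] eq by auto
    have "b (f z - m (f z) * int n) (g z - m (f z) * int n) (z - m (f z) * int r)
      = b (f z - m (f z) * int n) (g z - m (f z) * int n) (z' - m (f z) * int r)"
      using eq l unfolding \<phi>_def by simp
    then have "z - m (f z) * int r = z' - m (f z) * int r"
      by (rule inj_onD[OF bij_betw_imp_inj_on[OF b]]) (simp_all add: ef l)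
    then show "z = z'" by simp
  qed
  moreover have "surj \<phi>"
  proof (rule surjI)
    fix y
    let ?k = "m (f' y)"
    let ?i = "f' y - ?k * int n" and ?j = "g' y - ?k * int n"
    have "y - ?k * int r \<in> {z. f' z = ?i \<and> g' z = ?j}" by (simp add: ef)
    then have "y - ?k * int r \<in> b ?i ?j ` {z. f z = ?i \<and> g z = ?j}"
      using bij_betw_imp_surj_on[OF b[of ?i ?j]] by (simp only:)
    then obtain x where x: "f x = ?i" "g x = ?j" "b ?i ?j x = y - ?k * int r"
      by (auto elim!: imageE)
    let ?z = "x + ?k * int r"
    have "f ?z = f' y" "g ?z = g' y" using x by (simp_all add: eqv_shift[OF e(1)] eqv_shift[OF e(2)])
    then have "\<phi> ?z = y" unfolding \<phi>_def using x by simp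
    then show "\<phi> (SOME z. \<phi> z = y) = y" by (rule someI)
  qed
  ultimately have "\<phi> \<in> G" using sh by (simp add: G_iff bij_def)
  then show ?thesis using lab by blast
qed

text \<open>The equivariant extension of a labelling of the window \<open>{1..r}\<close>.\<close>

definition eext :: "(int \<Rightarrow> int) \<Rightarrow> int \<Rightarrow> int" where
  "eext k z = k ((z - 1) mod int r + 1) + ((z - 1) div int r) * int n"

lemma eext_eqv: "eqv (eext k)"
  unfolding eqv_def eext_def
proof
  fix z
  have e: "z + int r - 1 = (z - 1) + int r" by simp
  have "(z + int r - 1) div int r = (z - 1) div int r + 1" "(z + int r - 1) mod int r = (z - 1) mod int r"
    unfolding e using r_pos by simp_all
  then show "k ((z + int r - 1) mod int r + 1) + (z + int r - 1) div int r * int n =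
         k ((z - 1) mod int r + 1) + (z - 1) div int r * int n + int n"
    by (simp add: algebra_simps)
qed

lemma eext_window: "z \<in> {1..int r} \<Longrightarrow> eext k z = k z"
  by (simp add: eext_def)

lemma eqv_ext: "eqv f \<Longrightarrow> eqv g \<Longrightarrow> (\<And>z. z \<in> {1..int r} \<Longrightarrow> f z = g z) \<Longrightarrow> f z = g z"
  using eqv_shift[of f "(z - 1) mod int r + 1" "(z - 1) div int r"]
    eqv_shift[of g "(z - 1) mod int r + 1" "(z - 1) div int r"] window_mem[of z] div_window[of z]
  by simp

subsection \<open>The block map of a composition\<close>

text \<open>The last integer before the block with label \<open>k\<close>.\<close>

definition bstart :: "seq \<Rightarrow> int \<Rightarrow> int" where
  "bstart l k = ((k - 1) div int n) * int r + (\<Sum>t=1..(k - 1) mod int n. l t)"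

lemma Rset_eq: "Rset n r l k = {bstart l k + 1..bstart l k + l k}"
  by (simp add: Rset_def bstart_def Let_def)

definition blk :: "seq \<Rightarrow> int \<Rightarrow> int" where
  "blk l z = (THE k. z \<in> Rset n r l k)"

abbreviation "L \<equiv> Lambda n r"

lemma L_nonneg: "l \<in> L \<Longrightarrow> 0 \<le> l i" by (auto simp: Lambda_def Nseq_def)
lemma L_per: "l \<in> L \<Longrightarrow> l (i + int n) = l i" by (auto simp: Lambda_def Nseq_def Zseq_def)
lemma L_sum: "l \<in> L \<Longrightarrow> (\<Sum>i=1..int n. l i) = int r" by (auto simp: Lambda_def sigma_seq_def)

lemma bstart_Suc:
  assumes l: "l \<in> L" shows "bstart l (k + 1) = bstart l k + l k"
proof -
  let ?q = "(k - 1) div int n" and ?t = "(k - 1) mod int n"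
  have k: "k = (?t + 1) + ?q * int n" by (simp add: algebra_simps)
  have lk: "l k = l (?t + 1)" using periodic_window[of l n k] L_per[OF l] by simp
  have t: "0 \<le> ?t" "?t < int n" using n1 by simp_all
  have s: "(\<Sum>t=1..?t + 1. l t) = (\<Sum>t=1..?t. l t) + l (?t + 1)"
  proof -
    have "{1..?t + 1} = insert (?t + 1) {1..?t}" using t by auto
    then show ?thesis by simp
  qed
  show ?thesis
  proof (cases "?t + 1 < int n")
    case True
    obtain Q R where Q: "Q = ?q" "R = ?t" by simp
    then have k: "k = (R + 1) + Q * int n" and R: "0 \<le> R + 1" "R + 1 < int n" using k t True by simp_all
    have "k div int n = Q" "k mod int n = R + 1"
      unfolding k using R by (simp_all add: div_pos_pos_trivial)
    then have "k div int n = ?q" "k mod int n = ?t + 1" using Q by simp_all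
    then show ?thesis unfolding bstart_def using s lk by simp
  next
    case False
    then have e: "?t + 1 = int n" using t by simp
    then have "k = (?q + 1) * int n" using k by (simp add: algebra_simps)
    then have kk: "k = (?q + 1) * int n" .
    obtain Q where Q0: "Q = ?q" by simp
    then have Q: "Q = ?q" "k = (Q + 1) * int n" using kk by metis+
    then have "k div int n = ?q + 1" "k mod int n = 0" unfolding Q(1)[symmetric] Q(2) using n1 by simp_all
    moreover have "(\<Sum>t=1..?t. l t) + l (?t + 1) = int r" using s L_sum[OF l] e by simp
    ultimately show ?thesis unfolding bstart_def using lk by (simp add: algebra_simps)
  qed
qed

lemma bstart_shift: "bstart l (k + m * int n) = bstart l k + m * int r"
proof -
  have e: "k + m * int n - 1 = (k - 1) + m * int n" by simp
  have "(k + m * int n - 1) div int n = (k - 1) div int n + m" "(k + m * int n - 1) mod int n = (k - 1) mod int n"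
    unfolding e using n1 by simp_all
  then show ?thesis unfolding bstart_def by (simp add: algebra_simps)
qed

lemma bstart_mono:
  assumes l: "l \<in> L" and k: "k \<le> k'" shows "bstart l k \<le> bstart l k'"
  using k
proof (induction k' rule: int_ge_induct)
  case base show ?case by simp
next
  case (step i) then show ?case using bstart_Suc[OF l, of i] L_nonneg[OF l, of i] by simp
qed

lemma bstart_1: "bstart l 1 = 0" by (simp add: bstart_def)

lemma Rset_iff: "l \<in> L \<Longrightarrow> z \<in> Rset n r l k \<longleftrightarrow> bstart l k < z \<and> z \<le> bstart l (k + 1)"
  by (auto simp: Rset_eq bstart_Suc)

lemma Rset_unique:
  assumes l: "l \<in> L" and "z \<in> Rset n r l k" "z \<in> Rset n r l k'" shows "k = k'"
proof (rule ccontr)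
  assume "k \<noteq> k'"
  then have "k + 1 \<le> k' \<or> k' + 1 \<le> k" by linarith
  then show False using bstart_mono[OF l, of "k + 1" k'] bstart_mono[OF l, of "k' + 1" k] assms
    by (auto simp: Rset_iff)
qed

lemma Rset_exists:
  assumes l: "l \<in> L" shows "\<exists>k. z \<in> Rset n r l k"
proof -
  define lo where "lo = 1 + (- \<bar>z\<bar> - 1) * int n"
  define hi where "hi = 1 + \<bar>z\<bar> * int n"
  have "bstart l lo = (- \<bar>z\<bar> - 1) * int r" unfolding lo_def bstart_shift by (simp add: bstart_1)
  also have "\<dots> \<le> (- \<bar>z\<bar> - 1) * 1" using r_pos by (intro mult_left_mono_neg) auto
  finally have lo: "bstart l lo < z" by simp
  have "bstart l hi = \<bar>z\<bar> * int r" unfolding hi_def bstart_shift by (simp add: bstart_1)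
  moreover have "\<bar>z\<bar> * int r \<ge> \<bar>z\<bar> * 1" using r_pos by (intro mult_left_mono) auto
  ultimately have hi: "z \<le> bstart l hi" by simp
  let ?S = "{k \<in> {lo..hi}. bstart l k < z}"
  have lohi: "lo \<le> hi" unfolding lo_def hi_def by (simp add: algebra_simps)
  have ne: "lo \<in> ?S" using lo lohi by simp
  define k where "k = Max ?S"
  have fS: "finite ?S" by (rule finite_subset[of _ "{lo..hi}"]) auto
  have k: "k \<in> ?S" unfolding k_def by (rule Max_in[OF fS]) (use ne in blast)
  have "k \<noteq> hi" using k hi by auto
  then have "k + 1 \<in> {lo..hi}" using k by auto
  moreover have "k + 1 \<notin> ?S"
  proof
    assume "k + 1 \<in> ?S"
    then have "k + 1 \<le> k" unfolding k_def by (rule Max_ge[OF fS])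
    then show False by simp
  qed
  ultimately have "z \<le> bstart l (k + 1)" by auto
  then show ?thesis using k l by (auto simp: Rset_iff)
qed

lemma blk_iff: "l \<in> L \<Longrightarrow> blk l z = k \<longleftrightarrow> z \<in> Rset n r l k"
proof
  assume l: "l \<in> L"
  have ex: "\<exists>!k. z \<in> Rset n r l k" using Rset_exists[OF l] Rset_unique[OF l] by blast
  show "z \<in> Rset n r l k" if "blk l z = k" using theI'[OF ex] that unfolding blk_def by simp
  show "blk l z = k" if "z \<in> Rset n r l k" unfolding blk_def by (rule the1_equality[OF ex that])
qed

lemma Rset_blk: "l \<in> L \<Longrightarrow> Rset n r l k = {z. blk l z = k}"
  by (auto simp: blk_iff)

lemma blk_eqv: "l \<in> L \<Longrightarrow> eqv (blk l)"
  unfolding eqv_def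
proof
  fix z assume l: "l \<in> L"
  have "z \<in> Rset n r l (blk l z)" using blk_iff[OF l] by blast
  then have "z + int r \<in> Rset n r l (blk l z + int n)"
    using bstart_shift[of l "blk l z" 1] bstart_shift[of l "blk l z + 1" 1] l
    by (simp add: Rset_iff add.commute add.left_commute)
  then show "blk l (z + int r) = blk l z + int n" using blk_iff[OF l] by blast
qed

lemma blk_mono: "l \<in> L \<Longrightarrow> z \<le> z' \<Longrightarrow> blk l z \<le> blk l z'"
proof (rule ccontr)
  assume l: "l \<in> L" and z: "z \<le> z'" and "\<not> blk l z \<le> blk l z'"
  then have "bstart l (blk l z' + 1) \<le> bstart l (blk l z)" by (intro bstart_mono) auto
  moreover have "bstart l (blk l z) < z" "z' \<le> bstart l (blk l z' + 1)"
    using blk_iff[OF l, of z "blk l z"] blk_iff[OF l, of z' "blk l z'"] Rset_iff[OF l] by blast+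
  ultimately show False using z by simp
qed

lemma card_blk: "l \<in> L \<Longrightarrow> int (card {z. blk l z = k}) = l k"
  using Rset_blk[of l k] L_nonneg[of l k] by (simp add: Rset_eq flip: Rset_blk)

text \<open>Labels \<open>1..n\<close> occur exactly on the window \<open>{1..r}\<close>, which is why an equivariant statement need only
  be checked for row labels in \<open>{1..n}\<close>.\<close>

lemma blk_window: "l \<in> L \<Longrightarrow> blk l z \<in> {1..int n} \<longleftrightarrow> z \<in> {1..int r}"
proof -
  assume l: "l \<in> L"
  have b0: "bstart l 1 = 0" and bn: "bstart l (int n + 1) = int r"
    using bstart_shift[of l 1 1] by (simp_all add: bstart_1 add.commute)
  have z: "bstart l (blk l z) < z" "z \<le> bstart l (blk l z + 1)"
    using blk_iff[OF l, of z "blk l z"] Rset_iff[OF l] by blast+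
  show ?thesis
  proof
    assume "blk l z \<in> {1..int n}"
    then have "bstart l 1 \<le> bstart l (blk l z)" "bstart l (blk l z + 1) \<le> bstart l (int n + 1)"
      by (auto intro: bstart_mono l)
    then show "z \<in> {1..int r}" using z b0 bn by simp
  next
    assume a: "z \<in> {1..int r}"
    have "\<not> blk l z + 1 \<le> 1" using bstart_mono[OF l, of "blk l z + 1" 1] z a b0 by auto
    moreover have "\<not> int n + 1 \<le> blk l z" using bstart_mono[OF l, of "int n + 1" "blk l z"] z a bn by auto
    ultimately show "blk l z \<in> {1..int n}" by simp
  qed
qed

subsection \<open>Young subgroups and double cosets\<close>

abbreviation "Y \<equiv> Young n r"

lemma Y_iff:
  assumes l: "l \<in> L" shows "w \<in> Y l \<longleftrightarrow> w \<in> G \<and> (\<forall>z. blk l (w z) = blk l z)"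
proof
  assume "w \<in> Y l"
  then have w: "w \<in> G" and im: "\<And>i. i \<in> {1..int n} \<Longrightarrow> w ` Rset n r l i = Rset n r l i"
    by (auto simp: Young_def)
  have "blk l (w z) = blk l z" for z
  proof (rule eqv_ext[OF eqv_comp[OF blk_eqv[OF l] w] blk_eqv[OF l]])
    fix z assume "z \<in> {1..int r}"
    then have i: "blk l z \<in> {1..int n}" using blk_window[OF l] by blast
    have "z \<in> Rset n r l (blk l z)" using blk_iff[OF l] by blast
    then have "w z \<in> Rset n r l (blk l z)" using im[OF i] by blast
    then show "blk l (w z) = blk l z" using blk_iff[OF l] by blast
  qed
  then show "w \<in> G \<and> (\<forall>z. blk l (w z) = blk l z)" using w by blast
next
  assume a: "w \<in> G \<and> (\<forall>z. blk l (w z) = blk l z)"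
  have "w ` Rset n r l i = Rset n r l i" for i
  proof
    show "w ` Rset n r l i \<subseteq> Rset n r l i" using a by (auto simp: Rset_blk[OF l])
    show "Rset n r l i \<subseteq> w ` Rset n r l i"
    proof
      fix z assume "z \<in> Rset n r l i"
      then have "blk l z = i" by (simp add: Rset_blk[OF l])
      moreover have "blk l (w (ipm w z)) = blk l (ipm w z)" using a by blast
      moreover have "w (ipm w z) = z" using a G_ipm_right by blast
      ultimately have "blk l (ipm w z) = i" by metis
      then have "ipm w z \<in> Rset n r l i" by (simp add: Rset_blk[OF l])
      then show "z \<in> w ` Rset n r l i" using G_ipm_right[of w z] a by (metis image_eqI)
    qed
  qed
  then show "w \<in> Y l" using a by (simp add: Young_def)
qed

lemma Y_G: "u \<in> Y l \<Longrightarrow> u \<in> G" by (simp add: Young_def)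

lemma Y_id: "l \<in> L \<Longrightarrow> id \<in> Y l" by (simp add: Y_iff G_id)

lemma Y_comp: "l \<in> L \<Longrightarrow> u \<in> Y l \<Longrightarrow> v \<in> Y l \<Longrightarrow> u \<circ> v \<in> Y l"
  by (simp add: Y_iff G_comp)

lemma Y_ipm: "l \<in> L \<Longrightarrow> u \<in> Y l \<Longrightarrow> ipm u \<in> Y l"
  by (simp add: Y_iff G_ipm) (metis G_ipm_right)

lemma Y_blk: "l \<in> L \<Longrightarrow> u \<in> Y l \<Longrightarrow> blk l (u z) = blk l z" by (simp add: Y_iff)

lemma finite_G_window: "finite S \<Longrightarrow> finite {w \<in> G. w ` {1..int r} \<subseteq> S}"
proof -
  assume S: "finite S"
  have "inj_on (\<lambda>w. restrict w {1..int r}) {w \<in> G. w ` {1..int r} \<subseteq> S}"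
  proof (rule inj_onI)
    fix w w' assume w: "w \<in> {w \<in> G. w ` {1..int r} \<subseteq> S}" "w' \<in> {w \<in> G. w ` {1..int r} \<subseteq> S}"
      and e: "restrict w {1..int r} = restrict w' {1..int r}"
    show "w = w'"
    proof
      fix z
      have "w ((z - 1) mod int r + 1) = w' ((z - 1) mod int r + 1)"
        using fun_cong[OF e, of "(z - 1) mod int r + 1"] window_mem[of z] by simp
      then show "w z = w' z" using div_window[of z] G_shift w by (metis (mono_tags, lifting) mem_Collect_eq)
    qed
  qed
  moreover have "(\<lambda>w. restrict w {1..int r}) ` {w \<in> G. w ` {1..int r} \<subseteq> S} \<subseteq> {1..int r} \<rightarrow>\<^sub>E S"
    by auto
  moreover have "finite ({1..int r} \<rightarrow>\<^sub>E S)" using S by (intro finite_PiE) auto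
  ultimately show ?thesis using finite_imageD finite_subset by blast
qed

lemma finite_Y: "l \<in> L \<Longrightarrow> finite (Y l)"
proof -
  assume l: "l \<in> L"
  have "Y l \<subseteq> {w \<in> G. w ` {1..int r} \<subseteq> {1..int r}}"
  proof
    fix w assume w: "w \<in> Y l"
    have "w z \<in> {1..int r}" if "z \<in> {1..int r}" for z
      using that blk_window[OF l] Y_blk[OF l w] by metis
    then show "w \<in> {w \<in> G. w ` {1..int r} \<subseteq> {1..int r}}" using Y_G[OF w] by blast
  qed
  then show ?thesis by (rule finite_subset) (rule finite_G_window, simp)
qed

lemma s_Y: "l \<in> L \<Longrightarrow> s i \<in> Y l \<longleftrightarrow> blk l i = blk l (i + 1)"
proof
  assume l: "l \<in> L"
  show "blk l i = blk l (i + 1)" if "s i \<in> Y l"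
    using Y_blk[OF l that, of i] by (simp add: s_at)
  assume e: "blk l i = blk l (i + 1)"
  have "blk l (s i z) = blk l z" for z
  proof -
    consider k where "z = i + k * int r" | k where "z = (i + 1) + k * int r"
      | "z mod int r \<noteq> i mod int r" "z mod int r \<noteq> (i + 1) mod int r"
      using mod_eqE by metis
    then show ?thesis
    proof cases
      case 1
      then have "s i z = (i + 1) + k * int r" using G_shift[OF G_s] by (simp add: s_at)
      then show ?thesis using 1 e eqv_shift[OF blk_eqv[OF l]] by simp
    next
      case 2
      then have "s i z = i + k * int r" using G_shift[OF G_s] by (simp add: s_at_Suc)
      then show ?thesis using 2 e eqv_shift[OF blk_eqv[OF l]] by simp
    next
      case 3 then show ?thesis by (simp add: s_fix)
    qed
  qed
  then show "s i \<in> Y l" using l by (simp add: Y_iff G_s)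
qed

lemma Y_rho: "l \<in> L \<Longrightarrow> rho m \<in> Y l \<Longrightarrow> m = 0"
proof -
  assume l: "l \<in> L" and m: "rho m \<in> Y l"
  have "blk l (0 + int r * m) = blk l 0"
    by (rule periodic_shift) (use Y_blk[OF l m] in simp)
  moreover have "blk l (0 + m * int r) = blk l 0 + m * int n" by (rule eqv_shift[OF blk_eqv[OF l]])
  ultimately show ?thesis using n1 by (simp add: mult.commute)
qed

text \<open>Blocks are intervals, so an element that preserves blocks can only invert strands of one block.\<close>

lemma Y_descent:
  assumes l: "l \<in> L" and u: "u \<in> Y l" and d: "ipm u (i + 1) < ipm u i"
  shows "s i \<in> Y l"
proof -
  have "blk l i = blk l (ipm u i)" "blk l (i + 1) = blk l (ipm u (i + 1))"
    using Y_blk[OF l Y_ipm[OF l u]] by auto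
  moreover have "blk l (ipm u (i + 1)) \<le> blk l (ipm u i)" "blk l i \<le> blk l (i + 1)"
    using blk_mono[OF l] d by auto
  ultimately show ?thesis using s_Y[OF l] by simp
qed

lemma Y_induct [consumes 2, case_names id step]:
  assumes l: "l \<in> L" and u: "u \<in> Y l" and base: "P id"
    and step: "\<And>u i. u \<in> Y l \<Longrightarrow> s i \<in> Y l \<Longrightarrow> ipm u i < ipm u (i + 1) \<Longrightarrow>
       elen (s i \<circ> u) = elen u + 1 \<Longrightarrow> P u \<Longrightarrow> P (s i \<circ> u)"
  shows "P u"
  using u
proof (induction "elen u" arbitrary: u rule: less_induct)
  case less
  show ?case
  proof (cases "\<exists>i. ipm u (i + 1) < ipm u i")
    case True
    then obtain i where i: "ipm u (i + 1) < ipm u i" by blast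
    have si: "s i \<in> Y l" by (rule Y_descent[OF l less(2) i])
    let ?v = "s i \<circ> u"
    have v: "?v \<in> Y l" by (rule Y_comp[OF l si less(2)])
    have el: "elen u = elen ?v + 1" by (rule elen_down_left[OF Y_G[OF less(2)] i])
    have P: "P ?v" using less(1)[OF _ v] el by simp
    have "ipm ?v i < ipm ?v (i + 1)" unfolding ipm_comp_s[OF Y_G[OF less(2)]] using i by (simp add: s_at s_at_Suc)
    from step[OF v si this _ P] el show ?thesis by (simp only: s_comp_s_comp)
  next
    case False
    then obtain m where m: "ipm u = rho m" using no_descent[OF G_ipm[OF Y_G[OF less(2)]]] by auto
    have "m = 0" using Y_rho[OF l] Y_ipm[OF l less(2)] m by simp
    then have "ipm u = id" using m by (simp add: id_def)
    then have "u = id" using ipm_ipm[OF Y_G[OF less(2)]] ipm_unique[OF G_id, of id] by simp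
    then show ?thesis using base by simp
  qed
qed

text \<open>Being increasing on each block is enough for lengths to add: along a reduced word of \<open>u\<close> every
  letter meets an ascent of \<open>d\<close>.\<close>

lemma Dleft_additive:
  assumes l: "l \<in> L" and d: "d \<in> G" and inc: "\<And>i. s i \<in> Y l \<Longrightarrow> ipm d i < ipm d (i + 1)"
    and u: "u \<in> Y l"
  shows "elen (u \<circ> d) = elen u + elen d"
  using l u
proof (induction rule: Y_induct)
  case id show ?case by (simp only: elen_id id_comp add_0)
next
  case (step u i)
  have inc_fib: "ipm d p < ipm d q'" if "p < q'" "blk l p = blk l q'" for p q'
    using that
  proof (induction q' rule: int_gr_induct)
    case base then show ?case using inc s_Y[OF l] by simp
  next
    case (step j)
    have "blk l p \<le> blk l j" "blk l j \<le> blk l (j + 1)" using step(1) by (auto intro: blk_mono[OF l])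
    then have e: "blk l p = blk l j" "blk l j = blk l (j + 1)" using step(3) by auto
    then have "ipm d p < ipm d j" using step(2) by simp
    moreover have "ipm d j < ipm d (j + 1)" using inc s_Y[OF l] e by simp
    ultimately show ?case by simp
  qed
  have uG: "u \<in> G" by (rule Y_G[OF step(1)])
  have b: "blk l (ipm u i) = blk l (ipm u (i + 1))"
    using Y_blk[OF l Y_ipm[OF l step(1)]] s_Y[OF l] step(2) by simp
  have "ipm d (ipm u i) < ipm d (ipm u (i + 1))" by (rule inc_fib[OF step(3) b])
  then have "ipm (u \<circ> d) i < ipm (u \<circ> d) (i + 1)" by (simp add: ipm_comp[OF uG d])
  from elen_up_left[OF G_comp[OF uG d] this] have "elen (s i \<circ> u \<circ> d) = elen (u \<circ> d) + 1"
    by (simp only: comp_assoc)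
  then show "elen (s i \<circ> u \<circ> d) = elen (s i \<circ> u) + elen d" using step by linarith
qed

lemma Dleft_iff_len: "d \<in> Dleft n r l \<longleftrightarrow> d \<in> G \<and> (\<forall>u\<in>Y l. elen (u \<circ> d) = elen u + elen d)"
proof -
  have "len r (u \<circ> d) = len r u + len r d \<longleftrightarrow> elen (u \<circ> d) = elen u + elen d" if "u \<in> Y l" "d \<in> G" for u
    using len_eq[OF Y_G[OF that(1)]] len_eq[OF that(2)] len_eq[OF G_comp[OF Y_G[OF that(1)] that(2)]] by simp
  then show ?thesis by (auto simp: Dleft_def)
qed

lemma mat_of_cell:
  assumes "l \<in> L" "m \<in> L" "d \<in> G"
  shows "mat_of n r l d m i j = int (cell (\<lambda>z. blk l (d z)) (blk m) i j)"
proof -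
  have "Rset n r l i \<inter> d ` Rset n r m j = d ` {z. blk l (d z) = i \<and> blk m z = j}"
    using assms by (auto simp: Rset_blk)
  moreover have "inj_on d {z. blk l (d z) = i \<and> blk m z = j}"
    using G_inj[OF assms(3)] by (simp add: inj_on_def)
  ultimately show ?thesis by (simp add: mat_of_def cell_def card_image)
qed

text \<open>The affine permutations with a given matrix; these are the double cosets (\<open>dcoset_eq\<close>).\<close>

definition Dset :: "seq \<Rightarrow> mat \<Rightarrow> seq \<Rightarrow> perm set" where
  "Dset l A m = {x \<in> G. mat_of n r l x m = A}"

text \<open>Elements with the same matrix give the same cell counts for the pair of block maps, so
  \<open>equivariant_bijection\<close> turns one into the other, and what it produces preserves blocks.\<close>

lemma dcoset_eq:
  assumes l: "l \<in> L" and m: "m \<in> L" and d: "d \<in> G"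
  shows "dcoset n r l d m = Dset l (mat_of n r l d m) m"
proof
  show "dcoset n r l d m \<subseteq> Dset l (mat_of n r l d m) m"
  proof
    fix x assume "x \<in> dcoset n r l d m"
    then obtain u w where uw: "u \<in> Y l" "w \<in> Y m" "x = u \<circ> d \<circ> w" by (auto simp: dcoset_def)
    have wG: "w \<in> G" and x: "x \<in> G" using uw d Y_G G_comp by auto
    have "mat_of n r l x m i j = mat_of n r l d m i j" for i j
    proof -
      have "cell (\<lambda>z. blk l (x z)) (blk m) i j = cell (\<lambda>z. blk l (d (w z))) (\<lambda>z. blk m (w z)) i j"
        by (simp add: uw(3) Y_blk[OF l uw(1)] Y_blk[OF m uw(2)])
      also have "\<dots> = cell (\<lambda>z. blk l (d z)) (blk m) i j" by (rule cell_comp[OF wG])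
      finally show ?thesis by (simp add: mat_of_cell l m d x)
    qed
    then show "x \<in> Dset l (mat_of n r l d m) m" using x by (auto simp: Dset_def fun_eq_iff)
  qed
next
  show "Dset l (mat_of n r l d m) m \<subseteq> dcoset n r l d m"
  proof
    fix x assume "x \<in> Dset l (mat_of n r l d m) m"
    then have x: "x \<in> G" and e: "mat_of n r l x m = mat_of n r l d m" by (auto simp: Dset_def)
    have "\<exists>\<phi>\<in>G. \<forall>z. blk l (d (\<phi> z)) = blk l (x z) \<and> blk m (\<phi> z) = blk m z"
    proof (rule equivariant_bijection)
      show "cell (\<lambda>z. blk l (x z)) (blk m) i j = cell (\<lambda>z. blk l (d z)) (blk m) i j" for i j
        using fun_cong[OF fun_cong[OF e, of i], of j] by (simp add: mat_of_cell l m d x)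
    qed (use l m d x in \<open>auto intro: eqv_comp blk_eqv\<close>)
    then obtain \<phi> where p: "\<phi> \<in> G" "\<And>z. blk l (d (\<phi> z)) = blk l (x z)" "\<And>z. blk m (\<phi> z) = blk m z" by blast
    have pY: "\<phi> \<in> Y m" using p m by (simp add: Y_iff)
    \<comment> \<open>\<open>x\<close> and \<open>v\<close> have the same row labels, so their quotient lies in the left Young subgroup\<close>
    define v where "v = d \<circ> \<phi>"
    have v: "v \<in> G" unfolding v_def using d p(1) G_comp by blast
    define u where "u = x \<circ> ipm v"
    have u: "u \<in> G" unfolding u_def using x v G_comp G_ipm by blast
    have "blk l (u z) = blk l z" for z
      using p(2)[of "ipm v z"] G_ipm_right[OF v, of z] by (simp add: u_def v_def)
    then have uY: "u \<in> Y l" using u l by (simp add: Y_iff)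
    have "x = u \<circ> d \<circ> \<phi>"
      unfolding u_def by (simp only: comp_assoc v_def[symmetric] comp_ipm[OF v] comp_id)
    then show "x \<in> dcoset n r l d m" using uY pY by (auto simp: dcoset_def)
  qed
qed

lemma finite_dcoset: "l \<in> L \<Longrightarrow> m \<in> L \<Longrightarrow> finite (dcoset n r l d m)"
proof -
  assume lm: "l \<in> L" "m \<in> L"
  have "dcoset n r l d m = (\<lambda>(u, w). u \<circ> d \<circ> w) ` (Y l \<times> Y m)" by (auto simp: dcoset_def)
  then show ?thesis using lm finite_Y by simp
qed

lemma finite_Dset: "l \<in> L \<Longrightarrow> m \<in> L \<Longrightarrow> finite (Dset l A m)"
proof -
  assume lm: "l \<in> L" "m \<in> L"
  show ?thesis
  proof (cases "Dset l A m = {}")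
    case False
    then obtain d where "d \<in> Dset l A m" by blast
    then have "d \<in> G" "mat_of n r l d m = A" by (auto simp: Dset_def)
    then show ?thesis using dcoset_eq[OF lm] finite_dcoset[OF lm] by metis
  qed simp
qed

text \<open>A shortest element of the double coset has no descent inside a block on either side.\<close>

lemma Ddouble_exists:
  assumes l: "l \<in> L" and m: "m \<in> L" and w: "w \<in> G"
  shows "\<exists>d\<in>Ddouble n r l m. d \<in> G \<and> mat_of n r l d m = mat_of n r l w m"
proof -
  let ?D = "Dset l (mat_of n r l w m) m"
  have wD: "w \<in> ?D" using w by (simp add: Dset_def)
  define d where "d = arg_min elen (\<lambda>x. x \<in> ?D)"
  have d: "d \<in> ?D" unfolding d_def by (rule arg_min_natI[of "\<lambda>x. x \<in> ?D", OF wD])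
  have min: "elen d \<le> elen x" if "x \<in> ?D" for x
    unfolding d_def using arg_min_nat_le[of "\<lambda>x. x \<in> ?D" x elen] that by simp
  have dG: "d \<in> G" and dm: "mat_of n r l d m = mat_of n r l w m" using d by (auto simp: Dset_def)
  have cos: "dcoset n r l d m = ?D" using dcoset_eq[OF l m dG] dm by simp
  have "ipm d i < ipm d (i + 1)" if "s i \<in> Y l" for i
  proof (rule ccontr)
    assume "\<not> ?thesis"
    then have "ipm d (i + 1) < ipm d i" using G_neq_Suc[OF G_ipm[OF dG], of i] by linarith
    from elen_down_left[OF dG this] have "elen (s i \<circ> d) < elen d" by simp
    moreover have "s i \<circ> d \<circ> id \<in> dcoset n r l d m" using that Y_id[OF m] unfolding dcoset_def by blast
    then have "elen d \<le> elen (s i \<circ> d)" using min unfolding cos by (simp only: comp_id id_comp)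
    ultimately show False by linarith
  qed
  then have 1: "d \<in> Dleft n r l" using Dleft_additive[OF l dG] dG by (simp add: Dleft_iff_len)
  have "ipm (ipm d) i < ipm (ipm d) (i + 1)" if "s i \<in> Y m" for i
  proof (rule ccontr)
    assume "\<not> ?thesis"
    then have "d (i + 1) < d i" using G_neq_Suc[OF dG, of i] by (simp add: ipm_ipm[OF dG])
    from elen_down[OF dG this] have "elen (d \<circ> s i) < elen d" by simp
    moreover have "id \<circ> d \<circ> s i \<in> dcoset n r l d m" using that Y_id[OF l] unfolding dcoset_def by blast
    then have "elen d \<le> elen (d \<circ> s i)" using min unfolding cos by (simp only: comp_id id_comp)
    ultimately show False by linarith
  qed
  then have 2: "ipm d \<in> Dleft n r m" using Dleft_additive[OF m G_ipm[OF dG]] G_ipm[OF dG] by (simp add: Dleft_iff_len)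
  have "d \<in> Ddouble n r l m" unfolding Ddouble_def using 1 2 ipm_ipm[OF dG] by (metis IntI image_eqI)
  then show ?thesis using dG dm by blast
qed

lemma Ddouble_G: "d \<in> Ddouble n r l m \<Longrightarrow> d \<in> G"
  by (auto simp: Ddouble_def Dleft_def)

lemma ro_mat_of: "l \<in> L \<Longrightarrow> m \<in> L \<Longrightarrow> d \<in> G \<Longrightarrow> ro (mat_of n r l d m) = l"
proof
  fix i assume a: "l \<in> L" "m \<in> L" "d \<in> G"
  have "cell (\<lambda>z. blk l (d z)) (\<lambda>z. blk l (d z)) i i = cell (blk l) (blk l) i i" by (rule cell_comp[OF a(3)])
  then have "card {z. blk l (d z) = i} = card {z. blk l z = i}" by (simp add: cell_def)
  then show "ro (mat_of n r l d m) i = l i"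
    using cell_row_sum[OF eqv_comp[OF blk_eqv[OF a(1)] a(3)], of "blk m" i] card_blk[OF a(1), of i]
    by (simp add: ro_eq mat_of_cell a)
qed

lemma co_mat_of: "l \<in> L \<Longrightarrow> m \<in> L \<Longrightarrow> d \<in> G \<Longrightarrow> co (mat_of n r l d m) = m"
  by (rule ext) (simp add: co_eq mat_of_cell cell_col_sum blk_eqv card_blk)

lemma mat_of_Theta_r:
  assumes a: "l \<in> L" "m \<in> L" "d \<in> G" shows "mat_of n r l d m \<in> Theta_r n r"
proof -
  have e: "eqv (\<lambda>z. blk l (d z))" "eqv (blk m)" using a by (auto intro: eqv_comp blk_eqv)
  have "sigma_mat n (mat_of n r l d m) = int r"
    using a by (simp add: sigma_mat_eq ro_mat_of Lambda_def)
  then show ?thesis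
    using finite_cell_row[OF e(1), of "blk m"] finite_cell_col[OF e(2), of "\<lambda>z. blk l (d z)"]
      cell_shift[OF e, of _ 1]
    by (simp add: Theta_r_def Theta_def per_mats_def mat_of_cell a)
qed

lemma Theta_r_L:
  assumes C: "C \<in> Theta_r n r" shows "ro C \<in> L" "co C \<in> L"
proof -
  have per: "\<And>i j. C i j = C (i + int n) (j + int n)" and pm: "C \<in> per_mats n" and nn: "\<And>i j. 0 \<le> C i j"
    and sg: "sigma_seq n (ro C) = int r"
    using C by (auto simp: Theta_r_def Theta_def per_mats_def sigma_mat_eq)
  have "ro C (i + int n) = ro C i" for i
  proof -
    have "Sum_any (\<lambda>j. C (i + int n) j) = Sum_any (\<lambda>j. C i j)"
      by (rule Sum_any.reindex_cong[of "\<lambda>j. j + int n"])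
        (auto simp: per[symmetric] fun_eq_iff intro!: bij_betw_byWitness[where f' = "\<lambda>j. j - int n"])
    then show ?thesis by (simp add: ro_eq)
  qed
  moreover have "co C (i + int n) = co C i" for i
  proof -
    have "Sum_any (\<lambda>j. C j (i + int n)) = Sum_any (\<lambda>j. C j i)"
      by (rule Sum_any.reindex_cong[of "\<lambda>j. j + int n"])
        (auto simp: per[symmetric] fun_eq_iff intro!: bij_betw_byWitness[where f' = "\<lambda>j. j - int n"])
    then show ?thesis by (simp add: co_eq)
  qed
  moreover have "0 \<le> ro C i" "0 \<le> co C i" for i using nn by (auto simp: ro_def co_def intro!: sum_nonneg)
  ultimately show "ro C \<in> L" "co C \<in> L" using sg sigma_ro_co[OF n1 pm]
    by (auto simp: Lambda_def Nseq_def Zseq_def)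
qed

text \<open>Fill each row block with column labels as \<open>C\<close> prescribes; the resulting labelling has the fibres of
  the block map of \<open>co C\<close> and is a translate of it.\<close>

lemma mat_of_surj:
  assumes C: "C \<in> Theta_r n r"
  shows "\<exists>d\<in>G. mat_of n r (ro C) d (co C) = C"
proof -
  note L = Theta_r_L[OF C]
  have per: "\<And>i j. C (i + int n) (j + int n) = C i j" and nn: "\<And>i j. 0 \<le> C i j"
    and fr: "\<And>i. finite {j. C i j \<noteq> 0}"
    using C by (auto simp: Theta_r_def Theta_def per_mats_def)
  have per': "C (i + k * int n) (j + k * int n) = C i j" for i j k
  proof -
    have "(\<lambda>x. C (i + x) (j + x)) (0 + k * int n) = (\<lambda>x. C (i + x) (j + x)) 0"
      by (rule periodic_shift) (use per in \<open>simp add: add.assoc[symmetric]\<close>)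
    then show ?thesis by simp
  qed
  let ?f = "blk (ro C)"
  have f: "eqv ?f" by (rule blk_eqv[OF L(1)])
  have "\<exists>k. (\<forall>z\<in>{z. ?f z = i}. k z \<in> {j. C i j \<noteq> 0}) \<and> (\<forall>j\<in>{j. C i j \<noteq> 0}. card {z \<in> {z. ?f z = i}. k z = j} = nat (C i j))" for i
  proof (rule split_exists[OF fr finite_fibre[OF f]])
    have "int (\<Sum>j | C i j \<noteq> 0. nat (C i j)) = ro C i" using nn by (simp add: ro_def)
    then show "(\<Sum>j | C i j \<noteq> 0. nat (C i j)) = card {z. ?f z = i}" using card_blk[OF L(1), of i] by linarith
  qed
  then obtain k where k: "\<And>i z. ?f z = i \<Longrightarrow> C i (k i z) \<noteq> 0"
      "\<And>i j. C i j \<noteq> 0 \<Longrightarrow> card {z. ?f z = i \<and> k i z = j} = nat (C i j)"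
    by simp metis
  have k2: "card {z. ?f z = i \<and> k i z = j} = nat (C i j)" for i j
  proof (cases "C i j = 0")
    case True
    then have e: "{z. ?f z = i \<and> k i z = j} = {}" using k(1) by blast
    show ?thesis unfolding e using True by simp
  qed (use k(2) in simp)
  define F where "F = eext (\<lambda>z. k (?f z) z)"
  have F: "eqv F" unfolding F_def by (rule eext_eqv)
  have cell0: "cell ?f F i j = nat (C i j)" if i: "i \<in> {1..int n}" for i j
  proof -
    have "{z. ?f z = i \<and> F z = j} = {z. ?f z = i \<and> k i z = j}"
    proof -
      have "F z = k i z" if "?f z = i" for z
      proof -
        have "z \<in> {1..int r}" using blk_window[OF L(1), of z] that i by simp
        then show ?thesis using that by (simp add: F_def eext_window)
      qed
      then show ?thesis by auto
    qed
    then show ?thesis unfolding cell_def using k2 by simp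
  qed
  have cell1: "cell ?f F i j = nat (C i j)" for i j
  proof -
    let ?m = "(i - 1) div int n"
    have "cell ?f F i j = cell ?f F (i - ?m * int n) (j - ?m * int n)"
      using cell_shift[OF f F, of i "- ?m" j] by simp
    also have "\<dots> = nat (C (i - ?m * int n) (j - ?m * int n))" by (rule cell0[OF div_n_range])
    also have "\<dots> = nat (C i j)" using per'[of i "- ?m" j] by simp
    finally show ?thesis .
  qed
  let ?g = "blk (co C)"
  have g: "eqv ?g" by (rule blk_eqv[OF L(2)])
  have cF: "card {z. F z = j} = card {z. ?g z = j}" for j
  proof -
    have "int (card {z. F z = j}) = Sum_any (\<lambda>i. int (cell ?f F i j))" using cell_col_sum[OF F] by simp
    also have "\<dots> = co C j" unfolding co_eq using nn by (simp add: cell1)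
    finally show ?thesis using card_blk[OF L(2), of j] by simp
  qed
  have "\<exists>\<phi>\<in>G. \<forall>z. ?g (\<phi> z) = F z \<and> ?g (\<phi> z) = F z"
  proof (rule equivariant_bijection[OF F F g g])
    show "cell F F i j = cell ?g ?g i j" for i j
    proof (cases "i = j")
      case True then show ?thesis using cF[of i] by (simp add: cell_def)
    next
      case False
      then have "{z. F z = i \<and> F z = j} = {}" "{z. ?g z = i \<and> ?g z = j} = {}" by blast+
      then show ?thesis unfolding cell_def by (simp only:)
    qed
  qed
  then obtain \<phi> where p: "\<phi> \<in> G" "\<And>z. ?g (\<phi> z) = F z" by blast
  have "mat_of n r (ro C) (ipm \<phi>) (co C) i j = C i j" for i j
  proof -
    have "cell (\<lambda>z. ?f (ipm \<phi> z)) ?g i j = cell (\<lambda>z. ?f (ipm \<phi> (\<phi> z))) (\<lambda>z. ?g (\<phi> z)) i j"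
      by (rule cell_comp[OF p(1), symmetric])
    also have "\<dots> = cell ?f F i j" by (simp add: G_ipm_left[OF p(1)] p(2))
    finally show ?thesis using nn by (simp add: mat_of_cell L G_ipm p(1) cell1)
  qed
  then show ?thesis using G_ipm[OF p(1)] by (intro bexI[of _ "ipm \<phi>"]) (auto simp: fun_eq_iff)
qed

lemma finite_L: "finite L"
proof -
  have "inj_on (\<lambda>l. restrict l {1..int n}) L"
  proof (rule inj_onI)
    fix l l' assume a: "l \<in> L" "l' \<in> L" "restrict l {1..int n} = restrict l' {1..int n}"
    show "l = l'"
    proof
      fix z
      have "(z - 1) mod int n + 1 \<in> {1..int n}" using n1 by (simp add: add1_zle_eq)
      then have "l ((z - 1) mod int n + 1) = l' ((z - 1) mod int n + 1)"
        using fun_cong[OF a(3), of "(z - 1) mod int n + 1"] by simp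
      then show "l z = l' z" using periodic_window[of l n z] periodic_window[of l' n z] L_per a by metis
    qed
  qed
  moreover have "(\<lambda>l. restrict l {1..int n}) ` L \<subseteq> {1..int n} \<rightarrow>\<^sub>E {0..int r}"
  proof -
    have "l i \<le> int r" if "l \<in> L" "i \<in> {1..int n}" for l i
      using member_le_sum[of i "{1..int n}" l] L_nonneg[OF that(1)] L_sum[OF that(1)] that(2) by simp
    then show ?thesis using L_nonneg by auto
  qed
  moreover have "finite ({1..int n} \<rightarrow>\<^sub>E {0..int r})" by (intro finite_PiE) auto
  ultimately show ?thesis by (metis finite_imageD finite_subset)
qed

end

section \<open>The affine Schur algebra and its structure constants at \<open>v = 1\<close>\<close>

lemma q_nz: "q \<noteq> 0"
  by (simp add: vpow_def)

lemma vpow_mult: "vpow a * vpow b = vpow (a + b)"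
  by (simp add: vpow_def mult_single)

lemma at_one_q_power: "at_one (q ^ k) = 1"
  by (induction k) (simp_all add: at_one_one at_one_mult at_one_vpow)

lemma hscale_eq_0: "c \<noteq> 0 \<Longrightarrow> hscale c z = 0 \<Longrightarrow> z = 0"
proof (rule poly_mapping_eqI)
  fix k assume "c \<noteq> 0" "hscale c z = 0"
  then show "lk z k = lk 0 k" using lookup_hscale[of c z k] by simp
qed

lemma sum_fun_apply: "sum f A x = (\<Sum>a\<in>A. f a x)"
  by (induction A rule: infinite_finite_induct) auto

context affine
begin

text \<open>Being an eigenvector of a generator for the eigenvalue \<open>q\<close> means constancy on its cosets.\<close>

lemma left_inv_iff:
  assumes z: "z \<in> Hecke r"
  shows "T (s i) \<star> z = hscale q z \<longleftrightarrow> (\<forall>w\<in>G. lk z (s i \<circ> w) = lk z w)"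
proof
  assume e: "T (s i) \<star> z = hscale q z"
  have up: "lk z (s i \<circ> w) = lk z w" if w: "w \<in> G" and "ipm w i < ipm w (i + 1)" for w
  proof -
    have "q * lk z (s i \<circ> w) = q * lk z w"
      using arg_cong[OF e, of "\<lambda>h. lk h w"] that by (simp add: hm_left_s[OF z] lookup_Lop)
    then show ?thesis using q_nz by (simp only: mult_cancel_left simp_thms)
  qed
  show "\<forall>w\<in>G. lk z (s i \<circ> w) = lk z w"
  proof
    fix w assume w: "w \<in> G"
    show "lk z (s i \<circ> w) = lk z w"
    proof (cases "ipm w i < ipm w (i + 1)")
      case True then show ?thesis by (rule up[OF w])
    next
      case False
      then have "ipm (s i \<circ> w) i < ipm (s i \<circ> w) (i + 1)"
        unfolding ipm_comp_s[OF w] using G_neq_Suc[OF G_ipm[OF w], of i] by (simp add: s_at s_at_Suc)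
      from up[OF G_comp[OF G_s w] this] show ?thesis by (simp only: s_comp_s_comp)
    qed
  qed
next
  assume a: "\<forall>w\<in>G. lk z (s i \<circ> w) = lk z w"
  show "T (s i) \<star> z = hscale q z"
  proof (rule poly_mapping_eqI)
    fix w
    show "lk (T (s i) \<star> z) w = lk (hscale q z) w"
    proof (cases "w \<in> G")
      case True
      have "lk z (s i \<circ> w) = lk z w" using a True by blast
      then show ?thesis using True unfolding hm_left_s[OF z] by (simp add: lookup_Lop algebra_simps)
    next
      case False
      then show ?thesis using z unfolding hm_left_s[OF z] by (simp add: lookup_Lop Hecke_iff)
    qed
  qed
qed

lemma right_inv_iff:
  assumes z: "z \<in> Hecke r"
  shows "z \<star> T (s i) = hscale q z \<longleftrightarrow> (\<forall>w\<in>G. lk z (w \<circ> s i) = lk z w)"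
proof
  assume e: "z \<star> T (s i) = hscale q z"
  have up: "lk z (w \<circ> s i) = lk z w" if w: "w \<in> G" and "w i < w (i + 1)" for w
  proof -
    have "q * lk z (w \<circ> s i) = q * lk z w"
      using arg_cong[OF e, of "\<lambda>h. lk h w"] that by (simp add: hm_right_s[OF z] lookup_Rop)
    then show ?thesis using q_nz by (simp only: mult_cancel_left simp_thms)
  qed
  show "\<forall>w\<in>G. lk z (w \<circ> s i) = lk z w"
  proof
    fix w assume w: "w \<in> G"
    show "lk z (w \<circ> s i) = lk z w"
    proof (cases "w i < w (i + 1)")
      case True then show ?thesis by (rule up[OF w])
    next
      case False
      then have "(w \<circ> s i) i < (w \<circ> s i) (i + 1)"
        using G_neq_Suc[OF w, of i] by (simp add: s_at s_at_Suc)
      from up[OF G_comp[OF w G_s] this] show ?thesis by (simp only: comp_s_s)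
    qed
  qed
next
  assume a: "\<forall>w\<in>G. lk z (w \<circ> s i) = lk z w"
  show "z \<star> T (s i) = hscale q z"
  proof (rule poly_mapping_eqI)
    fix w
    show "lk (z \<star> T (s i)) w = lk (hscale q z) w"
    proof (cases "w \<in> G")
      case True
      have "lk z (w \<circ> s i) = lk z w" using a True by blast
      then show ?thesis using True unfolding hm_right_s[OF z] by (simp add: lookup_Rop algebra_simps)
    next
      case False
      then show ?thesis using z unfolding hm_right_s[OF z] by (simp add: lookup_Rop Hecke_iff)
    qed
  qed
qed

end

context affine_n
begin

abbreviation "xl \<equiv> xelt n r"

text \<open>Constancy on cosets of a Young subgroup characterizes the ideals \<open>xl l \<star> h\<close> (\<open>linv_generated\<close>) without
  reference to generators.\<close>

definition linv :: "seq \<Rightarrow> hecke \<Rightarrow> bool" where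
  "linv l z \<longleftrightarrow> (\<forall>u\<in>Y l. \<forall>w\<in>G. lk z (u \<circ> w) = lk z w)"

definition rinv :: "seq \<Rightarrow> hecke \<Rightarrow> bool" where
  "rinv l z \<longleftrightarrow> (\<forall>u\<in>Y l. \<forall>w\<in>G. lk z (w \<circ> u) = lk z w)"

lemma linv_iff:
  assumes l: "l \<in> L" and z: "z \<in> Hecke r"
  shows "linv l z \<longleftrightarrow> (\<forall>i. s i \<in> Y l \<longrightarrow> T (s i) \<star> z = hscale q z)"
proof
  assume "linv l z"
  then show "\<forall>i. s i \<in> Y l \<longrightarrow> T (s i) \<star> z = hscale q z"
    unfolding left_inv_iff[OF z] linv_def by blast
next
  assume "\<forall>i. s i \<in> Y l \<longrightarrow> T (s i) \<star> z = hscale q z"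
  then have a: "\<And>i w. s i \<in> Y l \<Longrightarrow> w \<in> G \<Longrightarrow> lk z (s i \<circ> w) = lk z w"
    unfolding left_inv_iff[OF z] by blast
  have "\<forall>w\<in>G. lk z (u \<circ> w) = lk z w" if "u \<in> Y l" for u
    using l that
  proof (induction rule: Y_induct)
    case id show ?case by simp
  next
    case (step u i)
    show "\<forall>w\<in>G. lk z (s i \<circ> u \<circ> w) = lk z w"
    proof
      fix w assume w: "w \<in> G"
      have "lk z (s i \<circ> (u \<circ> w)) = lk z (u \<circ> w)" by (rule a[OF step(2) G_comp[OF Y_G[OF step(1)] w]])
      moreover have "lk z (u \<circ> w) = lk z w" using step(5) w by blast
      ultimately show "lk z (s i \<circ> u \<circ> w) = lk z w" by (simp only: comp_assoc)
    qed
  qed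
  then show "linv l z" by (simp add: linv_def)
qed

lemma rinv_iff:
  assumes l: "l \<in> L" and z: "z \<in> Hecke r"
  shows "rinv l z \<longleftrightarrow> (\<forall>i. s i \<in> Y l \<longrightarrow> z \<star> T (s i) = hscale q z)"
proof
  assume "rinv l z"
  then show "\<forall>i. s i \<in> Y l \<longrightarrow> z \<star> T (s i) = hscale q z"
    unfolding right_inv_iff[OF z] rinv_def by blast
next
  assume "\<forall>i. s i \<in> Y l \<longrightarrow> z \<star> T (s i) = hscale q z"
  then have a: "\<And>i w. s i \<in> Y l \<Longrightarrow> w \<in> G \<Longrightarrow> lk z (w \<circ> s i) = lk z w"
    unfolding right_inv_iff[OF z] by blast
  have "\<forall>w\<in>G. lk z (w \<circ> u) = lk z w" if "u \<in> Y l" for u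
    using l that
  proof (induction rule: Y_induct)
    case id show ?case by simp
  next
    case (step u i)
    show "\<forall>w\<in>G. lk z (w \<circ> (s i \<circ> u)) = lk z w"
    proof
      fix w assume w: "w \<in> G"
      have "lk z ((w \<circ> s i) \<circ> u) = lk z (w \<circ> s i)" using step(5) G_comp[OF w G_s] by blast
      then show "lk z (w \<circ> (s i \<circ> u)) = lk z w" using a[OF step(2) w] by (simp only: comp_assoc)
    qed
  qed
  then show "rinv l z" by (simp add: rinv_def)
qed

lemma rinv_mult_T:
  assumes l: "l \<in> L" and z: "z \<in> Hecke r" and r: "rinv l z" and u: "u \<in> Y l"
  shows "z \<star> T u = hscale (q ^ elen u) z"
  using l u
proof (induction rule: Y_induct)
  case id show "z \<star> T id = hscale (q ^ elen id) z" by (simp only: hm_id_right[OF z] elen_id power_0 hscale_one)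
next
  case (step u i)
  have uG: "u \<in> G" by (rule Y_G[OF step(1)])
  have zs: "z \<star> T (s i) = hscale q z" using r rinv_iff[OF l z] step(2) by blast
  have "T (s i \<circ> u) = T (s i) \<star> T u"
    by (rule hm_T_T[OF G_s uG, symmetric]) (simp only: step(4) elen_s1 add.commute)
  then have "z \<star> T (s i \<circ> u) = z \<star> T (s i) \<star> T u"
    by (simp only: hm_assoc[OF z Hecke_T[OF G_s] Hecke_T[OF uG]])
  also have "\<dots> = hscale q (z \<star> T u)" unfolding zs by (rule hm_scale_left[OF z Hecke_T[OF uG]])
  also have "\<dots> = hscale (q ^ elen (s i \<circ> u)) z"
    unfolding step(5) step(4) hscale_hscale by (simp only: power_add power_one_right mult.commute)
  finally show "z \<star> T (s i \<circ> u) = hscale (q ^ elen (s i \<circ> u)) z" .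
qed

lemma xl_Hecke: "xl l \<in> Hecke r"
  unfolding xelt_def by (rule Hecke_Tsum) (use Y_G in blast)

lemma lookup_xl: "l \<in> L \<Longrightarrow> lk (xl l) w = (if w \<in> Y l then 1 else 0)"
  unfolding xelt_def by (rule lookup_Tsum[OF finite_Y])

lemma linv_xl: "l \<in> L \<Longrightarrow> linv l (xl l)"
  unfolding linv_def
proof (intro ballI)
  fix u w assume l: "l \<in> L" and u: "u \<in> Y l" and w: "w \<in> G"
  have "u \<circ> w \<in> Y l \<longleftrightarrow> w \<in> Y l"
  proof
    assume "u \<circ> w \<in> Y l"
    then have "ipm u \<circ> (u \<circ> w) \<in> Y l" by (rule Y_comp[OF l Y_ipm[OF l u]])
    then show "w \<in> Y l" by (simp only: comp_assoc[symmetric] comp_ipm(2)[OF Y_G[OF u]] id_comp)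
  qed (rule Y_comp[OF l u])
  then show "lk (xl l) (u \<circ> w) = lk (xl l) w" by (simp only: lookup_xl[OF l])
qed

text \<open>The Poincare polynomial of a Young subgroup; at \<open>v = 1\<close> it becomes the order of the group.\<close>

definition PY :: "seq \<Rightarrow> laurent" where "PY l = (\<Sum>u\<in>Y l. q ^ elen u)"

lemma at_one_PY: "at_one (PY l) = int (card (Y l))"
  by (simp add: PY_def at_one_sum at_one_q_power)

lemma PY_nz: "l \<in> L \<Longrightarrow> PY l \<noteq> 0"
proof
  assume l: "l \<in> L" and "PY l = 0"
  then have "card (Y l) = 0" using at_one_PY[of l] by simp
  then show False using finite_Y[OF l] Y_id[OF l] by auto
qed

lemma rinv_mult_xl:
  assumes l: "l \<in> L" and z: "z \<in> Hecke r" and r: "rinv l z"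
  shows "z \<star> xl l = hscale (PY l) z"
proof -
  have "z \<star> xl l = (\<Sum>u\<in>Y l. z \<star> T u)"
    unfolding xelt_def Tsum_def by (rule hm_sum_right[OF _ z]) (simp add: Hecke_T Y_G)
  also have "\<dots> = (\<Sum>u\<in>Y l. hscale (q ^ elen u) z)" by (rule sum.cong) (simp_all add: rinv_mult_T[OF l z r])
  also have "\<dots> = hscale (PY l) z"
    by (rule poly_mapping_eqI) (simp add: lookup_sum PY_def sum_distrib_right)
  finally show ?thesis .
qed

lemma linv_mult:
  assumes l: "l \<in> L" and z: "z \<in> Hecke r" and h: "h \<in> Hecke r" and i: "linv l z"
  shows "linv l (z \<star> h)"
proof -
  have "T (s i) \<star> (z \<star> h) = hscale q (z \<star> h)" if "s i \<in> Y l" for i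
    using that i linv_iff[OF l z] hm_assoc[OF Hecke_T[OF G_s, of i] z h] by (simp add: hm_scale_left z h)
  then show ?thesis using linv_iff[OF l hm_closed[OF z h]] by blast
qed

lemma rinv_mult:
  assumes l: "l \<in> L" and z: "z \<in> Hecke r" and h: "h \<in> Hecke r" and i: "rinv l z"
  shows "rinv l (h \<star> z)"
proof -
  have "(h \<star> z) \<star> T (s i) = hscale q (h \<star> z)" if "s i \<in> Y l" for i
    using that i rinv_iff[OF l z] hm_assoc[OF h z Hecke_T[OF G_s, of i]] by (simp add: hm_scale_right z h)
  then show ?thesis using rinv_iff[OF l hm_closed[OF h z]] by blast
qed

lemma linv_add: "linv l x \<Longrightarrow> linv l y \<Longrightarrow> linv l (x + y)"
  by (simp add: linv_def lookup_add)
lemma linv_scale: "linv l x \<Longrightarrow> linv l (hscale c x)"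
  by (simp add: linv_def)
lemma linv_zero: "linv l 0"
  by (simp add: linv_def)
lemma linv_diff: "linv l x \<Longrightarrow> linv l y \<Longrightarrow> linv l (x - y)"
  by (simp add: linv_def lookup_minus)

text \<open>Subtract multiples of \<open>xl l \<star> T d\<close> for \<open>d\<close> a shortest element
  of the support, which is necessarily a distinguished coset representative.\<close>

lemma linv_generated:
  assumes l: "l \<in> L" and z: "z \<in> Hecke r" and i: "linv l z"
  shows "\<exists>h\<in>Hecke r. z = xl l \<star> h"
  using z i
proof (induction "card (Poly_Mapping.keys z)" arbitrary: z rule: less_induct)
  case less
  note z = less(2) and i = less(3)
  show ?case
  proof (cases "Poly_Mapping.keys z = {}")
    case True
    then have "z = 0" by simp
    then show ?thesis using hm_zero(1)[OF xl_Hecke] by (intro bexI[of _ 0]) auto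
  next
    case False
    then obtain w0 where w0: "w0 \<in> Poly_Mapping.keys z" by blast
    define d where "d = arg_min elen (\<lambda>x. x \<in> Poly_Mapping.keys z)"
    have d: "d \<in> Poly_Mapping.keys z" unfolding d_def by (rule arg_min_natI[of "\<lambda>x. x \<in> Poly_Mapping.keys z", OF w0])
    have min: "elen d \<le> elen x" if "x \<in> Poly_Mapping.keys z" for x
      unfolding d_def using arg_min_nat_le[of "\<lambda>x. x \<in> Poly_Mapping.keys z" x elen] that by simp
    have dG: "d \<in> G" using d z by (auto simp: Hecke_def)
    have inv: "lk z (u \<circ> d) = lk z d" if "u \<in> Y l" for u using i that dG unfolding linv_def by blast
    have inc: "ipm d j < ipm d (j + 1)" if "s j \<in> Y l" for j
    proof (rule ccontr)
      assume "\<not> ?thesis"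
      then have "ipm d (j + 1) < ipm d j" using G_neq_Suc[OF G_ipm[OF dG], of j] by linarith
      from elen_down_left[OF dG this] have "elen (s j \<circ> d) < elen d" by simp
      moreover have "s j \<circ> d \<in> Poly_Mapping.keys z"
        using d inv[OF that] by (simp only: in_keys_iff not_False_eq_True)
      ultimately show False using min by fastforce
    qed
    note add = Dleft_additive[OF l dG inc]
    have Td: "T d \<in> Hecke r" by (rule Hecke_T[OF dG])
    have xT: "xl l \<star> T d = (\<Sum>u\<in>Y l. T (u \<circ> d))"
    proof -
      have "xl l \<star> T d = (\<Sum>u\<in>Y l. T u \<star> T d)"
        unfolding xelt_def Tsum_def by (rule hm_sum_left[OF _ Td]) (simp add: Hecke_T Y_G)
      also have "\<dots> = (\<Sum>u\<in>Y l. T (u \<circ> d))" by (rule sum.cong) (simp_all add: hm_T_T Y_G dG add)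
      finally show ?thesis .
    qed
    have injd: "u = u'" if "u \<circ> d = u' \<circ> d" for u u'
    proof -
      have "u \<circ> d \<circ> ipm d = u' \<circ> d \<circ> ipm d" using that by simp
      then show ?thesis by (simp only: comp_assoc comp_ipm(1)[OF dG] comp_id)
    qed
    have lx: "lk (xl l \<star> T d) w = (if \<exists>u\<in>Y l. w = u \<circ> d then 1 else 0)" for w
    proof (cases "\<exists>u\<in>Y l. w = u \<circ> d")
      case True
      then obtain u where u: "u \<in> Y l" "w = u \<circ> d" by blast
      have "lk (xl l \<star> T d) w = (\<Sum>v\<in>Y l. if v = u then 1 else 0)"
        unfolding xT lookup_sum by (rule sum.cong) (use injd u in \<open>auto simp: lookup_T\<close>)
      then show ?thesis using u True finite_Y[OF l] by simp
    next
      case False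
      then have "lk (xl l \<star> T d) w = 0"
        unfolding xT lookup_sum by (intro sum.neutral) (auto simp: lookup_T)
      then show ?thesis using False by simp
    qed
    define z' where "z' = z - hscale (lk z d) (xl l \<star> T d)"
    have xTH: "xl l \<star> T d \<in> Hecke r" by (rule hm_closed[OF xl_Hecke Td])
    have z': "z' \<in> Hecke r" unfolding z'_def by (intro Hecke_diff z Hecke_scale xTH)
    have i': "linv l z'" unfolding z'_def
      by (intro linv_diff i linv_scale linv_mult[OF l xl_Hecke Td] linv_xl[OF l])
    have lz': "lk z' w = (if \<exists>u\<in>Y l. w = u \<circ> d then 0 else lk z w)" for w
      unfolding z'_def lookup_minus lookup_hscale lx using inv by auto
    have "Poly_Mapping.keys z' \<subset> Poly_Mapping.keys z"
    proof
      show "Poly_Mapping.keys z' \<subseteq> Poly_Mapping.keys z" by (auto simp: in_keys_iff lz' split: if_splits)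
      have "d = id \<circ> d" by simp
      then have "lk z' d = 0" using lz'[of d] Y_id[OF l] by auto
      then show "Poly_Mapping.keys z' \<noteq> Poly_Mapping.keys z" using d by (auto simp: in_keys_iff)
    qed
    then have "card (Poly_Mapping.keys z') < card (Poly_Mapping.keys z)" by (intro psubset_card_mono) auto
    then obtain h where h: "h \<in> Hecke r" "z' = xl l \<star> h" using less(1)[OF _ z' i'] by blast
    have "z = z' + hscale (lk z d) (xl l \<star> T d)" by (simp add: z'_def)
    also have "\<dots> = xl l \<star> (h + hscale (lk z d) (T d))"
      unfolding h(2) by (simp only: hm_add_right[OF h(1) Hecke_scale[OF Td] xl_Hecke] hm_scale_right[OF xl_Hecke Td])
    finally show ?thesis using Hecke_add[OF h(1) Hecke_scale[OF Td]] by blast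
  qed
qed

abbreviation "M \<equiv> Tmod n r"

lemma Tmod_iff: "t \<in> M \<longleftrightarrow> (\<forall>l. l \<notin> L \<longrightarrow> t l = 0) \<and> (\<forall>l\<in>L. t l \<in> Hecke r \<and> linv l (t l))"
proof -
  have "(\<exists>h\<in>Hecke r. t l = xl l \<star> h) \<longleftrightarrow> t l \<in> Hecke r \<and> linv l (t l)" if l: "l \<in> L" for l
    using linv_generated[OF l] linv_mult[OF l xl_Hecke _ linv_xl[OF l]] hm_closed[OF xl_Hecke] by metis
  then show ?thesis unfolding Tmod_def by auto
qed

lemma Tmod_add: "t \<in> M \<Longrightarrow> t' \<in> M \<Longrightarrow> t + t' \<in> M"
  by (simp add: Tmod_iff linv_add Hecke_add)

lemma Tmod_Hecke: "t \<in> M \<Longrightarrow> t l \<in> Hecke r"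
  by (cases "l \<in> L") (simp_all add: Tmod_iff)

lemma Tmod_mult: "t \<in> M \<Longrightarrow> h \<in> Hecke r \<Longrightarrow> (\<lambda>l. t l \<star> h) \<in> M"
  by (simp add: Tmod_iff linv_mult hm_closed hm_zero)

lemma Tmod_scale: "t \<in> M \<Longrightarrow> (\<lambda>l. hscale c (t l)) \<in> M"
  by (simp add: Tmod_iff linv_scale Hecke_scale)

lemma Tmod_zero: "0 \<in> M"
  by (simp add: Tmod_iff linv_zero)

lemma Tmod_sum: "(\<And>a. a \<in> A \<Longrightarrow> t a \<in> M) \<Longrightarrow> sum t A \<in> M"
  by (induction A rule: infinite_finite_induct) (simp_all add: Tmod_add Tmod_zero)

lemma inj_sum_Tmod: "l \<in> L \<Longrightarrow> x \<in> Hecke r \<Longrightarrow> linv l x \<Longrightarrow> inj_sum l x \<in> M"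
  by (simp add: Tmod_iff inj_sum_def linv_zero)

lemma inj_xl_Tmod: "l \<in> L \<Longrightarrow> inj_sum l (xl l) \<in> M"
  by (simp add: inj_sum_Tmod xl_Hecke linv_xl)

lemma Tmod_decomp:
  assumes t: "t \<in> M" shows "t = (\<Sum>k\<in>L. inj_sum k (t k))"
proof
  fix l
  have "(\<Sum>k\<in>L. inj_sum k (t k)) l = (\<Sum>k\<in>L. if k = l then t k else 0)"
    unfolding sum_fun_apply inj_sum_def by (rule sum.cong) auto
  then show "t l = (\<Sum>k\<in>L. inj_sum k (t k)) l" using finite_L t by (simp add: Tmod_iff)
qed

abbreviation "S \<equiv> Schur n r"

lemma S_M: "f \<in> S \<Longrightarrow> t \<in> M \<Longrightarrow> f t \<in> M"
  by (auto simp: Schur_def)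
lemma S_add: "f \<in> S \<Longrightarrow> t \<in> M \<Longrightarrow> t' \<in> M \<Longrightarrow> f (t + t') = f t + f t'"
  by (simp add: Schur_def)
lemma S_mult: "f \<in> S \<Longrightarrow> t \<in> M \<Longrightarrow> h \<in> Hecke r \<Longrightarrow> f (\<lambda>l. t l \<star> h) = (\<lambda>l. f t l \<star> h)"
  by (simp add: Schur_def)
lemma S_zero: "f \<in> S \<Longrightarrow> f 0 = 0"
  using S_add[of f 0 0] by (simp add: Tmod_zero)
lemma S_sum: "f \<in> S \<Longrightarrow> (\<And>a. a \<in> A \<Longrightarrow> t a \<in> M) \<Longrightarrow> f (sum t A) = (\<Sum>a\<in>A. f (t a))"
proof (induction A rule: infinite_finite_induct)
  case (infinite A) then show ?case by (simp only: sum.infinite S_zero not_False_eq_True)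
next
  case empty then show ?case by (simp only: sum.empty S_zero)
next
  case (insert x A)
  have "f (sum t (insert x A)) = f (t x + sum t A)" using insert(1,2) by (simp only: sum.insert not_False_eq_True)
  also have "\<dots> = f (t x) + f (sum t A)" by (rule S_add[OF insert(4)]) (use insert(5) in \<open>auto intro: Tmod_sum\<close>)
  also have "f (sum t A) = (\<Sum>a\<in>A. f (t a))" by (rule insert(3)[OF insert(4)]) (use insert(5) in blast)
  finally show ?case using insert(1,2) by (simp only: sum.insert not_False_eq_True)
qed

lemma inj_sum_mult: "h \<in> Hecke r \<Longrightarrow> inj_sum k (x \<star> h) = (\<lambda>l. inj_sum k x l \<star> h)"
  by (auto simp: inj_sum_def hm_zero fun_eq_iff)

lemma S_gen:
  assumes f: "f \<in> S" and k: "k \<in> L" and h: "h \<in> Hecke r"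
  shows "f (inj_sum k (xl k \<star> h)) = (\<lambda>l. f (inj_sum k (xl k)) l \<star> h)"
  unfolding inj_sum_mult[OF h] by (rule S_mult[OF f inj_xl_Tmod[OF k] h])

text \<open>The elements \<open>xl k\<close> generate the module under right multiplication.\<close>

lemma S_ext:
  assumes f: "f \<in> S" and f': "f' \<in> S" and e: "\<And>k. k \<in> L \<Longrightarrow> f (inj_sum k (xl k)) = f' (inj_sum k (xl k))"
  shows "f = f'"
proof
  fix t
  show "f t = f' t"
  proof (cases "t \<in> M")
    case False
    then show ?thesis using f f' by (auto simp: Schur_def PiE_def extensional_def)
  next
    case t: True
    have 1: "inj_sum k (t k) \<in> M" if "k \<in> L" for k
      by (rule inj_sum_Tmod[OF that]) (use t that in \<open>auto simp: Tmod_iff\<close>)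
    have 2: "f (inj_sum k (t k)) = f' (inj_sum k (t k))" if k: "k \<in> L" for k
    proof -
      obtain h where h: "h \<in> Hecke r" "t k = xl k \<star> h" using t k unfolding Tmod_def by blast
      show ?thesis unfolding h(2) S_gen[OF f k h(1)] S_gen[OF f' k h(1)] e[OF k] ..
    qed
    have "f (\<Sum>k\<in>L. inj_sum k (t k)) = f' (\<Sum>k\<in>L. inj_sum k (t k))"
    proof -
      have "f (\<Sum>k\<in>L. inj_sum k (t k)) = (\<Sum>k\<in>L. f (inj_sum k (t k)))" by (rule S_sum[OF f 1])
      also have "\<dots> = (\<Sum>k\<in>L. f' (inj_sum k (t k)))" by (rule sum.cong[OF refl 2])
      also have "\<dots> = f' (\<Sum>k\<in>L. inj_sum k (t k))" by (rule S_sum[OF f' 1, symmetric])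
      finally show ?thesis .
    qed
    then show ?thesis by (simp only: Tmod_decomp[OF t, symmetric])
  qed
qed

text \<open>The assignment is well defined because \<open>PY m \<cdot> z h = z xl m h\<close> depends on \<open>xl m h\<close> alone and
  \<open>PY m\<close> can be cancelled.\<close>

lemma schur_exists:
  assumes l: "l \<in> L" and m: "m \<in> L" and z: "z \<in> Hecke r" and zl: "linv l z" and zr: "rinv m z"
  shows "\<exists>f\<in>S. \<forall>k\<in>L. \<forall>h\<in>Hecke r. f (inj_sum k (xl k \<star> h)) = (if k = m then inj_sum l (z \<star> h) else 0)"
proof -
  have wd: "z \<star> h = z \<star> h'" if h: "h \<in> Hecke r" "h' \<in> Hecke r" and e: "xl m \<star> h = xl m \<star> h'" for h h'
  proof -
    have a: "hscale (PY m) (z \<star> h) = z \<star> (xl m \<star> h)" if "h \<in> Hecke r" for h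
      using rinv_mult_xl[OF m z zr] hm_assoc[OF z xl_Hecke that, of m] hm_scale_left[OF z that] by simp
    have "hscale (PY m) (z \<star> h - z \<star> h') = hscale (PY m) (z \<star> h) - hscale (PY m) (z \<star> h')"
      by (rule poly_mapping_eqI) (simp add: lookup_minus algebra_simps)
    also have "\<dots> = 0" using a[OF h(1)] a[OF h(2)] e by simp
    finally have "z \<star> h - z \<star> h' = 0" by (rule hscale_eq_0[OF PY_nz[OF m]])
    then show ?thesis by simp
  qed
  define c where "c = (\<lambda>t::tensor. SOME h. h \<in> Hecke r \<and> t m = xl m \<star> h)"
  have c: "c t \<in> Hecke r" "t m = xl m \<star> c t" if "t \<in> M" for t
  proof -
    have "\<exists>h. h \<in> Hecke r \<and> t m = xl m \<star> h" using that m unfolding Tmod_def by blast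
    from someI_ex[OF this] show "c t \<in> Hecke r" "t m = xl m \<star> c t" unfolding c_def by blast+
  qed
  have cz: "z \<star> c t = z \<star> h" if "t \<in> M" "h \<in> Hecke r" "t m = xl m \<star> h" for t h
    by (rule wd) (use c[OF that(1)] that in auto)
  define f where "f = (\<lambda>t\<in>M. inj_sum l (z \<star> c t))"
  have fM: "f t \<in> M" if "t \<in> M" for t
    using that by (simp add: f_def inj_sum_Tmod l hm_closed z c linv_mult zl)
  have fadd: "f (x + y) = f x + f y" if xy: "x \<in> M" "y \<in> M" for x y
  proof -
    have "z \<star> c (x + y) = z \<star> (c x + c y)"
      by (rule cz[OF Tmod_add[OF xy] Hecke_add]) (use c xy in \<open>auto simp: hm_add_right xl_Hecke\<close>)
    also have "\<dots> = z \<star> c x + z \<star> c y" using c xy by (simp add: hm_add_right z)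
    finally show ?thesis using xy by (auto simp: f_def Tmod_add inj_sum_def fun_eq_iff)
  qed
  have fmul: "f (\<lambda>l. x l \<star> h) = (\<lambda>l. f x l \<star> h)" if x: "x \<in> M" and h: "h \<in> Hecke r" for x h
  proof -
    have "z \<star> c (\<lambda>l. x l \<star> h) = z \<star> (c x \<star> h)"
      by (rule cz[OF Tmod_mult[OF x h] hm_closed[OF c(1)[OF x] h]])
        (simp add: c(2)[OF x] hm_assoc[OF xl_Hecke c(1)[OF x] h])
    also have "\<dots> = z \<star> c x \<star> h" by (rule hm_assoc[OF z c(1)[OF x] h, symmetric])
    finally show ?thesis using x by (auto simp: f_def Tmod_mult[OF x h] inj_sum_def fun_eq_iff hm_zero(2)[OF h])
  qed
  have fS: "f \<in> S"
    unfolding Schur_def using fM fadd fmul by (auto simp: f_def)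
  moreover have "f (inj_sum k (xl k \<star> h)) = (if k = m then inj_sum l (z \<star> h) else 0)" if k: "k \<in> L" and h: "h \<in> Hecke r" for k h
  proof -
    let ?t = "inj_sum k (xl k \<star> h)"
    have t: "?t \<in> M" by (rule inj_sum_Tmod[OF k hm_closed[OF xl_Hecke h] linv_mult[OF k xl_Hecke h linv_xl[OF k]]])
    show ?thesis
    proof (cases "k = m")
      case True
      have "z \<star> c ?t = z \<star> h" by (rule cz[OF t h]) (simp add: inj_sum_def True)
      then show ?thesis using t True by (simp add: f_def)
    next
      case False
      have "z \<star> c ?t = z \<star> 0" by (rule cz[OF t Hecke_zero]) (use False in \<open>simp add: inj_sum_def hm_zero(1)[OF xl_Hecke]\<close>)
      then show ?thesis using t False by (auto simp: f_def hm_zero(1)[OF z] inj_sum_def fun_eq_iff)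
    qed
  qed
  ultimately show ?thesis by blast
qed

subsection \<open>The basis indexed by matrices\<close>

abbreviation "Th \<equiv> Theta_r n r"
abbreviation "DA A \<equiv> Dset (ro A) A (co A)"

lemma DA_G: "d \<in> DA A \<Longrightarrow> d \<in> G" by (simp add: Dset_def)

lemma dcoset_inv:
  assumes l: "l \<in> L" and m: "m \<in> L" and u: "u \<in> Y l" and v: "v \<in> Y m" and x: "x \<in> G"
  shows "mat_of n r l (u \<circ> x \<circ> v) m = mat_of n r l x m"
proof -
  have "u \<circ> x \<circ> v \<in> dcoset n r l x m" using u v unfolding dcoset_def by blast
  then show ?thesis unfolding dcoset_eq[OF l m x] Dset_def by blast
qed

lemma Dset_linv: "l \<in> L \<Longrightarrow> m \<in> L \<Longrightarrow> linv l (Tsum (Dset l A m))"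
  unfolding linv_def
proof (intro ballI)
  fix u w assume l: "l \<in> L" and m: "m \<in> L" and u: "u \<in> Y l" and w: "w \<in> G"
  have "mat_of n r l (u \<circ> w) m = mat_of n r l w m"
    using dcoset_inv[OF l m u Y_id[OF m] w] by (simp only: comp_id)
  then have "u \<circ> w \<in> Dset l A m \<longleftrightarrow> w \<in> Dset l A m"
    using w G_comp[OF Y_G[OF u] w] unfolding Dset_def by (simp only: mem_Collect_eq)
  then show "lk (Tsum (Dset l A m)) (u \<circ> w) = lk (Tsum (Dset l A m)) w"
    by (simp only: lookup_Tsum[OF finite_Dset[OF l m]])
qed

lemma Dset_rinv: "l \<in> L \<Longrightarrow> m \<in> L \<Longrightarrow> rinv m (Tsum (Dset l A m))"
  unfolding rinv_def
proof (intro ballI)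
  fix u w assume l: "l \<in> L" and m: "m \<in> L" and u: "u \<in> Y m" and w: "w \<in> G"
  have "mat_of n r l (w \<circ> u) m = mat_of n r l w m"
    using dcoset_inv[OF l m Y_id[OF l] u w] by (simp only: id_comp)
  then have "w \<circ> u \<in> Dset l A m \<longleftrightarrow> w \<in> Dset l A m"
    using w G_comp[OF w Y_G[OF u]] unfolding Dset_def by (simp only: mem_Collect_eq)
  then show "lk (Tsum (Dset l A m)) (w \<circ> u) = lk (Tsum (Dset l A m)) w"
    by (simp only: lookup_Tsum[OF finite_Dset[OF l m]])
qed

lemma Dset_Hecke: "Tsum (Dset l A m) \<in> Hecke r"
  by (rule Hecke_Tsum) (auto simp: Dset_def)

lemma phi_spec:
  assumes l: "l \<in> L" and m: "m \<in> L" and d: "d \<in> G"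
  shows "phi n r l d m \<in> S \<and> (\<forall>k\<in>L. \<forall>h\<in>Hecke r. phi n r l d m (inj_sum k (xl k \<star> h)) =
     (if k = m then inj_sum l (Tsum (dcoset n r l d m) \<star> h) else 0))"
proof -
  have e: "dcoset n r l d m = Dset l (mat_of n r l d m) m" by (rule dcoset_eq[OF l m d])
  let ?P = "\<lambda>f. f \<in> S \<and> (\<forall>k\<in>L. \<forall>h\<in>Hecke r. f (inj_sum k (xl k \<star> h)) =
     (if k = m then inj_sum l (Tsum (dcoset n r l d m) \<star> h) else 0))"
  have ex: "\<exists>f. ?P f"
    using schur_exists[OF l m Dset_Hecke Dset_linv[OF l m] Dset_rinv[OF l m], of "mat_of n r l d m"]
    unfolding e by blast
  moreover have "f = f'" if "?P f" "?P f'" for f f'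
  proof (rule S_ext)
    show "f \<in> S" "f' \<in> S" using that by auto
    fix k assume k: "k \<in> L"
    show "f (inj_sum k (xl k)) = f' (inj_sum k (xl k))"
      using that k Hecke_T[OF G_id] hm_id_right[OF xl_Hecke, of k] by metis
  qed
  ultimately have "\<exists>!f. ?P f" by blast
  from theI'[OF this] show ?thesis unfolding phi_def .
qed

lemma ebasis_spec:
  assumes A: "A \<in> Th"
  shows "ebasis n r A \<in> S" and "k \<in> L \<Longrightarrow> h \<in> Hecke r \<Longrightarrow>
    ebasis n r A (inj_sum k (xl k \<star> h)) = (if k = co A then inj_sum (ro A) (Tsum (DA A) \<star> h) else 0)"
proof -
  note lm = Theta_r_L[OF A]
  obtain w where w: "w \<in> G" "mat_of n r (ro A) w (co A) = A" using mat_of_surj[OF A] by blast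
  obtain d where d: "d \<in> Ddouble n r (ro A) (co A)" "d \<in> G" "mat_of n r (ro A) d (co A) = A"
    using Ddouble_exists[OF lm w(1)] w(2) by auto
  have "ebasis n r A = phi n r (ro A) d (co A)"
    unfolding ebasis_def
  proof (rule the_equality)
    show "\<exists>l\<in>L. \<exists>m\<in>L. \<exists>d'\<in>Ddouble n r l m. mat_of n r l d' m = A \<and> phi n r (ro A) d (co A) = phi n r l d' m"
      using lm d by blast
    fix f assume "\<exists>l\<in>L. \<exists>m\<in>L. \<exists>d'\<in>Ddouble n r l m. mat_of n r l d' m = A \<and> f = phi n r l d' m"
    then obtain l m d' where *: "l \<in> L" "m \<in> L" "d' \<in> Ddouble n r l m" "mat_of n r l d' m = A" "f = phi n r l d' m"
      by blast
    have d'G: "d' \<in> G" by (rule Ddouble_G[OF *(3)])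
    have lm': "l = ro A" "m = co A" using ro_mat_of[OF *(1,2) d'G] co_mat_of[OF *(1,2) d'G] *(4) by auto
    have "dcoset n r (ro A) d' (co A) = dcoset n r (ro A) d (co A)"
      using dcoset_eq[OF lm d'G] dcoset_eq[OF lm d(2)] *(4) lm' d(3) by simp
    then show "f = phi n r (ro A) d (co A)" unfolding *(5) lm' phi_def by simp
  qed
  then show "ebasis n r A \<in> S" and "k \<in> L \<Longrightarrow> h \<in> Hecke r \<Longrightarrow>
    ebasis n r A (inj_sum k (xl k \<star> h)) = (if k = co A then inj_sum (ro A) (Tsum (DA A) \<star> h) else 0)"
    using phi_spec[OF lm d(2)] dcoset_eq[OF lm d(2)] d(3) by auto
qed

lemma lincomb_S:
  assumes b: "\<And>C. C \<in> Poly_Mapping.keys g \<Longrightarrow> b C \<in> S"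
  shows "schur_lincomb n r g b \<in> S"
proof -
  let ?K = "Poly_Mapping.keys g"
  let ?F = "\<lambda>x. \<lambda>l. \<Sum>C\<in>?K. hscale (lk g C) (b C x l)"
  have FM: "?F x \<in> M" if x: "x \<in> M" for x
  proof -
    have "?F x = (\<Sum>C\<in>?K. (\<lambda>l. hscale (lk g C) (b C x l)))" by (auto simp: sum_fun_apply)
    moreover have "(\<Sum>C\<in>?K. (\<lambda>l. hscale (lk g C) (b C x l))) \<in> M"
    proof (rule Tmod_sum)
      fix C assume "C \<in> ?K"
      from Tmod_scale[OF S_M[OF b[OF this] x], of "lk g C"] show "(\<lambda>l. hscale (lk g C) (b C x l)) \<in> M" .
    qed
    ultimately show ?thesis by (simp only:)
  qed
  have "?F (x + y) = ?F x + ?F y" if "x \<in> M" "y \<in> M" for x y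
    using S_add[OF b that] by (auto simp: fun_eq_iff hscale_add sum.distrib)
  moreover have "?F (\<lambda>l. x l \<star> h) = (\<lambda>l. ?F x l \<star> h)" if x: "x \<in> M" and h: "h \<in> Hecke r" for x h
  proof
    fix l
    have H: "b C x l \<in> Hecke r" if "C \<in> ?K" for C by (rule Tmod_Hecke[OF S_M[OF b[OF that] x]])
    have "?F (\<lambda>l. x l \<star> h) l = (\<Sum>C\<in>?K. hscale (lk g C) (b C x l \<star> h))"
      by (rule sum.cong) (simp_all add: S_mult[OF b x h])
    also have "\<dots> = (\<Sum>C\<in>?K. hscale (lk g C) (b C x l)) \<star> h"
      by (subst hm_sum_left[OF _ h]) (auto simp: H Hecke_scale hm_scale_left[OF H h])
    finally show "?F (\<lambda>l. x l \<star> h) l = (\<lambda>l. ?F x l \<star> h) l" .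
  qed
  ultimately show ?thesis unfolding Schur_def schur_lincomb_def
    using FM by (auto simp: Tmod_add Tmod_mult)
qed

lemma vpow_nz: "vpow k \<noteq> 0" by (simp add: vpow_def)

lemma nbasis_S: "A \<in> Th \<Longrightarrow> nbasis n r A \<in> S"
  unfolding nbasis_def by (rule lincomb_S) (auto simp: ebasis_spec split: if_splits)

lemma nbasis_apply: "t \<in> M \<Longrightarrow> nbasis n r A t = (\<lambda>l. hscale (vpow (- dA n A)) (ebasis n r A t l))"
  by (auto simp: nbasis_def schur_lincomb_def vpow_nz)

lemma nbasis_gen:
  assumes A: "A \<in> Th" and k: "k \<in> L" and h: "h \<in> Hecke r"
  shows "nbasis n r A (inj_sum k (xl k \<star> h)) =
    (if k = co A then inj_sum (ro A) (hscale (vpow (- dA n A)) (Tsum (DA A) \<star> h)) else 0)"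
proof -
  have "inj_sum k (xl k \<star> h) \<in> M"
    by (rule inj_sum_Tmod[OF k hm_closed[OF xl_Hecke h] linv_mult[OF k xl_Hecke h linv_xl[OF k]]])
  then show ?thesis using ebasis_spec(2)[OF A k h] by (auto simp: nbasis_apply inj_sum_def fun_eq_iff)
qed

lemma nbasis_gen1:
  assumes A: "A \<in> Th" and k: "k \<in> L"
  shows "nbasis n r A (inj_sum k (xl k)) =
    (if k = co A then inj_sum (ro A) (hscale (vpow (- dA n A)) (Tsum (DA A))) else 0)"
  using nbasis_gen[OF A k Hecke_T[OF G_id]] by (simp only: hm_id_right[OF xl_Hecke] hm_id_right[OF Dset_Hecke])

lemma DA_iff: "l \<in> L \<Longrightarrow> m \<in> L \<Longrightarrow> c \<in> G \<Longrightarrow> ro C = l \<Longrightarrow> co C = m \<Longrightarrow> c \<in> DA C \<longleftrightarrow> C = mat_of n r l c m"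
  by (auto simp: Dset_def)

text \<open>Double cosets are disjoint, so the coefficients of a linear combination of basis elements can be
  read off its values on the generators.\<close>

lemma lincomb_gen:
  assumes g: "Poly_Mapping.keys g \<subseteq> Th" and k: "k \<in> L" and l: "l \<in> L" and c: "c \<in> G"
  shows "lk (schur_lincomb n r g (nbasis n r) (inj_sum k (xl k)) l) c =
    lk g (mat_of n r l c k) * vpow (- dA n (mat_of n r l c k))"
proof -
  let ?K = "Poly_Mapping.keys g" and ?C = "mat_of n r l c k"
  have rc: "ro ?C = l" "co ?C = k" using ro_mat_of[OF l k c] co_mat_of[OF l k c] by auto
  have "lk (schur_lincomb n r g (nbasis n r) (inj_sum k (xl k)) l) c
     = (\<Sum>C\<in>?K. lk g C * lk (nbasis n r C (inj_sum k (xl k)) l) c)"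
    by (simp add: schur_lincomb_def inj_xl_Tmod[OF k] lookup_sum)
  also have "\<dots> = (\<Sum>C\<in>?K. if C = ?C then lk g C * vpow (- dA n C) else 0)"
  proof (rule sum.cong)
    fix C assume C: "C \<in> ?K"
    then have CT: "C \<in> Th" using g by blast
    note lmC = Theta_r_L[OF CT]
    show "lk g C * lk (nbasis n r C (inj_sum k (xl k)) l) c = (if C = ?C then lk g C * vpow (- dA n C) else 0)"
    proof (cases "co C = k \<and> ro C = l")
      case True
      then have "nbasis n r C (inj_sum k (xl k)) l = hscale (vpow (- dA n C)) (Tsum (DA C))"
        using nbasis_gen1[OF CT k] by (simp add: inj_sum_def)
      moreover have "c \<in> DA C \<longleftrightarrow> C = ?C" by (rule DA_iff[OF l k c]) (use True in auto)
      ultimately show ?thesis by (simp add: lookup_Tsum[OF finite_Dset[OF lmC]])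
    next
      case False
      then have "lk (nbasis n r C (inj_sum k (xl k)) l) c = 0"
        using nbasis_gen1[OF CT k] by (auto simp: inj_sum_def)
      moreover have "C \<noteq> ?C" using False rc by auto
      ultimately show ?thesis by simp
    qed
  qed simp
  also have "\<dots> = lk g ?C * vpow (- dA n ?C)" by (simp add: in_keys_iff)
  finally show ?thesis .
qed

lemma Tsum_factor:
  assumes A: "A \<in> Th" shows "\<exists>h\<in>Hecke r. Tsum (DA A) = xl (ro A) \<star> h"
  by (rule linv_generated[OF Theta_r_L(1)[OF A] Dset_Hecke Dset_linv[OF Theta_r_L[OF A]]])

text \<open>The product of two double coset sums is invariant on both sides, hence a combination of double coset
  sums, and each coefficient is read off at one representative \<open>c\<close>. At \<open>v = 1\<close> the multiplication is that of the
  group ring, and the factor \<open>PY (ro A)\<close> of the product becomes the order of the Young subgroup.\<close>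

theorem schur_struct_at_one:
  assumes A: "A \<in> Th" and B: "B \<in> Th" and BA: "co B = ro A"
  shows "Poly_Mapping.keys (schur_struct n r B A) \<subseteq> {C \<in> Th. ro C = ro B \<and> co C = co A}"
    and "C \<in> Th \<Longrightarrow> ro C = ro B \<Longrightarrow> co C = co A \<Longrightarrow> c \<in> DA C \<Longrightarrow>
      int (card (Y (ro A))) * at_one (lk (schur_struct n r B A) C) = int (card {b \<in> DA B. ipm b \<circ> c \<in> DA A})"
proof -
  note lA = Theta_r_L[OF A] and lB = Theta_r_L[OF B]
  obtain h where h: "h \<in> Hecke r" "Tsum (DA A) = xl (ro A) \<star> h" using Tsum_factor[OF A] by blast
  \<comment> \<open>the product of the two double coset sums, with the redundant factor \<open>PY (ro A)\<close> divided out\<close>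
  define y where "y = Tsum (DA B) \<star> h"
  have yH: "y \<in> Hecke r" unfolding y_def by (rule hm_closed[OF Dset_Hecke h(1)])
  have prod: "Tsum (DA B) \<star> Tsum (DA A) = hscale (PY (ro A)) y"
  proof -
    have "Tsum (DA B) \<star> xl (ro A) = hscale (PY (ro A)) (Tsum (DA B))"
      by (rule rinv_mult_xl[OF lA(1) Dset_Hecke]) (use Dset_rinv[OF lB] BA in simp)
    then show ?thesis unfolding h(2) y_def
      by (simp only: hm_assoc[OF Dset_Hecke xl_Hecke h(1), symmetric] hm_scale_left[OF Dset_Hecke h(1)])
  qed
  have yl: "linv (ro B) y" unfolding y_def by (rule linv_mult[OF lB(1) Dset_Hecke h(1) Dset_linv[OF lB]])
  have yr: "rinv (co A) y"
  proof -
    have *: "rinv (co A) (hscale (PY (ro A)) y)" unfolding prod[symmetric]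
      by (rule rinv_mult[OF lA(2) Dset_Hecke Dset_Hecke Dset_rinv[OF lA]])
    show ?thesis unfolding rinv_def
    proof (intro ballI)
      fix u w assume u: "u \<in> Y (co A)" "w \<in> G"
      have "lk (hscale (PY (ro A)) y) (w \<circ> u) = lk (hscale (PY (ro A)) y) w" using * u unfolding rinv_def by blast
      then have "PY (ro A) * lk y (w \<circ> u) = PY (ro A) * lk y w" by (simp only: lookup_hscale)
      then show "lk y (w \<circ> u) = lk y w" using PY_nz[OF lA(1)] by (simp only: mult_cancel_left simp_thms)
    qed
  qed
  have yconst: "lk y c = lk y c'" if "c \<in> G" "c' \<in> G" "mat_of n r (ro B) c (co A) = mat_of n r (ro B) c' (co A)" for c c'
  proof -
    have "c' \<in> dcoset n r (ro B) c (co A)" using that dcoset_eq[OF lB(1) lA(2) that(1)] by (simp add: Dset_def)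
    then obtain u v where uv: "u \<in> Y (ro B)" "v \<in> Y (co A)" "c' = u \<circ> c \<circ> v" unfolding dcoset_def by blast
    have "lk y (u \<circ> c \<circ> v) = lk y (u \<circ> c)" using yr uv G_comp[OF Y_G[OF uv(1)] that(1)] unfolding rinv_def by blast
    also have "\<dots> = lk y c" using yl uv that(1) unfolding linv_def by blast
    finally show ?thesis by (simp only: uv(3))
  qed
  let ?cond = "\<lambda>g. Poly_Mapping.keys g \<subseteq> Th \<and>
     compose M (nbasis n r B) (nbasis n r A) = schur_lincomb n r g (nbasis n r)"
  let ?v = "vpow (- dA n A - dA n B)"
  have compS: "compose M (nbasis n r B) (nbasis n r A) \<in> S"
    using nbasis_S[OF A] nbasis_S[OF B]
    by (auto simp: Schur_def compose_def Tmod_add Tmod_mult PiE_def Pi_def)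
  have comp_gen: "compose M (nbasis n r B) (nbasis n r A) (inj_sum k (xl k)) l
      = (if k = co A \<and> l = ro B then hscale ?v y else 0)" if k: "k \<in> L" for k l
  proof -
    have "compose M (nbasis n r B) (nbasis n r A) (inj_sum k (xl k)) = nbasis n r B (nbasis n r A (inj_sum k (xl k)))"
      by (simp add: compose_def inj_xl_Tmod k)
    also have "\<dots> = (if k = co A then inj_sum (ro B) (hscale ?v y) else 0)"
    proof (cases "k = co A")
      case True
      have "nbasis n r A (inj_sum k (xl k)) = inj_sum (ro A) (xl (ro A) \<star> hscale (vpow (- dA n A)) h)"
        using nbasis_gen1[OF A k] True by (simp add: h(2) hm_scale_right[OF xl_Hecke h(1)])
      then have "nbasis n r B (nbasis n r A (inj_sum k (xl k)))
          = inj_sum (ro B) (hscale (vpow (- dA n B)) (Tsum (DA B) \<star> hscale (vpow (- dA n A)) h))"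
        using nbasis_gen[OF B lA(1) Hecke_scale[OF h(1)]] BA by simp
      also have "\<dots> = inj_sum (ro B) (hscale ?v y)"
        unfolding hm_scale_right[OF Dset_Hecke h(1)] hscale_hscale vpow_mult y_def by (simp add: algebra_simps)
      finally show ?thesis using True by simp
    next
      case False
      then show ?thesis using nbasis_gen1[OF A k] S_zero[OF nbasis_S[OF B]] by simp
    qed
    finally show ?thesis by (auto simp: inj_sum_def)
  qed
  \<comment> \<open>comparing values on generators turns the defining equation into one equation per double coset\<close>
  have key: "?cond g \<longleftrightarrow> Poly_Mapping.keys g \<subseteq> Th \<and> (\<forall>k\<in>L. \<forall>l\<in>L. \<forall>c\<in>G.
      lk g (mat_of n r l c k) * vpow (- dA n (mat_of n r l c k))
        = (if k = co A \<and> l = ro B then ?v * lk y c else 0))" (is "_ \<longleftrightarrow> ?rhs g") for g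
  proof
    assume a: "?cond g"
    have "lk g (mat_of n r l c k) * vpow (- dA n (mat_of n r l c k))
        = (if k = co A \<and> l = ro B then ?v * lk y c else 0)" if "k \<in> L" "l \<in> L" "c \<in> G" for k l c
    proof -
      have "lk (compose M (nbasis n r B) (nbasis n r A) (inj_sum k (xl k)) l) c
          = lk g (mat_of n r l c k) * vpow (- dA n (mat_of n r l c k))"
        using lincomb_gen[OF conjunct1[OF a] that] a by simp
      then show ?thesis unfolding comp_gen[OF that(1)] by (auto split: if_splits)
    qed
    then show "?rhs g" using a by blast
  next
    assume a: "?rhs g"
    have gT: "Poly_Mapping.keys g \<subseteq> Th" using a by blast
    have lS: "schur_lincomb n r g (nbasis n r) \<in> S" by (rule lincomb_S) (use gT nbasis_S in blast)
    have "compose M (nbasis n r B) (nbasis n r A) = schur_lincomb n r g (nbasis n r)"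
    proof (rule S_ext[OF compS lS])
      fix k assume k: "k \<in> L"
      show "compose M (nbasis n r B) (nbasis n r A) (inj_sum k (xl k)) = schur_lincomb n r g (nbasis n r) (inj_sum k (xl k))"
      proof
        fix l
        show "compose M (nbasis n r B) (nbasis n r A) (inj_sum k (xl k)) l = schur_lincomb n r g (nbasis n r) (inj_sum k (xl k)) l"
        proof (cases "l \<in> L")
          case False
          then show ?thesis using S_M[OF compS inj_xl_Tmod[OF k]] S_M[OF lS inj_xl_Tmod[OF k]] by (simp add: Tmod_iff)
        next
          case l: True
          show ?thesis
          proof (rule poly_mapping_eqI)
            fix c
            show "lk (compose M (nbasis n r B) (nbasis n r A) (inj_sum k (xl k)) l) c
               = lk (schur_lincomb n r g (nbasis n r) (inj_sum k (xl k)) l) c"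
            proof (cases "c \<in> G")
              case True
              have "lk g (mat_of n r l c k) * vpow (- dA n (mat_of n r l c k))
                  = (if k = co A \<and> l = ro B then ?v * lk y c else 0)" using a k l True by blast
              then show ?thesis unfolding comp_gen[OF k] lincomb_gen[OF gT k l True] by simp
            next
              case False
              then show ?thesis using Tmod_Hecke[OF S_M[OF compS inj_xl_Tmod[OF k]], of l]
                  Tmod_Hecke[OF S_M[OF lS inj_xl_Tmod[OF k]], of l] by (simp add: Hecke_iff)
            qed
          qed
        qed
      qed
    qed
    then show "?cond g" using gT by blast
  qed
  let ?f = "\<lambda>C. if C \<in> Th \<and> ro C = ro B \<and> co C = co A then vpow (dA n C - dA n A - dA n B) * lk y (SOME c. c \<in> DA C) else 0"
  define g0 where "g0 = Abs_poly_mapping ?f"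
  have some: "(SOME c. c \<in> DA C) \<in> DA C" if "C \<in> Th" for C
  proof -
    obtain d where "d \<in> G" "mat_of n r (ro C) d (co C) = C" using mat_of_surj[OF \<open>C \<in> Th\<close>] by blast
    then have "d \<in> DA C" by (simp add: Dset_def)
    then show ?thesis by (rule someI[of "\<lambda>c. c \<in> DA C"])
  qed
  have fin: "finite {C. ?f C \<noteq> 0}"
  proof -
    have "{C. ?f C \<noteq> 0} \<subseteq> (\<lambda>c. mat_of n r (ro B) c (co A)) ` Poly_Mapping.keys y"
    proof
      fix C assume "C \<in> {C. ?f C \<noteq> 0}"
      then have C: "C \<in> Th" "ro C = ro B" "co C = co A" "lk y (SOME c. c \<in> DA C) \<noteq> 0" by (auto split: if_splits)
      show "C \<in> (\<lambda>c. mat_of n r (ro B) c (co A)) ` Poly_Mapping.keys y"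
        using some[OF C(1)] C by (intro image_eqI[of _ _ "SOME c. c \<in> DA C"]) (auto simp: Dset_def in_keys_iff)
    qed
    then show ?thesis by (rule finite_subset) simp
  qed
  have g0: "lk g0 C = ?f C" for C unfolding g0_def using lookup_Abs_poly_mapping[OF fin] by simp
  have g0_keys: "Poly_Mapping.keys g0 \<subseteq> {C \<in> Th. ro C = ro B \<and> co C = co A}"
    by (auto simp: in_keys_iff g0 split: if_splits)
  have g0_val: "lk g0 C = vpow (dA n C - dA n A - dA n B) * lk y c"
    if C: "C \<in> Th" "ro C = ro B" "co C = co A" and c: "c \<in> DA C" for C c
  proof -
    have "lk y (SOME c. c \<in> DA C) = lk y c"
      by (rule yconst) (use some[OF C(1)] c C in \<open>auto simp: Dset_def\<close>)
    then show ?thesis using C by (simp add: g0)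
  qed
  have g0_cond: "?rhs g0"
  proof (intro conjI ballI)
    show "Poly_Mapping.keys g0 \<subseteq> Th" using g0_keys by blast
    fix k l c assume klc: "k \<in> L" "l \<in> L" "c \<in> G"
    let ?C = "mat_of n r l c k"
    have C: "?C \<in> Th" "ro ?C = l" "co ?C = k" using mat_of_Theta_r ro_mat_of co_mat_of klc by auto
    show "lk g0 ?C * vpow (- dA n ?C) = (if k = co A \<and> l = ro B then ?v * lk y c else 0)"
    proof (cases "k = co A \<and> l = ro B")
      case True
      have "lk g0 ?C = vpow (dA n ?C - dA n A - dA n B) * lk y c"
        by (rule g0_val) (use C True klc in \<open>auto simp: Dset_def\<close>)
      then have "lk g0 ?C * vpow (- dA n ?C) = (vpow (dA n ?C - dA n A - dA n B) * vpow (- dA n ?C)) * lk y c"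
        by (simp only: mult.commute mult.left_commute)
      then show ?thesis using True unfolding vpow_mult by simp
    next
      case False
      then show ?thesis using C by (auto simp: g0)
    qed
  qed
  have uniq: "g = g0" if "?rhs g" for g
  proof (rule poly_mapping_eqI)
    fix C
    show "lk g C = lk g0 C"
    proof (cases "C \<in> Th")
      case False
      then have "C \<notin> Poly_Mapping.keys g" "C \<notin> Poly_Mapping.keys g0" using that g0_cond by blast+
      then show ?thesis by (simp add: in_keys_iff)
    next
      case True
      obtain d where d: "d \<in> G" "mat_of n r (ro C) d (co C) = C" using mat_of_surj[OF True] by blast
      note lC = Theta_r_L[OF True]
      have "lk g C * vpow (- dA n C) = (if co C = co A \<and> ro C = ro B then ?v * lk y d else 0)"
        using that lC d(1) d(2) by metis
      moreover have "lk g0 C * vpow (- dA n C) = (if co C = co A \<and> ro C = ro B then ?v * lk y d else 0)"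
        using g0_cond lC d(1) d(2) by metis
      ultimately have "lk g C * vpow (- dA n C) = lk g0 C * vpow (- dA n C)" by simp
      then show ?thesis using vpow_nz by (simp only: mult_cancel_right simp_thms)
    qed
  qed
  have st: "schur_struct n r B A = g0"
    unfolding schur_struct_def
  proof (rule the_equality)
    show "?cond g0" using g0_cond unfolding key .
    show "g = g0" if "?cond g" for g using that unfolding key by (rule uniq)
  qed
  show "Poly_Mapping.keys (schur_struct n r B A) \<subseteq> {C \<in> Th. ro C = ro B \<and> co C = co A}"
    unfolding st by (rule g0_keys)
  show "int (card (Y (ro A))) * at_one (lk (schur_struct n r B A) C) = int (card {b \<in> DA B. ipm b \<circ> c \<in> DA A})"
    if C: "C \<in> Th" "ro C = ro B" "co C = co A" and c: "c \<in> DA C"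
  proof -
    have "at_one (lk (schur_struct n r B A) C) = at_one (lk y c)"
      unfolding st g0_val[OF C c] by (simp add: at_one_mult at_one_vpow)
    then have "int (card (Y (ro A))) * at_one (lk (schur_struct n r B A) C)
        = at_one (lk (hscale (PY (ro A)) y) c)"
      by (simp add: at_one_mult at_one_PY)
    also have "\<dots> = (\<Sum>b\<in>Poly_Mapping.keys (Tsum (DA B)). at_one (lk (Tsum (DA B)) b) * at_one (lk (Tsum (DA A)) (ipm b \<circ> c)))"
      unfolding prod[symmetric] by (rule at_one_mult_hm[OF Dset_Hecke Dset_Hecke DA_G[OF c]])
    also have "\<dots> = (\<Sum>b\<in>DA B. if ipm b \<circ> c \<in> DA A then 1 else 0)"
      unfolding keys_Tsum[OF finite_Dset[OF lB]]
      by (rule sum.cong) (simp_all add: lookup_Tsum finite_Dset lA lB at_one_one)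
    also have "\<dots> = int (card {b \<in> DA B. ipm b \<circ> c \<in> DA A})"
      using finite_Dset[OF lB] by (simp add: sum.If_cases Int_def)
    finally show ?thesis .
  qed
qed

end

section \<open>Counting middle labellings\<close>

lemma Sum_any_int: "int (Sum_any (f :: 'a \<Rightarrow> nat)) = Sum_any (\<lambda>x. int (f x))"
  unfolding Sum_any.expand_set by simp

lemma card_fibre_sum_nat: "finite S \<Longrightarrow> Sum_any (\<lambda>j. card {y \<in> S. g y = j}) = card S"
proof -
  assume "finite S"
  then have "int (Sum_any (\<lambda>j. card {y \<in> S. g y = j})) = int (card S)"
    by (simp only: Sum_any_int card_fibre_sum)
  then show ?thesis by simp
qed

lemma Sum_any_split:
  fixes g :: "'a \<Rightarrow> 'b::comm_monoid_add"
  assumes "finite {k. g k \<noteq> 0}"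
  shows "Sum_any g = g i + Sum_any (\<lambda>k. if k = i then 0 else g k)"
proof -
  let ?S = "insert i {k. g k \<noteq> 0}"
  have f: "finite ?S" using assms by simp
  have "Sum_any g = sum g ?S" by (rule Sum_any_eq[OF f]) auto
  also have "\<dots> = g i + sum g (?S - {i})" by (rule sum.remove[OF f]) simp
  also have "sum g (?S - {i}) = sum (\<lambda>k. if k = i then 0 else g k) (?S - {i})" by (rule sum.cong) auto
  also have "\<dots> = Sum_any (\<lambda>k. if k = i then 0 else g k)"
    by (rule Sum_any_eq[symmetric]) (use f in auto)
  finally show ?thesis .
qed

lemma Sum_any_ge_nat:
  fixes g :: "'a \<Rightarrow> nat"
  assumes "finite {k. g k \<noteq> 0}" shows "g i \<le> Sum_any g"
  by (subst Sum_any_split[OF assms, of i]) simp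

lemma Sum_any_zero_nat:
  fixes g :: "'a \<Rightarrow> nat"
  assumes "finite {k. g k \<noteq> 0}" "Sum_any g = 0" shows "g i = 0"
  using Sum_any_ge_nat[OF assms(1), of i] assms(2) by simp

subsection \<open>Functions with prescribed fibres\<close>

definition prescribed :: "int set \<Rightarrow> (int \<Rightarrow> nat) \<Rightarrow> (int \<Rightarrow> int) set" where
  "prescribed Q \<tau> = {\<psi> \<in> extensional Q. \<forall>k. card {z \<in> Q. \<psi> z = k} = \<tau> k}"

text \<open>The multinomial coefficient of \<open>\<tau>\<close>, defined by what it counts so that integrality is free.\<close>

definition msplit :: "(int \<Rightarrow> nat) \<Rightarrow> nat" where
  "msplit \<tau> = card (prescribed {1..int (Sum_any \<tau>)} \<tau>)"

lemma prescribed_sub: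
  assumes Q: "finite Q" shows "prescribed Q \<tau> \<subseteq> Q \<rightarrow>\<^sub>E {k. \<tau> k \<noteq> 0}"
proof
  fix \<psi> assume p: "\<psi> \<in> prescribed Q \<tau>"
  have "\<tau> (\<psi> z) \<noteq> 0" if "z \<in> Q" for z
  proof -
    have "z \<in> {y \<in> Q. \<psi> y = \<psi> z}" using that by simp
    moreover have "finite {y \<in> Q. \<psi> y = \<psi> z}" by (rule finite_subset[OF _ Q]) auto
    ultimately have "0 < card {y \<in> Q. \<psi> y = \<psi> z}" unfolding card_gt_0_iff by (intro conjI) (rule notI, simp only: empty_iff)
    then show ?thesis using p by (simp add: prescribed_def)
  qed
  then show "\<psi> \<in> Q \<rightarrow>\<^sub>E {k. \<tau> k \<noteq> 0}" using p by (auto simp: prescribed_def PiE_def)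
qed

lemma finite_prescribed:
  assumes Q: "finite Q" and t: "finite {k. \<tau> k \<noteq> 0}" shows "finite (prescribed Q \<tau>)"
  by (rule finite_subset[OF prescribed_sub[OF Q]]) (use Q t in \<open>auto intro: finite_PiE\<close>)

lemma card_prescribed_cong:
  assumes b: "bij_betw b Q Q'"
  shows "card (prescribed Q \<tau>) = card (prescribed Q' \<tau>)"
proof -
  have inv: "bij_betw (inv_into Q b) Q' Q" by (rule bij_betw_inv_into[OF b])
  have maps: "(\<lambda>\<psi>. \<lambda>z\<in>Q. \<psi> (b z)) ` prescribed Q' \<tau> \<subseteq> prescribed Q \<tau>"
    if b: "bij_betw b Q Q'" for b Q Q'
  proof
    fix \<phi> assume "\<phi> \<in> (\<lambda>\<psi>. \<lambda>z\<in>Q. \<psi> (b z)) ` prescribed Q' \<tau>"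
    then obtain \<psi> where p: "\<psi> \<in> prescribed Q' \<tau>" "\<phi> = (\<lambda>z\<in>Q. \<psi> (b z))" by blast
    have "card {z \<in> Q. \<phi> z = k} = \<tau> k" for k
    proof -
      have "bij_betw b {z \<in> Q. \<phi> z = k} {z \<in> Q'. \<psi> z = k}"
        unfolding bij_betw_def
      proof
        show "inj_on b {z \<in> Q. \<phi> z = k}" by (rule inj_on_subset[OF bij_betw_imp_inj_on[OF b]]) auto
        show "b ` {z \<in> Q. \<phi> z = k} = {z \<in> Q'. \<psi> z = k}"
          using bij_betw_imp_surj_on[OF b] unfolding p(2) by auto
      qed
      then have "card {z \<in> Q. \<phi> z = k} = card {z \<in> Q'. \<psi> z = k}" by (rule bij_betw_same_card)
      then show ?thesis using p(1) by (simp add: prescribed_def)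
    qed
    then show "\<phi> \<in> prescribed Q \<tau>" using p(2) by (simp add: prescribed_def)
  qed
  have "bij_betw (\<lambda>\<psi>. \<lambda>z\<in>Q. \<psi> (b z)) (prescribed Q' \<tau>) (prescribed Q \<tau>)"
  proof (rule bij_betw_byWitness[where f' = "\<lambda>\<psi>. \<lambda>z\<in>Q'. \<psi> (inv_into Q b z)"])
    show "\<forall>\<psi>\<in>prescribed Q' \<tau>. (\<lambda>z\<in>Q'. (\<lambda>z\<in>Q. \<psi> (b z)) (inv_into Q b z)) = \<psi>"
    proof
      fix \<psi> assume p: "\<psi> \<in> prescribed Q' \<tau>"
      show "(\<lambda>z\<in>Q'. (\<lambda>z\<in>Q. \<psi> (b z)) (inv_into Q b z)) = \<psi>"
      proof
        fix z
        show "(\<lambda>z\<in>Q'. (\<lambda>z\<in>Q. \<psi> (b z)) (inv_into Q b z)) z = \<psi> z"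
        proof (cases "z \<in> Q'")
          case True
          then have "inv_into Q b z \<in> Q" "b (inv_into Q b z) = z"
            using bij_betw_apply[OF inv] bij_betw_inv_into_right[OF b] by auto
          then show ?thesis using True by simp
        next
          case False then show ?thesis using p by (auto simp: prescribed_def extensional_def)
        qed
      qed
    qed
    show "\<forall>\<psi>\<in>prescribed Q \<tau>. (\<lambda>z\<in>Q. (\<lambda>z\<in>Q'. \<psi> (inv_into Q b z)) (b z)) = \<psi>"
    proof
      fix \<psi> assume p: "\<psi> \<in> prescribed Q \<tau>"
      show "(\<lambda>z\<in>Q. (\<lambda>z\<in>Q'. \<psi> (inv_into Q b z)) (b z)) = \<psi>"
      proof
        fix z
        show "(\<lambda>z\<in>Q. (\<lambda>z\<in>Q'. \<psi> (inv_into Q b z)) (b z)) z = \<psi> z"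
        proof (cases "z \<in> Q")
          case True
          then have "b z \<in> Q'" "inv_into Q b (b z) = z"
            using bij_betw_apply[OF b] bij_betw_inv_into_left[OF b] by auto
          then show ?thesis using True by simp
        next
          case False then show ?thesis using p by (auto simp: prescribed_def extensional_def)
        qed
      qed
    qed
  qed (use maps[OF b] maps[OF inv] in auto)
  then show ?thesis by (rule bij_betw_same_card[symmetric])
qed

lemma card_prescribed:
  assumes "finite Q" "card Q = Sum_any \<tau>"
  shows "card (prescribed Q \<tau>) = msplit \<tau>"
proof -
  have "\<exists>b. bij_betw b Q {1..int (Sum_any \<tau>)}"
    by (rule finite_same_card_bij) (use assms in auto)
  then show ?thesis unfolding msplit_def using card_prescribed_cong by blast
qed

lemma msplit_single:
  assumes "\<And>k. k \<noteq> k0 \<Longrightarrow> \<tau> k = 0" shows "msplit \<tau> = 1"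
proof -
  have S: "Sum_any \<tau> = \<tau> k0" using Sum_any_eq[of "{k0}" \<tau>] assms by simp
  let ?Q = "{1..int (\<tau> k0)}"
  have "prescribed ?Q \<tau> = {\<lambda>z\<in>?Q. k0}"
  proof
    show "prescribed ?Q \<tau> \<subseteq> {\<lambda>z\<in>?Q. k0}"
    proof
      fix \<psi> assume p: "\<psi> \<in> prescribed ?Q \<tau>"
      then have "\<psi> \<in> ?Q \<rightarrow>\<^sub>E {k. \<tau> k \<noteq> 0}" using prescribed_sub[of ?Q \<tau>] by auto
      then have "\<psi> z = k0" if "z \<in> ?Q" for z using that assms by (metis (mono_tags) PiE_mem mem_Collect_eq)
      then have "\<psi> = (\<lambda>z\<in>?Q. k0)" using p by (auto simp: prescribed_def extensional_def fun_eq_iff)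
      then show "\<psi> \<in> {\<lambda>z\<in>?Q. k0}" by simp
    qed
    have "card {z \<in> ?Q. (\<lambda>z\<in>?Q. k0) z = k} = \<tau> k" for k
    proof (cases "k = k0")
      case True
      then have "{z \<in> ?Q. (\<lambda>z\<in>?Q. k0) z = k} = ?Q" by auto
      then show ?thesis using True by simp
    next
      case False
      then have e: "{z \<in> ?Q. (\<lambda>z\<in>?Q. k0) z = k} = {}" by auto
      show ?thesis unfolding e using assms[OF False] by simp
    qed
    then show "{\<lambda>z\<in>?Q. k0} \<subseteq> prescribed ?Q \<tau>" by (simp add: prescribed_def)
  qed
  then show ?thesis unfolding msplit_def S by simp
qed

text \<open>Labellings of \<open>P\<close> in which the number of points labelled \<open>d\<close> is whatever is left over.\<close>

definition prescribed_off :: "int \<Rightarrow> int set \<Rightarrow> (int \<Rightarrow> nat) \<Rightarrow> (int \<Rightarrow> int) set" where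
  "prescribed_off d P \<tau> = {\<phi> \<in> extensional P. \<forall>k. k \<noteq> d \<longrightarrow> card {z \<in> P. \<phi> z = k} = \<tau> k}"

text \<open>Choose the points that do not get the default label \<open>d\<close>, then distribute the others.\<close>

lemma card_prescribed_off:
  assumes P: "finite P" and t: "finite {k. \<tau> k \<noteq> 0}" and d: "\<tau> d = 0"
  shows "finite (prescribed_off d P \<tau>)"
    and "card (prescribed_off d P \<tau>) = (card P choose Sum_any \<tau>) * msplit \<tau>"
proof -
  let ?S = "Sum_any \<tau>"
  let ?Q = "{Q. Q \<subseteq> P \<and> card Q = ?S}"
  let ?Z = "SIGMA Q:?Q. prescribed Q \<tau>"
  have fQ: "finite ?Q" by (rule finite_subset[of _ "Pow P"]) (use P in auto)
  have fin: "finite Q" if "Q \<in> ?Q" for Q using that P finite_subset by blast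
  have nd: "\<psi> z \<noteq> d" if "\<psi> \<in> prescribed Q \<tau>" "z \<in> Q" "finite Q" for \<psi> z Q
    using prescribed_sub[OF that(3), of \<tau>] that d by (metis (mono_tags) PiE_mem mem_Collect_eq subsetD)
  have bij: "bij_betw (\<lambda>\<phi>. ({z \<in> P. \<phi> z \<noteq> d}, restrict \<phi> {z \<in> P. \<phi> z \<noteq> d})) (prescribed_off d P \<tau>) ?Z"
  proof (rule bij_betw_byWitness[where f' = "\<lambda>(Q, \<psi>). \<lambda>z\<in>P. if z \<in> Q then \<psi> z else d"])
    show "\<forall>\<phi>\<in>prescribed_off d P \<tau>. (case ({z \<in> P. \<phi> z \<noteq> d}, restrict \<phi> {z \<in> P. \<phi> z \<noteq> d}) of
        (Q, \<psi>) \<Rightarrow> \<lambda>z\<in>P. if z \<in> Q then \<psi> z else d) = \<phi>"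
      by (auto simp: prescribed_off_def extensional_def fun_eq_iff)
    show "\<forall>a\<in>?Z. ({z \<in> P. (case a of (Q, \<psi>) \<Rightarrow> \<lambda>z\<in>P. if z \<in> Q then \<psi> z else d) z \<noteq> d},
        restrict (case a of (Q, \<psi>) \<Rightarrow> \<lambda>z\<in>P. if z \<in> Q then \<psi> z else d)
          {z \<in> P. (case a of (Q, \<psi>) \<Rightarrow> \<lambda>z\<in>P. if z \<in> Q then \<psi> z else d) z \<noteq> d}) = a"
    proof
      fix a assume "a \<in> ?Z"
      then obtain Q \<psi> where a: "a = (Q, \<psi>)" "Q \<in> ?Q" "\<psi> \<in> prescribed Q \<tau>" by auto
      have e: "{z \<in> P. (\<lambda>z\<in>P. if z \<in> Q then \<psi> z else d) z \<noteq> d} = Q"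
        using nd[OF a(3) _ fin[OF a(2)]] a(2) by auto
      have "restrict (\<lambda>z\<in>P. if z \<in> Q then \<psi> z else d) Q = \<psi>"
        using a(2,3) by (auto simp: prescribed_def extensional_def fun_eq_iff)
      then show "({z \<in> P. (case a of (Q, \<psi>) \<Rightarrow> \<lambda>z\<in>P. if z \<in> Q then \<psi> z else d) z \<noteq> d},
        restrict (case a of (Q, \<psi>) \<Rightarrow> \<lambda>z\<in>P. if z \<in> Q then \<psi> z else d)
          {z \<in> P. (case a of (Q, \<psi>) \<Rightarrow> \<lambda>z\<in>P. if z \<in> Q then \<psi> z else d) z \<noteq> d}) = a"
        unfolding a(1) prod.case e by simp
    qed
    show "(\<lambda>\<phi>. ({z \<in> P. \<phi> z \<noteq> d}, restrict \<phi> {z \<in> P. \<phi> z \<noteq> d})) ` prescribed_off d P \<tau> \<subseteq> ?Z"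
    proof
      fix a assume "a \<in> (\<lambda>\<phi>. ({z \<in> P. \<phi> z \<noteq> d}, restrict \<phi> {z \<in> P. \<phi> z \<noteq> d})) ` prescribed_off d P \<tau>"
      then obtain \<phi> where p: "\<phi> \<in> prescribed_off d P \<tau>" "a = ({z \<in> P. \<phi> z \<noteq> d}, restrict \<phi> {z \<in> P. \<phi> z \<noteq> d})" by blast
      let ?A = "{z \<in> P. \<phi> z \<noteq> d}"
      have c: "card {z \<in> ?A. \<phi> z = k} = \<tau> k" for k
      proof (cases "k = d")
        case True
        then have e: "{z \<in> ?A. \<phi> z = k} = {}" by auto
        show ?thesis unfolding e using d True by simp
      next
        case False
        then have e: "{z \<in> ?A. \<phi> z = k} = {z \<in> P. \<phi> z = k}" by auto
        show ?thesis unfolding e using p(1) False by (simp add: prescribed_off_def)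
      qed
      have fA: "finite ?A" using P by simp
      have "card ?A = ?S" using card_fibre_sum_nat[OF fA, of \<phi>] unfolding c by simp
      moreover have "restrict \<phi> ?A \<in> prescribed ?A \<tau>"
      proof -
        have "{z \<in> ?A. restrict \<phi> ?A z = k} = {z \<in> ?A. \<phi> z = k}" for k by auto
        then show ?thesis unfolding prescribed_def using c by simp
      qed
      ultimately show "a \<in> ?Z" unfolding p(2) by blast
    qed
    show "(\<lambda>(Q, \<psi>). \<lambda>z\<in>P. if z \<in> Q then \<psi> z else d) ` ?Z \<subseteq> prescribed_off d P \<tau>"
    proof
      fix \<phi> assume "\<phi> \<in> (\<lambda>(Q, \<psi>). \<lambda>z\<in>P. if z \<in> Q then \<psi> z else d) ` ?Z"
      then obtain Q \<psi> where a: "\<phi> = (\<lambda>z\<in>P. if z \<in> Q then \<psi> z else d)" "Q \<in> ?Q" "\<psi> \<in> prescribed Q \<tau>" by auto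
      have "card {z \<in> P. \<phi> z = k} = \<tau> k" if "k \<noteq> d" for k
      proof -
        have "{z \<in> P. \<phi> z = k} = {z \<in> Q. \<psi> z = k}" using that a(2) unfolding a(1) by auto
        then show ?thesis using a(3) by (simp add: prescribed_def)
      qed
      then show "\<phi> \<in> prescribed_off d P \<tau>" unfolding prescribed_off_def using a(1) by simp
    qed
  qed
  have fZ: "finite ?Z" by (intro finite_SigmaI fQ finite_prescribed t fin)
  show "finite (prescribed_off d P \<tau>)" using bij_betw_finite[OF bij] fZ by simp
  have "card (prescribed_off d P \<tau>) = card ?Z" by (rule bij_betw_same_card[OF bij])
  also have "\<dots> = (\<Sum>Q\<in>?Q. card (prescribed Q \<tau>))"
    by (rule card_SigmaI[OF fQ]) (intro ballI finite_prescribed[OF fin t])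
  also have "\<dots> = (\<Sum>Q\<in>?Q. msplit \<tau>)"
  proof (rule sum.cong[OF refl])
    fix Q assume Q: "Q \<in> ?Q"
    then have "card Q = ?S" by simp
    then show "card (prescribed Q \<tau>) = msplit \<tau>" by (rule card_prescribed[OF fin[OF Q]])
  qed
  also have "\<dots> = (card P choose ?S) * msplit \<tau>" by (simp add: n_subsets[OF P])
  finally show "card (prescribed_off d P \<tau>) = (card P choose Sum_any \<tau>) * msplit \<tau>" .
qed

subsection \<open>Transport tensors\<close>

text \<open>A tensor records how many unit entries of \<open>A\<close> in position \<open>(k, j)\<close> are moved to row \<open>i\<close>
  when \<open>A\<close> is multiplied from the left by \<open>B\<close>.\<close>

type_synonym tens = "int \<Rightarrow> int \<Rightarrow> int \<Rightarrow> nat"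

definition tin :: "tens \<Rightarrow> int \<Rightarrow> int \<Rightarrow> nat" where "tin t i j = Sum_any (\<lambda>k. t i k j)"
definition tout :: "tens \<Rightarrow> int \<Rightarrow> int \<Rightarrow> nat" where "tout t k j = Sum_any (\<lambda>i. t i k j)"
definition trow :: "tens \<Rightarrow> int \<Rightarrow> int \<Rightarrow> nat" where "trow t i k = Sum_any (\<lambda>j. t i k j)"

text \<open>Only off-diagonal entries of \<open>A\<close> limit what can be taken away, so the set does not see the
  diagonals. If a diagonal entry of a non-negative \<open>A\<close> cannot supply what is taken from it, a binomial in
  the count vanishes instead.\<close>

definition TT :: "nat \<Rightarrow> mat \<Rightarrow> mat \<Rightarrow> tens set" where
  "TT n B A = {t. (\<forall>i k j. t (i + int n) (k + int n) (j + int n) = t i k j) \<and> (\<forall>i j. t i i j = 0) \<and>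
     (\<forall>i k. finite {j. t i k j \<noteq> 0}) \<and> (\<forall>i k. i \<noteq> k \<longrightarrow> int (trow t i k) = B i k) \<and>
     (\<forall>k j. k \<noteq> j \<longrightarrow> int (tout t k j) \<le> A k j)}"

definition moved :: "mat \<Rightarrow> tens \<Rightarrow> mat" where
  "moved A t = (\<lambda>i j. A i j + int (tin t i j) - int (tout t i j))"

text \<open>One representative of each periodic class of positions that receive something.\<close>

definition tsupp :: "nat \<Rightarrow> tens \<Rightarrow> (int \<times> int) set" where
  "tsupp n t = {(i, j). i \<in> {1..int n} \<and> tin t i j \<noteq> 0}"

context affine_n
begin

text \<open>Labellings \<open>F\<close> that interpolate between the row labelling of \<open>B\<close> and the translate by \<open>c\<close> of the
  column labelling of \<open>A\<close>.\<close>

definition mids :: "mat \<Rightarrow> mat \<Rightarrow> perm \<Rightarrow> (int \<Rightarrow> int) set" where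
  "mids B A c = {F. eqv F \<and> (\<forall>i k. int (cell (blk (ro B)) F i k) = B i k) \<and>
     (\<forall>k j. int (cell F (\<lambda>z. blk (co A) (ipm c z)) k j) = A k j)}"

text \<open>A factorization \<open>c = b a\<close> is the same as the middle labelling \<open>z \<mapsto> blk (ro A) (ipm b z)\<close> together
  with an element of the middle Young subgroup.\<close>

lemma card_factorizations:
  assumes A: "A \<in> Th" and B: "B \<in> Th" and BA: "co B = ro A" and c: "c \<in> G"
  shows "card {b \<in> DA B. ipm b \<circ> c \<in> DA A} = card (mids B A c) * card (Y (ro A))"
proof -
  note lA = Theta_r_L[OF A] and lB = Theta_r_L[OF B]
  let ?f = "blk (ro B)" and ?g = "blk (ro A)" and ?h = "\<lambda>z. blk (co A) (ipm c z)"
  let ?Z = "{b \<in> DA B. ipm b \<circ> c \<in> DA A}"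
  have Z_iff: "b \<in> ?Z \<longleftrightarrow> (\<lambda>z. ?g (ipm b z)) \<in> mids B A c" if b: "b \<in> G" for b
  proof -
    have ib: "ipm b \<in> G" and ibc: "ipm b \<circ> c \<in> G" using b c G_ipm G_comp by auto
    have e: "eqv (\<lambda>z. ?g (ipm b z))" by (rule eqv_comp[OF blk_eqv[OF lA(1)] ib])
    have 1: "mat_of n r (ro B) b (co B) i k = int (cell ?f (\<lambda>z. ?g (ipm b z)) i k)" for i k
    proof -
      have "cell (\<lambda>z. ?f (b z)) ?g i k = cell (\<lambda>z. ?f (b (ipm b z))) (\<lambda>z. ?g (ipm b z)) i k"
        by (rule cell_comp[OF ib, symmetric])
      then show ?thesis using lB BA b by (simp add: mat_of_cell G_ipm_right[OF b])
    qed
    have 2: "mat_of n r (ro A) (ipm b \<circ> c) (co A) k j = int (cell (\<lambda>z. ?g (ipm b z)) ?h k j)" for k j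
    proof -
      have "cell (\<lambda>z. ?g ((ipm b \<circ> c) z)) (blk (co A)) k j
          = cell (\<lambda>z. ?g ((ipm b \<circ> c) (ipm c z))) (\<lambda>z. blk (co A) (ipm c z)) k j"
        by (rule cell_comp[OF G_ipm[OF c], symmetric])
      also have "\<dots> = cell (\<lambda>z. ?g (ipm b z)) ?h k j" by (simp add: G_ipm_right[OF c])
      finally show ?thesis by (simp only: mat_of_cell[OF lA ibc])
    qed
    have "b \<in> ?Z \<longleftrightarrow> mat_of n r (ro B) b (co B) = B \<and> mat_of n r (ro A) (ipm b \<circ> c) (co A) = A"
      using b ibc by (auto simp: Dset_def)
    also have "\<dots> \<longleftrightarrow> (\<forall>i k. mat_of n r (ro B) b (co B) i k = B i k) \<and>
        (\<forall>k j. mat_of n r (ro A) (ipm b \<circ> c) (co A) k j = A k j)" by (simp only: fun_eq_iff)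
    finally show ?thesis unfolding 1 2 mids_def using e by blast
  qed
  have "\<exists>b\<in>G. \<forall>z. ?g (ipm b z) = F z" if F: "F \<in> mids B A c" for F
  proof -
    have eF: "eqv F" using F by (simp add: mids_def)
    have cF: "card {z. F z = k} = card {z. ?g z = k}" for k
    proof -
      have "int (card {z. F z = k}) = Sum_any (\<lambda>i. int (cell ?f F i k))" using cell_col_sum[OF eF] by simp
      also have "\<dots> = co B k" unfolding co_eq using F by (simp add: mids_def)
      finally show ?thesis using card_blk[OF lA(1), of k] BA by simp
    qed
    have "\<exists>\<phi>\<in>G. \<forall>z. ?g (\<phi> z) = F z \<and> ?g (\<phi> z) = F z"
    proof (rule equivariant_bijection[OF eF eF blk_eqv[OF lA(1)] blk_eqv[OF lA(1)]])
      show "cell F F i j = cell ?g ?g i j" for i j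
      proof (cases "i = j")
        case True then show ?thesis using cF[of i] by (simp add: cell_def)
      next
        case False
        then have "{z. F z = i \<and> F z = j} = {}" "{z. ?g z = i \<and> ?g z = j} = {}" by blast+
        then show ?thesis unfolding cell_def by (simp only:)
      qed
    qed
    then obtain \<phi> where p: "\<phi> \<in> G" "\<And>z. ?g (\<phi> z) = F z" by blast
    show ?thesis using p G_ipm[OF p(1)] ipm_ipm[OF p(1)] by (intro bexI[of _ "ipm \<phi>"]) auto
  qed
  then obtain b where b: "\<And>F. F \<in> mids B A c \<Longrightarrow> b F \<in> G" "\<And>F z. F \<in> mids B A c \<Longrightarrow> ?g (ipm (b F) z) = F z"
    by metis
  have lab: "?g (ipm (b F \<circ> u) z) = F z" if "F \<in> mids B A c" "u \<in> Y (ro A)" for F u z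
    using b that Y_blk[OF lA(1) Y_ipm[OF lA(1) that(2)]] by (simp add: ipm_comp Y_G)
  have "bij_betw (\<lambda>(F, u). b F \<circ> u) (mids B A c \<times> Y (ro A)) ?Z"
    unfolding bij_betw_def
  proof
    show "inj_on (\<lambda>(F, u). b F \<circ> u) (mids B A c \<times> Y (ro A))"
    proof (rule inj_onI, clarify)
      fix F u F' u' assume a: "F \<in> mids B A c" "u \<in> Y (ro A)" "F' \<in> mids B A c" "u' \<in> Y (ro A)"
        and e: "b F \<circ> u = b F' \<circ> u'"
      have F: "F = F'" using lab[OF a(1,2)] lab[OF a(3,4)] e by (intro ext) simp
      have "ipm (b F) \<circ> (b F \<circ> u) = ipm (b F) \<circ> (b F \<circ> u')" using e F by simp
      then have "u = u'" by (simp only: comp_assoc[symmetric] comp_ipm(2)[OF b(1)[OF a(1)]] id_comp)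
      then show "F = F' \<and> u = u'" using F by simp
    qed
    show "(\<lambda>(F, u). b F \<circ> u) ` (mids B A c \<times> Y (ro A)) = ?Z"
    proof
      show "(\<lambda>(F, u). b F \<circ> u) ` (mids B A c \<times> Y (ro A)) \<subseteq> ?Z"
      proof (clarify)
        fix F u assume a: "F \<in> mids B A c" "u \<in> Y (ro A)"
        have "b F \<circ> u \<in> ?Z"
          using Z_iff[OF G_comp[OF b(1)[OF a(1)] Y_G[OF a(2)]]] lab[OF a] a(1) by simp
        then show "b F \<circ> u \<in> DA B \<and> ipm (b F \<circ> u) \<circ> c \<in> DA A" by blast
      qed
      show "?Z \<subseteq> (\<lambda>(F, u). b F \<circ> u) ` (mids B A c \<times> Y (ro A))"
      proof
        fix x assume x: "x \<in> ?Z"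
        then have xG: "x \<in> G" using DA_G by blast
        let ?F = "\<lambda>z. ?g (ipm x z)"
        have F: "?F \<in> mids B A c" using Z_iff[OF xG] x by blast
        let ?u = "ipm (b ?F) \<circ> x"
        have uG: "?u \<in> G" using G_comp[OF G_ipm[OF b(1)[OF F]] xG] .
        have "?g (?u z) = ?g z" for z using b(2)[OF F, of "x z"] by (simp add: G_ipm_left[OF xG])
        then have "?u \<in> Y (ro A)" using uG lA by (simp add: Y_iff)
        moreover have "x = b ?F \<circ> ?u" by (simp only: comp_assoc[symmetric] comp_ipm(1)[OF b(1)[OF F]] id_comp)
        ultimately show "x \<in> (\<lambda>(F, u). b F \<circ> u) ` (mids B A c \<times> Y (ro A))"
          using F by (intro image_eqI[of _ _ "(?F, ?u)"]) auto
      qed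
    qed
  qed
  from bij_betw_same_card[OF this] show ?thesis by (simp add: card_cartesian_product)
qed

text \<open>Points whose middle label equals their row label are not moved and not recorded.\<close>

definition tens_of :: "(int \<Rightarrow> int) \<Rightarrow> (int \<Rightarrow> int) \<Rightarrow> (int \<Rightarrow> int) \<Rightarrow> tens" where
  "tens_of f F h = (\<lambda>i k j. if k = i then 0 else card {z. f z = i \<and> F z = k \<and> h z = j})"

context
  fixes f F h assumes e: "eqv f" "eqv F" "eqv h"
begin

lemma finite_fib2: "finite {z. f z = i \<and> F z = k}" "finite {z. F z = k \<and> h z = j}" "finite {z. f z = i \<and> h z = j}"
  by (rule finite_subset[OF _ finite_fibre[OF e(1), of i]], auto,
      rule finite_subset[OF _ finite_fibre[OF e(2), of k]], auto,
      rule finite_subset[OF _ finite_fibre[OF e(1), of i]], auto)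

lemma tens_of_per: "tens_of f F h (i + int n) (k + int n) (j + int n) = tens_of f F h i k j"
proof -
  have "bij_betw (\<lambda>z. z + int r) {z. f z = i \<and> F z = k \<and> h z = j}
      {z. f z = i + int n \<and> F z = k + int n \<and> h z = j + int n}"
  proof (rule bij_betw_byWitness[where f' = "\<lambda>z. z - int r"])
    show "(\<lambda>z. z - int r) ` {z. f z = i + int n \<and> F z = k + int n \<and> h z = j + int n} \<subseteq> {z. f z = i \<and> F z = k \<and> h z = j}"
      using eqv_shift[OF e(1), of _ "- 1"] eqv_shift[OF e(2), of _ "- 1"] eqv_shift[OF e(3), of _ "- 1"] by auto
  qed (use e in \<open>auto simp: eqv_def\<close>)
  from bij_betw_same_card[OF this] show ?thesis by (simp add: tens_of_def)
qed

lemma tens_of_fin: "finite {j. tens_of f F h i k j \<noteq> 0}"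
proof -
  have "{j. tens_of f F h i k j \<noteq> 0} \<subseteq> h ` {z. f z = i}"
    by (auto simp: tens_of_def card_gt_0_iff split: if_splits)
  then show ?thesis by (rule finite_subset) (simp add: finite_fibre e)
qed

lemma trow_tens_of: "i \<noteq> k \<Longrightarrow> trow (tens_of f F h) i k = cell f F i k"
proof -
  assume "i \<noteq> k"
  then have "trow (tens_of f F h) i k = Sum_any (\<lambda>j. card {z \<in> {z. f z = i \<and> F z = k}. h z = j})"
    by (simp add: trow_def tens_of_def conj_assoc)
  then show ?thesis using card_fibre_sum_nat[OF finite_fib2(1), of i k h] by (simp add: cell_def)
qed

lemma tout_tens_of: "tout (tens_of f F h) k j = card {z. F z = k \<and> h z = j \<and> f z \<noteq> k}"
proof -
  have "tout (tens_of f F h) k j = Sum_any (\<lambda>i. card {z \<in> {z. F z = k \<and> h z = j \<and> f z \<noteq> k}. f z = i})"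
    unfolding tout_def tens_of_def
  proof (rule arg_cong[where f = Sum_any], rule ext)
    fix i
    have "{z \<in> {z. F z = k \<and> h z = j \<and> f z \<noteq> k}. f z = i} = (if k = i then {} else {z. f z = i \<and> F z = k \<and> h z = j})"
      by auto
    then show "(if k = i then 0 else card {z. f z = i \<and> F z = k \<and> h z = j}) = card {z \<in> {z. F z = k \<and> h z = j \<and> f z \<noteq> k}. f z = i}"
      by (simp only: if_distrib[of card] card.empty)
  qed
  also have "\<dots> = card {z. F z = k \<and> h z = j \<and> f z \<noteq> k}"
    by (rule card_fibre_sum_nat) (rule finite_subset[OF _ finite_fib2(2)[of k j]], auto)
  finally show ?thesis .
qed

lemma tin_tens_of: "tin (tens_of f F h) i j = card {z. f z = i \<and> h z = j \<and> F z \<noteq> i}"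
proof -
  have "tin (tens_of f F h) i j = Sum_any (\<lambda>k. card {z \<in> {z. f z = i \<and> h z = j \<and> F z \<noteq> i}. F z = k})"
    unfolding tin_def tens_of_def
  proof (rule arg_cong[where f = Sum_any], rule ext)
    fix k
    have "{z \<in> {z. f z = i \<and> h z = j \<and> F z \<noteq> i}. F z = k} = (if k = i then {} else {z. f z = i \<and> F z = k \<and> h z = j})"
      by auto
    then show "(if k = i then 0 else card {z. f z = i \<and> F z = k \<and> h z = j}) = card {z \<in> {z. f z = i \<and> h z = j \<and> F z \<noteq> i}. F z = k}"
      by (simp only: if_distrib[of card] card.empty)
  qed
  also have "\<dots> = card {z. f z = i \<and> h z = j \<and> F z \<noteq> i}"
    by (rule card_fibre_sum_nat) (rule finite_subset[OF _ finite_fib2(3)[of i j]], auto)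
  finally show ?thesis .
qed

lemma cell_tout: "cell F h i j = card {z. f z = i \<and> F z = i \<and> h z = j} + tout (tens_of f F h) i j"
proof -
  have "{z. F z = i \<and> h z = j} = {z. f z = i \<and> F z = i \<and> h z = j} \<union> {z. F z = i \<and> h z = j \<and> f z \<noteq> i}" by auto
  then have "card {z. F z = i \<and> h z = j} = card ({z. f z = i \<and> F z = i \<and> h z = j} \<union> {z. F z = i \<and> h z = j \<and> f z \<noteq> i})"
    by (rule arg_cong)
  also have "\<dots> = card {z. f z = i \<and> F z = i \<and> h z = j} + card {z. F z = i \<and> h z = j \<and> f z \<noteq> i}"
    by (rule card_Un_disjoint; (rule finite_subset[OF _ finite_fib2(2)[of i j]])?) auto
  finally show ?thesis unfolding cell_def tout_tens_of .
qed

lemma cell_tin: "cell f h i j = card {z. f z = i \<and> F z = i \<and> h z = j} + tin (tens_of f F h) i j"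
proof -
  have "{z. f z = i \<and> h z = j} = {z. f z = i \<and> F z = i \<and> h z = j} \<union> {z. f z = i \<and> h z = j \<and> F z \<noteq> i}" by auto
  then have "card {z. f z = i \<and> h z = j} = card ({z. f z = i \<and> F z = i \<and> h z = j} \<union> {z. f z = i \<and> h z = j \<and> F z \<noteq> i})"
    by (rule arg_cong)
  also have "\<dots> = card {z. f z = i \<and> F z = i \<and> h z = j} + card {z. f z = i \<and> h z = j \<and> F z \<noteq> i}"
    by (rule card_Un_disjoint; (rule finite_subset[OF _ finite_fib2(3)[of i j]])?) auto
  finally show ?thesis unfolding cell_def tin_tens_of .
qed

end

text \<open>The conditions on \<open>F\<close> for \<open>A\<close> say that \<open>moved A t\<close> is the matrix of the outer labellings, and those for
  off-diagonal entries of \<open>B\<close> are the row sums of \<open>t\<close>. The diagonal entries of \<open>B\<close> follow from the column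
  sums.\<close>

lemma mids_iff:
  assumes A: "A \<in> Th" and B: "B \<in> Th" and BA: "co B = ro A" and c: "c \<in> G"
    and C: "\<And>i j. C i j = int (cell (blk (ro B)) (\<lambda>z. blk (co A) (ipm c z)) i j)" and eF: "eqv F"
  defines "t \<equiv> tens_of (blk (ro B)) F (\<lambda>z. blk (co A) (ipm c z))"
  shows "F \<in> mids B A c \<longleftrightarrow> t \<in> TT n B A \<and> moved A t = C"
proof -
  note lA = Theta_r_L[OF A] and lB = Theta_r_L[OF B]
  let ?f = "blk (ro B)" and ?h = "\<lambda>z. blk (co A) (ipm c z)"
  have e: "eqv ?f" "eqv F" "eqv ?h" using blk_eqv lA lB eF eqv_comp G_ipm[OF c] by auto
  have mv: "moved A t i j = C i j \<longleftrightarrow> int (cell F ?h i j) = A i j" for i j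
    unfolding moved_def C t_def using cell_tin[OF e, of i j] cell_tout[OF e, of i j] by linarith
  have le: "int (tout t k j) \<le> A k j" if "int (cell F ?h k j) = A k j" for k j
    using that cell_tout[OF e, of k j] unfolding t_def by linarith
  have diag: "int (cell ?f F i i) = B i i"
    if 1: "\<And>k j. int (cell F ?h k j) = A k j" and 2: "\<And>i k. i \<noteq> k \<Longrightarrow> int (cell ?f F i k) = B i k" for i
  proof -
    have fB: "finite {k. B k i \<noteq> 0}" using B by (simp add: Theta_r_def Theta_def per_mats_def)
    have "Sum_any (\<lambda>k. int (cell ?f F k i)) = int (card {z. F z = i})" by (rule cell_col_sum[OF e(2)])
    also have "\<dots> = Sum_any (\<lambda>j. int (cell F ?h i j))" by (rule cell_row_sum[OF e(2), symmetric])
    also have "\<dots> = Sum_any (\<lambda>k. B k i)" using BA 1 by (simp add: ro_eq co_eq fun_eq_iff)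
    finally have s: "Sum_any (\<lambda>k. int (cell ?f F k i)) = Sum_any (\<lambda>k. B k i)" .
    have fc: "finite {k. int (cell ?f F k i) \<noteq> 0}" using finite_cell_col[OF e(2), of ?f i] by simp
    have "(\<lambda>k. if k = i then 0 else int (cell ?f F k i)) = (\<lambda>k. if k = i then 0 else B k i)" using 2 by auto
    then have "Sum_any (\<lambda>k. if k = i then 0 else int (cell ?f F k i)) = Sum_any (\<lambda>k. if k = i then 0 else B k i)"
      by (rule arg_cong)
    then show ?thesis using s Sum_any_split[OF fc, of i] Sum_any_split[OF fB, of i] by linarith
  qed
  have "F \<in> mids B A c \<longleftrightarrow> (\<forall>k j. int (cell F ?h k j) = A k j) \<and> (\<forall>i k. i \<noteq> k \<longrightarrow> int (cell ?f F i k) = B i k)"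
    (is "?l \<longleftrightarrow> ?r")
  proof
    show "?l \<Longrightarrow> ?r" by (simp add: mids_def)
    assume a: "?r"
    have "int (cell ?f F i k) = B i k" for i k
      using diag[of i] a by (cases "i = k") auto
    then show "?l" using a eF by (simp add: mids_def)
  qed
  also have "\<dots> \<longleftrightarrow> moved A t = C \<and> (\<forall>i k. i \<noteq> k \<longrightarrow> int (trow t i k) = B i k)"
    unfolding fun_eq_iff mv using trow_tens_of[OF e] by (auto simp: t_def)
  also have "\<dots> \<longleftrightarrow> t \<in> TT n B A \<and> moved A t = C"
  proof
    assume a: "moved A t = C \<and> (\<forall>i k. i \<noteq> k \<longrightarrow> int (trow t i k) = B i k)"
    then have "\<And>k j. int (tout t k j) \<le> A k j" using le mv by simp
    then show "t \<in> TT n B A \<and> moved A t = C"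
      using a tens_of_per[OF e] tens_of_fin[OF e] unfolding TT_def t_def by (auto simp: tens_of_def)
  qed (auto simp: TT_def)
  finally show ?thesis .
qed

text \<open>The labelling is chosen independently on each cell \<open>f z = i\<close>, \<open>h z = j\<close> with \<open>i\<close> in \<open>{1..n}\<close>. On that
  cell \<open>t i k j\<close> points get the label \<open>k \<noteq> i\<close> and the others keep the default \<open>i\<close>, which is what
  \<open>card_prescribed_off\<close> counts.\<close>

lemma card_tens_fibre:
  assumes e: "eqv f" "eqv h" and fw: "\<And>z. f z \<in> {1..int n} \<longleftrightarrow> z \<in> {1..int r}"
    and C: "\<And>i j. C i j = cell f h i j"
    and per: "\<And>i k j. t (i + int n) (k + int n) (j + int n) = t i k j" and t0: "\<And>i j. t i i j = 0"
    and fk: "\<And>i j. finite {k. t i k j \<noteq> 0}" and fs: "finite (tsupp n t)"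
  shows "finite {F. eqv F \<and> tens_of f F h = t}"
    and "card {F. eqv F \<and> tens_of f F h = t} = (\<Prod>(i,j)\<in>tsupp n t. (C i j choose tin t i j) * msplit (\<lambda>k. t i k j))"
proof -
  let ?P = "\<lambda>i j. {z. f z = i \<and> h z = j}"
  \<comment> \<open>positions where the cell or the demand is non-empty: a demand on an empty cell must make the product vanish\<close>
  define I where "I = tsupp n t \<union> {(i, j). i \<in> {1..int n} \<and> C i j \<noteq> 0}"
  have fI: "finite I"
  proof -
    have "{(i, j). i \<in> {1..int n} \<and> C i j \<noteq> 0} \<subseteq> Sigma {1..int n} (\<lambda>i. {j. cell f h i j \<noteq> 0})" using C by auto
    then have "finite {(i, j). i \<in> {1..int n} \<and> C i j \<noteq> 0}"
      by (rule finite_subset) (use finite_cell_row[OF e(1)] in auto)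
    then show ?thesis using fs by (simp add: I_def)
  qed
  have I1: "i \<in> {1..int n}" if "(i, j) \<in> I" for i j using that by (auto simp: I_def tsupp_def)
  have fP: "finite (?P i j)" for i j by (rule finite_subset[OF _ finite_fibre[OF e(1), of i]]) auto
  have tz: "t i k j = 0" if "i \<in> {1..int n}" "(i, j) \<notin> I" for i j k
    using that Sum_any_zero_nat[OF fk, of i j k] by (auto simp: I_def tsupp_def tin_def)
  have Pz: "?P i j = {}" if "i \<in> {1..int n}" "(i, j) \<notin> I" for i j
  proof -
    have "card (?P i j) = 0" using that C[of i j] by (auto simp: I_def cell_def)
    then show ?thesis using fP by simp
  qed
  let ?E = "\<lambda>(i, j). prescribed_off i (?P i j) (\<lambda>k. t i k j)"
  have mem: "(f z, h z) \<in> I" if "z \<in> {1..int r}" for z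
  proof -
    have i: "f z \<in> {1..int n}" using that fw by blast
    have "z \<in> ?P (f z) (h z)" by simp
    then show ?thesis using Pz[OF i] by blast
  qed
  have Pw: "z \<in> {1..int r}" if "i \<in> {1..int n}" "z \<in> ?P i j" for i j z
    using that fw by auto
  have tshift: "t (i + m * int n) (k + m * int n) (j + m * int n) = t i k j" for i k j m
  proof -
    have "(\<lambda>x. t (i + x) (k + x) (j + x)) (0 + m * int n) = (\<lambda>x. t (i + x) (k + x) (j + x)) 0"
      by (rule periodic_shift) (use per in \<open>simp add: add.assoc[symmetric]\<close>)
    then show ?thesis by simp
  qed
  have cond: "tens_of f F h = t \<longleftrightarrow> (\<forall>(i,j)\<in>I. \<forall>k. k \<noteq> i \<longrightarrow> card {z \<in> ?P i j. F z = k} = t i k j)" if F: "eqv F" for F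
  proof
    assume a: "tens_of f F h = t"
    have "card {z \<in> ?P i j. F z = k} = t i k j" if "k \<noteq> i" for i j k
    proof -
      have "{z \<in> ?P i j. F z = k} = {z. f z = i \<and> F z = k \<and> h z = j}" by auto
      then show ?thesis using that a[symmetric] by (simp add: tens_of_def)
    qed
    then show "\<forall>(i,j)\<in>I. \<forall>k. k \<noteq> i \<longrightarrow> card {z \<in> ?P i j. F z = k} = t i k j" by blast
  next
    assume a: "\<forall>(i,j)\<in>I. \<forall>k. k \<noteq> i \<longrightarrow> card {z \<in> ?P i j. F z = k} = t i k j"
    have w: "tens_of f F h i k j = t i k j" if i: "i \<in> {1..int n}" for i k j
    proof (cases "k = i")
      case True then show ?thesis using t0 by (simp add: tens_of_def)
    next
      case False
      have s: "{z \<in> ?P i j. F z = k} = {z. f z = i \<and> F z = k \<and> h z = j}" by auto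
      show ?thesis
      proof (cases "(i, j) \<in> I")
        case True
        then have "card {z \<in> ?P i j. F z = k} = t i k j" using a False by blast
        then show ?thesis using False s by (simp add: tens_of_def)
      next
        case nI: False
        have "{z \<in> ?P i j. F z = k} = {}" using Pz[OF i nI] by blast
        then have "card {z. f z = i \<and> F z = k \<and> h z = j} = 0" unfolding s by (simp only: card.empty)
        then show ?thesis using False tz[OF i nI] by (simp add: tens_of_def)
      qed
    qed
    show "tens_of f F h = t"
    proof (intro ext)
      fix i k j
      let ?m = "(i - 1) div int n"
      have Fs: "tens_of f F h (i' + m * int n) (k' + m * int n) (j' + m * int n) = tens_of f F h i' k' j'" for i' k' j' m
      proof -
        have "(\<lambda>x. tens_of f F h (i' + x) (k' + x) (j' + x)) (0 + m * int n) = (\<lambda>x. tens_of f F h (i' + x) (k' + x) (j' + x)) 0"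
          by (rule periodic_shift) (use tens_of_per[OF e(1) F e(2)] in \<open>simp add: add.assoc[symmetric]\<close>)
        then show ?thesis by simp
      qed
      have "tens_of f F h i k j = tens_of f F h (i - ?m * int n) (k - ?m * int n) (j - ?m * int n)"
        using Fs[of i "- ?m" k j] by simp
      also have "\<dots> = t (i - ?m * int n) (k - ?m * int n) (j - ?m * int n)" by (rule w[OF div_n_range])
      also have "\<dots> = t i k j" using tshift[of i "- ?m" k j] by simp
      finally show "tens_of f F h i k j = t i k j" .
    qed
  qed
  have rcard: "{z \<in> ?P i j. restrict F (?P i j) z = k} = {z \<in> ?P i j. F z = k}" for F i j k by auto
  have bij: "bij_betw (\<lambda>F. \<lambda>(i,j)\<in>I. restrict F (?P i j)) {F. eqv F \<and> tens_of f F h = t} (PiE I ?E)"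
  proof (rule bij_betw_byWitness[where f' = "\<lambda>\<psi>. eext (\<lambda>z. \<psi> (f z, h z) z)"])
    show "\<forall>F\<in>{F. eqv F \<and> tens_of f F h = t}. eext (\<lambda>z. (\<lambda>(i,j)\<in>I. restrict F (?P i j)) (f z, h z) z) = F"
    proof
      fix F assume "F \<in> {F. eqv F \<and> tens_of f F h = t}"
      then have F: "eqv F" by simp
      show "eext (\<lambda>z. (\<lambda>(i,j)\<in>I. restrict F (?P i j)) (f z, h z) z) = F"
        by (rule ext, rule eqv_ext[OF eext_eqv F]) (simp add: eext_window mem)
    qed
    show "\<forall>\<psi>\<in>PiE I ?E. (\<lambda>(i,j)\<in>I. restrict (eext (\<lambda>z. \<psi> (f z, h z) z)) (?P i j)) = \<psi>"
    proof
      fix \<psi> assume p: "\<psi> \<in> PiE I ?E"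
      show "(\<lambda>(i,j)\<in>I. restrict (eext (\<lambda>z. \<psi> (f z, h z) z)) (?P i j)) = \<psi>"
      proof
        fix x :: "int \<times> int"
        obtain i j where x: "x = (i, j)" by (cases x)
        show "(\<lambda>(i,j)\<in>I. restrict (eext (\<lambda>z. \<psi> (f z, h z) z)) (?P i j)) x = \<psi> x"
        proof (cases "x \<in> I")
          case True
          have ex: "\<psi> (i, j) \<in> extensional (?P i j)"
            using PiE_mem[OF p True] unfolding x by (simp add: prescribed_off_def)
          have "restrict (eext (\<lambda>z. \<psi> (f z, h z) z)) (?P i j) = \<psi> (i, j)"
          proof
            fix z
            show "restrict (eext (\<lambda>z. \<psi> (f z, h z) z)) (?P i j) z = \<psi> (i, j) z"
            proof (cases "z \<in> ?P i j")
              case zP: True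
              have "z \<in> {1..int r}" by (rule Pw[OF _ zP]) (use I1 True x in blast)
              then show ?thesis using zP by (simp add: eext_window)
            next
              case False
              then have "\<psi> (i, j) z = undefined" using ex unfolding extensional_def by blast
              then show ?thesis using False by (simp only: restrict_def if_False)
            qed
          qed
          then show ?thesis using True x by simp
        next
          case False
          then have "\<psi> x = undefined" using p unfolding PiE_def extensional_def by blast
          then show ?thesis using False by (simp only: restrict_def if_False)
        qed
      qed
    qed
    show "(\<lambda>F. \<lambda>(i,j)\<in>I. restrict F (?P i j)) ` {F. eqv F \<and> tens_of f F h = t} \<subseteq> PiE I ?E"
    proof
      fix \<psi> assume "\<psi> \<in> (\<lambda>F. \<lambda>(i,j)\<in>I. restrict F (?P i j)) ` {F. eqv F \<and> tens_of f F h = t}"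
      then obtain F where F: "eqv F" "tens_of f F h = t" and p: "\<psi> = (\<lambda>(i,j)\<in>I. restrict F (?P i j))" by blast
      have "\<psi> x \<in> ?E x" if "x \<in> I" for x
      proof -
        obtain i j where x: "x = (i, j)" by (cases x)
        have "\<forall>k. k \<noteq> i \<longrightarrow> card {z \<in> ?P i j. F z = k} = t i k j" using cond[OF F(1)] F(2) that x by blast
        then have "restrict F (?P i j) \<in> prescribed_off i (?P i j) (\<lambda>k. t i k j)"
          unfolding prescribed_off_def using rcard[of i j F] by simp
        then show ?thesis unfolding p using that x by simp
      qed
      then show "\<psi> \<in> PiE I ?E" unfolding PiE_def p by auto
    qed
    show "(\<lambda>\<psi>. eext (\<lambda>z. \<psi> (f z, h z) z)) ` PiE I ?E \<subseteq> {F. eqv F \<and> tens_of f F h = t}"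
    proof
      fix F assume "F \<in> (\<lambda>\<psi>. eext (\<lambda>z. \<psi> (f z, h z) z)) ` PiE I ?E"
      then obtain \<psi> where p: "\<psi> \<in> PiE I ?E" and F: "F = eext (\<lambda>z. \<psi> (f z, h z) z)" by blast
      have eF: "eqv F" unfolding F by (rule eext_eqv)
      have "card {z \<in> ?P i j. F z = k} = t i k j" if ij: "(i, j) \<in> I" and k: "k \<noteq> i" for i j k
      proof -
        have "F z = \<psi> (i, j) z" if z: "z \<in> ?P i j" for z
        proof -
          have "z \<in> {1..int r}" by (rule Pw[OF I1[OF ij] z])
          then show ?thesis using z by (simp add: F eext_window)
        qed
        then have "{z \<in> ?P i j. F z = k} = {z \<in> ?P i j. \<psi> (i, j) z = k}" by auto
        then show ?thesis using PiE_mem[OF p ij] k by (simp add: prescribed_off_def)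
      qed
      then show "F \<in> {F. eqv F \<and> tens_of f F h = t}" using cond[OF eF] eF by blast
    qed
  qed
  have Efin: "finite (?E x)" and Ecard: "card (?E x) = (case x of (i, j) \<Rightarrow> (C i j choose tin t i j) * msplit (\<lambda>k. t i k j))" for x
  proof -
    obtain i j where x: "x = (i, j)" by (cases x)
    show "finite (?E x)" unfolding x using card_prescribed_off(1)[OF fP fk t0] by simp
    show "card (?E x) = (case x of (i, j) \<Rightarrow> (C i j choose tin t i j) * msplit (\<lambda>k. t i k j))"
      unfolding x using card_prescribed_off(2)[OF fP fk t0] by (simp add: C cell_def tin_def)
  qed
  have "finite (PiE I ?E)" by (rule finite_PiE[OF fI]) (rule Efin)
  then show "finite {F. eqv F \<and> tens_of f F h = t}" using bij_betw_finite[OF bij] by blast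
  have "card {F. eqv F \<and> tens_of f F h = t} = card (PiE I ?E)" by (rule bij_betw_same_card[OF bij])
  also have "\<dots> = (\<Prod>x\<in>I. card (?E x))" by (rule card_PiE[OF fI])
  also have "\<dots> = (\<Prod>(i,j)\<in>I. (C i j choose tin t i j) * msplit (\<lambda>k. t i k j))" by (rule prod.cong) (use Ecard in auto)
  also have "\<dots> = (\<Prod>(i,j)\<in>tsupp n t. (C i j choose tin t i j) * msplit (\<lambda>k. t i k j))"
  proof (rule prod.mono_neutral_right[OF fI])
    show "tsupp n t \<subseteq> I" by (simp add: I_def)
    show "\<forall>x\<in>I - tsupp n t. (case x of (i, j) \<Rightarrow> (C i j choose tin t i j) * msplit (\<lambda>k. t i k j)) = 1"
    proof
      fix x assume x: "x \<in> I - tsupp n t"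
      obtain i j where xij: "x = (i, j)" by (cases x)
      have ij: "(i, j) \<in> I" "(i, j) \<notin> tsupp n t" using x unfolding xij by blast+
      have z: "tin t i j = 0" using ij I1[OF ij(1)] unfolding tsupp_def by blast
      have tz0: "t i k j = 0" for k by (rule Sum_any_zero_nat[OF fk z[unfolded tin_def]])
      have "msplit (\<lambda>k. t i k j) = 1" by (rule msplit_single[of 0]) (rule tz0)
      then show "(case x of (i, j) \<Rightarrow> (C i j choose tin t i j) * msplit (\<lambda>k. t i k j)) = 1"
        unfolding xij prod.case z by simp
    qed
  qed
  finally show "card {F. eqv F \<and> tens_of f F h = t} = (\<Prod>(i,j)\<in>tsupp n t. (C i j choose tin t i j) * msplit (\<lambda>k. t i k j))" .
qed

end

locale transport =
  fixes n :: nat and B A :: mat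
  assumes n: "1 \<le> n" and Bp: "B \<in> per_mats n" and Ap: "A \<in> per_mats n"
begin

lemma fin: "finite {j. B i j \<noteq> 0}" "finite {i. B i j \<noteq> 0}" "finite {j. A i j \<noteq> 0}" "finite {i. A i j \<noteq> 0}"
  using Bp Ap by (auto simp: per_mats_def)

context
  fixes t assumes t: "t \<in> TT n B A"
begin

lemma t_per: "t (i + int n) (k + int n) (j + int n) = t i k j"
  and t_diag: "t i i j = 0" and t_fin_j: "finite {j. t i k j \<noteq> 0}"
  and t_row: "i \<noteq> k \<Longrightarrow> int (trow t i k) = B i k"
  and t_col: "k \<noteq> j \<Longrightarrow> int (tout t k j) \<le> A k j"
  using t by (auto simp: TT_def)

lemma t_le_B: "i \<noteq> k \<Longrightarrow> int (t i k j) \<le> B i k"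
  using Sum_any_ge_nat[OF t_fin_j, of i k j] t_row[of i k] by (simp add: trow_def)

lemma t_nz_B: "t i k j \<noteq> 0 \<Longrightarrow> i \<noteq> k \<and> B i k \<noteq> 0"
  using t_le_B[of i k j] t_diag[of i j] by (cases "i = k") auto

lemma t_fin_k: "finite {k. t i k j \<noteq> 0}"
  by (rule finite_subset[OF _ fin(1)[of i]]) (use t_nz_B in auto)

lemma t_fin_i: "finite {i. t i k j \<noteq> 0}"
  by (rule finite_subset[OF _ fin(2)[of k]]) (use t_nz_B in auto)

lemma t_nz_A: "t i k j \<noteq> 0 \<Longrightarrow> k \<noteq> j \<Longrightarrow> A k j \<noteq> 0"
  using Sum_any_ge_nat[OF t_fin_i[of k j], of i] t_col[of k j] by (simp add: tout_def)

lemma t_fin_kj: "finite {(k, j). t i k j \<noteq> 0}"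
  by (rule finite_subset[of _ "Sigma {k. B i k \<noteq> 0} (\<lambda>k. {j. t i k j \<noteq> 0})"])
    (use t_nz_B fin t_fin_j in auto)

lemma t_fin_ij: "finite {(i, j). t i k j \<noteq> 0}"
  by (rule finite_subset[of _ "Sigma {i. B i k \<noteq> 0} (\<lambda>i. {j. t i k j \<noteq> 0})"])
    (use t_nz_B fin t_fin_j in auto)

lemma t_fin_ki: "finite {(k, i). t i k j \<noteq> 0}"
  by (rule finite_subset[of _ "Sigma (insert j {k. A k j \<noteq> 0}) (\<lambda>k. {i. B i k \<noteq> 0})"])
    (use t_nz_B t_nz_A fin in auto)

lemma tin_fin_j: "finite {j. tin t i j \<noteq> 0}"
proof -
  have "{j. tin t i j \<noteq> 0} \<subseteq> snd ` {(k, j). t i k j \<noteq> 0}"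
  proof
    fix j assume "j \<in> {j. tin t i j \<noteq> 0}"
    then obtain k where "t i k j \<noteq> 0" using Sum_any.not_neutral_obtains_not_neutral[of "\<lambda>k. t i k j"] by (auto simp: tin_def)
    then show "j \<in> snd ` {(k, j). t i k j \<noteq> 0}" by force
  qed
  then show ?thesis by (rule finite_subset) (rule finite_imageI[OF t_fin_kj])
qed

lemma tin_fin_i: "finite {i. tin t i j \<noteq> 0}"
proof -
  have "{i. tin t i j \<noteq> 0} \<subseteq> snd ` {(k, i). t i k j \<noteq> 0}"
  proof
    fix i assume "i \<in> {i. tin t i j \<noteq> 0}"
    then obtain k where "t i k j \<noteq> 0" using Sum_any.not_neutral_obtains_not_neutral[of "\<lambda>k. t i k j"] by (auto simp: tin_def)
    then show "i \<in> snd ` {(k, i). t i k j \<noteq> 0}" by force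
  qed
  then show ?thesis by (rule finite_subset) (rule finite_imageI[OF t_fin_ki])
qed

lemma tout_fin_j: "finite {j. tout t k j \<noteq> 0}"
proof -
  have "{j. tout t k j \<noteq> 0} \<subseteq> snd ` {(i, j). t i k j \<noteq> 0}"
  proof
    fix j assume "j \<in> {j. tout t k j \<noteq> 0}"
    then obtain i where "t i k j \<noteq> 0" using Sum_any.not_neutral_obtains_not_neutral[of "\<lambda>i. t i k j"] by (auto simp: tout_def)
    then show "j \<in> snd ` {(i, j). t i k j \<noteq> 0}" by force
  qed
  then show ?thesis by (rule finite_subset) (rule finite_imageI[OF t_fin_ij])
qed

lemma tout_fin_k: "finite {k. tout t k j \<noteq> 0}"
proof -
  have "{k. tout t k j \<noteq> 0} \<subseteq> fst ` {(k, i). t i k j \<noteq> 0}"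
  proof
    fix k assume "k \<in> {k. tout t k j \<noteq> 0}"
    then obtain i where "t i k j \<noteq> 0" using Sum_any.not_neutral_obtains_not_neutral[of "\<lambda>i. t i k j"] by (auto simp: tout_def)
    then show "k \<in> fst ` {(k, i). t i k j \<noteq> 0}" by force
  qed
  then show ?thesis by (rule finite_subset) (rule finite_imageI[OF t_fin_ki])
qed

lemma tsupp_fin: "finite (tsupp n t)"
  by (rule finite_subset[of _ "Sigma {1..int n} (\<lambda>i. {j. tin t i j \<noteq> 0})"]) (use tin_fin_j in \<open>auto simp: tsupp_def\<close>)

lemma t_shift: "t (i + m * int n) (k + m * int n) (j + m * int n) = t i k j"
proof -
  have "(\<lambda>x. t (i + x) (k + x) (j + x)) (0 + m * int n) = (\<lambda>x. t (i + x) (k + x) (j + x)) 0"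
    by (rule periodic_shift) (use t_per in \<open>simp add: add.assoc[symmetric]\<close>)
  then show ?thesis by simp
qed

lemma Sum_any_swap2:
  fixes g :: "int \<Rightarrow> int \<Rightarrow> nat"
  assumes "finite {(a, b). g a b \<noteq> 0}"
  shows "Sum_any (\<lambda>a. Sum_any (g a)) = Sum_any (\<lambda>b. Sum_any (\<lambda>a. g a b))"
proof (rule Sum_any.swap[where C = "fst ` {(a, b). g a b \<noteq> 0} \<times> snd ` {(a, b). g a b \<noteq> 0}"])
  show "finite (fst ` {(a, b). g a b \<noteq> 0} \<times> snd ` {(a, b). g a b \<noteq> 0})" using assms by simp
  show "{a. \<exists>b. g a b \<noteq> 0} \<times> {b. \<exists>a. g a b \<noteq> 0} \<subseteq> fst ` {(a, b). g a b \<noteq> 0} \<times> snd ` {(a, b). g a b \<noteq> 0}"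
    by force
qed

lemma sum_tin_row: "Sum_any (\<lambda>j. tin t i j) = Sum_any (\<lambda>k. trow t i k)"
  unfolding tin_def trow_def by (rule Sum_any_swap2[of "\<lambda>k j. t i k j", symmetric]) (rule t_fin_kj)

lemma sum_tout_row: "Sum_any (\<lambda>j. tout t k j) = Sum_any (\<lambda>i. trow t i k)"
  unfolding tout_def trow_def by (rule Sum_any_swap2[of "\<lambda>i j. t i k j", symmetric]) (rule t_fin_ij)

lemma sum_tin_col: "Sum_any (\<lambda>i. tin t i j) = Sum_any (\<lambda>k. tout t k j)"
  unfolding tin_def tout_def by (rule Sum_any_swap2[of "\<lambda>k i. t i k j", symmetric]) (rule t_fin_ki)

lemma sum_trow: "int (Sum_any (\<lambda>k. trow t i k)) = ro B i - B i i"
  "int (Sum_any (\<lambda>i. trow t i k)) = co B k - B k k"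
proof -
  have 0: "trow t i i = 0" for i using t_diag by (simp add: trow_def)
  have "int (Sum_any (\<lambda>k. trow t i k)) = Sum_any (\<lambda>k. if k = i then 0 else B i k)"
    unfolding Sum_any_int using t_row 0 by (intro arg_cong[where f = Sum_any]) (auto simp: fun_eq_iff)
  then show "int (Sum_any (\<lambda>k. trow t i k)) = ro B i - B i i"
    using Sum_any_split[OF fin(1), of i i] by (simp add: ro_eq)
  have "int (Sum_any (\<lambda>i. trow t i k)) = Sum_any (\<lambda>i. if i = k then 0 else B i k)"
    unfolding Sum_any_int using t_row 0 by (intro arg_cong[where f = Sum_any]) (auto simp: fun_eq_iff)
  then show "int (Sum_any (\<lambda>i. trow t i k)) = co B k - B k k"
    using Sum_any_split[OF fin(2), of k k] by (simp add: co_eq)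
qed

lemma Sum_any_moved:
  fixes a :: "int \<Rightarrow> int" and b c :: "int \<Rightarrow> nat"
  assumes "finite {j. a j \<noteq> 0}" "finite {j. b j \<noteq> 0}" "finite {j. c j \<noteq> 0}"
  shows "Sum_any (\<lambda>j. a j + int (b j) - int (c j)) = Sum_any a + int (Sum_any b) - int (Sum_any c)"
proof -
  let ?S = "{j. a j \<noteq> 0} \<union> {j. b j \<noteq> 0} \<union> {j. c j \<noteq> 0}"
  have f: "finite ?S" using assms by simp
  have "Sum_any (\<lambda>j. a j + int (b j) - int (c j)) = (\<Sum>j\<in>?S. a j + int (b j) - int (c j))"
    by (rule Sum_any_eq[OF f]) auto
  moreover have "Sum_any a = sum a ?S" "Sum_any b = sum b ?S" "Sum_any c = sum c ?S"
    by (rule Sum_any_eq[OF f]; auto)+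
  ultimately show ?thesis by (simp add: sum.distrib sum_subtractf)
qed

lemma ro_moved: "co B = ro A \<Longrightarrow> ro (moved A t) = ro B"
proof
  fix i assume e: "co B = ro A"
  have "ro (moved A t) i = ro A i + int (Sum_any (\<lambda>j. tin t i j)) - int (Sum_any (\<lambda>j. tout t i j))"
    unfolding ro_eq moved_def by (rule Sum_any_moved) (use fin tin_fin_j tout_fin_j in auto)
  then show "ro (moved A t) i = ro B i"
    unfolding sum_tin_row sum_tout_row sum_trow e by simp
qed

lemma co_moved: "co (moved A t) = co A"
proof
  fix j
  have "co (moved A t) j = co A j + int (Sum_any (\<lambda>i. tin t i j)) - int (Sum_any (\<lambda>i. tout t i j))"
    unfolding co_eq moved_def by (rule Sum_any_moved) (use fin tin_fin_i tout_fin_k in auto)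
  then show "co (moved A t) j = co A j" by (simp add: sum_tin_col)
qed

end

text \<open>The rows of \<open>B\<close> bound the values of a tensor and, together with \<open>A\<close>, its support.\<close>

lemma finite_TT: "finite (TT n B A)"
proof -
  \<comment> \<open>where a tensor can be non-zero, up to periodicity; \<open>j = k\<close> is the diagonal source\<close>
  let ?I = "SIGMA i:{1..int n}. SIGMA k:{k. B i k \<noteq> 0}. insert k {j. A k j \<noteq> 0}"
  have fI: "finite ?I" by (intro finite_SigmaI) (use fin in auto)
  let ?r = "\<lambda>t. \<lambda>(i,k,j)\<in>?I. t i k j"
  have "inj_on ?r (TT n B A)"
  proof (rule inj_onI)
    fix t t' assume t: "t \<in> TT n B A" and t': "t' \<in> TT n B A" and e: "?r t = ?r t'"
    have w: "t i k j = t' i k j" if i: "i \<in> {1..int n}" for i k j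
    proof (cases "(i, k, j) \<in> ?I")
      case True
      then show ?thesis using fun_cong[OF e, of "(i, k, j)"] by simp
    next
      case False
      then have "t i k j = 0" "t' i k j = 0"
        using i t_nz_B[OF t, of i k j] t_nz_A[OF t, of i k j] t_nz_B[OF t', of i k j] t_nz_A[OF t', of i k j] by auto
      then show ?thesis by simp
    qed
    show "t = t'"
    proof (intro ext)
      fix i k j
      let ?m = "(i - 1) div int n"
      have "t (i - ?m * int n) (k - ?m * int n) (j - ?m * int n) = t' (i - ?m * int n) (k - ?m * int n) (j - ?m * int n)"
        by (rule w[OF window_div_range[OF n]])
      then show "t i k j = t' i k j" using t_shift[OF t, of i "- ?m" k j] t_shift[OF t', of i "- ?m" k j] by simp
    qed
  qed
  moreover have "?r ` TT n B A \<subseteq> PiE ?I (\<lambda>(i,k,j). {..nat (B i k)})"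
  proof
    fix g assume "g \<in> ?r ` TT n B A"
    then obtain t where t: "t \<in> TT n B A" and g: "g = ?r t" by blast
    have "t i k j \<le> nat (B i k)" for i k j
      using t_le_B[OF t, of i k j] t_diag[OF t, of i j] by (cases "i = k") auto
    then show "g \<in> PiE ?I (\<lambda>(i,k,j). {..nat (B i k)})" unfolding g by auto
  qed
  moreover have "finite (PiE ?I (\<lambda>(i,k,j). {..nat (B i k)}))" by (rule finite_PiE[OF fI]) auto
  ultimately show ?thesis using finite_imageD finite_subset by blast
qed

end

text \<open>The multiplicity with which the transport \<open>t\<close> contributes to the matrix \<open>X\<close>; it is a
  polynomial in the entries of \<open>X\<close>, which is what makes stabilization visible.\<close>

definition tcoef :: "nat \<Rightarrow> tens \<Rightarrow> mat \<Rightarrow> rat" where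
  "tcoef n t X = (\<Prod>(i,j)\<in>tsupp n t. ((of_int (X i j) :: rat) gchoose tin t i j) * of_nat (msplit (\<lambda>k. t i k j)))"

context affine_n
begin

lemma Th_per: "A \<in> Th \<Longrightarrow> A \<in> per_mats n" by (simp add: Theta_r_def Theta_def)

text \<open>Sort the middle labellings by their tensors.\<close>

theorem schur_coefficient:
  assumes A: "A \<in> Th" and B: "B \<in> Th" and BA: "co B = ro A"
  shows "(of_int (at_one (lk (schur_struct n r B A) C)) :: rat) =
    (if C \<in> Th then (\<Sum>t | t \<in> TT n B A \<and> moved A t = C. tcoef n t C) else 0)"
proof (cases "C \<in> Th \<and> ro C = ro B \<and> co C = co A")
  case False
  interpret transport n B A by unfold_locales (use n1 Th_per A B in auto)
  have "lk (schur_struct n r B A) C = 0"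
    using schur_struct_at_one(1)[OF A B BA] False by (auto simp: in_keys_iff)
  moreover have "{t. t \<in> TT n B A \<and> moved A t = C} = {}" if "C \<in> Th"
    using False that ro_moved BA co_moved by blast
  ultimately show ?thesis by (cases "C \<in> Th") (simp_all only: at_one_zero of_int_0 sum.empty if_True if_False)
next
  case C: True
  interpret transport n B A by unfold_locales (use n1 Th_per A B in auto)
  note lA = Theta_r_L[OF A] and lB = Theta_r_L[OF B]
  obtain c where c: "c \<in> G" "mat_of n r (ro C) c (co C) = C" using mat_of_surj C by blast
  have cD: "c \<in> DA C" using c by (simp add: Dset_def)
  let ?f = "blk (ro B)" and ?h = "\<lambda>z. blk (co A) (ipm c z)"
  have Cc: "C i j = int (cell ?f ?h i j)" for i j
  proof -
    have "cell (\<lambda>z. ?f (c z)) (blk (co A)) i j = cell (\<lambda>z. ?f (c (ipm c z))) ?h i j"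
      by (rule cell_comp[OF G_ipm[OF c(1)], symmetric])
    also have "\<dots> = cell ?f ?h i j" by (simp add: G_ipm_right[OF c(1)])
    finally have 1: "cell (\<lambda>z. ?f (c z)) (blk (co A)) i j = cell ?f ?h i j" .
    have "mat_of n r (ro B) c (co A) i j = C i j" using c(2) C by simp
    then show ?thesis unfolding mat_of_cell[OF lB(1) lA(2) c(1)] 1 by simp
  qed
  have e: "eqv ?f" "eqv ?h" using blk_eqv lA lB eqv_comp G_ipm[OF c(1)] by auto
  have fw: "?f z \<in> {1..int n} \<longleftrightarrow> z \<in> {1..int r}" for z by (rule blk_window[OF lB(1)])
  let ?T = "{t. t \<in> TT n B A \<and> moved A t = C}"
  let ?F = "\<lambda>t. {F. eqv F \<and> tens_of ?f F ?h = t}"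
  have fT: "finite ?T" by (rule finite_subset[OF _ finite_TT]) auto
  have mids_eq: "mids B A c = (\<Union>t\<in>?T. ?F t)"
  proof (rule Set.set_eqI)
    fix F
    show "F \<in> mids B A c \<longleftrightarrow> F \<in> (\<Union>t\<in>?T. ?F t)"
    proof (cases "eqv F")
      case True
      then show ?thesis using mids_iff[OF A B BA c(1) Cc True] by blast
    next
      case False
      then show ?thesis by (auto simp: mids_def)
    qed
  qed
  have cn: "C i j = int (nat (C i j))" for i j using Cc by simp
  have Cn: "nat (C i j) = cell ?f ?h i j" for i j using Cc by simp
  have cF: "finite (?F t) \<and> of_nat (card (?F t)) = tcoef n t C" if t: "t \<in> ?T" for t
  proof
    have tt: "t \<in> TT n B A" using t by blast
    note cc = card_tens_fibre[OF e fw Cn t_per[OF tt] t_diag[OF tt] t_fin_k[OF tt] tsupp_fin[OF tt]]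
    show "finite (?F t)" by (rule cc(1))
    have "of_int (C i j) = (of_nat (nat (C i j)) :: rat)" for i j using cn[of i j] by (metis of_int_of_nat_eq)
    then have "tcoef n t C = (\<Prod>(i,j)\<in>tsupp n t. of_nat ((nat (C i j) choose tin t i j) * msplit (\<lambda>k. t i k j)))"
      unfolding tcoef_def by (simp add: binomial_gbinomial)
    also have "\<dots> = of_nat (card (?F t))"
      unfolding cc(2) of_nat_prod by (simp add: case_prod_unfold)
    finally show "of_nat (card (?F t)) = tcoef n t C" by simp
  qed
  have "card (mids B A c) = (\<Sum>t\<in>?T. card (?F t))"
    unfolding mids_eq by (rule card_UN_disjoint[OF fT]) (use cF in auto)
  then have m: "(of_nat (card (mids B A c)) :: rat) = (\<Sum>t\<in>?T. tcoef n t C)" using cF by simp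
  have "int (card (Y (ro A))) * at_one (lk (schur_struct n r B A) C) = int (card {b \<in> DA B. ipm b \<circ> c \<in> DA A})"
    by (rule schur_struct_at_one(2)[OF A B BA]) (use C cD in auto)
  also have "\<dots> = int (card (Y (ro A))) * int (card (mids B A c))"
    unfolding card_factorizations[OF A B BA c(1)] by simp
  finally have "at_one (lk (schur_struct n r B A) C) = int (card (mids B A c))"
    using finite_Y[OF lA(1)] Y_id[OF lA(1)] by auto
  then show ?thesis using C m by simp
qed

end

section \<open>Stabilization\<close>

lemma Theta_tilde_per: "A \<in> Theta_tilde n \<Longrightarrow> A \<in> per_mats n"
  by (simp add: Theta_tilde_def)

lemma shift_apply: "shift a A i j = (if i = j then A i j + a else A i j)"
  by (simp add: shift_def diag_def)

lemma TT_offdiag_cong: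
  assumes "\<And>i j. i \<noteq> j \<Longrightarrow> B i j = B' i j" "\<And>i j. i \<noteq> j \<Longrightarrow> A i j = A' i j"
  shows "TT n B A = TT n B' A'"
proof -
  have b: "(\<forall>i k. i \<noteq> k \<longrightarrow> int (trow t i k) = B i k) \<longleftrightarrow> (\<forall>i k. i \<noteq> k \<longrightarrow> int (trow t i k) = B' i k)" for t
    using assms(1) by auto
  have a: "(\<forall>k j. k \<noteq> j \<longrightarrow> int (tout t k j) \<le> A k j) \<longleftrightarrow> (\<forall>k j. k \<noteq> j \<longrightarrow> int (tout t k j) \<le> A' k j)" for t
    using assms(2) by auto
  show ?thesis unfolding TT_def a b ..
qed

lemma TT_shift: "TT n (shift a B) (shift a A) = TT n B A"
  by (rule TT_offdiag_cong) (simp_all add: shift_apply)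

lemma moved_shift: "moved (shift a A) t = shift a (moved A t)"
  by (auto simp: moved_def shift_apply fun_eq_iff)

lemma shift_inj: "shift a X = C \<longleftrightarrow> X = shift (- a) C"
proof
  assume "shift a X = C"
  then have "C i j = (if i = j then X i j + a else X i j)" for i j using shift_apply[of a X i j] by simp
  then show "X = shift (- a) C" by (intro ext) (simp add: shift_apply)
qed (auto simp: shift_apply fun_eq_iff)

lemma per_mats_add_diag:
  assumes A: "A \<in> per_mats n" and m: "m \<in> Zseq n"
  shows "A + diag m \<in> per_mats n"
proof -
  have 1: "finite {j. (A + diag m) i j \<noteq> 0}" for i
    by (rule finite_subset[of _ "insert i {j. A i j \<noteq> 0}"]) (use A in \<open>auto simp: per_mats_def diag_def split: if_splits\<close>)
  have 2: "finite {i. (A + diag m) i j \<noteq> 0}" for j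
    by (rule finite_subset[of _ "insert j {i. A i j \<noteq> 0}"]) (use A in \<open>auto simp: per_mats_def diag_def split: if_splits\<close>)
  have 3: "(A + diag m) i j = (A + diag m) (i + int n) (j + int n)" for i j
    using A m by (simp add: per_mats_def diag_def Zseq_def)
  show ?thesis unfolding per_mats_def using 1 2 3 by blast
qed

lemma ro_add_diag:
  assumes A: "A \<in> per_mats n" shows "ro (A + diag m) = ro A + m" and "co (A + diag m) = co A + m"
proof -
  have f: "finite (insert i {j. A i j \<noteq> 0})" "finite (insert i {j. A j i \<noteq> 0})" for i using A by (auto simp: per_mats_def)
  show "ro (A + diag m) = ro A + m"
  proof
    fix i
    let ?S = "insert i {j. A i j \<noteq> 0}"
    have "ro (A + diag m) i = (\<Sum>j\<in>?S. (A + diag m) i j)"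
      unfolding ro_eq by (rule Sum_any_eq[OF f(1)]) (auto simp: diag_def)
    also have "\<dots> = (\<Sum>j\<in>?S. A i j) + (\<Sum>j\<in>?S. if i = j then m i else 0)"
      by (simp add: diag_def sum.distrib)
    also have "(\<Sum>j\<in>?S. A i j) = ro A i" unfolding ro_eq by (rule Sum_any_eq[symmetric, OF f(1)]) auto
    also have "(\<Sum>j\<in>?S. if i = j then m i else 0) = m i" using f(1)[of i] by (simp add: sum.delta)
    finally have "ro (A + diag m) i = ro A i + m i" .
    then show "ro (A + diag m) i = (ro A + m) i" unfolding plus_fun_apply[of "ro A"] .
  qed
  show "co (A + diag m) = co A + m"
  proof
    fix i
    let ?S = "insert i {j. A j i \<noteq> 0}"
    have "co (A + diag m) i = (\<Sum>j\<in>?S. (A + diag m) j i)"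
      unfolding co_eq by (rule Sum_any_eq[OF f(2)]) (auto simp: diag_def)
    also have "\<dots> = (\<Sum>j\<in>?S. A j i) + (\<Sum>j\<in>?S. if j = i then m i else 0)"
      by (simp add: sum.distrib[symmetric] diag_def) (rule sum.cong, auto)
    also have "(\<Sum>j\<in>?S. A j i) = co A i" unfolding co_eq by (rule Sum_any_eq[symmetric, OF f(2)]) auto
    also have "(\<Sum>j\<in>?S. if j = i then m i else 0) = m i" using f(2)[of i] by (simp add: sum.delta)
    finally have "co (A + diag m) i = co A i + m i" .
    then show "co (A + diag m) i = (co A + m) i" unfolding plus_fun_apply[of "co A"] .
  qed
qed

lemma shift_per: "A \<in> per_mats n \<Longrightarrow> shift a A \<in> per_mats n"
  unfolding shift_def by (rule per_mats_add_diag) (simp_all add: Zseq_def)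

lemma ro_shift: "A \<in> per_mats n \<Longrightarrow> ro (shift a A) = (\<lambda>i. ro A i + a)"
  and co_shift: "A \<in> per_mats n \<Longrightarrow> co (shift a A) = (\<lambda>i. co A i + a)"
  unfolding shift_def by (simp_all add: ro_add_diag fun_eq_iff)

lemma sigma_shift: "A \<in> per_mats n \<Longrightarrow> sigma_mat n (shift a A) = sigma_mat n A + a * int n"
  by (simp add: sigma_mat_eq ro_shift sigma_seq_def sum.distrib mult.commute)

lemma per_mats_shift_n: "A \<in> per_mats n \<Longrightarrow> A (i + k * int n) (j + k * int n) = A i j"
proof -
  assume A: "A \<in> per_mats n"
  have "(\<lambda>x. A (i + x) (j + x)) (0 + k * int n) = (\<lambda>x. A (i + x) (j + x)) 0"
    by (rule periodic_shift) (use A in \<open>simp add: per_mats_def add.assoc[symmetric]\<close>)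
  then show ?thesis by simp
qed

lemma eventually_shift_Theta:
  assumes n: "1 \<le> n" and A: "A \<in> Theta_tilde n"
  shows "\<forall>\<^sub>F a in at_top. 2 \<le> nat (a * int n + sigma_mat n A) \<and>
    shift a A \<in> Theta_r n (nat (a * int n + sigma_mat n A))"
proof -
  \<comment> \<open>large enough for rank two and for all diagonal entries to become non-negative\<close>
  define a0 where "a0 = 2 + \<bar>sigma_mat n A\<bar> + (\<Sum>i=1..int n. \<bar>A i i\<bar>)"
  have "2 \<le> nat (a * int n + sigma_mat n A) \<and> shift a A \<in> Theta_r n (nat (a * int n + sigma_mat n A))"
    if a: "a \<ge> a0" for a
  proof -
    have s0: "0 \<le> (\<Sum>i=1..int n. \<bar>A i i\<bar>)" by (rule sum_nonneg) simp
    then have a': "a \<ge> 2 + \<bar>sigma_mat n A\<bar>" using a unfolding a0_def by linarith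
    have "a * int n \<ge> a * 1" using n a' by (intro mult_left_mono) auto
    then have 2: "2 \<le> a * int n + sigma_mat n A" using a' by linarith
    have d: "0 \<le> A i i + a" for i
    proof -
      let ?m = "(i - 1) div int n"
      have "A i i = A (i - ?m * int n) (i - ?m * int n)"
        using per_mats_shift_n[OF Theta_tilde_per[OF A], of i "- ?m" i] by simp
      moreover have "\<bar>A (i - ?m * int n) (i - ?m * int n)\<bar> \<le> (\<Sum>i=1..int n. \<bar>A i i\<bar>)"
        by (rule member_le_sum[where f = "\<lambda>i. \<bar>A i i\<bar>"]) (use window_div_range[OF n, of i] in auto)
      ultimately show ?thesis using a unfolding a0_def by linarith
    qed
    have "0 \<le> shift a A i j" for i j using d A by (auto simp: shift_apply Theta_tilde_def)
    then have "shift a A \<in> Theta n" using shift_per[OF Theta_tilde_per[OF A]] by (simp add: Theta_def)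
    moreover have "sigma_mat n (shift a A) = int (nat (a * int n + sigma_mat n A))"
      using sigma_shift[OF Theta_tilde_per[OF A]] 2 by simp
    ultimately show ?thesis using 2 by (simp add: Theta_r_def)
  qed
  then show ?thesis unfolding eventually_at_top_linorder by blast
qed

lemma lookup_schurZ_br1:
  assumes "B \<in> Theta_r n r" "A \<in> Theta_r n r"
  shows "lk (schurZ_mult n r (br1 n r B) (br1 n r A)) C = at_one (lk (schur_struct n r B A) C)"
  using assms by (simp add: schurZ_mult_def br1_def lookup_map_zero)

text \<open>At most one matrix shifts to \<open>C\<close>.\<close>

lemma sum_br1:
  "(\<Sum>X\<in>Poly_Mapping.keys P. poly (lk P X) c * of_int (lk (br1 n r (shift a X)) C))
    = (if C \<in> Theta_r n r then poly (lk P (shift (- a) C)) c else (0::rat))"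
proof -
  have "(\<Sum>X\<in>Poly_Mapping.keys P. poly (lk P X) c * of_int (lk (br1 n r (shift a X)) C))
      = (\<Sum>X\<in>Poly_Mapping.keys P. if X = shift (- a) C then (if C \<in> Theta_r n r then poly (lk P (shift (- a) C)) c else 0) else 0)"
  proof (rule sum.cong[OF refl])
    fix X
    have "lk (br1 n r (shift a X)) C = (if shift a X = C \<and> C \<in> Theta_r n r then 1 else 0)"
      by (auto simp: br1_def lookup_single when_def)
    then show "poly (lk P X) c * of_int (lk (br1 n r (shift a X)) C)
       = (if X = shift (- a) C then (if C \<in> Theta_r n r then poly (lk P (shift (- a) C)) c else 0) else 0)"
      unfolding shift_inj by auto
  qed
  also have "\<dots> = (if C \<in> Theta_r n r then poly (lk P (shift (- a) C)) c else 0)"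
    by (simp add: in_keys_iff)
  finally show ?thesis .
qed

lemma Z1_zero: "0 \<in> Z1"
  using Z1.add[OF Z1.one Z1.uminus[OF Z1.one]] by simp

lemma Z1_of_nat: "of_nat k \<in> Z1"
  by (induction k) (simp_all add: Z1_zero Z1.one Z1.add)

lemma Z1_sum: "(\<And>a. a \<in> S \<Longrightarrow> f a \<in> Z1) \<Longrightarrow> sum f S \<in> Z1"
  by (induction S rule: infinite_finite_induct) (simp_all add: Z1_zero Z1.add)

lemma Z1_prod: "(\<And>a. a \<in> S \<Longrightarrow> f a \<in> Z1) \<Longrightarrow> prod f S \<in> Z1"
  by (induction S rule: infinite_finite_induct) (simp_all add: Z1.one Z1.mult)

lemma poly_binom_poly: "poly (binom_poly c k) x = (of_int c + x) gchoose k"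
  by (simp add: binom_poly_def gbinomial_prod_rev poly_prod atLeast0LessThan algebra_simps)

text \<open>The function \<open>a \<mapsto> tcoef n t (shift a X)\<close> as a polynomial; off the diagonal the shift changes
  nothing and the binomial is a constant.\<close>

definition pcoef :: "nat \<Rightarrow> tens \<Rightarrow> mat \<Rightarrow> rat poly" where
  "pcoef n t X = (\<Prod>(i,j)\<in>tsupp n t.
     (if i = j then binom_poly (X i j) (tin t i j) else [:of_int (X i j) gchoose tin t i j:]) *
     of_nat (msplit (\<lambda>k. t i k j)))"

lemma poly_pcoef: "poly (pcoef n t X) (of_int a) = tcoef n t (shift a X)"
  unfolding pcoef_def tcoef_def poly_prod
  by (rule prod.cong) (auto simp: poly_binom_poly shift_apply split: prod.splits)

lemma pcoef_Z1:
  assumes "\<And>i j. i \<noteq> j \<Longrightarrow> 0 \<le> X i j" shows "pcoef n t X \<in> Z1"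
  unfolding pcoef_def
proof (rule Z1_prod)
  fix x :: "int \<times> int"
  obtain i j where x: "x = (i, j)" by (cases x)
  have "[:(of_int (X i j) :: rat) gchoose tin t i j:] \<in> Z1" if "i \<noteq> j"
  proof -
    have "(of_int (X i j) :: rat) = of_nat (nat (X i j))" using assms[OF that] by simp
    then have "(of_int (X i j) :: rat) gchoose tin t i j = of_nat (nat (X i j) choose tin t i j)"
      by (simp only: binomial_gbinomial)
    then show ?thesis using Z1_of_nat[of "nat (X i j) choose tin t i j"] by (simp add: of_nat_poly)
  qed
  then show "(case x of (i, j) \<Rightarrow> (if i = j then binom_poly (X i j) (tin t i j) else [:of_int (X i j) gchoose tin t i j:]) *
     of_nat (msplit (\<lambda>k. t i k j))) \<in> Z1"
    unfolding x prod.case by (intro Z1.mult Z1_of_nat) (simp add: Z1.binom)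
qed

context transport
begin

lemma moved_per:
  assumes t: "t \<in> TT n B A" shows "moved A t \<in> per_mats n"
proof -
  have p: "tin t (i + int n) (j + int n) = tin t i j" "tout t (i + int n) (j + int n) = tout t i j" for i j
  proof -
    have "Sum_any (\<lambda>k. t (i + int n) k (j + int n)) = Sum_any (\<lambda>k. t i k j)"
      by (rule Sum_any.reindex_cong[of "\<lambda>k. k + int n"])
        (auto simp: t_per[OF t] fun_eq_iff intro!: bij_betw_byWitness[where f' = "\<lambda>j. j - int n"])
    then show "tin t (i + int n) (j + int n) = tin t i j" by (simp add: tin_def)
    have "Sum_any (\<lambda>k. t k (i + int n) (j + int n)) = Sum_any (\<lambda>k. t k i j)"
      by (rule Sum_any.reindex_cong[of "\<lambda>k. k + int n"])
        (auto simp: t_per[OF t] fun_eq_iff intro!: bij_betw_byWitness[where f' = "\<lambda>j. j - int n"])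
    then show "tout t (i + int n) (j + int n) = tout t i j" by (simp add: tout_def)
  qed
  have "finite {j. moved A t i j \<noteq> 0}" for i
    by (rule finite_subset[of _ "{j. A i j \<noteq> 0} \<union> {j. tin t i j \<noteq> 0} \<union> {j. tout t i j \<noteq> 0}"])
      (use fin tin_fin_j[OF t] tout_fin_j[OF t] in \<open>auto simp: moved_def\<close>)
  moreover have "finite {i. moved A t i j \<noteq> 0}" for j
    by (rule finite_subset[of _ "{i. A i j \<noteq> 0} \<union> {i. tin t i j \<noteq> 0} \<union> {i. tout t i j \<noteq> 0}"])
      (use fin tin_fin_i[OF t] tout_fin_k[OF t] in \<open>auto simp: moved_def\<close>)
  ultimately show ?thesis using Ap p by (simp add: per_mats_def moved_def)
qed

lemma moved_Theta_tilde:
  assumes t: "t \<in> TT n B A" shows "moved A t \<in> Theta_tilde n"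
  using moved_per[OF t] t_col[OF t] by (fastforce simp: Theta_tilde_def moved_def)

lemma sigma_moved:
  assumes t: "t \<in> TT n B A" shows "sigma_mat n (moved A t) = sigma_mat n A"
  using sigma_ro_co[OF n moved_per[OF t]] sigma_ro_co[OF n Ap] co_moved[OF t] by (simp add: sigma_mat_eq)

definition Pstab :: "mat \<Rightarrow>\<^sub>0 rat poly" where
  "Pstab = Abs_poly_mapping (\<lambda>X. \<Sum>t | t \<in> TT n B A \<and> moved A t = X. pcoef n t X)"

lemma lookup_Pstab: "lk Pstab X = (\<Sum>t | t \<in> TT n B A \<and> moved A t = X. pcoef n t X)"
proof -
  have "{X. (\<Sum>t | t \<in> TT n B A \<and> moved A t = X. pcoef n t X) \<noteq> 0} \<subseteq> moved A ` TT n B A"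
  proof
    fix X assume "X \<in> {X. (\<Sum>t | t \<in> TT n B A \<and> moved A t = X. pcoef n t X) \<noteq> 0}"
    then have "{t. t \<in> TT n B A \<and> moved A t = X} \<noteq> {}" by (metis (mono_tags, lifting) mem_Collect_eq sum.empty)
    then show "X \<in> moved A ` TT n B A" by blast
  qed
  then have "finite {X. (\<Sum>t | t \<in> TT n B A \<and> moved A t = X. pcoef n t X) \<noteq> 0}"
    by (rule finite_subset) (simp add: finite_TT)
  then show ?thesis unfolding Pstab_def by (rule lookup_Abs_poly_mapping[THEN fun_cong])
qed

lemma poly_Pstab: "poly (lk Pstab X) (of_int a) = (\<Sum>t | t \<in> TT n B A \<and> moved A t = X. tcoef n t (shift a X))"
  unfolding lookup_Pstab poly_sum poly_pcoef ..

lemma Pstab_keys: "X \<in> Poly_Mapping.keys Pstab \<Longrightarrow> \<exists>t\<in>TT n B A. moved A t = X"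
proof -
  assume "X \<in> Poly_Mapping.keys Pstab"
  then have "(\<Sum>t | t \<in> TT n B A \<and> moved A t = X. pcoef n t X) \<noteq> 0" by (simp add: in_keys_iff lookup_Pstab)
  then have "{t. t \<in> TT n B A \<and> moved A t = X} \<noteq> {}" by (metis (mono_tags, lifting) sum.empty)
  then show ?thesis by blast
qed

text \<open>Shifting both factors by \<open>a\<close> leaves the set of transports alone and shifts their results,
  so the count at level \<open>a\<close> is the value of one polynomial.\<close>

lemma stab_value:
  assumes r: "2 \<le> r" and Ba: "shift a B \<in> Theta_r n r" and Aa: "shift a A \<in> Theta_r n r" and BA: "co B = ro A"
  shows "of_int (lk (schurZ_mult n r (br1 n r (shift a B)) (br1 n r (shift a A))) C)
    = (if C \<in> Theta_r n r then poly (lk Pstab (shift (- a) C)) (of_int a) else 0)"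
proof -
  interpret affine_n r n by unfold_locales (use r n in auto)
  have BA': "co (shift a B) = ro (shift a A)" using BA by (simp add: co_shift[OF Bp] ro_shift[OF Ap])
  have "of_int (lk (schurZ_mult n r (br1 n r (shift a B)) (br1 n r (shift a A))) C)
     = (if C \<in> Theta_r n r then (\<Sum>t | t \<in> TT n B A \<and> shift a (moved A t) = C. tcoef n t C) else 0)"
    unfolding lookup_schurZ_br1[OF Ba Aa] schur_coefficient[OF Aa Ba BA'] TT_shift moved_shift ..
  also have "(\<Sum>t | t \<in> TT n B A \<and> shift a (moved A t) = C. tcoef n t C) = poly (lk Pstab (shift (- a) C)) (of_int a)"
    unfolding poly_Pstab shift_inj[of a "moved A _" C]
    using shift_inj[of a "shift (- a) C" C] by simp
  finally show ?thesis .
qed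

lemma Pstab_is_stab:
  assumes Bt: "B \<in> Theta_tilde n" and At: "A \<in> Theta_tilde n" and BA: "co B = ro A"
  shows "is_stab_prod n B A Pstab"
  unfolding is_stab_prod_def
proof
  show "\<forall>X\<in>Poly_Mapping.keys Pstab. X \<in> Theta_tilde n \<and> sigma_mat n X = sigma_mat n A \<and> lk Pstab X \<in> Z1"
  proof
    fix X assume X: "X \<in> Poly_Mapping.keys Pstab"
    obtain t where t: "t \<in> TT n B A" "moved A t = X" using Pstab_keys[OF X] by blast
    have XT: "X \<in> Theta_tilde n" using moved_Theta_tilde[OF t(1)] t(2) by simp
    have "lk Pstab X \<in> Z1" unfolding lookup_Pstab
      by (intro Z1_sum pcoef_Z1) (use XT in \<open>simp add: Theta_tilde_def\<close>)
    then show "X \<in> Theta_tilde n \<and> sigma_mat n X = sigma_mat n A \<and> lk Pstab X \<in> Z1"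
      using XT sigma_moved[OF t(1)] t(2) by simp
  qed
  have s: "sigma_mat n B = sigma_mat n A"
    using sigma_ro_co[OF n Bp] BA by (simp add: sigma_mat_eq)
  show "\<forall>\<^sub>F a in at_top. let r = nat (a * int n + sigma_mat n A) in
        \<forall>C. of_int (lk (schurZ_mult n r (br1 n r (shift a B)) (br1 n r (shift a A))) C) =
            (\<Sum>X\<in>Poly_Mapping.keys Pstab. poly (lk Pstab X) (of_int a) * of_int (lk (br1 n r (shift a X)) C))"
    using eventually_shift_Theta[OF n At] eventually_shift_Theta[OF n Bt]
  proof eventually_elim
    case (elim a)
    then show ?case unfolding Let_def sum_br1 using stab_value[OF _ _ _ BA] s by simp
  qed
qed

text \<open>Polynomials that agree at all large integers are equal.\<close>

lemma stab_unique:
  assumes Bt: "B \<in> Theta_tilde n" and At: "A \<in> Theta_tilde n" and BA: "co B = ro A"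
    and P: "is_stab_prod n B A P"
  shows "P = Pstab"
proof (rule poly_mapping_eqI)
  fix X
  note P0 = Pstab_is_stab[OF Bt At BA]
  show "lk P X = lk Pstab X"
  proof (cases "X \<in> Theta_tilde n \<and> sigma_mat n X = sigma_mat n A")
    case False
    then have "X \<notin> Poly_Mapping.keys P" "X \<notin> Poly_Mapping.keys Pstab" using P P0 unfolding is_stab_prod_def by blast+
    then show ?thesis by (simp add: in_keys_iff)
  next
    case X: True
    have ev: "\<forall>\<^sub>F a in at_top. let r = nat (a * int n + sigma_mat n A) in
        \<forall>C. of_int (lk (schurZ_mult n r (br1 n r (shift a B)) (br1 n r (shift a A))) C) =
            (\<Sum>X\<in>Poly_Mapping.keys Q. poly (lk Q X) (of_int a) * of_int (lk (br1 n r (shift a X)) C))"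
      if "is_stab_prod n B A Q" for Q using that unfolding is_stab_prod_def by blast
    have "\<forall>\<^sub>F a in at_top. poly (lk P X - lk Pstab X) (of_int a) = 0"
      using ev[OF P] ev[OF P0] eventually_shift_Theta[OF n conjunct1[OF X]]
    proof eventually_elim
      case (elim a)
      let ?r = "nat (a * int n + sigma_mat n A)"
      have C: "shift a X \<in> Theta_r n ?r" using elim(3) X by simp
      have "shift (- a) (shift a X) = X" using shift_inj[of a X "shift a X"] by simp
      then show ?case using elim(1,2) C unfolding Let_def sum_br1 by (auto dest!: spec[of _ "shift a X"])
    qed
    then obtain N where N: "\<And>a. a \<ge> N \<Longrightarrow> poly (lk P X - lk Pstab X) (of_int a) = 0"
      unfolding eventually_at_top_linorder by blast
    have "infinite ((of_int :: int \<Rightarrow> rat) ` {N..})"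
      by (simp add: finite_image_iff inj_on_def infinite_Ici)
    moreover have "(of_int :: int \<Rightarrow> rat) ` {N..} \<subseteq> {x. poly (lk P X - lk Pstab X) x = 0}" using N by auto
    ultimately have "lk P X - lk Pstab X = 0" using poly_roots_finite finite_subset by blast
    then show ?thesis by simp
  qed
qed

text \<open>Evaluate the stabilized coefficient at \<open>a = 0\<close>.\<close>

theorem lookup_KZ_prod:
  assumes Bt: "B \<in> Theta_tilde n" and At: "A \<in> Theta_tilde n" and BA: "co B = ro A"
  shows "lk (KZ_prod n B A) X = (\<Sum>t | t \<in> TT n B A \<and> moved A t = X. tcoef n t X)"
proof -
  have "(THE P. is_stab_prod n B A P) = Pstab"
    by (rule the_equality) (rule Pstab_is_stab[OF Bt At BA], rule stab_unique[OF Bt At BA])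
  then have "Ktilde_prod n B A = Pstab" using BA by (simp add: Ktilde_prod_def)
  then have "lk (KZ_prod n B A) X = poly (lk Pstab X) 0" by (simp add: KZ_prod_def lookup_map_zero)
  moreover have "shift 0 X = X" by (simp add: shift_def diag_def fun_eq_iff)
  ultimately show ?thesis using poly_Pstab[of X 0] by simp
qed

end

lemma KZ_prod_zero: "co B \<noteq> ro A \<Longrightarrow> KZ_prod n B A = 0"
  by (rule poly_mapping_eqI) (simp add: KZ_prod_def Ktilde_prod_def lookup_map_zero)

section \<open>Integer-valued polynomials\<close>

text \<open>The ring of polynomials with integral values at integers, given as the additive group spanned by
  the binomials; Newton interpolation keeps translates and products inside.\<close>

inductive_set int_valued :: "(int \<Rightarrow> rat) set" where
  base: "(\<lambda>x. of_int x gchoose k) \<in> int_valued"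
| zero: "(\<lambda>x. 0) \<in> int_valued"
| add: "p \<in> int_valued \<Longrightarrow> p' \<in> int_valued \<Longrightarrow> (\<lambda>x. p x + p' x) \<in> int_valued"
| neg: "p \<in> int_valued \<Longrightarrow> (\<lambda>x. - p x) \<in> int_valued"

lemma int_valued_one: "(\<lambda>x. 1) \<in> int_valued"
  using int_valued.base[of 0] by simp

lemma int_valued_const: "(\<lambda>x. of_int c) \<in> int_valued"
proof -
  have "(\<lambda>x::int. of_nat k) \<in> int_valued" for k
  proof (induction k)
    case 0 show ?case using int_valued.zero by simp
  next
    case (Suc k) show ?case using int_valued.add[OF int_valued_one Suc] by simp
  qed
  note nat = this
  show ?thesis
  proof (cases "c \<ge> 0")
    case True then show ?thesis using nat[of "nat c"] by (simp add: of_nat_nat)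
  next
    case False then show ?thesis using int_valued.neg[OF nat[of "nat (- c)"]] by (simp add: of_nat_nat)
  qed
qed

lemma gbinomial_step: "((of_int (x + 1) :: rat) gchoose Suc k) - (of_int x gchoose Suc k) = of_int x gchoose k"
  using gbinomial_Suc_Suc[of "of_int x :: rat" k] by simp

text \<open>Newton interpolation: a function is determined by its value at \<open>0\<close> and its differences.\<close>

lemma int_valued_newton:
  assumes d: "d \<in> int_valued" and p: "\<And>x. p (x + 1) - p x = d x" and c: "p 0 = of_int c"
  shows "p \<in> int_valued"
proof -
  have "\<exists>P\<in>int_valued. P 0 = 0 \<and> (\<forall>x. P (x + 1) - P x = d x)"
    using d
  proof induction
    case (base k)
    show ?case by (rule bexI[OF _ int_valued.base[of "Suc k"]]) (use gbinomial_step in simp)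
  next
    case zero show ?case by (rule bexI[OF _ int_valued.zero]) simp
  next
    case (add p q)
    then obtain P Q where P: "P \<in> int_valued" "P 0 = 0" "\<And>x. P (x + 1) - P x = p x"
      and Q: "Q \<in> int_valued" "Q 0 = 0" "\<And>x. Q (x + 1) - Q x = q x" by blast
    have "(P (x + 1) + Q (x + 1)) - (P x + Q x) = p x + q x" for x using P(3)[of x] Q(3)[of x] by simp
    then show ?case using P Q by (intro bexI[OF _ int_valued.add[OF P(1) Q(1)]]) simp
  next
    case (neg p)
    then obtain P where P: "P \<in> int_valued" "P 0 = 0" "\<And>x. P (x + 1) - P x = p x" by blast
    have "- P (x + 1) - - P x = - p x" for x using P(3)[of x] by simp
    then show ?case using P by (intro bexI[OF _ int_valued.neg[OF P(1)]]) simp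
  qed
  then obtain P where P: "P \<in> int_valued" "P 0 = 0" "\<And>x. P (x + 1) - P x = d x" by blast
  have step: "p (x + 1) - P (x + 1) = p x - P x" for x using p[of x] P(3)[of x] by linarith
  have "p x - P x = p 0 - P 0" for x
  proof (induction x rule: int_induct[where k = 0])
    case base show ?case ..
  next
    case (step1 i) then show ?case using step[of i] by simp
  next
    case (step2 i) then show ?case using step[of "i - 1"] by simp
  qed
  then have "p x = P x + of_int c" for x using P(2) c by (metis diff_add_cancel diff_zero add.commute)
  then have "p = (\<lambda>x. P x + of_int c)" by (rule ext)
  then show ?thesis using int_valued.add[OF P(1) int_valued_const] by simp
qed

lemma gbinomial_int: "\<exists>z. (of_int c :: rat) gchoose k = of_int z"
proof (induction k arbitrary: c)
  case 0 show ?case by (intro exI[of _ 1]) simp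
next
  case (Suc k)
  show ?case
  proof (induction c rule: int_induct[where k = 0])
    case base show ?case by (intro exI[of _ 0]) simp
  next
    case (step1 i)
    obtain a b where "(of_int i :: rat) gchoose k = of_int a" "(of_int i :: rat) gchoose Suc k = of_int b"
      using Suc step1 by blast
    then have "(of_int (i + 1) :: rat) gchoose Suc k = of_int (a + b)" using gbinomial_step[of i k] by simp
    then show ?case by blast
  next
    case (step2 i)
    obtain a b where "(of_int (i - 1) :: rat) gchoose k = of_int a" "(of_int i :: rat) gchoose Suc k = of_int b"
      using Suc step2 by blast
    then have "(of_int (i - 1) :: rat) gchoose Suc k = of_int (b - a)" using gbinomial_step[of "i - 1" k] by simp
    then show ?case by blast
  qed
qed

lemma int_valued_shift: "(\<lambda>x. of_int (x + c) gchoose k) \<in> int_valued"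
proof (induction k)
  case 0 show ?case using int_valued_one by simp
next
  case (Suc k)
  obtain z where z: "(of_int c :: rat) gchoose Suc k = of_int z" using gbinomial_int by blast
  show ?case
  proof (rule int_valued_newton[OF Suc])
    show "(of_int (x + 1 + c) gchoose Suc k) - (of_int (x + c) gchoose Suc k) = (of_int (x + c) :: rat) gchoose k" for x
      using gbinomial_step[of "x + c" k] by (simp add: add_ac)
    show "(of_int (0 + c) gchoose Suc k) = (of_int z :: rat)" using z by simp
  qed
qed

text \<open>The difference of a product of binomials is a combination of products of smaller total degree.\<close>

lemma int_valued_mult_base: "(\<lambda>x. (of_int x gchoose k) * (of_int x gchoose l)) \<in> int_valued"
proof (induction "k + l" arbitrary: k l rule: less_induct)
  case less
  show ?case
  proof (cases k)
    case 0 then show ?thesis using int_valued.base[of l] by simp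
  next
    case k: (Suc k')
    show ?thesis
    proof (cases l)
      case 0 then show ?thesis using int_valued.base[of k] by simp
    next
      case l: (Suc l')
      let ?b = "\<lambda>k x. (of_int x :: rat) gchoose k"
      have d: "(\<lambda>x. (?b k x * ?b l' x + ?b k' x * ?b l x) + ?b k' x * ?b l' x) \<in> int_valued"
        by (intro int_valued.add less) (auto simp: k l)
      show ?thesis
      proof (rule int_valued_newton[OF d])
        fix x
        have "?b k (x + 1) = ?b k' x + ?b k x" "?b l (x + 1) = ?b l' x + ?b l x"
          using gbinomial_step[of x k'] gbinomial_step[of x l'] by (simp_all add: k l)
        then show "?b k (x + 1) * ?b l (x + 1) - ?b k x * ?b l x = (?b k x * ?b l' x + ?b k' x * ?b l x) + ?b k' x * ?b l' x"
          by (simp add: algebra_simps)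
        show "?b k 0 * ?b l 0 = of_int 0" by (simp add: k)
      qed
    qed
  qed
qed

lemma int_valued_mult: "p \<in> int_valued \<Longrightarrow> p' \<in> int_valued \<Longrightarrow> (\<lambda>x. p x * p' x) \<in> int_valued"
proof (induction p rule: int_valued.induct)
  case (base k)
  from base show ?case
  proof (induction p' rule: int_valued.induct)
    case (base l) show ?case by (rule int_valued_mult_base)
  next
    case zero show ?case using int_valued.zero by simp
  next
    case (add p q) then show ?case using int_valued.add by (fastforce simp: distrib_left)
  next
    case (neg p) then show ?case using int_valued.neg by fastforce
  qed
next
  case zero show ?case using int_valued.zero by simp
next
  case (add p q) then show ?case using int_valued.add by (fastforce simp: distrib_right)
next
  case (neg p) then show ?case using int_valued.neg by fastforce
qed

section \<open>Diagonal families\<close>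

text \<open>The elements \<open>A{\<lambda>}\<close> with an arbitrary coefficient function in place of a binomial.\<close>

definition family :: "nat \<Rightarrow> mat \<Rightarrow> (seq \<Rightarrow> rat) \<Rightarrow> (mat \<Rightarrow> rat)" where
  "family n A P = (\<lambda>X. \<Sum>m | m \<in> Zseq n \<and> X = A + diag m. P m)"

lemma brace_eq: "brace n A l = family n A (\<lambda>m. binom_seq n m l)"
  by (simp add: brace_def family_def)

lemma diag_apply [simp]: "diag m i j = (if i = j then m i else 0)"
  by (simp add: diag_def)

lemma add_diag_apply: "(A + diag m) i j = (if i = j then A i j + m i else A i j)"
  by (simp add: diag_def)

lemma add_diag_inj: "A + diag m = A + diag m' \<longleftrightarrow> m = m'"
proof
  assume e: "A + diag m = A + diag m'"
  show "m = m'"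
  proof
    fix i show "m i = m' i" using fun_cong[OF fun_cong[OF e, of i], of i] by (simp add: add_diag_apply)
  qed
qed simp

lemma family_apply: "m \<in> Zseq n \<Longrightarrow> family n A P (A + diag m) = P m"
proof -
  assume m: "m \<in> Zseq n"
  have "{m'. m' \<in> Zseq n \<and> A + diag m = A + diag m'} = {m}" unfolding add_diag_inj using m by blast
  then show ?thesis by (simp add: family_def)
qed

lemma family_outside: "(\<And>m. m \<in> Zseq n \<Longrightarrow> X \<noteq> A + diag m) \<Longrightarrow> family n A P X = 0"
  unfolding family_def by (rule sum.neutral) auto

lemma family_nonzero: "family n A P X \<noteq> 0 \<Longrightarrow> \<exists>m\<in>Zseq n. X = A + diag m"
  using family_outside by blast

lemma family_add: "family n A (\<lambda>m. P m + Q m) = family n A P + family n A Q"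
  by (auto simp: family_def sum.distrib fun_eq_iff)

lemma family_neg: "family n A (\<lambda>m. - P m) = - family n A P"
  by (auto simp: family_def sum_negf fun_eq_iff)

lemma family_zero: "family n A (\<lambda>m. 0) = 0"
  by (auto simp: family_def fun_eq_iff)

lemma family_cong: "(\<And>m. m \<in> Zseq n \<Longrightarrow> P m = Q m) \<Longrightarrow> family n A P = family n A Q"
  unfolding family_def by (intro ext sum.cong) auto

definition add_closed :: "(mat \<Rightarrow> rat) set \<Rightarrow> bool" where
  "add_closed U \<longleftrightarrow> 0 \<in> U \<and> (\<forall>x\<in>U. \<forall>y\<in>U. x + y \<in> U) \<and> (\<forall>x\<in>U. - x \<in> U)"

lemma add_closed_sum: "add_closed U \<Longrightarrow> (\<And>a. a \<in> S \<Longrightarrow> f a \<in> U) \<Longrightarrow> sum f S \<in> U"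
  by (induction S rule: infinite_finite_induct) (auto simp: add_closed_def)

lemma add_closed_diff: "add_closed U \<Longrightarrow> x \<in> U \<Longrightarrow> y \<in> U \<Longrightarrow> x - y \<in> U"
  unfolding add_closed_def using add_uminus_conv_diff by metis

text \<open>Expanding one factor \<open>p i\<close> at a time into binomials. The offset \<open>c\<close> allows binomials in translated
  variables as input.\<close>

lemma family_in:
  assumes n: "1 \<le> n" and U: "add_closed U" and br: "\<And>l. l \<in> Nseq n \<Longrightarrow> family n A (\<lambda>m. binom_seq n (m + c) l) \<in> U"
    and p: "\<And>i. i \<in> {1..int n} \<Longrightarrow> p i \<in> int_valued"
  shows "family n A (\<lambda>m. \<Prod>i=1..int n. p i (m i + c i)) \<in> U"
proof -
  have U0: "0 \<in> U" and Ua: "\<And>x y. x \<in> U \<Longrightarrow> y \<in> U \<Longrightarrow> x + y \<in> U" and Un: "\<And>x. x \<in> U \<Longrightarrow> - x \<in> U"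
    using U by (auto simp: add_closed_def)
  have "family n A (\<lambda>m. \<Prod>i=1..int n. p i (m i + c i)) \<in> U"
    if "finite S" "S \<subseteq> {1..int n}" "\<And>i. i \<in> S \<Longrightarrow> p i \<in> int_valued"
      "\<And>i. i \<in> {1..int n} - S \<Longrightarrow> p i = (\<lambda>x. of_int x gchoose l i)" for S p and l :: "int \<Rightarrow> nat"
    using that
  proof (induction S arbitrary: p l rule: finite_induct)
    case empty
    let ?l = "\<lambda>j. int (l ((j - 1) mod int n + 1))"
    have "(i + int n - 1) mod int n = (i - 1) mod int n" for i
      using mod_add_self2[of "i - 1" "int n"] by (simp add: algebra_simps)
    then have "?l \<in> Nseq n" by (simp add: Nseq_def Zseq_def)
    moreover have "(\<Prod>i=1..int n. p i (m i + c i)) = binom_seq n (m + c) ?l" for m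
      unfolding binom_seq_def by (rule prod.cong) (use empty in auto)
    ultimately show ?case using br[of ?l] by simp
  next
    case (insert a S)
    have a: "a \<in> {1..int n}" using insert by auto
    have split: "(\<Prod>i=1..int n. (p(a := g)) i (m i + c i)) = g (m a + c a) * (\<Prod>i\<in>{1..int n} - {a}. p i (m i + c i))" for g m
    proof -
      have "(\<Prod>i=1..int n. (p(a := g)) i (m i + c i)) = (p(a := g)) a (m a + c a) * (\<Prod>i\<in>{1..int n} - {a}. (p(a := g)) i (m i + c i))"
        by (rule prod.remove) (use a in auto)
      also have "(\<Prod>i\<in>{1..int n} - {a}. (p(a := g)) i (m i + c i)) = (\<Prod>i\<in>{1..int n} - {a}. p i (m i + c i))"
        by (rule prod.cong) auto
      finally show ?thesis by simp
    qed
    have "family n A (\<lambda>m. g (m a + c a) * (\<Prod>i\<in>{1..int n} - {a}. p i (m i + c i))) \<in> U" if "g \<in> int_valued" for g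
      using that
    proof induction
      case (base k)
      have "family n A (\<lambda>m. \<Prod>i=1..int n. (p(a := \<lambda>x. of_int x gchoose k)) i (m i + c i)) \<in> U"
      proof (rule insert.IH[where l = "l(a := k)"])
        show "S \<subseteq> {1..int n}" using insert.prems by blast
        show "(p(a := \<lambda>x. of_int x gchoose k)) i \<in> int_valued" if "i \<in> S" for i
          using that insert.prems(2)[of i] int_valued.base[of k] by simp
        show "(p(a := \<lambda>x. of_int x gchoose k)) i = (\<lambda>x. of_int x gchoose (l(a := k)) i)" if "i \<in> {1..int n} - S" for i
          using that insert.prems(3)[of i] by auto
      qed
      then show ?case unfolding split .
    next
      case zero show ?case by (simp only: mult_zero_left family_zero U0)
    next
      case (add g g')
      show ?case unfolding distrib_right family_add by (rule Ua[OF add(3,4)])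
    next
      case (neg g)
      show ?case unfolding mult_minus_left family_neg by (rule Un[OF neg(2)])
    qed
    from this[OF insert.prems(2)[of a]] have "family n A (\<lambda>m. \<Prod>i=1..int n. (p(a := p a)) i (m i + c i)) \<in> U"
      unfolding split by simp
    then show ?case by simp
  qed
  from this[of "{1..int n}" p "\<lambda>_. 0"] show ?thesis using p by simp
qed

section \<open>Products of diagonal families\<close>

definition offd :: "mat \<Rightarrow> mat" where "offd X = (\<lambda>i j. if i = j then 0 else X i j)"

definition tdelta :: "tens \<Rightarrow> seq" where "tdelta t = (\<lambda>i. int (tin t i i) - int (tout t i i))"

lemma offd_add_diag: "offd (A + diag m) = offd A"
  by (simp add: offd_def add_diag_apply fun_eq_iff)

lemma offd_decomp: "X = offd X + diag (\<lambda>i. X i i)"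
  by (intro ext) (simp add: offd_def add_diag_apply)

lemma family_offd:
  assumes "\<And>i. X0 i i = 0"
  shows "family n X0 R X = (if offd X = X0 \<and> (\<lambda>i. X i i) \<in> Zseq n then R (\<lambda>i. X i i) else 0)"
proof (cases "offd X = X0 \<and> (\<lambda>i. X i i) \<in> Zseq n")
  case True
  then have "family n X0 R X = family n X0 R (X0 + diag (\<lambda>i. X i i))" using offd_decomp[of X] by metis
  then show ?thesis using True family_apply by simp
next
  case False
  have "X \<noteq> X0 + diag m" if "m \<in> Zseq n" for m
  proof
    assume e: "X = X0 + diag m"
    have o: "offd X0 = X0" using assms by (auto simp: offd_def fun_eq_iff)
    have "offd X = X0" unfolding e offd_add_diag o ..
    moreover have "(\<lambda>i. X i i) = m" unfolding e using assms by (auto simp: add_diag_apply)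
    ultimately show False using False that by simp
  qed
  then have "family n X0 R X = 0" by (rule family_outside)
  then show ?thesis by (simp only: False if_False)
qed

lemma Theta_pm_tilde: "A \<in> Theta_pm n \<Longrightarrow> A \<in> Theta_tilde n"
  by (simp add: Theta_pm_def Theta_def Theta_tilde_def)

lemma Theta_pm_per: "A \<in> Theta_pm n \<Longrightarrow> A \<in> per_mats n"
  by (simp add: Theta_pm_def Theta_def)

lemma Theta_pm_diag: "A \<in> Theta_pm n \<Longrightarrow> A i i = 0"
  by (simp add: Theta_pm_def)

lemma Theta_pm_nonneg: "A \<in> Theta_pm n \<Longrightarrow> 0 \<le> A i j"
  by (simp add: Theta_pm_def Theta_def)

lemma Theta_tilde_add_diag: "A \<in> Theta_tilde n \<Longrightarrow> m \<in> Zseq n \<Longrightarrow> A + diag m \<in> Theta_tilde n"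
  using per_mats_add_diag[of A n m] by (simp add: Theta_tilde_def add_diag_apply)

lemma Zseq_add: "a \<in> Zseq n \<Longrightarrow> b \<in> Zseq n \<Longrightarrow> a + b \<in> Zseq n"
  and Zseq_diff: "a \<in> Zseq n \<Longrightarrow> b \<in> Zseq n \<Longrightarrow> a - b \<in> Zseq n"
  by (simp_all add: Zseq_def)

lemma ro_Zseq: "A \<in> per_mats n \<Longrightarrow> ro A \<in> Zseq n" and co_Zseq: "A \<in> per_mats n \<Longrightarrow> co A \<in> Zseq n"
proof -
  assume A: "A \<in> per_mats n"
  have p: "A (i + int n) (j + int n) = A i j" for i j using A by (simp add: per_mats_def)
  have "Sum_any (\<lambda>j. A (i + int n) j) = Sum_any (\<lambda>j. A i j)" for i
    by (rule Sum_any.reindex_cong[of "\<lambda>j. j + int n"])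
      (auto simp: p fun_eq_iff intro!: bij_betw_byWitness[where f' = "\<lambda>j. j - int n"])
  then show "ro A \<in> Zseq n" by (simp add: Zseq_def ro_eq)
  have "Sum_any (\<lambda>j. A j (i + int n)) = Sum_any (\<lambda>j. A j i)" for i
    by (rule Sum_any.reindex_cong[of "\<lambda>j. j + int n"])
      (auto simp: p fun_eq_iff intro!: bij_betw_byWitness[where f' = "\<lambda>j. j - int n"])
  then show "co A \<in> Zseq n" by (simp add: Zseq_def co_eq)
qed

lemma KZ_support:
  assumes n: "1 \<le> n" and B: "B \<in> Theta_tilde n" and A: "A \<in> Theta_tilde n" and X: "lk (KZ_prod n B A) X \<noteq> 0"
  shows "co B = ro A" "\<exists>t\<in>TT n B A. moved A t = X" "X \<in> Theta_tilde n" "ro X = ro B" "co X = co A"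
proof -
  interpret transport n B A by unfold_locales (use n A B Theta_tilde_per in auto)
  show c: "co B = ro A"
  proof (rule ccontr)
    assume "co B \<noteq> ro A"
    then show False using X KZ_prod_zero[of B A n] by simp
  qed
  have "(\<Sum>t | t \<in> TT n B A \<and> moved A t = X. tcoef n t X) \<noteq> 0" using X lookup_KZ_prod[OF B A c] by simp
  then have "{t. t \<in> TT n B A \<and> moved A t = X} \<noteq> {}" by (metis (mono_tags, lifting) sum.empty)
  then obtain t where t: "t \<in> TT n B A" "moved A t = X" by blast
  then show "\<exists>t\<in>TT n B A. moved A t = X" by blast
  show "X \<in> Theta_tilde n" "ro X = ro B" "co X = co A"
    using moved_Theta_tilde[OF t(1)] ro_moved[OF t(1) c] co_moved[OF t(1)] t(2) by auto
qed

locale family_product =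
  fixes n :: nat and B A :: mat
  assumes n: "1 \<le> n" and Bpm: "B \<in> Theta_pm n" and Apm: "A \<in> Theta_pm n"
begin

sublocale transport n B A
  by unfold_locales (use n Bpm Apm Theta_pm_per in auto)

lemma moved_add_diag: "moved (A + diag \<alpha>) t = offd (moved A t) + diag (\<alpha> + tdelta t)"
  using Theta_pm_diag[OF Apm] by (intro ext) (simp add: moved_def offd_def tdelta_def add_diag_apply)

lemma moved_diag: "moved A t i i = tdelta t i"
  using Theta_pm_diag[OF Apm] by (simp add: moved_def tdelta_def)

lemma tdelta_Zseq: "t \<in> TT n B A \<Longrightarrow> tdelta t \<in> Zseq n"
  using moved_per[of t] moved_diag[of t] by (auto simp: per_mats_def Zseq_def) metis

lemma offd_moved_pm: "t \<in> TT n B A \<Longrightarrow> offd (moved A t) \<in> Theta_pm n"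
proof -
  assume t: "t \<in> TT n B A"
  have p: "moved A t \<in> per_mats n" and nn: "\<And>i j. i \<noteq> j \<Longrightarrow> 0 \<le> moved A t i j"
    using moved_Theta_tilde[OF t] by (auto simp: Theta_tilde_def)
  have "- tdelta t \<in> Zseq n" using tdelta_Zseq[OF t] by (simp add: Zseq_def)
  from per_mats_add_diag[OF p this] have "moved A t + diag (- tdelta t) \<in> per_mats n" .
  moreover have "moved A t + diag (- tdelta t) = offd (moved A t)"
    by (intro ext) (simp add: add_diag_apply offd_def moved_diag)
  ultimately show ?thesis using nn by (simp add: Theta_pm_def Theta_def offd_def)
qed

lemma TT_add_diag: "TT n (B + diag \<beta>) (A + diag \<alpha>) = TT n B A"
  by (rule TT_offdiag_cong) (simp_all add: add_diag_apply)

text \<open>The diagonals of the two factors that a tensor \<open>t\<close> turns into the diagonal \<open>\<xi>\<close>: the right one by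
  undoing the move, the left one from \<open>co B = ro A\<close> for the full matrices.\<close>

definition arg_right :: "tens \<Rightarrow> seq \<Rightarrow> seq" where "arg_right t \<xi> = \<xi> - tdelta t"
definition arg_left :: "tens \<Rightarrow> seq \<Rightarrow> seq" where "arg_left t \<xi> = \<xi> - tdelta t + ro A - co B"

text \<open>Different tensors may come from the same pair of factors, so the pairs contributing to \<open>X\<close> are
  summed over the fibres of the map sending a tensor to its pair.\<close>

theorem Khat_mult_family:
  "Khat_mult n (family n B P) (family n A Q) = (\<Sum>t\<in>TT n B A. family n (offd (moved A t))
     (\<lambda>\<xi>. P (arg_left t \<xi>) * Q (arg_right t \<xi>) * tcoef n t (offd (moved A t) + diag \<xi>)))"
proof
  fix X :: mat
  define \<xi> where "\<xi> = (\<lambda>i. X i i)"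
  let ?F = "\<lambda>(B', A'). family n B P B' * family n A Q A' * lk (KZ_prod n B' A') X"
  let ?N = "{(B', A'). family n B P B' * family n A Q A' * lk (KZ_prod n B' A') X \<noteq> 0}"
  let ?Q = "{t \<in> TT n B A. offd (moved A t) = offd X}"
  let ?g = "\<lambda>t. P (arg_left t \<xi>) * Q (arg_right t \<xi>) * tcoef n t X"
  have L: "Khat_mult n (family n B P) (family n A Q) X = (\<Sum>p\<in>?N. ?F p)"
    unfolding Khat_mult_def ..
  have X: "X = offd X + diag \<xi>" unfolding \<xi>_def by (rule offd_decomp)
  have R: "(\<Sum>t\<in>TT n B A. family n (offd (moved A t))
     (\<lambda>\<xi>. P (arg_left t \<xi>) * Q (arg_right t \<xi>) * tcoef n t (offd (moved A t) + diag \<xi>))) X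
     = (\<Sum>t\<in>TT n B A. if offd (moved A t) = offd X \<and> \<xi> \<in> Zseq n then ?g t else 0)"
    unfolding sum_fun_apply
  proof (rule sum.cong[OF refl])
    fix t
    have "offd X = offd (moved A t) \<Longrightarrow> offd (moved A t) + diag \<xi> = X" using X by simp
    then show "family n (offd (moved A t)) (\<lambda>\<xi>. P (arg_left t \<xi>) * Q (arg_right t \<xi>) * tcoef n t (offd (moved A t) + diag \<xi>)) X
        = (if offd (moved A t) = offd X \<and> \<xi> \<in> Zseq n then ?g t else 0)"
      by (subst family_offd) (auto simp: offd_def \<xi>_def)
  qed
  have N: "\<exists>\<beta>\<in>Zseq n. \<exists>\<alpha>\<in>Zseq n. B' = B + diag \<beta> \<and> A' = A + diag \<alpha> \<and> co B' = ro A' \<and>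
      (\<exists>t\<in>TT n B A. moved A' t = X) \<and> X \<in> Theta_tilde n" if p: "(B', A') \<in> ?N" for B' A'
  proof -
    have nz: "family n B P B' \<noteq> 0" "family n A Q A' \<noteq> 0" "lk (KZ_prod n B' A') X \<noteq> 0" using p by auto
    obtain \<beta> \<alpha> where ba: "\<beta> \<in> Zseq n" "B' = B + diag \<beta>" "\<alpha> \<in> Zseq n" "A' = A + diag \<alpha>"
      using family_nonzero[OF nz(1)] family_nonzero[OF nz(2)] by blast
    have T: "B' \<in> Theta_tilde n" "A' \<in> Theta_tilde n"
      using ba Theta_tilde_add_diag Theta_pm_tilde Apm Bpm by auto
    show ?thesis using ba KZ_support[OF n T nz(3)] TT_add_diag by blast
  qed
  show "Khat_mult n (family n B P) (family n A Q) X = (\<Sum>t\<in>TT n B A. family n (offd (moved A t))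
     (\<lambda>\<xi>. P (arg_left t \<xi>) * Q (arg_right t \<xi>) * tcoef n t (offd (moved A t) + diag \<xi>))) X"
  proof (cases "\<xi> \<in> Zseq n")
    case False
    have "?N = {}"
    proof (rule ccontr)
      assume "?N \<noteq> {}"
      then obtain B' A' where "(B', A') \<in> ?N" by auto
      from N[OF this] have "X \<in> per_mats n" using Theta_tilde_per by blast
      then show False using False by (simp add: per_mats_def Zseq_def \<xi>_def)
    qed
    then have "(\<Sum>p\<in>?N. ?F p) = 0" by (simp only: sum.empty)
    then show ?thesis unfolding L R using False by simp
  next
    case \<xi>: True
    have argZ: "arg_right t \<xi> \<in> Zseq n" "arg_left t \<xi> \<in> Zseq n" if "t \<in> TT n B A" for t
      unfolding arg_right_def arg_left_def
      by (intro Zseq_add Zseq_diff \<xi> tdelta_Zseq[OF that] ro_Zseq[OF Ap] co_Zseq[OF Bp])+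
    let ?\<phi> = "\<lambda>t. (B + diag (arg_left t \<xi>), A + diag (arg_right t \<xi>))"
    have fQ: "finite ?Q" using finite_TT by simp
    have mX: "moved (A + diag \<alpha>) t = X \<longleftrightarrow> offd (moved A t) = offd X \<and> \<alpha> = arg_right t \<xi>" for \<alpha> t
    proof
      assume e: "moved (A + diag \<alpha>) t = X"
      then have e': "offd (moved A t) + diag (\<alpha> + tdelta t) = X" unfolding moved_add_diag .
      have "offd X = offd (offd (moved A t))" unfolding e'[symmetric] by (rule offd_add_diag)
      then have o: "offd (moved A t) = offd X" by (simp add: offd_def fun_eq_iff)
      have "\<xi> = \<alpha> + tdelta t" unfolding \<xi>_def e'[symmetric] by (auto simp: add_diag_apply offd_def)
      then show "offd (moved A t) = offd X \<and> \<alpha> = arg_right t \<xi>" using o by (simp add: arg_right_def)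
    next
      assume a: "offd (moved A t) = offd X \<and> \<alpha> = arg_right t \<xi>"
      then have "\<alpha> + tdelta t = \<xi>" by (simp add: arg_right_def)
      then show "moved (A + diag \<alpha>) t = X" unfolding moved_add_diag using a X by simp
    qed
    have comp: "co (B + diag \<beta>) = ro (A + diag \<alpha>) \<longleftrightarrow> \<beta> = \<alpha> + ro A - co B" for \<beta> \<alpha>
    proof -
      have "co B + \<beta> = ro A + \<alpha> \<longleftrightarrow> \<beta> = \<alpha> + ro A - co B" by (auto simp: algebra_simps)
      then show ?thesis by (simp only: ro_add_diag[OF Ap] ro_add_diag[OF Bp])
    qed
    have Nsub: "?N \<subseteq> ?\<phi> ` ?Q"
    proof
      fix p assume p: "p \<in> ?N"
      obtain B' A' where p': "p = (B', A')" by (cases p)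
      from N[OF p[unfolded p']] obtain \<beta> \<alpha> t where *: "B' = B + diag \<beta>" "A' = A + diag \<alpha>" "co B' = ro A'"
        "t \<in> TT n B A" "moved A' t = X" by blast
      have t: "offd (moved A t) = offd X" "\<alpha> = arg_right t \<xi>" using * mX by auto
      have "\<beta> = arg_left t \<xi>" using * comp t by (simp add: arg_left_def arg_right_def)
      then show "p \<in> ?\<phi> ` ?Q" unfolding p' using * t by blast
    qed
    have val: "?F p = (\<Sum>t | t \<in> ?Q \<and> ?\<phi> t = p. ?g t)" if p: "p \<in> ?\<phi> ` ?Q" for p
    proof -
      obtain t0 where t0: "t0 \<in> ?Q" "p = ?\<phi> t0" using p by blast
      let ?B = "B + diag (arg_left t0 \<xi>)" and ?A = "A + diag (arg_right t0 \<xi>)"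
      have tt: "t0 \<in> TT n B A" using t0 by simp
      have T: "?B \<in> Theta_tilde n" "?A \<in> Theta_tilde n"
        using argZ[OF tt] Theta_tilde_add_diag Theta_pm_tilde Apm Bpm by auto
      have c: "co ?B = ro ?A" unfolding comp by (simp add: arg_left_def arg_right_def)
      interpret T2: transport n ?B ?A by unfold_locales (use n T Theta_tilde_per in auto)
      have eqn: "arg_right t \<xi> = arg_right t0 \<xi> \<longleftrightarrow> ?\<phi> t = ?\<phi> t0" for t
        unfolding prod.inject add_diag_inj by (auto simp: arg_left_def arg_right_def)
      have S: "{t. t \<in> TT n ?B ?A \<and> moved ?A t = X} = {t. t \<in> ?Q \<and> ?\<phi> t = p}"
        unfolding TT_add_diag mX t0(2) eqn[symmetric] by auto
      have "lk (KZ_prod n ?B ?A) X = (\<Sum>t | t \<in> ?Q \<and> ?\<phi> t = p. tcoef n t X)"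
        unfolding T2.lookup_KZ_prod[OF T c] S ..
      then have "?F p = (\<Sum>t | t \<in> ?Q \<and> ?\<phi> t = p. P (arg_left t0 \<xi>) * Q (arg_right t0 \<xi>) * tcoef n t X)"
        unfolding t0(2) prod.case family_apply[OF argZ(1)[OF tt]] family_apply[OF argZ(2)[OF tt]]
        by (simp add: sum_distrib_left)
      also have "\<dots> = (\<Sum>t | t \<in> ?Q \<and> ?\<phi> t = p. ?g t)"
      proof (rule sum.cong[OF refl])
        fix t assume "t \<in> {t. t \<in> ?Q \<and> ?\<phi> t = p}"
        then have "?\<phi> t = ?\<phi> t0" unfolding t0(2) by blast
        then have "arg_left t \<xi> = arg_left t0 \<xi>" "arg_right t \<xi> = arg_right t0 \<xi>"
          unfolding prod.inject add_diag_inj by blast+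
        then show "P (arg_left t0 \<xi>) * Q (arg_right t0 \<xi>) * tcoef n t X = ?g t" by (simp only:)
      qed
      finally show ?thesis .
    qed
    have "(\<Sum>p\<in>?N. ?F p) = (\<Sum>p\<in>?\<phi> ` ?Q. ?F p)"
      by (rule sum.mono_neutral_left) (use fQ Nsub in auto)
    also have "\<dots> = (\<Sum>p\<in>?\<phi> ` ?Q. \<Sum>t | t \<in> ?Q \<and> ?\<phi> t = p. ?g t)" by (rule sum.cong[OF refl val])
    also have "\<dots> = (\<Sum>t\<in>?Q. ?g t)" using sum.image_gen[OF fQ, of ?g ?\<phi>] by simp
    also have "\<dots> = (\<Sum>t\<in>TT n B A. if offd (moved A t) = offd X \<and> \<xi> \<in> Zseq n then ?g t else 0)"
      using \<xi> finite_TT by (simp add: sum.inter_filter)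
    finally show ?thesis unfolding L R .
  qed
qed

end

text \<open>Off the diagonal the entries of the result do not depend on \<open>\<xi>\<close>.\<close>

lemma tcoef_diag:
  assumes fs: "finite (tsupp n t)"
  shows "\<exists>N. \<forall>\<xi>. tcoef n t (offd X + diag \<xi>) = of_int N * (\<Prod>i=1..int n. of_int (\<xi> i) gchoose tin t i i)"
proof -
  let ?O = "{x \<in> tsupp n t. fst x \<noteq> snd x}" and ?D = "{x \<in> tsupp n t. fst x = snd x}"
  let ?g = "\<lambda>X (x :: int \<times> int). (of_int (X (fst x) (snd x)) :: rat) gchoose tin t (fst x) (snd x)"
  let ?M = "\<Prod>x\<in>tsupp n t. (of_nat (msplit (\<lambda>k. t (fst x) k (snd x))) :: rat)"
  let ?C = "(\<Prod>x\<in>?O. ?g (offd X) x) * ?M"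
  have "?C \<in> \<int>"
    by (intro Ints_mult Ints_prod Ints_of_nat) (metis Ints_of_int gbinomial_int)
  then obtain N where N: "?C = of_int N" by (auto elim: Ints_cases)
  have "tcoef n t (offd X + diag \<xi>) = of_int N * (\<Prod>i=1..int n. of_int (\<xi> i) gchoose tin t i i)" for \<xi>
  proof -
    let ?X = "offd X + diag \<xi>"
    have "tcoef n t ?X = (\<Prod>x\<in>tsupp n t. ?g ?X x) * ?M"
      unfolding tcoef_def prod.distrib[symmetric] by (simp add: case_prod_unfold)
    also have "(\<Prod>x\<in>tsupp n t. ?g ?X x) = (\<Prod>x\<in>?O. ?g ?X x) * (\<Prod>x\<in>?D. ?g ?X x)"
    proof -
      have "tsupp n t = ?O \<union> ?D" by blast
      moreover have "(\<Prod>x\<in>?O \<union> ?D. ?g ?X x) = (\<Prod>x\<in>?O. ?g ?X x) * (\<Prod>x\<in>?D. ?g ?X x)"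
        by (rule prod.union_disjoint) (use fs in auto)
      ultimately show ?thesis by simp
    qed
    also have "(\<Prod>x\<in>?O. ?g ?X x) = (\<Prod>x\<in>?O. ?g (offd X) x)"
      by (rule prod.cong) auto
    also have "(\<Prod>x\<in>?D. ?g ?X x) = (\<Prod>i\<in>{i \<in> {1..int n}. tin t i i \<noteq> 0}. of_int (\<xi> i) gchoose tin t i i)"
      by (rule prod.reindex_bij_witness[of _ "\<lambda>i. (i, i)" fst]) (auto simp: tsupp_def offd_def)
    also have "\<dots> = (\<Prod>i=1..int n. of_int (\<xi> i) gchoose tin t i i)"
      by (rule prod.mono_neutral_left) auto
    finally have e: "tcoef n t (offd X + diag \<xi>) = ((\<Prod>x\<in>?O. ?g (offd X) x) *
      (\<Prod>i=1..int n. of_int (\<xi> i) gchoose tin t i i)) * ?M" .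
    show ?thesis unfolding N[symmetric] e by (simp only: mult_ac)
  qed
  then show ?thesis by blast
qed

context family_product
begin

definition summand :: "seq \<Rightarrow> seq \<Rightarrow> tens \<Rightarrow> (mat \<Rightarrow> rat)" where
  "summand k l t = family n (offd (moved A t)) (\<lambda>\<xi>. binom_seq n (arg_left t \<xi>) k *
     binom_seq n (arg_right t \<xi>) l * tcoef n t (offd (moved A t) + diag \<xi>))"

lemma Khat_mult_brace: "Khat_mult n (brace n B k) (brace n A l) = (\<Sum>t\<in>TT n B A. summand k l t)"
  unfolding brace_eq Khat_mult_family summand_def ..

text \<open>The coefficient is a product over \<open>i\<close> of integer-valued polynomials in \<open>\<xi> i\<close>; the constant of
  \<open>tcoef_diag\<close> is put into the factor \<open>i = 1\<close>.\<close>

lemma summand_in: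
  assumes U: "add_closed U" and t: "t \<in> TT n B A"
    and br: "\<And>l. l \<in> Nseq n \<Longrightarrow> brace n (offd (moved A t)) l \<in> U"
  shows "summand k l t \<in> U"
proof -
  obtain N where N: "\<And>\<xi>. tcoef n t (offd (moved A t) + diag \<xi>) = of_int N * (\<Prod>i=1..int n. of_int (\<xi> i) gchoose tin t i i)"
    using tcoef_diag[OF tsupp_fin[OF t]] by blast
  let ?p = "\<lambda>i x. (((of_int (x + (- tdelta t i + ro A i - co B i)) gchoose nat (k i)) *
      (of_int (x + (- tdelta t i)) gchoose nat (l i))) * (of_int x gchoose tin t i i)) * (of_int (if i = 1 then N else 1) :: rat)"
  have "(\<Prod>i=1..int n. (of_int (if i = 1 then N else 1) :: rat)) = of_int N"
  proof -
    have "(\<Prod>i=1..int n. (of_int (if i = 1 then N else 1) :: rat)) = (\<Prod>i=1..int n. if i = 1 then of_int N else 1)"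
      by (rule prod.cong) auto
    then show ?thesis using n by (simp add: prod.delta)
  qed
  then have "binom_seq n (arg_left t \<xi>) k * binom_seq n (arg_right t \<xi>) l * tcoef n t (offd (moved A t) + diag \<xi>)
      = (\<Prod>i=1..int n. ?p i (\<xi> i + 0))" for \<xi>
    unfolding N binom_seq_def prod.distrib by (simp add: arg_left_def arg_right_def algebra_simps)
  moreover have "family n (offd (moved A t)) (\<lambda>\<xi>. \<Prod>i=1..int n. ?p i (\<xi> i + (0::seq) i)) \<in> U"
  proof (rule family_in[OF n U])
    show "family n (offd (moved A t)) (\<lambda>m. binom_seq n (m + 0) l) \<in> U" if "l \<in> Nseq n" for l
      using br[OF that] unfolding brace_eq add_0_right .
    show "?p i \<in> int_valued" for i
      by (intro int_valued_mult int_valued_shift int_valued.base int_valued_const)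
  qed
  ultimately show ?thesis unfolding summand_def by (simp only: zero_fun_apply)
qed

end

section \<open>The completed algebra\<close>

definition contributing :: "nat \<Rightarrow> (mat \<Rightarrow> rat) \<Rightarrow> (mat \<Rightarrow> rat) \<Rightarrow> mat \<Rightarrow> (mat \<times> mat) set" where
  "contributing n b c X = {(B, A). b B * c A * lk (KZ_prod n B A) X \<noteq> 0}"

text \<open>The row sums of the left factor and the column sums of the right factor are those of \<open>X\<close>, and
  the carrier admits finitely many matrices with given sums.\<close>

lemma finite_contributing:
  assumes n: "1 \<le> n" and b: "b \<in> Khat_carrier n" and c: "c \<in> Khat_carrier n"
  shows "finite (contributing n b c X)"
proof (cases "ro X \<in> Zseq n \<and> co X \<in> Zseq n")
  case True
  have "contributing n b c X \<subseteq> {B. b B \<noteq> 0 \<and> ro B = ro X} \<times> {A. c A \<noteq> 0 \<and> co A = co X}"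
  proof
    fix p assume "p \<in> contributing n b c X"
    then obtain B A where p: "p = (B, A)" "b B \<noteq> 0" "c A \<noteq> 0" "lk (KZ_prod n B A) X \<noteq> 0"
      by (auto simp: contributing_def)
    have "B \<in> Theta_tilde n" "A \<in> Theta_tilde n" using b c p by (auto simp: Khat_carrier_def)
    from KZ_support[OF n this p(4)] show "p \<in> {B. b B \<noteq> 0 \<and> ro B = ro X} \<times> {A. c A \<noteq> 0 \<and> co A = co X}"
      using p by simp
  qed
  moreover have "finite ({B. b B \<noteq> 0 \<and> ro B = ro X} \<times> {A. c A \<noteq> 0 \<and> co A = co X})"
    using b c True by (simp add: Khat_carrier_def)
  ultimately show ?thesis by (rule finite_subset)
next
  case False
  have "contributing n b c X = {}"
  proof (rule ccontr)
    assume "contributing n b c X \<noteq> {}"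
    then obtain B A where p: "b B \<noteq> 0" "c A \<noteq> 0" "lk (KZ_prod n B A) X \<noteq> 0"
      by (auto simp: contributing_def)
    have "B \<in> Theta_tilde n" "A \<in> Theta_tilde n" using b c p by (auto simp: Khat_carrier_def)
    from KZ_support(3)[OF n this p(3)] show False
      using False ro_Zseq co_Zseq Theta_tilde_per by blast
  qed
  then show ?thesis by simp
qed

lemma Khat_mult_superset:
  assumes "finite S" "contributing n b c X \<subseteq> S"
  shows "Khat_mult n b c X = (\<Sum>(B, A)\<in>S. b B * c A * lk (KZ_prod n B A) X)"
  unfolding Khat_mult_def
  by (rule sum.mono_neutral_left[OF assms(1)]) (use assms(2) in \<open>auto simp: contributing_def\<close>)

lemma Khat_carrier_add: "b \<in> Khat_carrier n \<Longrightarrow> c \<in> Khat_carrier n \<Longrightarrow> b + c \<in> Khat_carrier n"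
proof -
  assume b: "b \<in> Khat_carrier n" and c: "c \<in> Khat_carrier n"
  have "finite {A. (b + c) A \<noteq> 0 \<and> ro A = x} \<and> finite {A. (b + c) A \<noteq> 0 \<and> co A = x}" if x: "x \<in> Zseq n" for x
  proof
    show "finite {A. (b + c) A \<noteq> 0 \<and> ro A = x}"
      by (rule finite_subset[of _ "{A. b A \<noteq> 0 \<and> ro A = x} \<union> {A. c A \<noteq> 0 \<and> ro A = x}"])
        (use b c x in \<open>auto simp: Khat_carrier_def\<close>)
    show "finite {A. (b + c) A \<noteq> 0 \<and> co A = x}"
      by (rule finite_subset[of _ "{A. b A \<noteq> 0 \<and> co A = x} \<union> {A. c A \<noteq> 0 \<and> co A = x}"])
        (use b c x in \<open>auto simp: Khat_carrier_def\<close>)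
  qed
  moreover have "A \<in> Theta_tilde n" if "(b + c) A \<noteq> 0" for A
    using that b c by (cases "b A = 0") (auto simp: Khat_carrier_def)
  ultimately show ?thesis unfolding Khat_carrier_def by blast
qed

lemma Khat_carrier_scale: "b \<in> Khat_carrier n \<Longrightarrow> (\<lambda>X. of_int k * b X) \<in> Khat_carrier n"
proof -
  assume b: "b \<in> Khat_carrier n"
  have "finite {A. of_int k * b A \<noteq> 0 \<and> ro A = x} \<and> finite {A. of_int k * b A \<noteq> 0 \<and> co A = x}" if x: "x \<in> Zseq n" for x
  proof
    show "finite {A. of_int k * b A \<noteq> 0 \<and> ro A = x}"
      by (rule finite_subset[of _ "{A. b A \<noteq> 0 \<and> ro A = x}"]) (use b x in \<open>auto simp: Khat_carrier_def\<close>)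
    show "finite {A. of_int k * b A \<noteq> 0 \<and> co A = x}"
      by (rule finite_subset[of _ "{A. b A \<noteq> 0 \<and> co A = x}"]) (use b x in \<open>auto simp: Khat_carrier_def\<close>)
  qed
  then show ?thesis using b unfolding Khat_carrier_def by auto
qed

lemma Khat_carrier_zero: "0 \<in> Khat_carrier n" by (simp add: Khat_carrier_def)

lemma Khat_carrier_neg: "b \<in> Khat_carrier n \<Longrightarrow> - b \<in> Khat_carrier n"
  using Khat_carrier_scale[of b n "- 1"] by (simp add: fun_Compl_def)

context
  fixes n :: nat assumes n: "1 \<le> n"
begin

lemma Khat_mult_add_left:
  assumes "b \<in> Khat_carrier n" "b' \<in> Khat_carrier n" "c \<in> Khat_carrier n"
  shows "Khat_mult n (b + b') c = Khat_mult n b c + Khat_mult n b' c"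
proof
  fix X
  let ?S = "contributing n b c X \<union> contributing n b' c X \<union> contributing n (b + b') c X"
  have f: "finite ?S" using assms Khat_carrier_add finite_contributing[OF n] by blast
  have "Khat_mult n (b + b') c X = (\<Sum>(B, A)\<in>?S. (b + b') B * c A * lk (KZ_prod n B A) X)"
    "Khat_mult n b c X = (\<Sum>(B, A)\<in>?S. b B * c A * lk (KZ_prod n B A) X)"
    "Khat_mult n b' c X = (\<Sum>(B, A)\<in>?S. b' B * c A * lk (KZ_prod n B A) X)"
    by (rule Khat_mult_superset[OF f]; blast)+
  then show "Khat_mult n (b + b') c X = (Khat_mult n b c + Khat_mult n b' c) X"
    by (simp add: case_prod_unfold sum.distrib[symmetric] algebra_simps)
qed

lemma Khat_mult_add_right:
  assumes "b \<in> Khat_carrier n" "b' \<in> Khat_carrier n" "c \<in> Khat_carrier n"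
  shows "Khat_mult n c (b + b') = Khat_mult n c b + Khat_mult n c b'"
proof
  fix X
  let ?S = "contributing n c b X \<union> contributing n c b' X \<union> contributing n c (b + b') X"
  have f: "finite ?S" using assms Khat_carrier_add finite_contributing[OF n] by blast
  have "Khat_mult n c (b + b') X = (\<Sum>(B, A)\<in>?S. c B * (b + b') A * lk (KZ_prod n B A) X)"
    "Khat_mult n c b X = (\<Sum>(B, A)\<in>?S. c B * b A * lk (KZ_prod n B A) X)"
    "Khat_mult n c b' X = (\<Sum>(B, A)\<in>?S. c B * b' A * lk (KZ_prod n B A) X)"
    by (rule Khat_mult_superset[OF f]; blast)+
  then show "Khat_mult n c (b + b') X = (Khat_mult n c b + Khat_mult n c b') X"
    by (simp add: case_prod_unfold sum.distrib[symmetric] algebra_simps)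
qed

lemma Khat_mult_scale:
  assumes "b \<in> Khat_carrier n" "c \<in> Khat_carrier n"
  shows "Khat_mult n (\<lambda>X. of_int k * b X) c = (\<lambda>X. of_int k * Khat_mult n b c X)"
    and "Khat_mult n c (\<lambda>X. of_int k * b X) = (\<lambda>X. of_int k * Khat_mult n c b X)"
proof -
  show "Khat_mult n (\<lambda>X. of_int k * b X) c = (\<lambda>X. of_int k * Khat_mult n b c X)"
  proof
    fix X
    have f: "finite (contributing n b c X)" using assms finite_contributing[OF n] by blast
    have s: "contributing n (\<lambda>X. of_int k * b X) c X \<subseteq> contributing n b c X" by (auto simp: contributing_def)
    show "Khat_mult n (\<lambda>X. of_int k * b X) c X = of_int k * Khat_mult n b c X"
      by (simp add: Khat_mult_superset[OF f s] Khat_mult_superset[OF f] case_prod_unfold sum_distrib_left mult.assoc)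
  qed
  show "Khat_mult n c (\<lambda>X. of_int k * b X) = (\<lambda>X. of_int k * Khat_mult n c b X)"
  proof
    fix X
    have f: "finite (contributing n c b X)" using assms finite_contributing[OF n] by blast
    have s: "contributing n c (\<lambda>X. of_int k * b X) X \<subseteq> contributing n c b X" by (auto simp: contributing_def)
    show "Khat_mult n c (\<lambda>X. of_int k * b X) X = of_int k * Khat_mult n c b X"
      by (simp add: Khat_mult_superset[OF f s] Khat_mult_superset[OF f] case_prod_unfold sum_distrib_left algebra_simps)
  qed
qed

text \<open>The row sums, or the column sums, of \<open>A + diag \<mu>\<close> determine \<open>\<mu>\<close>.\<close>

lemma brace_carrier:
  assumes A: "A \<in> Theta_pm n" shows "brace n A l \<in> Khat_carrier n"
proof -
  have nz: "\<exists>m\<in>Zseq n. X = A + diag m" if "brace n A l X \<noteq> 0" for X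
    using that unfolding brace_eq by (rule family_nonzero)
  have "finite {X. brace n A l X \<noteq> 0 \<and> ro X = x} \<and> finite {X. brace n A l X \<noteq> 0 \<and> co X = x}" for x
  proof
    have "X = A + diag (x - ro A)" if h: "brace n A l X \<noteq> 0" "ro X = x" for X
    proof -
      obtain m where m: "X = A + diag m" using nz[OF h(1)] by blast
      then have "m = x - ro A" using h(2) ro_add_diag(1)[OF Theta_pm_per[OF A], of m] by auto
      then show ?thesis using m by simp
    qed
    then have "{X. brace n A l X \<noteq> 0 \<and> ro X = x} \<subseteq> {A + diag (x - ro A)}" by blast
    then show "finite {X. brace n A l X \<noteq> 0 \<and> ro X = x}" by (rule finite_subset) simp
    have "X = A + diag (x - co A)" if h: "brace n A l X \<noteq> 0" "co X = x" for X
    proof -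
      obtain m where m: "X = A + diag m" using nz[OF h(1)] by blast
      then have "m = x - co A" using h(2) ro_add_diag(2)[OF Theta_pm_per[OF A], of m] by auto
      then show ?thesis using m by simp
    qed
    then have "{X. brace n A l X \<noteq> 0 \<and> co X = x} \<subseteq> {A + diag (x - co A)}" by blast
    then show "finite {X. brace n A l X \<noteq> 0 \<and> co X = x}" by (rule finite_subset) simp
  qed
  moreover have "X \<in> Theta_tilde n" if "brace n A l X \<noteq> 0" for X
    using nz[OF that] Theta_tilde_add_diag Theta_pm_tilde[OF A] by auto
  ultimately show ?thesis by (simp add: Khat_carrier_def)
qed

end

interpretation iscale: Modules.module "\<lambda>(k::int) (b :: mat \<Rightarrow> rat). (\<lambda>X. of_int k * b X)"
  by unfold_locales (auto simp: fun_eq_iff algebra_simps)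

abbreviation "braces n \<equiv> {brace n A l | A l. A \<in> Theta_pm n \<and> l \<in> Nseq n}"

lemma VZ_eq: "VZ n = iscale.span (braces n)" by (simp add: VZ_def)

lemma VZ_add_closed: "add_closed (VZ n)"
  unfolding add_closed_def VZ_eq using iscale.span_zero iscale.span_add iscale.span_neg by blast

lemma brace_VZ: "A \<in> Theta_pm n \<Longrightarrow> l \<in> Nseq n \<Longrightarrow> brace n A l \<in> VZ n"
  unfolding VZ_eq by (rule iscale.span_base) blast

lemma VZ_scale: "x \<in> VZ n \<Longrightarrow> (\<lambda>X. of_int k * x X) \<in> VZ n"
  unfolding VZ_eq by (rule iscale.span_scale)

lemma VZ_carrier:
  assumes n: "1 \<le> n" and x: "x \<in> VZ n" shows "x \<in> Khat_carrier n"
  using x unfolding VZ_eq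
proof (induction rule: iscale.span_induct_alt)
  case base show ?case by (rule Khat_carrier_zero)
next
  case (step c x y)
  then have "x \<in> Khat_carrier n" using brace_carrier[OF n] by blast
  then show ?case by (rule Khat_carrier_add[OF Khat_carrier_scale step(2)])
qed

theorem VZ_mult:
  assumes n: "1 \<le> n" and x: "x \<in> VZ n" and y: "y \<in> VZ n"
  shows "Khat_mult n x y \<in> VZ n"
proof -
  have zero: "Khat_mult n 0 y = 0" "Khat_mult n y 0 = 0" for y by (auto simp: Khat_mult_def fun_eq_iff)
  have U: "add_closed (VZ n)" by (rule VZ_add_closed)
  have sp: "add_closed (VZ n) \<Longrightarrow> a \<in> VZ n \<Longrightarrow> b \<in> VZ n \<Longrightarrow> a + b \<in> VZ n" for a b
    by (simp add: add_closed_def)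
  have 1: "y \<in> Khat_carrier n \<and> Khat_mult n b y \<in> VZ n" if b: "b \<in> braces n" for b
    using y unfolding VZ_eq[of n]
  proof (induction rule: iscale.span_induct_alt)
    case base show ?case unfolding zero using iscale.span_zero Khat_carrier_zero by (intro conjI)
  next
    case (step c a y)
    obtain B k A l where ba: "b = brace n B k" "a = brace n A l" "B \<in> Theta_pm n" "A \<in> Theta_pm n"
      using b step(1) by blast
    interpret family_product n B A by unfold_locales (use n ba in auto)
    have "Khat_mult n b a \<in> VZ n"
      unfolding ba(1,2) Khat_mult_brace
    proof (rule add_closed_sum[OF U])
      fix t assume t: "t \<in> TT n B A"
      show "summand k l t \<in> VZ n" by (rule summand_in[OF U t brace_VZ[OF offd_moved_pm[OF t]]])
    qed
    then have *: "(\<lambda>X. of_int c * Khat_mult n b a X) \<in> VZ n" by (rule VZ_scale)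
    have bc: "b \<in> Khat_carrier n" and ac: "a \<in> Khat_carrier n" using ba brace_carrier[OF n] by auto
    have yc: "y \<in> Khat_carrier n" and by_VZ: "Khat_mult n b y \<in> VZ n" using step(2) unfolding VZ_eq[of n] by blast+
    have "(\<lambda>X. of_int c * a X) + y \<in> Khat_carrier n" by (rule Khat_carrier_add[OF Khat_carrier_scale[OF ac] yc])
    moreover have "Khat_mult n b ((\<lambda>X. of_int c * a X) + y) \<in> VZ n"
      unfolding Khat_mult_add_right[OF n Khat_carrier_scale[OF ac] yc bc] Khat_mult_scale(2)[OF n ac bc]
      by (rule sp[OF U * by_VZ])
    ultimately show ?case unfolding VZ_eq[of n] by (intro conjI)
  qed
  have yc: "y \<in> Khat_carrier n" by (rule VZ_carrier[OF n y])
  have "x \<in> Khat_carrier n \<and> Khat_mult n x y \<in> VZ n"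
    using x unfolding VZ_eq[of n]
  proof (induction rule: iscale.span_induct_alt)
    case base show ?case unfolding zero using iscale.span_zero Khat_carrier_zero by (intro conjI)
  next
    case (step c b x)
    have *: "(\<lambda>X. of_int c * Khat_mult n b y X) \<in> VZ n" by (rule VZ_scale) (use 1[OF step(1)] in blast)
    have bc: "b \<in> Khat_carrier n" using step(1) brace_carrier[OF n] by blast
    have xc: "x \<in> Khat_carrier n" and xy_VZ: "Khat_mult n x y \<in> VZ n" using step(2) unfolding VZ_eq[of n] by blast+
    have "(\<lambda>X. of_int c * b X) + x \<in> Khat_carrier n" by (rule Khat_carrier_add[OF Khat_carrier_scale[OF bc] xc])
    moreover have "Khat_mult n ((\<lambda>X. of_int c * b X) + x) y \<in> VZ n"
      unfolding Khat_mult_add_left[OF n Khat_carrier_scale[OF bc] xc yc] Khat_mult_scale(1)[OF n bc yc]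
      by (rule sp[OF U * xy_VZ])
    ultimately show ?case unfolding VZ_eq[of n] by (intro conjI)
  qed
  then show ?thesis ..
qed

section \<open>Generation\<close>

lemma Sum_any_diff:
  fixes f g :: "int \<Rightarrow> int"
  assumes "finite {j. f j \<noteq> 0}" "finite {j. g j \<noteq> 0}"
  shows "Sum_any (\<lambda>j. f j - g j) = Sum_any f - Sum_any g"
proof -
  let ?S = "{j. f j \<noteq> 0} \<union> {j. g j \<noteq> 0}"
  have S: "finite ?S" using assms by simp
  have "Sum_any (\<lambda>j. f j - g j) = (\<Sum>j\<in>?S. f j - g j)" by (rule Sum_any_eq[OF S]) auto
  moreover have "Sum_any f = sum f ?S" "Sum_any g = sum g ?S" by (rule Sum_any_eq[OF S]; auto)+
  ultimately show ?thesis by (simp add: sum_subtractf)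
qed

lemma Sum_any_nonneg: "(\<And>j. 0 \<le> (f j :: int)) \<Longrightarrow> 0 \<le> Sum_any f"
  unfolding Sum_any.expand_set by (rule sum_nonneg) simp

lemma Sum_any_ge:
  fixes f :: "int \<Rightarrow> int"
  assumes "finite {j. f j \<noteq> 0}" "\<And>j. 0 \<le> f j" shows "f i \<le> Sum_any f"
proof -
  have "Sum_any f = f i + Sum_any (\<lambda>k. if k = i then 0 else f k)" by (rule Sum_any_split[OF assms(1)])
  moreover have "0 \<le> Sum_any (\<lambda>k. if k = i then 0 else f k)" by (rule Sum_any_nonneg) (simp add: assms(2))
  ultimately show ?thesis by simp
qed

lemma Sum_any_mono:
  fixes f g :: "int \<Rightarrow> int"
  assumes "finite {j. f j \<noteq> 0}" "finite {j. g j \<noteq> 0}" "\<And>j. f j \<le> g j"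
  shows "Sum_any f \<le> Sum_any g"
  using Sum_any_diff[OF assms(2,1)] Sum_any_nonneg[of "\<lambda>j. g j - f j"] assms(3) by simp

lemma Sum_any_row_per:
  fixes f :: "int \<Rightarrow> int \<Rightarrow> 'a::comm_monoid_add"
  assumes "\<And>i j. f (i + p) (j + p) = f i j"
  shows "Sum_any (f (i + p)) = Sum_any (f i)"
  by (rule Sum_any.reindex_cong[of "\<lambda>j. j + p"])
    (auto simp: assms fun_eq_iff intro!: bij_betw_byWitness[where f' = "\<lambda>j. j - p"])

lemma binom_seq_cong: "(\<And>i. i \<in> {1..int n} \<Longrightarrow> l i = l' i) \<Longrightarrow> binom_seq n m l = binom_seq n m l'"
  unfolding binom_seq_def by (rule prod.cong) auto

lemma binom_seq_zero: "binom_seq n m 0 = 1"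
  by (simp add: binom_seq_def)

lemma brace_cong: "(\<And>i. i \<in> {1..int n} \<Longrightarrow> l i = l' i) \<Longrightarrow> brace n A l = brace n A l'"
  unfolding brace_eq using binom_seq_cong[of n l l'] by simp

lemma gbinomial_self: "0 \<le> x \<Longrightarrow> (of_int x :: rat) gchoose nat x = 1"
proof -
  assume "0 \<le> x"
  then have "(of_int x :: rat) = of_nat (nat x)" by simp
  then show ?thesis by (simp only: binomial_gbinomial[symmetric] binomial_n_n of_nat_1)
qed

lemma Theta_pm_zero: "0 \<in> Theta_pm n"
  by (simp add: Theta_pm_def Theta_def per_mats_def)

lemma Theta_pmI:
  assumes "\<And>i j. A (i + int n) (j + int n) = A i j" "\<And>i. finite {j. A i j \<noteq> 0}" "\<And>j. finite {i. A i j \<noteq> 0}"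
    "\<And>i j. 0 \<le> A i j" "\<And>i. A i i = 0"
  shows "A \<in> Theta_pm n"
  using assms by (simp add: Theta_pm_def Theta_def per_mats_def)

lemma Theta_pmD:
  assumes "A \<in> Theta_pm n"
  shows "A (i + int n) (j + int n) = A i j" "finite {j. A i j \<noteq> 0}" "finite {i. A i j \<noteq> 0}"
  using assms by (simp_all add: Theta_pm_def Theta_def per_mats_def)

text \<open>The transport that moves only entries from the diagonal of the right factor: its result is
  \<open>A + B\<close>.\<close>

definition tdiag :: "mat \<Rightarrow> tens" where
  "tdiag B = (\<lambda>i k j. if j = k \<and> i \<noteq> k then nat (B i k) else 0)"

context family_product
begin

lemma trow_tdiag: "trow (tdiag B) i k = (if i \<noteq> k then nat (B i k) else 0)"
  unfolding trow_def tdiag_def by (subst Sum_any_eq[of "{k}"]) auto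

lemma tin_tdiag: "tin (tdiag B) i j = (if i \<noteq> j then nat (B i j) else 0)"
  unfolding tin_def tdiag_def by (subst Sum_any_eq[of "{j}"]) auto

lemma tout_tdiag: "int (tout (tdiag B) k j) = (if k = j then co B k else 0)"
proof -
  have "(\<lambda>i. int (tdiag B i k j)) = (\<lambda>i. if k = j then B i k else 0)"
    using Theta_pm_nonneg[OF Bpm] Theta_pm_diag[OF Bpm] by (auto simp: tdiag_def fun_eq_iff)
  then have "int (tout (tdiag B) k j) = Sum_any (\<lambda>i. if k = j then B i k else 0)"
    unfolding tout_def Sum_any_int by (rule arg_cong)
  then show ?thesis by (simp add: co_eq)
qed

lemma tdiag_TT: "tdiag B \<in> TT n B A"
proof -
  have "finite {j. tdiag B i k j \<noteq> 0}" for i k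
    by (rule finite_subset[of _ "{k}"]) (auto simp: tdiag_def)
  moreover have "tdiag B (i + int n) (k + int n) (j + int n) = tdiag B i k j" for i k j
    using Theta_pmD(1)[OF Bpm] by (simp add: tdiag_def)
  ultimately show ?thesis
    using Theta_pm_nonneg[OF Bpm] Theta_pm_nonneg[OF Apm]
    by (simp add: TT_def trow_tdiag tout_tdiag) (simp add: tdiag_def)
qed

lemma moved_tdiag: "offd (moved A (tdiag B)) = A + B"
proof (intro ext)
  fix i j
  show "offd (moved A (tdiag B)) i j = (A + B) i j"
    using tout_tdiag[of i j] Theta_pm_nonneg[OF Bpm, of i j] Theta_pm_diag[OF Bpm] Theta_pm_diag[OF Apm]
    by (auto simp: offd_def moved_def tin_tdiag)
qed

lemma arg_tdiag: "arg_right (tdiag B) \<xi> = \<xi> + co B" "arg_left (tdiag B) \<xi> = \<xi> + ro A"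
proof -
  have "tdelta (tdiag B) = - co B"
    using tout_tdiag by (auto simp: tdelta_def tin_tdiag)
  then show "arg_right (tdiag B) \<xi> = \<xi> + co B" "arg_left (tdiag B) \<xi> = \<xi> + ro A"
    by (simp_all add: arg_right_def arg_left_def fun_eq_iff)
qed

lemma tcoef_tdiag:
  assumes dis: "\<And>i j. B i j \<noteq> 0 \<Longrightarrow> A i j = 0"
  shows "tcoef n (tdiag B) (A + B + diag \<xi>) = 1"
  unfolding tcoef_def
proof (rule prod.neutral, rule ballI)
  fix x assume x: "x \<in> tsupp n (tdiag B)"
  obtain i j where ij: "x = (i, j)" by (cases x)
  have nz: "i \<noteq> j" "B i j \<noteq> 0" using x unfolding ij by (auto simp: tsupp_def tin_tdiag split: if_splits)
  have "(A + B + diag \<xi>) i j = B i j" using nz dis by simp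
  moreover have "msplit (\<lambda>k. tdiag B i k j) = 1" by (rule msplit_single[of j]) (auto simp: tdiag_def)
  ultimately show "(case x of (i, j) \<Rightarrow> ((of_int ((A + B + diag \<xi>) i j) :: rat) gchoose tin (tdiag B) i j) *
     of_nat (msplit (\<lambda>k. tdiag B i k j))) = 1"
    using nz Theta_pm_nonneg[OF Bpm, of i j] unfolding ij by (simp add: tin_tdiag gbinomial_self)
qed

lemma summand_tdiag:
  assumes dis: "\<And>i j. B i j \<noteq> 0 \<Longrightarrow> A i j = 0"
  shows "summand k l (tdiag B) = family n (A + B) (\<lambda>\<xi>. binom_seq n (\<xi> + ro A) k * binom_seq n (\<xi> + co B) l)"
proof -
  have "tcoef n (tdiag B) (A + B + diag \<xi>) = 1" for \<xi>
    by (rule tcoef_tdiag) (rule dis)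
  then show ?thesis unfolding summand_def moved_tdiag arg_tdiag by (simp only: mult_1_right)
qed

text \<open>Diagonal sources leave no choice: the row sums of \<open>t\<close> are the entries of \<open>B\<close>.\<close>

lemma tdiag_unique:
  assumes t: "t \<in> TT n B A" and d: "\<And>i k j. t i k j \<noteq> 0 \<Longrightarrow> j = k" shows "t = tdiag B"
proof (intro ext)
  fix i k j
  have "trow t i k = t i k k" unfolding trow_def by (subst Sum_any_eq[of "{k}"]) (use d in auto)
  then show "t i k j = tdiag B i k j"
    using t_row[OF t, of i k] t_diag[OF t, of i j] d[of i k j] by (cases "j = k"; cases "i = k") (auto simp: tdiag_def)
qed

text \<open>A moved unit adds one to the off-diagonal total, less one if it lands on the diagonal and less one
  if it was taken from off the diagonal.\<close>

lemma sigma_offd_moved: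
  assumes t: "t \<in> TT n B A"
  shows "sigma_mat n (offd (moved A t)) = sigma_mat n A + sigma_mat n B -
    (\<Sum>i=1..int n. int (tin t i i) + int (Sum_any (\<lambda>j. if j = i then 0 else tout t i j)))"
proof -
  have "ro (offd (moved A t)) i = ro A i + ro B i - (int (tin t i i) + int (Sum_any (\<lambda>j. if j = i then 0 else tout t i j)))" for i
  proof -
    have fm: "finite {j. moved A t i j \<noteq> 0}" using moved_per[OF t] by (simp add: per_mats_def)
    have "ro (moved A t) i = moved A t i i + ro (offd (moved A t)) i"
    proof -
      have "(\<lambda>j. offd (moved A t) i j) = (\<lambda>k. if k = i then 0 else moved A t i k)" by (auto simp: offd_def fun_eq_iff)
      then show ?thesis using Sum_any_split[OF fm, of i] by (simp add: ro_eq)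
    qed
    moreover have "ro (moved A t) i = ro A i + int (Sum_any (\<lambda>j. tin t i j)) - int (Sum_any (\<lambda>j. tout t i j))"
      unfolding ro_eq moved_def by (rule Sum_any_moved[OF t]) (use fin tin_fin_j[OF t] tout_fin_j[OF t] in auto)
    moreover have "int (Sum_any (\<lambda>j. tin t i j)) = ro B i"
      unfolding sum_tin_row[OF t] sum_trow(1)[OF t] using Theta_pm_diag[OF Bpm] by simp
    moreover have "Sum_any (\<lambda>j. tout t i j) = tout t i i + Sum_any (\<lambda>j. if j = i then 0 else tout t i j)"
      by (rule Sum_any_split[OF tout_fin_j[OF t]])
    ultimately show ?thesis using moved_diag[of t i] by (simp add: tdelta_def)
  qed
  then show ?thesis by (simp add: sigma_mat_eq sigma_seq_def sum.distrib sum_subtractf)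
qed

end

text \<open>The right factor has no off-diagonal entries, so only the transport from the diagonal remains.\<close>

lemma Khat_mult_brace_zero:
  assumes n: "1 \<le> n" and B: "B \<in> Theta_pm n"
  shows "Khat_mult n (brace n B k) (brace n 0 l) = family n B (\<lambda>\<xi>. binom_seq n \<xi> k * binom_seq n (\<xi> + co B) l)"
proof -
  interpret family_product n B 0 by unfold_locales (use n B Theta_pm_zero in auto)
  have "t = tdiag B" if t: "t \<in> TT n B 0" for t
    by (rule tdiag_unique[OF t]) (use t_nz_A[OF t] in auto)
  then have "TT n B 0 = {tdiag B}" using tdiag_TT by blast
  moreover have "ro (0 :: mat) = 0" by (auto simp: ro_def fun_eq_iff)
  ultimately show ?thesis using summand_tdiag[of k l] by (simp add: Khat_mult_brace)
qed

text \<open>The total distance of the entries from the diagonal, towards the side given by the sign \<open>e\<close>.\<close>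

definition degsum :: "nat \<Rightarrow> int \<Rightarrow> mat \<Rightarrow> int" where
  "degsum n e A = (\<Sum>i=1..int n. Sum_any (\<lambda>j. e * (j - i) * A i j))"

definition triangular :: "int \<Rightarrow> mat \<Rightarrow> bool" where
  "triangular e A \<longleftrightarrow> (\<forall>i j. A i j \<noteq> 0 \<longrightarrow> 0 < e * (j - i))"

lemma sigma_nonneg: "A \<in> Theta_pm n \<Longrightarrow> 0 \<le> sigma_mat n A"
  unfolding sigma_mat_eq sigma_seq_def ro_eq
  by (intro sum_nonneg Sum_any_nonneg) (simp add: Theta_pm_nonneg)

lemma sigma_pos:
  assumes n: "1 \<le> n" and A: "A \<in> Theta_pm n" and nz: "A \<noteq> 0" shows "0 < sigma_mat n A"
proof -
  obtain i j where ij: "A i j \<noteq> 0" using nz by (auto simp: fun_eq_iff)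
  let ?m = "(i - 1) div int n"
  let ?i = "i - ?m * int n" and ?j = "j - ?m * int n"
  have "A ?i ?j = A i j" using per_mats_shift_n[OF Theta_pm_per[OF A], of i "- ?m" j] by simp
  then have "0 < A ?i ?j" using ij Theta_pm_nonneg[OF A, of ?i ?j] by linarith
  also have "A ?i ?j \<le> ro A ?i" unfolding ro_eq
    by (rule Sum_any_ge[OF Theta_pmD(2)[OF A] Theta_pm_nonneg[OF A]])
  also have "\<dots> \<le> (\<Sum>i=1..int n. ro A i)"
    by (rule member_le_sum[OF window_div_range[OF n]]) (auto simp: ro_eq intro!: Sum_any_nonneg Theta_pm_nonneg[OF A])
  finally show ?thesis by (simp add: sigma_mat_eq sigma_seq_def)
qed

lemma degsum_ge_sigma:
  assumes A: "A \<in> Theta_pm n" and tri: "triangular e A" shows "sigma_mat n A \<le> degsum n e A"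
  unfolding sigma_mat_eq sigma_seq_def degsum_def ro_eq
proof (rule sum_mono)
  fix i
  show "Sum_any (\<lambda>j. A i j) \<le> Sum_any (\<lambda>j. e * (j - i) * A i j)"
  proof (rule Sum_any_mono)
    show "finite {j. A i j \<noteq> 0}" by (rule Theta_pmD(2)[OF A])
    then show "finite {j. e * (j - i) * A i j \<noteq> 0}" by (rule rev_finite_subset) auto
    show "A i j \<le> e * (j - i) * A i j" for j
    proof (cases "A i j = 0")
      case False
      then have "1 \<le> e * (j - i)" using tri by (force simp: triangular_def)
      then have "1 * A i j \<le> e * (j - i) * A i j" by (rule mult_right_mono) (rule Theta_pm_nonneg[OF A])
      then show ?thesis by simp
    qed simp
  qed
qed

text \<open>The generators, written without the sum over unit matrices.\<close>

lemma window_sum_unit: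
  assumes n: "1 \<le> n" and a: "a \<in> Zseq n"
  shows "(\<Sum>i=1..int n. a i * (if \<exists>s. x = i + s * int n \<and> y = i + 1 + s * int n then 1 else 0)) = (if y = x + 1 then a x else 0)"
proof -
  let ?m = "(x - 1) div int n"
  let ?i = "x - ?m * int n"
  have i: "?i \<in> {1..int n}" by (rule window_div_range[OF n])
  have iff: "(\<exists>s. x = i + s * int n \<and> y = i + 1 + s * int n) \<longleftrightarrow> i = ?i \<and> y = x + 1" if "i \<in> {1..int n}" for i
  proof
    assume "\<exists>s. x = i + s * int n \<and> y = i + 1 + s * int n"
    then obtain s where s: "x = i + s * int n" "y = i + 1 + s * int n" by blast
    have "(i - 1) div int n = 0" by (rule div_pos_pos_trivial) (use that in auto)
    then have "?m = s" using window_div_shift[OF n, of i "- s"] s(1) by simp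
    then show "i = ?i \<and> y = x + 1" using s by simp
  next
    assume "i = ?i \<and> y = x + 1"
    then show "\<exists>s. x = i + s * int n \<and> y = i + 1 + s * int n" by (intro exI[of _ ?m]) auto
  qed
  have ax: "a ?i = a x" using periodic_shift[of a "int n" ?i ?m] a by (simp add: Zseq_def)
  have "(\<Sum>i=1..int n. a i * (if \<exists>s. x = i + s * int n \<and> y = i + 1 + s * int n then 1 else 0))
      = (\<Sum>i=1..int n. if i = ?i then (if y = x + 1 then a ?i else 0) else 0)"
    by (rule sum.cong) (use iff in auto)
  also have "\<dots> = (if y = x + 1 then a ?i else 0)" using i by (subst sum.delta) auto
  finally show ?thesis using ax by simp
qed

text \<open>An additive subgroup closed under products that contains the generators; the aim is that it
  contains every \<open>A{\<lambda>}\<close>.\<close>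

locale generated =
  fixes n :: nat and U :: "(mat \<Rightarrow> rat) set"
  assumes n2: "2 \<le> n" and U: "add_closed U"
    and Umult: "\<And>x y. x \<in> U \<Longrightarrow> y \<in> U \<Longrightarrow> Khat_mult n x y \<in> U"
    and Ugens: "VZ_gens n \<subseteq> U"
begin

lemma n: "1 \<le> n" using n2 by simp

text \<open>Multiply the elements \<open>0{l\<^sub>i e\<^sub>i}\<close> one index at a time; \<open>?lS S\<close> is \<open>l\<close> restricted to the classes in \<open>S\<close>.\<close>

lemma diagonal_in: assumes l: "l \<in> Nseq n" shows "brace n 0 l \<in> U"
proof -
  let ?w = "\<lambda>j. (j - 1) mod int n + 1"
  let ?lS = "\<lambda>S j. if ?w j \<in> S then l j else 0"
  have w: "?w i = i" if "i \<in> {1..int n}" for i using that by simp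
  have g: "brace n 0 (\<lambda>j. int t * unit_seq n i j) \<in> U" if "i \<in> {1..int n}" for t i
  proof (rule subsetD[OF Ugens])
    show "brace n 0 (\<lambda>j. int t * unit_seq n i j) \<in> VZ_gens n"
      unfolding VZ_gens_def
      by (rule UnI2, rule CollectI, rule exI[of _ t], rule exI[of _ i]) (use that in simp)
  qed
  have u: "unit_seq n i j = (if j = i then 1 else 0)" if "i \<in> {1..int n}" "j \<in> {1..int n}" for i j
  proof -
    have "s = 0" if "j = i + s * int n" for s
    proof -
      have "(i - 1) div int n = 0" "(j - 1) div int n = 0"
        using \<open>i \<in> _\<close> \<open>j \<in> _\<close> by (auto intro!: div_pos_pos_trivial)
      then show ?thesis using window_div_shift[OF n, of i "- s"] that by simp
    qed
    then show ?thesis by (auto simp: unit_seq_def intro!: exI[of _ 0])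
  qed
  have "brace n 0 (?lS S) \<in> U" if "finite S" "S \<subseteq> {1..int n}" for S
    using that
  proof (induction S rule: finite_induct)
    case empty
    have "brace n 0 (\<lambda>j. int 0 * unit_seq n 1 j) \<in> U" by (rule g) (use n in simp)
    moreover have "(\<lambda>j. int 0 * unit_seq n 1 j) = ?lS {}" by simp
    ultimately show ?case by (simp only:)
  next
    case (insert a S)
    have a: "a \<in> {1..int n}" using insert by auto
    let ?e = "\<lambda>j. int (nat (l a)) * unit_seq n a j"
    have la: "0 \<le> l a" using l by (simp add: Nseq_def)
    have "co (0 :: mat) = 0" by (auto simp: co_def fun_eq_iff)
    then have "Khat_mult n (brace n 0 (?lS S)) (brace n 0 ?e)
       = family n 0 (\<lambda>\<xi>. binom_seq n \<xi> (?lS S) * binom_seq n \<xi> ?e)"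
      using Khat_mult_brace_zero[OF n Theta_pm_zero] by simp
    also have "\<dots> = brace n 0 (?lS (insert a S))"
      unfolding brace_eq
    proof (rule family_cong)
      fix m :: seq
      show "binom_seq n m (?lS S) * binom_seq n m ?e = binom_seq n m (?lS (insert a S))"
        unfolding binom_seq_def prod.distrib[symmetric]
      proof (rule prod.cong[OF refl])
        fix i assume i: "i \<in> {1..int n}"
        show "((of_int (m i) :: rat) gchoose nat (?lS S i)) * (of_int (m i) gchoose nat (?e i)) =
          of_int (m i) gchoose nat (?lS (insert a S) i)"
          using u[OF a i] w[OF i] insert(2) la by auto
      qed
    qed
    finally have eq: "Khat_mult n (brace n 0 (?lS S)) (brace n 0 ?e) = brace n 0 (?lS (insert a S))" .
    have "brace n 0 (?lS S) \<in> U" by (rule insert.IH) (use insert.prems in blast)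
    from Umult[OF this g[OF a, of "nat (l a)"]] show ?case unfolding eq .
  qed
  from this[of "{1..int n}"] have "brace n 0 (?lS {1..int n}) \<in> U" by simp
  moreover have "brace n 0 (?lS {1..int n}) = brace n 0 l" by (rule brace_cong) (use w in auto)
  ultimately show ?thesis by simp
qed

lemma Nseq_zero: "0 \<in> Nseq n" by (simp add: Nseq_def Zseq_def)

text \<open>Multiplying \<open>B{0}\<close> by \<open>0{\<lambda>}\<close> gives the binomials in \<open>\<xi> + co B\<close>; translating the variable
  back expresses \<open>B{\<lambda>}\<close> through these.\<close>

lemma all_weights_in:
  assumes B: "B \<in> Theta_pm n" and B0: "brace n B 0 \<in> U" and l: "l \<in> Nseq n"
  shows "brace n B l \<in> U"
proof -
  have br: "family n B (\<lambda>m. binom_seq n (m + co B) l) \<in> U" if "l \<in> Nseq n" for l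
    using Umult[OF B0 diagonal_in[OF that]] unfolding Khat_mult_brace_zero[OF n B] binom_seq_zero by simp
  let ?p = "\<lambda>i x. (of_int (x + - co B i) :: rat) gchoose nat (l i)"
  have "family n B (\<lambda>m. \<Prod>i=1..int n. ?p i (m i + co B i)) \<in> U"
    by (rule family_in[OF n U br, where p = ?p]) (auto simp only: int_valued_shift)
  then show ?thesis by (simp add: brace_eq binom_seq_def)
qed

text \<open>For \<open>e = - 1\<close> the generators are indexed by columns and the layer by rows, hence the shift of the
  index of \<open>a\<close>.\<close>

lemma layer_gen:
  assumes a: "a \<in> Nseq n" and e: "e = 1 \<or> e = - 1"
  shows "brace n (\<lambda>k l. if l = k + e then a k else 0) 0 \<in> U"
  using e
proof
  assume e: "e = 1"
  have "(\<lambda>k l. \<Sum>i=1..int n. a i * unit_mat n i (i + 1) k l) = (\<lambda>k l. if l = k + e then a k else 0)"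
    using window_sum_unit[OF n, of a] a by (auto simp: unit_mat_def e Nseq_def fun_eq_iff)
  moreover have "brace n (\<lambda>k l. \<Sum>i=1..int n. a i * unit_mat n i (i + 1) k l) 0 \<in> VZ_gens n"
    using a unfolding VZ_gens_def by blast
  ultimately show ?thesis using Ugens by auto
next
  assume e: "e = - 1"
  let ?a = "\<lambda>i. a (i + 1)"
  have a': "?a \<in> Nseq n" using a by (simp add: Nseq_def Zseq_def algebra_simps) (metis add.commute add.left_commute)
  have "(\<lambda>k l. \<Sum>i=1..int n. ?a i * unit_mat n (i + 1) i k l) = (\<lambda>k l. if l = k + e then a k else 0)"
  proof (intro ext)
    fix k l
    have "(\<Sum>i=1..int n. ?a i * unit_mat n (i + 1) i k l) = (if k = l + 1 then ?a l else 0)"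
      using window_sum_unit[OF n, of ?a l k] a' by (simp add: unit_mat_def Nseq_def conj_commute)
    then show "(\<Sum>i=1..int n. ?a i * unit_mat n (i + 1) i k l) = (if l = k + e then a k else 0)"
      by (auto simp: e)
  qed
  moreover have "brace n (\<lambda>k l. \<Sum>i=1..int n. ?a i * unit_mat n (i + 1) i k l) 0 \<in> VZ_gens n"
    unfolding VZ_gens_def by (rule UnI1, rule UnI2, rule CollectI, rule exI[of _ ?a], rule conjI[OF refl a'])
  ultimately show ?thesis using Ugens by auto
qed

end

text \<open>Row \<open>i\<close> of \<open>A\<close> is assembled from row \<open>i + e\<close> of \<open>rest\<close>: all \<open>ro A i\<close> units that \<open>layer\<close> moves into row \<open>i\<close>
  come from there. The entry \<open>A i (i + e)\<close> comes from the diagonal, so \<open>rest\<close> can drop it.\<close>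

locale peel =
  fixes n :: nat and e :: int and A :: mat
  assumes n: "1 \<le> n" and e: "e = 1 \<or> e = - 1" and A: "A \<in> Theta_pm n" and tri: "triangular e A"
begin

definition layer :: mat where "layer = (\<lambda>k l. if l = k + e then ro A k else 0)"
definition rest :: mat where "rest = (\<lambda>k j. if k = j then 0 else A (k - e) j)"

lemma e0: "e \<noteq> 0" "e * e = 1" using e by auto

lemma A_per: "A (i + int n) (j + int n) = A i j" and A_nn: "0 \<le> A i j" and A_fin: "finite {j. A i j \<noteq> 0}"
  and A_fin': "finite {i. A i j \<noteq> 0}" and A_diag: "A i i = 0"
  using Theta_pmD[OF A] Theta_pm_nonneg[OF A] Theta_pm_diag[OF A] by auto

lemma roA_Nseq: "ro A \<in> Nseq n"
  using ro_Zseq[OF Theta_pm_per[OF A]] by (simp add: Nseq_def ro_eq Sum_any_nonneg A_nn)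

lemma layer_pm: "layer \<in> Theta_pm n"
proof (rule Theta_pmI)
  show "layer (i + int n) (j + int n) = layer i j" for i j
    using roA_Nseq by (simp add: layer_def Nseq_def Zseq_def)
  show "finite {j. layer i j \<noteq> 0}" for i by (rule finite_subset[of _ "{i + e}"]) (auto simp: layer_def)
  show "finite {i. layer i j \<noteq> 0}" for j by (rule finite_subset[of _ "{j - e}"]) (auto simp: layer_def)
  show "0 \<le> layer i j" for i j using roA_Nseq by (simp add: layer_def Nseq_def)
  show "layer i i = 0" for i using e0 by (simp add: layer_def)
qed

lemma rest_pm: "rest \<in> Theta_pm n"
proof (rule Theta_pmI)
  show "rest (i + int n) (j + int n) = rest i j" for i j
    using A_per[of "i - e" j] by (simp add: rest_def algebra_simps)
  show "finite {j. rest i j \<noteq> 0}" for i by (rule finite_subset[OF _ A_fin[of "i - e"]]) (auto simp: rest_def)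
  show "finite {i. rest i j \<noteq> 0}" for j
  proof (rule finite_subset[OF _ finite_imageI[OF A_fin'[of j], of "\<lambda>i. i + e"]], rule subsetI)
    fix i assume "i \<in> {i. rest i j \<noteq> 0}"
    then have "i - e \<in> {i. A i j \<noteq> 0}" by (simp add: rest_def split: if_splits)
    then have "i - e + e \<in> (\<lambda>i. i + e) ` {i. A i j \<noteq> 0}" by (rule imageI)
    then show "i \<in> (\<lambda>i. i + e) ` {i. A i j \<noteq> 0}" by simp
  qed
  show "0 \<le> rest i j" for i j using A_nn by (simp add: rest_def)
  show "rest i i = 0" for i by (simp add: rest_def)
qed

lemma rest_tri: "triangular e rest"
  unfolding triangular_def
proof (intro allI impI)
  fix i j assume "rest i j \<noteq> 0"
  then have "i \<noteq> j" "A (i - e) j \<noteq> 0" by (auto simp: rest_def split: if_splits)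
  then have "0 < e * (j - (i - e))" using tri unfolding triangular_def by blast
  then have "0 \<le> e * (j - i)" using e0 by (simp add: algebra_simps)
  moreover have "e * (j - i) \<noteq> 0" using \<open>i \<noteq> j\<close> e0 by simp
  ultimately show "0 < e * (j - i)" by linarith
qed

lemma row_shift: "(\<And>i. f (i + int n) = f i) \<Longrightarrow> (\<Sum>i=1..int n. f (i - e)) = (\<Sum>i=1..int n. (f i :: int))"
  using periodic_sum_shift[of n f "- e"] n by simp

definition wrow :: "(int \<Rightarrow> int \<Rightarrow> int) \<Rightarrow> int \<Rightarrow> int" where "wrow f i = Sum_any (\<lambda>j. e * (j - i) * f i j)"

lemma wrow_fin: "finite {j. f i j \<noteq> 0} \<Longrightarrow> finite {j. e * (j - i') * f i j \<noteq> 0}"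
  by (rule finite_subset) auto

lemma wrow_per: "(\<And>i j. f (i + int n) (j + int n) = f i j) \<Longrightarrow> wrow f (i + int n) = wrow f i"
  unfolding wrow_def by (rule Sum_any_row_per[of "\<lambda>i j. e * (j - i) * f i j"]) simp

lemma wrow_shift:
  assumes "finite {j. f (i - e) j \<noteq> 0}"
  shows "Sum_any (\<lambda>j. e * (j - i) * f (i - e) j) = wrow f (i - e) - Sum_any (f (i - e))"
proof -
  have "(\<lambda>j. e * (j - i) * f (i - e) j) = (\<lambda>j. e * (j - (i - e)) * f (i - e) j - f (i - e) j)"
  proof
    fix j
    have "e * (j - (i - e)) = e * (j - i) + e * e" by (simp add: algebra_simps)
    then show "e * (j - i) * f (i - e) j = e * (j - (i - e)) * f (i - e) j - f (i - e) j"
      by (simp add: e0 algebra_simps)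
  qed
  then have "Sum_any (\<lambda>j. e * (j - i) * f (i - e) j) = Sum_any (\<lambda>j. e * (j - (i - e)) * f (i - e) j - f (i - e) j)"
    by (rule arg_cong)
  also have "\<dots> = wrow f (i - e) - Sum_any (f (i - e))"
    unfolding wrow_def by (rule Sum_any_diff[OF wrow_fin[of f "i - e" "i - e", OF assms] assms])
  finally show ?thesis .
qed

lemma degsum_rest: "degsum n e rest = degsum n e A - sigma_mat n A"
proof -
  have "Sum_any (\<lambda>j. e * (j - i) * rest i j) = wrow A (i - e) - ro A (i - e)" for i
  proof -
    have "(\<lambda>j. e * (j - i) * rest i j) = (\<lambda>j. e * (j - i) * A (i - e) j)" by (auto simp: rest_def fun_eq_iff)
    then have "Sum_any (\<lambda>j. e * (j - i) * rest i j) = Sum_any (\<lambda>j. e * (j - i) * A (i - e) j)" by (rule arg_cong)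
    then show ?thesis unfolding wrow_shift[of A i, OF A_fin] ro_eq .
  qed
  then have "degsum n e rest = (\<Sum>i=1..int n. wrow A (i - e)) - (\<Sum>i=1..int n. ro A (i - e))"
    by (simp add: degsum_def sum_subtractf)
  also have "(\<Sum>i=1..int n. wrow A (i - e)) = (\<Sum>i=1..int n. wrow A i)" by (rule row_shift, rule wrow_per, rule A_per)
  also have "(\<Sum>i=1..int n. ro A (i - e)) = (\<Sum>i=1..int n. ro A i)"
    by (rule row_shift) (use roA_Nseq in \<open>simp add: Nseq_def Zseq_def\<close>)
  finally show ?thesis by (simp add: degsum_def wrow_def sigma_mat_eq sigma_seq_def)
qed

sublocale family_product n layer rest
  by unfold_locales (use n layer_pm rest_pm in auto)

text \<open>The transport that takes everything \<open>rest\<close> has to offer; its summand is \<open>A{0}\<close>.\<close>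

definition full :: tens where "full = (\<lambda>i k j. if k = i + e then nat (A i j) else 0)"

lemma tin_full: "tin full i j = nat (A i j)"
  unfolding tin_def full_def by (subst Sum_any_eq[of "{i + e}"]) auto

lemma tout_full: "tout full k j = nat (A (k - e) j)"
  unfolding tout_def full_def by (subst Sum_any_eq[of "{k - e}"]) auto

lemma trow_full: "int (trow full i k) = (if k = i + e then ro A i else 0)"
  unfolding trow_def full_def Sum_any_int by (simp add: ro_eq A_nn)

lemma full_TT: "full \<in> TT n layer rest"
proof -
  have "finite {j. full i k j \<noteq> 0}" for i k
    by (rule finite_subset[OF _ A_fin[of i]]) (auto simp: full_def split: if_splits)
  moreover have "full (i + int n) (k + int n) (j + int n) = full i k j" for i k j
    using A_per[of i j] by (simp add: full_def)
  ultimately show ?thesis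
    using e0 A_nn by (simp add: TT_def trow_full tout_full layer_def rest_def) (simp add: full_def)
qed

lemma moved_full: "offd (moved rest full) = A"
  by (intro ext) (simp add: offd_def moved_def tin_full tout_full rest_def A_nn A_diag)

lemma tcoef_full: "tcoef n full (A + diag \<xi>) = 1"
  unfolding tcoef_def
proof (rule prod.neutral, rule ballI)
  fix x assume x: "x \<in> tsupp n full"
  obtain i j where ij: "x = (i, j)" by (cases x)
  have nz: "A i j \<noteq> 0" using x unfolding ij by (auto simp: tsupp_def tin_full)
  then have "i \<noteq> j" using A_diag by auto
  then have "(A + diag \<xi>) i j = A i j" by simp
  moreover have "msplit (\<lambda>k. full i k j) = 1" by (rule msplit_single[of "i + e"]) (auto simp: full_def)
  ultimately show "(case x of (i, j) \<Rightarrow> ((of_int ((A + diag \<xi>) i j) :: rat) gchoose tin full i j) *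
     of_nat (msplit (\<lambda>k. full i k j))) = 1"
    unfolding ij by (simp add: tin_full gbinomial_self A_nn)
qed

lemma summand_full: "summand 0 0 full = brace n A 0"
  unfolding summand_def moved_full tcoef_full binom_seq_zero brace_eq by simp

context
  fixes t assumes t: "t \<in> TT n layer rest"
begin

text \<open>A transport for a single layer has one source row for each target row, so two indices remain.\<close>

definition u :: "int \<Rightarrow> int \<Rightarrow> nat" where "u i j = t i (i + e) j"

lemma t_u: "t i k j = (if k = i + e then u i j else 0)"
proof (cases "k = i + e")
  case False
  have "t i k j = 0"
  proof (rule ccontr)
    assume nz: "t i k j \<noteq> 0"
    then have "layer i k \<noteq> 0" using t_nz_B[OF t, of i k j] by simp
    then show False using False by (simp add: layer_def)
  qed
  then show ?thesis using False by simp
qed (simp add: u_def)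

lemma tin_u: "tin t i j = u i j"
  unfolding tin_def by (subst Sum_any_eq[of "{i + e}"]) (auto simp: t_u)

lemma tout_u: "tout t k j = u (k - e) j"
  unfolding tout_def by (subst Sum_any_eq[of "{k - e}"]) (auto simp: t_u)

lemma u_fin: "finite {j. u i j \<noteq> 0}"
  unfolding u_def by (rule t_fin_j[OF t])

lemma u_row: "int (Sum_any (u i)) = ro A i"
  using t_row[OF t, of i "i + e"] e0 unfolding trow_def by (simp add: u_def[abs_def] layer_def)

lemma u_le: "j \<noteq> i + e \<Longrightarrow> int (u i j) \<le> A i j"
  using t_col[OF t, of "i + e" j] by (simp add: tout_u rest_def)

lemma u_diag: "u i i = 0"
  using u_le[of i i] e0 A_diag[of i] by simp

lemma u_per: "u (i + int n) (j + int n) = u i j"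
  using t_per[OF t, of i "i + e" j] by (simp add: u_def algebra_simps)

text \<open>What \<open>t\<close> leaves behind compared with \<open>full\<close>. Only the source \<open>j = i + e\<close>, which is the diagonal of
  \<open>rest\<close>, can make up for it, so \<open>g i (i + e)\<close> is the negative of the total left behind.\<close>

definition g :: "int \<Rightarrow> int \<Rightarrow> int" where "g i j = A i j - int (u i j)"

lemma g_fin: "finite {j. g i j \<noteq> 0}"
  by (rule finite_subset[of _ "{j. A i j \<noteq> 0} \<union> {j. u i j \<noteq> 0}"]) (use A_fin u_fin in \<open>auto simp: g_def\<close>)

lemma g_sum: "Sum_any (g i) = 0"
proof -
  have "Sum_any (g i) = Sum_any (A i) - Sum_any (\<lambda>j. int (u i j))"
    unfolding g_def[abs_def] by (rule Sum_any_diff) (use A_fin u_fin in auto)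
  then show ?thesis using u_row[of i] by (simp add: Sum_any_int ro_eq)
qed

lemma g_nonneg: "j \<noteq> i + e \<Longrightarrow> 0 \<le> g i j" using u_le by (simp add: g_def)

lemma g_per: "g (i + int n) (j + int n) = g i j" by (simp add: g_def A_per u_per)

lemma g_split: "g i (i + e) + Sum_any (\<lambda>j. if j = i + e then 0 else g i j) = 0"
  using Sum_any_split[OF g_fin[of i], of "i + e"] g_sum[of i] by simp

lemma g_le: "g i (i + e) \<le> 0"
proof -
  have "0 \<le> Sum_any (\<lambda>j. if j = i + e then 0 else g i j)" by (rule Sum_any_nonneg) (simp add: g_nonneg)
  then show ?thesis using g_split[of i] by linarith
qed

lemma g_zero: "g i (i + e) = 0 \<Longrightarrow> g i j = 0"
proof (cases "j = i + e")
  case False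
  assume 0: "g i (i + e) = 0"
  have f: "finite {j. (if j = i + e then 0 else g i j) \<noteq> 0}" by (rule finite_subset[OF _ g_fin[of i]]) auto
  have "(if j = i + e then 0 else g i j) \<le> Sum_any (\<lambda>j. if j = i + e then 0 else g i j)"
    by (rule Sum_any_ge[OF f]) (simp add: g_nonneg)
  then show ?thesis using False g_nonneg[of j i] g_split[of i] 0 by simp
qed simp

abbreviation X0 :: mat where "X0 \<equiv> offd (moved rest t)"

lemma X0_eq: "X0 i j = (if j = i then 0 else g (i - e) j) + int (u i j)"
  using u_diag[of i] by (auto simp: offd_def moved_def tin_u tout_u rest_def g_def)

lemma X0_tri: "triangular e X0"
  unfolding triangular_def
proof (intro allI impI)
  fix i j assume nz: "X0 i j \<noteq> 0"
  then have ij: "i \<noteq> j" by (auto simp: offd_def)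
  have "j = i + e \<or> A i j \<noteq> 0 \<or> A (i - e) j \<noteq> 0"
  proof (rule ccontr)
    assume "\<not> ?thesis"
    then have a: "j \<noteq> i + e" "A i j = 0" "A (i - e) j = 0" by auto
    have "u i j = 0" using u_le[OF a(1)] a(2) by simp
    moreover have "u (i - e) j = 0" using u_le[of j "i - e"] ij a(3) by simp
    ultimately show False using nz ij a by (simp add: X0_eq g_def)
  qed
  then show "0 < e * (j - i)"
  proof (elim disjE)
    assume "j = i + e" then show ?thesis using e0 by simp
  next
    assume "A i j \<noteq> 0" then show ?thesis using tri by (simp add: triangular_def)
  next
    assume "A (i - e) j \<noteq> 0"
    then have "rest i j \<noteq> 0" using ij by (simp add: rest_def)
    then show ?thesis using rest_tri by (simp add: triangular_def)
  qed
qed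

lemma sigma_X0: "sigma_mat n X0 = sigma_mat n A - (\<Sum>i=1..int n. g i (i + e))"
proof -
  have "ro X0 i = ro A i - g (i - e) (i - e + e)" for i
  proof -
    have f1: "finite {j. (if j = i then 0 else g (i - e) j) \<noteq> 0}" by (rule finite_subset[OF _ g_fin[of "i - e"]]) auto
    have f2: "finite {j. int (u i j) \<noteq> 0}" using u_fin by simp
    have "ro X0 i = Sum_any (\<lambda>j. if j = i then 0 else g (i - e) j) + Sum_any (\<lambda>j. int (u i j))"
      unfolding ro_eq X0_eq by (rule Sum_any.distrib[OF f1 f2])
    then show ?thesis using g_split[of "i - e"] u_row[of i] by (simp add: Sum_any_int)
  qed
  then have "sigma_mat n X0 = sigma_mat n A - (\<Sum>i=1..int n. g (i - e) (i - e + e))"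
    by (simp add: sigma_mat_eq sigma_seq_def sum_subtractf)
  also have "(\<Sum>i=1..int n. g (i - e) (i - e + e)) = (\<Sum>i=1..int n. g i (i + e))"
  proof (rule row_shift)
    fix i show "g (i + int n) (i + int n + e) = g i (i + e)" using g_per[of i "i + e"] by (simp add: algebra_simps)
  qed
  finally show ?thesis .
qed

text \<open>Units moved from \<open>(i + e, j)\<close> to \<open>(i, j)\<close> gain distance one each, however the sources are chosen: a
  source on the diagonal starts from distance zero.\<close>

lemma degsum_X0: "degsum n e X0 = degsum n e A"
proof -
  have "Sum_any (\<lambda>j. e * (j - i) * X0 i j) = wrow g (i - e) + wrow (\<lambda>i j. int (u i j)) i" for i
  proof -
    have "(\<lambda>j. e * (j - i) * X0 i j) = (\<lambda>j. e * (j - i) * g (i - e) j + e * (j - i) * int (u i j))"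
      by (auto simp: X0_eq fun_eq_iff algebra_simps)
    then have "Sum_any (\<lambda>j. e * (j - i) * X0 i j) = Sum_any (\<lambda>j. e * (j - i) * g (i - e) j + e * (j - i) * int (u i j))"
      by (rule arg_cong)
    also have "\<dots> = Sum_any (\<lambda>j. e * (j - i) * g (i - e) j) + Sum_any (\<lambda>j. e * (j - i) * int (u i j))"
      by (rule Sum_any.distrib) (rule wrow_fin, use g_fin u_fin in simp)+
    finally show ?thesis using wrow_shift[of g i, OF g_fin] g_sum by (simp add: wrow_def)
  qed
  then have "degsum n e X0 = (\<Sum>i=1..int n. wrow g (i - e)) + (\<Sum>i=1..int n. wrow (\<lambda>i j. int (u i j)) i)"
    by (simp add: degsum_def sum.distrib)
  also have "(\<Sum>i=1..int n. wrow g (i - e)) = (\<Sum>i=1..int n. wrow g i)" by (rule row_shift, rule wrow_per, rule g_per)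
  also have "\<dots> = (\<Sum>i=1..int n. wrow A i - wrow (\<lambda>i j. int (u i j)) i)"
  proof (rule sum.cong[OF refl])
    fix i
    have "(\<lambda>j. e * (j - i) * g i j) = (\<lambda>j. e * (j - i) * A i j - e * (j - i) * int (u i j))"
      by (auto simp: g_def algebra_simps)
    then have "wrow g i = Sum_any (\<lambda>j. e * (j - i) * A i j - e * (j - i) * int (u i j))"
      unfolding wrow_def by (rule arg_cong)
    also have "\<dots> = wrow A i - wrow (\<lambda>i j. int (u i j)) i"
      unfolding wrow_def
      by (rule Sum_any_diff[OF wrow_fin[of A i i, OF A_fin[of i]] wrow_fin[of "\<lambda>i j. int (u i j)" i i]])
        (use u_fin[of i] in simp)
    finally show "wrow g i = wrow A i - wrow (\<lambda>i j. int (u i j)) i" .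
  qed
  finally show ?thesis by (simp add: sum_subtractf degsum_def wrow_def)
qed

text \<open>Every unit left behind in \<open>rest\<close> is replaced by one from the diagonal and stays as an extra entry.\<close>

lemma sigma_X0_less: "t \<noteq> full \<Longrightarrow> sigma_mat n A < sigma_mat n X0"
proof (rule ccontr)
  assume ne: "t \<noteq> full" and "\<not> sigma_mat n A < sigma_mat n X0"
  then have s: "0 \<le> (\<Sum>i=1..int n. g i (i + e))" using sigma_X0 by simp
  have "(\<Sum>i=1..int n. - g i (i + e)) = 0"
    using s sum_nonneg[of "{1..int n}" "\<lambda>i. - g i (i + e)"] g_le by (simp add: sum_negf)
  then have z: "g i (i + e) = 0" if "i \<in> {1..int n}" for i
    using that sum_nonneg_eq_0_iff[of "{1..int n}" "\<lambda>i. - g i (i + e)"] g_le by simp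
  have "g i j = 0" for i j
  proof -
    let ?m = "(i - 1) div int n"
    have gs: "g (i + k * int n) (j + k * int n) = g i j" for k
    proof -
      have "(\<lambda>x. g (i + x) (j + x)) (0 + k * int n) = (\<lambda>x. g (i + x) (j + x)) 0"
        by (rule periodic_shift) (use g_per in \<open>simp add: add.assoc[symmetric]\<close>)
      then show ?thesis by simp
    qed
    have "g (i - ?m * int n) (j - ?m * int n) = 0" by (rule g_zero[OF z[OF window_div_range[OF n]]])
    then show ?thesis using gs[of "- ?m"] by simp
  qed
  then have "int (u i j) = A i j" for i j by (simp add: g_def)
  then have "u i j = nat (A i j)" for i j by (metis nat_int)
  then have "t = full" by (auto simp: t_u full_def fun_eq_iff)
  then show False using ne by simp
qed

end

end

context generated
begin

text \<open>Subtracting the summands already known to lie in \<open>U\<close> isolates the leading one.\<close>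

lemma leading_in:
  assumes fp: "family_product n B A" and B: "brace n B 0 \<in> U" and A: "brace n A 0 \<in> U"
    and t0: "t0 \<in> TT n B A"
    and rest: "\<And>t. t \<in> TT n B A \<Longrightarrow> t \<noteq> t0 \<Longrightarrow> brace n (offd (moved A t)) 0 \<in> U"
  shows "family_product.summand n B A 0 0 t0 \<in> U"
proof -
  interpret family_product n B A by (rule fp)
  have P: "(\<Sum>t\<in>TT n B A. summand 0 0 t) \<in> U"
    using Umult[OF B A] unfolding Khat_mult_brace .
  have R: "(\<Sum>t\<in>TT n B A - {t0}. summand 0 0 t) \<in> U"
  proof (rule add_closed_sum[OF U])
    fix t assume t: "t \<in> TT n B A - {t0}"
    show "summand 0 0 t \<in> U"
    proof (rule summand_in[OF U])
      show "t \<in> TT n B A" using t by blast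
      show "brace n (offd (moved A t)) l \<in> U" if "l \<in> Nseq n" for l
        by (rule all_weights_in[OF offd_moved_pm rest that]) (use t in auto)
    qed
  qed
  have "(\<Sum>t\<in>TT n B A. summand 0 0 t) = summand 0 0 t0 + (\<Sum>t\<in>TT n B A - {t0}. summand 0 0 t)"
    by (rule sum.remove[OF finite_TT t0])
  then have "summand 0 0 t0 = (\<Sum>t\<in>TT n B A. summand 0 0 t) - (\<Sum>t\<in>TT n B A - {t0}. summand 0 0 t)" by simp
  then show ?thesis using add_closed_diff[OF U P R] by simp
qed

text \<open>Among the other summands \<open>degsum\<close> is unchanged and \<open>sigma_mat\<close> grows, but is bounded by \<open>degsum\<close>; \<open>rest\<close> has
  smaller \<open>degsum\<close>. Hence the lexicographic measure.\<close>

lemma triangular_in: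
  assumes e: "e = 1 \<or> e = - 1"
  shows "A \<in> Theta_pm n \<Longrightarrow> triangular e A \<Longrightarrow> brace n A 0 \<in> U"
proof (induction A rule: wf_induct_rule[OF wf_measures[of "[\<lambda>A. nat (degsum n e A), \<lambda>A. nat (degsum n e A - sigma_mat n A)]"]])
  case (1 A)
  note A = 1(2) and tri = 1(3)
  show ?case
  proof (cases "A = 0")
    case True show ?thesis unfolding True by (rule diagonal_in[OF Nseq_zero])
  next
    case False
    interpret peel n e A by unfold_locales (use n e A tri in auto)
    have s: "0 < sigma_mat n A" by (rule sigma_pos[OF n A False])
    have d: "sigma_mat n A \<le> degsum n e A" by (rule degsum_ge_sigma[OF A tri])
    have L: "brace n layer 0 \<in> U" unfolding layer_def by (rule layer_gen[OF roA_Nseq e])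
    have R: "brace n rest 0 \<in> U"
      by (rule 1(1)) (use s d degsum_rest rest_pm rest_tri in auto)
    have "summand 0 0 full \<in> U"
    proof (rule leading_in[OF _ L R full_TT])
      show "family_product n layer rest" by unfold_locales
      fix t assume t: "t \<in> TT n layer rest" "t \<noteq> full"
      have pm: "offd (moved rest t) \<in> Theta_pm n" by (rule offd_moved_pm[OF t(1)])
      have tr: "triangular e (offd (moved rest t))" by (rule X0_tri[OF t(1)])
      show "brace n (offd (moved rest t)) 0 \<in> U"
        by (rule 1(1)[OF _ pm tr])
          (use sigma_X0_less[OF t(1,2)] degsum_X0[OF t(1)] degsum_ge_sigma[OF pm tr] in auto)
    qed
    then show ?thesis by (simp only: summand_full)
  qed
qed

text \<open>The summand of \<open>tdiag\<close> in the product of the upper and the lower part is \<open>A{0}\<close>; any other transport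
  takes some unit from off the diagonal and loses part of the total.\<close>

lemma offdiagonal_in: "A \<in> Theta_pm n \<Longrightarrow> brace n A 0 \<in> U"
proof (induction "nat (sigma_mat n A)" arbitrary: A rule: less_induct)
  case less
  note A = less(2)
  let ?B = "\<lambda>i j. if i < j then A i j else 0" and ?C = "\<lambda>i j. if j < i then A i j else 0"
  have B: "?B \<in> Theta_pm n"
    by (rule Theta_pmI; (rule finite_subset[OF _ Theta_pmD(2)[OF A]] finite_subset[OF _ Theta_pmD(3)[OF A]])?)
      (auto simp: Theta_pmD(1)[OF A] Theta_pm_nonneg[OF A])
  have C: "?C \<in> Theta_pm n"
    by (rule Theta_pmI; (rule finite_subset[OF _ Theta_pmD(2)[OF A]] finite_subset[OF _ Theta_pmD(3)[OF A]])?)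
      (auto simp: Theta_pmD(1)[OF A] Theta_pm_nonneg[OF A])
  have BU: "brace n ?B 0 \<in> U" by (rule triangular_in[of 1]) (use B in \<open>auto simp: triangular_def\<close>)
  have CU: "brace n ?C 0 \<in> U" by (rule triangular_in[of "- 1"]) (use C in \<open>auto simp: triangular_def\<close>)
  have sum: "?C + ?B = A"
  proof (intro ext)
    fix i j show "(?C + ?B) i j = A i j" using Theta_pm_diag[OF A, of i] by (cases "i = j") auto
  qed
  interpret family_product n ?B ?C by unfold_locales (use n B C in auto)
  have sig: "sigma_mat n ?C + sigma_mat n ?B = sigma_mat n A"
  proof -
    have "ro ?C i + ro ?B i = ro A i" for i
    proof -
      have "Sum_any (\<lambda>j. ?C i j + ?B i j) = Sum_any (?C i) + Sum_any (?B i)"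
        by (rule Sum_any.distrib) (rule Theta_pmD(2)[OF C] Theta_pmD(2)[OF B])+
      moreover have "(\<lambda>j. ?C i j + ?B i j) = A i" using sum by (auto simp: fun_eq_iff)
      ultimately show ?thesis by (simp only: ro_eq)
    qed
    then show ?thesis by (simp only: sigma_mat_eq sigma_seq_def sum.distrib[symmetric])
  qed
  have "summand 0 0 (tdiag ?B) \<in> U"
  proof (rule leading_in[OF _ BU CU tdiag_TT])
    show "family_product n ?B ?C" by unfold_locales
    fix t assume t: "t \<in> TT n ?B ?C" "t \<noteq> tdiag ?B"
    let ?E = "\<lambda>i. int (tin t i i) + int (Sum_any (\<lambda>j. if j = i then 0 else tout t i j))"
    have "0 < (\<Sum>i=1..int n. ?E i)"
    proof (rule ccontr)
      assume "\<not> ?thesis"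
      then have "(\<Sum>i=1..int n. ?E i) = 0" using sum_nonneg[of "{1..int n}" ?E] by simp
      then have E0: "?E i = 0" if "i \<in> {1..int n}" for i
        using that sum_nonneg_eq_0_iff[of "{1..int n}" ?E] by simp
      have z: "t i k j = 0" if k: "k \<in> {1..int n}" and kj: "j \<noteq> k" for i k j
      proof -
        have f: "finite {j. (if j = k then 0 else tout t k j) \<noteq> 0}"
          by (rule finite_subset[OF _ tout_fin_j[OF t(1), of k]]) auto
        have "tout t k j = 0" using Sum_any_zero_nat[OF f, of j] E0[OF k] kj by simp
        then show ?thesis unfolding tout_def by (rule Sum_any_zero_nat[OF t_fin_i[OF t(1)]])
      qed
      have "t = tdiag ?B"
      proof (rule tdiag_unique[OF t(1)])
        fix i k j assume nz: "t i k j \<noteq> 0"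
        let ?m = "(k - 1) div int n"
        have "t (i - ?m * int n) (k - ?m * int n) (j - ?m * int n) \<noteq> 0"
          using nz t_shift[OF t(1), of i "- ?m" k j] by simp
        then have "j - ?m * int n = k - ?m * int n" using z[OF window_div_range[OF n, of k]] by metis
        then show "j = k" by simp
      qed
      then show False using t(2) by simp
    qed
    then have lt: "sigma_mat n (offd (moved ?C t)) < sigma_mat n A"
      using sigma_offd_moved[OF t(1)] sig by linarith
    have pm: "offd (moved ?C t) \<in> Theta_pm n" by (rule offd_moved_pm[OF t(1)])
    show "brace n (offd (moved ?C t)) 0 \<in> U"
      by (rule less(1)[OF _ pm]) (use lt sigma_nonneg[OF pm] in auto)
  qed
  moreover have "summand 0 0 (tdiag ?B) = brace n A 0"
    by (subst summand_tdiag) (auto simp: sum brace_eq binom_seq_zero)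
  ultimately show ?case by simp
qed

theorem brace_in: "A \<in> Theta_pm n \<Longrightarrow> l \<in> Nseq n \<Longrightarrow> brace n A l \<in> U"
  by (rule all_weights_in[OF _ offdiagonal_in])

end

lemma Khat_simps [simp]:
  "carrier (Khat n) = Khat_carrier n" "monoid.mult (Khat n) = Khat_mult n"
  "ring.add (Khat n) = (+)" "ring.zero (Khat n) = 0"
  by (simp_all add: Khat_def)

lemma Khat_one: "monoid.one (Khat n) = brace n 0 0"
proof
  fix X
  have "brace n 0 0 X = (if offd X = 0 \<and> (\<lambda>i. X i i) \<in> Zseq n then 1 else 0)"
    unfolding brace_eq binom_seq_zero by (rule family_offd) simp
  moreover have "X \<in> diag ` Zseq n \<longleftrightarrow> offd X = 0 \<and> (\<lambda>i. X i i) \<in> Zseq n"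
  proof
    assume "X \<in> diag ` Zseq n"
    then obtain m where m: "m \<in> Zseq n" "X = diag m" by blast
    have "offd X = 0" "(\<lambda>i. X i i) = m" unfolding m(2) by (auto simp: offd_def fun_eq_iff)
    then show "offd X = 0 \<and> (\<lambda>i. X i i) \<in> Zseq n" using m(1) by simp
  next
    assume a: "offd X = 0 \<and> (\<lambda>i. X i i) \<in> Zseq n"
    then have "X = diag (\<lambda>i. X i i)" using offd_decomp[of X] by simp
    then show "X \<in> diag ` Zseq n" using a by blast
  qed
  ultimately show "monoid.one (Khat n) X = brace n 0 0 X" by (simp add: Khat_def)
qed

lemma Khat_minus: "x \<in> Khat_carrier n \<Longrightarrow> \<ominus>\<^bsub>Khat n\<^esub> x = - x"
  unfolding a_inv_def m_inv_def
proof (rule the_equality)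
  assume x: "x \<in> Khat_carrier n"
  show "- x \<in> carrier (add_monoid (Khat n)) \<and> x \<otimes>\<^bsub>add_monoid (Khat n)\<^esub> - x = \<one>\<^bsub>add_monoid (Khat n)\<^esub>
      \<and> - x \<otimes>\<^bsub>add_monoid (Khat n)\<^esub> x = \<one>\<^bsub>add_monoid (Khat n)\<^esub>"
    using Khat_carrier_neg[OF x] by simp
next
  fix y
  assume "y \<in> carrier (add_monoid (Khat n)) \<and> x \<otimes>\<^bsub>add_monoid (Khat n)\<^esub> y = \<one>\<^bsub>add_monoid (Khat n)\<^esub>
      \<and> y \<otimes>\<^bsub>add_monoid (Khat n)\<^esub> x = \<one>\<^bsub>add_monoid (Khat n)\<^esub>"
  then have "x + y = 0" by simp
  then show "y = - x" by (metis minus_unique)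
qed

lemma VZ_subring:
  assumes n: "1 \<le> n" shows "subring (VZ n) (Khat n)"
proof -
  have ac: "add_closed (VZ n)" by (rule VZ_add_closed)
  have car: "VZ n \<subseteq> Khat_carrier n" using VZ_carrier[OF n] by blast
  have minus: "inv\<^bsub>add_monoid (Khat n)\<^esub> x \<in> VZ n" if x: "x \<in> VZ n" for x
  proof -
    have "inv\<^bsub>add_monoid (Khat n)\<^esub> x = - x" using Khat_minus[of x n] car x by (auto simp: a_inv_def)
    then show ?thesis using ac x by (simp add: add_closed_def)
  qed
  have one: "monoid.one (Khat n) \<in> VZ n"
    unfolding Khat_one by (rule brace_VZ) (auto simp: Theta_pm_zero Nseq_def Zseq_def)
  show ?thesis
  proof (rule subring.intro)
    show "subgroup (VZ n) (add_monoid (Khat n))"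
      by (rule subgroup.intro) (use ac car minus in \<open>auto simp: add_closed_def\<close>)
    show "Group.submonoid (VZ n) (Khat n)"
      by (rule submonoid.intro) (use car one VZ_mult[OF n] in auto)
  qed
qed

lemma layer_Theta_pm:
  assumes a: "a \<in> Nseq n" and e: "e \<noteq> 0"
  shows "(\<lambda>k l. if l = k + e then a k else 0) \<in> Theta_pm n"
proof (rule Theta_pmI)
  show "finite {j. (if j = i + e then a i else 0) \<noteq> 0}" for i by (rule finite_subset[of _ "{i + e}"]) auto
  show "finite {i. (if j = i + e then a i else 0) \<noteq> 0}" for j by (rule finite_subset[of _ "{j - e}"]) auto
qed (use a e in \<open>auto simp: Nseq_def Zseq_def\<close>)

lemma VZ_gens_VZ:
  assumes n: "1 \<le> n" shows "VZ_gens n \<subseteq> VZ n"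
proof
  have z: "0 \<in> Nseq n" by (simp add: Nseq_def Zseq_def)
  fix x assume "x \<in> VZ_gens n"
  then consider a where "a \<in> Nseq n" "x = brace n (\<lambda>k l. \<Sum>i=1..int n. a i * unit_mat n i (i + 1) k l) 0"
    | a where "a \<in> Nseq n" "x = brace n (\<lambda>k l. \<Sum>i=1..int n. a i * unit_mat n (i + 1) i k l) 0"
    | t i where "x = brace n 0 (\<lambda>j. int t * unit_seq n i j)"
    unfolding VZ_gens_def by blast
  then show "x \<in> VZ n"
  proof cases
    case 1
    have "(\<lambda>k l. \<Sum>i=1..int n. a i * unit_mat n i (i + 1) k l) = (\<lambda>k l. if l = k + 1 then a k else 0)"
      using window_sum_unit[OF n, of a] 1 by (auto simp: unit_mat_def Nseq_def fun_eq_iff)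
    then show ?thesis using 1 brace_VZ[OF layer_Theta_pm[OF 1(1), of 1] z] by simp
  next
    case 2
    let ?a = "\<lambda>k. a (k - 1)"
    have a': "?a \<in> Nseq n" using 2(1) by (auto simp: Nseq_def Zseq_def algebra_simps)
      (metis add.commute add_diff_eq)
    have "(\<lambda>k l. \<Sum>i=1..int n. a i * unit_mat n (i + 1) i k l) = (\<lambda>k l. if l = k + - 1 then ?a k else 0)"
    proof (intro ext)
      fix k l
      have "(\<Sum>i=1..int n. a i * unit_mat n (i + 1) i k l) = (if k = l + 1 then a l else 0)"
        using window_sum_unit[OF n, of a l k] 2(1) by (simp add: unit_mat_def Nseq_def conj_commute)
      then show "(\<Sum>i=1..int n. a i * unit_mat n (i + 1) i k l) = (if l = k + - 1 then ?a k else 0)" by auto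
    qed
    then show ?thesis using 2 brace_VZ[OF layer_Theta_pm[OF a', of "- 1"] z] by simp
  next
    case 3
    have "(\<lambda>j. int t * unit_seq n i j) \<in> Nseq n"
    proof -
      have "(\<exists>s. j + int n = i + s * int n) \<longleftrightarrow> (\<exists>s. j = i + s * int n)" for j
      proof
        assume "\<exists>s. j + int n = i + s * int n"
        then obtain s where "j + int n = i + s * int n" by blast
        then show "\<exists>s. j = i + s * int n" by (intro exI[of _ "s - 1"]) (simp add: algebra_simps)
      next
        assume "\<exists>s. j = i + s * int n"
        then obtain s where "j = i + s * int n" by blast
        then show "\<exists>s. j + int n = i + s * int n" by (intro exI[of _ "s + 1"]) (simp add: algebra_simps)
      qed
      then show ?thesis by (simp add: Nseq_def Zseq_def unit_seq_def)
    qed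
    then show ?thesis using 3 brace_VZ[OF Theta_pm_zero] by simp
  qed
qed

theorem proposition8p5:
  fixes n :: nat
  assumes "n \<ge> 2"
  shows "subring (VZ n) (Khat n)
         \<and> generate_ring (Khat n) (VZ_gens n) = VZ n"
proof
  have n: "1 \<le> n" using assms by simp
  show sub: "subring (VZ n) (Khat n)" by (rule VZ_subring[OF n])
  let ?U = "generate_ring (Khat n) (VZ_gens n)"
  have UV: "?U \<subseteq> VZ n"
  proof
    fix x assume "x \<in> ?U"
    then show "x \<in> VZ n"
    proof induction
      case one show ?case by (rule subringE(3)[OF sub])
    next
      case (incl h) show ?case by (rule subsetD[OF VZ_gens_VZ[OF n] incl])
    next
      case (a_inv h) show ?case by (rule subringE(5)[OF sub a_inv.IH])
    next
      case (eng_add h1 h2) show ?case by (rule subringE(7)[OF sub eng_add.IH])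
    next
      case (eng_mult h1 h2) show ?case by (rule subringE(6)[OF sub eng_mult.IH])
    qed
  qed
  have minus: "- x \<in> ?U" if "x \<in> ?U" for x
  proof -
    have "x \<in> Khat_carrier n" using VZ_carrier[OF n] UV that by blast
    then show ?thesis using generate_ring.a_inv[OF that] by (simp only: Khat_minus)
  qed
  have plus: "x + y \<in> ?U" if "x \<in> ?U" "y \<in> ?U" for x y
    using generate_ring.eng_add[OF that] by simp
  have zero: "0 \<in> ?U"
    using plus[OF generate_ring.one minus[OF generate_ring.one]] by simp
  interpret generated n ?U
  proof
    show "add_closed ?U" using zero plus minus by (simp add: add_closed_def)
    show "Khat_mult n x y \<in> ?U" if "x \<in> ?U" "y \<in> ?U" for x y
      using generate_ring.eng_mult[OF that] by simp
    show "VZ_gens n \<subseteq> ?U" by (rule subsetI) (rule generate_ring.incl)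
  qed (rule assms)
  have "VZ n \<subseteq> ?U"
  proof
    fix x assume "x \<in> VZ n"
    then show "x \<in> ?U" unfolding VZ_eq
    proof (induction rule: iscale.span_induct_alt)
      case base show ?case by (rule zero)
    next
      case (step c x y)
      have x: "x \<in> ?U" using step(1) brace_in by blast
      have nat: "(\<lambda>X. of_nat k * x X) \<in> ?U" for k
      proof (induction k)
        case 0 show ?case using zero by (simp add: zero_fun_def)
      next
        case (Suc k)
        have "(\<lambda>X. of_nat (Suc k) * x X) = x + (\<lambda>X. of_nat k * x X)"
        proof
          fix X show "of_nat (Suc k) * x X = (x + (\<lambda>X. of_nat k * x X)) X" by (simp add: distrib_right)
        qed
        then show ?case using plus[OF x Suc] by (simp only:)
      qed
      have "(\<lambda>X. of_int c * x X) \<in> ?U"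
      proof (cases "0 \<le> c")
        case True then show ?thesis using nat[of "nat c"] by (simp add: of_nat_nat[OF True])
      next
        case False
        then have "(\<lambda>X. of_int c * x X) = - (\<lambda>X. of_nat (nat (- c)) * x X)"
          by (intro ext) (simp add: of_nat_nat)
        then show ?thesis using minus[OF nat[of "nat (- c)"]] by (simp only:)
      qed
      then show ?case using plus step(2) by blast
    qed
  qed
  then show "?U = VZ n" using UV by blast
qed

end
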